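(* Let $C_S$ be the Sobolev embedding constant between $W^2_p(\Omega)$ and $W^1_\infty(\Omega)$, and let $$\Lambda=\kappa^{-1}C_AC_S\,(1+2C_AC_\#)^2.$$ Suppose that $$|v|_{W^1_p(\Omega)}\le\frac{1-\theta_1}{\alpha C_EC_A(1+\beta C_A)},\qquad\|u\|_{L^2(0,1)}\le\frac{\theta_1}{\alpha},\qquad C_AC_S(1+2C_AC_\#)\|v\|_{W^2_p(\Omega)}+\|u\|_{L^\infty(0,1)}\le\kappa ,$$ for some $\theta_1\in(\beta C_A/(1+\beta C_A),1)$. If, in addition, $v$ satisfies $$\|v\|_{W^2_p(\Omega)}\le(1-\theta_2)\Lambda^{-1}$$ for some $\theta_2\in(0,1)$, then the map $T$ is a contraction on $\mathbb B_2$ (with respect to $\|\cdot\|_{\mathbb W^{2,2}_{\infty,p}}$) with constant $1-\theta_2$, for all $u\in\mathcal U_{ad}$ (satisfying $\|u\|_{L^2(0,1)}\le\theta_1/\alpha$ and $C_AC_S(1+2C_AC_\#)\|v\|_{W^2_p(\Omega)}+\|u\|_{L^\infty(0,1)}\le\kappa$).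
   Context: $\Omega=(0,1)^2$, $\Gamma=(0,1)\times\{1\}$, $\Sigma=\partial\Omega\setminus\Gamma$. $W^k_p$ are Sobolev spaces with norm $\|\cdot\|_{W^k_p}$ and order-$k$ seminorm $|\cdot|_{W^k_p}$; a ring denotes zero boundary trace. $p>2$ (close enough to $2$), $q=p/(p-1)$, $\kappa>0$, $v\in W^2_p(\Omega)$. $\mathcal U_{ad}=\{u\in L^2(0,1):\|u\|_{L^2(0,1)}\le\theta_1/(2\alpha)\}$. $\mathcal B_\Gamma[\gamma,\xi]=\kappa\int_0^1\gamma'\xi'\,dx_1$, $\mathcal B_\Omega[y,z;M]=\int_\Omega M\nabla y\cdot\nabla z\,dx$, and $$A[\gamma]=\begin{bmatrix}1+\gamma(x_1)&-\gamma'(x_1)x_2\\-\gamma'(x_1)x_2&\dfrac{1+(\gamma'(x_1)x_2)^2}{1+\gamma(x_1)}\end{bmatrix}.$$ Constants: $\alpha$ is the inf-sup constant of $\mathcal B_\Gamma$, i.e. $|\gamma|_{W^1_\infty(0,1)}\le\alpha\sup_{\xi\ne0}\mathcal B_\Gamma[\gamma,\xi]/|\xi|_{W^1_1(0,1)}$ for $\gamma\in\mathring W^1_\infty(0,1)$; $\beta$ is the inf-sup constant of $\mathcal B_\Omega$, i.e. $|y|_{W^1_p(\Omega)}\le\beta\sup_{z\ne0}\mathcal B_\Omega[y,z;A[\gamma]]/|z|_{W^1_q(\Omega)}$ for $y\in\mathring W^1_p(\Omega)$ and $\gamma\in\mathring W^1_\infty(0,1)$ with $|\gamma|_{W^1_\infty}\le1$;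 $C_E$ is the stability constant of a fixed linear extension operator $E:\mathring W^1_1(0,1)\to W^1_q(\Omega)$ ($E\xi|_\Gamma=\xi$, $E\xi|_\Sigma=0$, $|E\xi|_{W^1_q(\Omega)}\le C_E|\xi|_{W^1_1(0,1)}$); $C_A$ is a bound in $L^\infty(\Omega)$ on the operator $A$ and its first and second order derivatives (over the functions $\gamma$ considered below); $C_\#$ is the constant in the a priori estimate $\|w\|_{W^2_p(\Omega)}\le C_\#\|f\|_{L^p(\Omega)}$ for solutions $w\in W^2_p(\Omega)\cap\mathring W^1_p(\Omega)$ of $-\operatorname{div}(A[\gamma]\nabla w)=f$ in $\Omega$, for $\gamma\in W^2_\infty(0,1)\cap\mathring W^1_\infty(0,1)$ with $|\gamma|_{W^1_\infty}\le1$, $|\gamma|_{W^2_\infty}\le1$. Spaces and sets: $\mathbb W^{2,2}_{\infty,p}=\big(\mathring W^1_\infty(0,1)\times\mathring W^1_p(\Omega)\big)\cap\big(W^2_\infty(0,1)\times W^2_p(\Omega)\big)$ with norm $\|(\gamma,y)\|_{\mathbb W^{2,2}_{\infty,p}}=(1+2C_AC_\#)\|v\|_{W^2_p(\Omega)}\|\gamma\|_{W^2_\infty(0,1)}+\|y\|_{W^2_p(\Omega)}$ (the norm $\|\gamma\|_{W^2_\infty(0,1)}$ is the maximum of the $L^\infty$ norms of the derivatives up to order two); $\mathbb B_1=\{(\gamma,y)\in\mathring W^1_\infty(0,1)\times\mathring W^1_p(\Omega):|y|_{W^1_p(\Omega)}\le\beta C_A|v|_{W^1_p(\Omega)},\ |\gamma|_{W^1_\infty(0,1)}\le1\}$;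 $\mathbb B_2=\{(\gamma,y)\in\mathbb B_1\cap\mathbb W^{2,2}_{\infty,p}:\|y\|_{W^2_p(\Omega)}\le2C_AC_\#\|v\|_{W^2_p(\Omega)},\ |\gamma|_{W^2_\infty(0,1)}\le1\}$. Operator: for $(\gamma,y)\in\mathbb B_2$, $T(\gamma,y)=(\widetilde\gamma,\widetilde y)$, where $\widetilde\gamma\in W^2_\infty(0,1)\cap\mathring W^1_\infty(0,1)$ is the unique solution of $-\kappa\,\widetilde\gamma''=A[\gamma]\nabla(y+v)\cdot\nu+u$ in $(0,1)$ (the first term on the right being evaluated on $\Gamma$, $\nu$ the outer unit normal), and $\widetilde y\in W^2_p(\Omega)\cap\mathring W^1_p(\Omega)$ is the unique solution of $-\operatorname{div}(A[\widetilde\gamma]\nabla\widetilde y)=\operatorname{div}(A[\widetilde\gamma]\nabla v)$ in $\Omega$. *)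

theory Defs
  imports "HOL-Analysis.Analysis" "HOL-Probability.Essential_Supremum"
begin

section \<open>Lebesgue spaces\<close>

text \<open>Exponents range over \<open>ereal\<close>, so that \<open>p = \<infinity>\<close> is allowed. Elements are functions, not
  equivalence classes; \<open>Lnorm\<close> is only meaningful on \<open>Lspace\<close>.\<close>

definition Lspace :: "ereal \<Rightarrow> 'a measure \<Rightarrow> ('a \<Rightarrow> 'b::real_normed_vector) set" where
  "Lspace p M = {f \<in> borel_measurable M.
     if p = \<infinity> then \<exists>C. AE x in M. norm (f x) \<le> C
     else integrable M (\<lambda>x. norm (f x) powr real_of_ereal p)}"

definition Lnorm :: "ereal \<Rightarrow> 'a measure \<Rightarrow> ('a \<Rightarrow> 'b::real_normed_vector) \<Rightarrow> real" where
  "Lnorm p M f =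
     (if p = \<infinity> then real_of_ereal (esssup M (\<lambda>x. ereal (norm (f x))))
      else (LINT x|M. norm (f x) powr real_of_ereal p) powr (1 / real_of_ereal p))"

section \<open>Test functions and weak derivatives\<close>

text \<open>A multi-index is a list of basis directions; \<open>[]\<close> stands for no derivative.\<close>

definition dpartial :: "'a::euclidean_space \<Rightarrow> ('a \<Rightarrow> real) \<Rightarrow> 'a \<Rightarrow> real" where
  "dpartial i f = (\<lambda>x. frechet_derivative f (at x) i)"

definition iter_partial :: "'a::euclidean_space list \<Rightarrow> ('a \<Rightarrow> real) \<Rightarrow> 'a \<Rightarrow> real" where
  "iter_partial is f = foldr dpartial is f"

definition smooth :: "('a::euclidean_space \<Rightarrow> real) \<Rightarrow> bool" where
  "smooth f \<longleftrightarrow> (\<forall>is\<in>lists Basis. iter_partial is f differentiable_on UNIV)"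

definition test_function :: "'a::euclidean_space set \<Rightarrow> ('a \<Rightarrow> real) \<Rightarrow> bool" where
  "test_function S \<phi> \<longleftrightarrow> smooth \<phi> \<and> (\<exists>K. compact K \<and> K \<subseteq> S \<and> (\<forall>x. x \<notin> K \<longrightarrow> \<phi> x = 0))"

definition loc_integrable :: "'a::euclidean_space set \<Rightarrow> ('a \<Rightarrow> 'b::euclidean_space) \<Rightarrow> bool" where
  "loc_integrable S f \<longleftrightarrow>
     f \<in> borel_measurable (lebesgue_on S) \<and>
     (\<forall>K. compact K \<and> K \<subseteq> S \<longrightarrow> integrable (lebesgue_on K) f)"

definition weak_deriv ::
    "'a::euclidean_space set \<Rightarrow> 'a list \<Rightarrow> ('a \<Rightarrow> real) \<Rightarrow> ('a \<Rightarrow> real) \<Rightarrow> bool" where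
  "weak_deriv S is f g \<longleftrightarrow> loc_integrable S f \<and> loc_integrable S g \<and>
     (\<forall>\<phi>. test_function S \<phi> \<longrightarrow>
        (LINT x|lebesgue_on S. f x * iter_partial is \<phi> x)
          = (- 1) ^ length is * (LINT x|lebesgue_on S. g x * \<phi> x))"

text \<open>A representative of the weak derivative, which is unique almost everywhere.\<close>

definition wderiv :: "'a::euclidean_space set \<Rightarrow> 'a list \<Rightarrow> ('a \<Rightarrow> real) \<Rightarrow> 'a \<Rightarrow> real" where
  "wderiv S is f = (SOME g. weak_deriv S is f g)"

definition has_weak_div ::
    "'a::euclidean_space set \<Rightarrow> ('a \<Rightarrow> 'a) \<Rightarrow> ('a \<Rightarrow> real) \<Rightarrow> bool" where
  "has_weak_div S F g \<longleftrightarrow> loc_integrable S F \<and> loc_integrable S g \<and>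
     (\<forall>\<phi>. test_function S \<phi> \<longrightarrow>
        (LINT x|lebesgue_on S. (\<Sum>i\<in>Basis. (F x \<bullet> i) * dpartial i \<phi> x))
          = - (LINT x|lebesgue_on S. g x * \<phi> x))"

section \<open>Sobolev spaces\<close>

definition sobolev :: "nat \<Rightarrow> ereal \<Rightarrow> 'a::euclidean_space set \<Rightarrow> ('a \<Rightarrow> real) set" where
  "sobolev k p S = {f. \<forall>is\<in>lists Basis. length is \<le> k \<longrightarrow>
     (\<exists>g\<in>Lspace p (lebesgue_on S). weak_deriv S is f g)}"

text \<open>The seminorm is the Lebesgue norm of the Euclidean length of the tensor of all derivatives of
  order \<open>j\<close>; for \<open>j = 2\<close> this is the Frobenius norm of the Hessian.\<close>

definition sob_seminorm :: "nat \<Rightarrow> ereal \<Rightarrow> 'a::euclidean_space set \<Rightarrow> ('a \<Rightarrow> real) \<Rightarrow> real" where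
  "sob_seminorm j p S f = Lnorm p (lebesgue_on S)
     (\<lambda>x. sqrt (\<Sum>is | is \<in> lists Basis \<and> length is = j. (wderiv S is f x)\<^sup>2))"

definition sob_norm :: "nat \<Rightarrow> ereal \<Rightarrow> 'a::euclidean_space set \<Rightarrow> ('a \<Rightarrow> real) \<Rightarrow> real" where
  "sob_norm k p S f =
     (if p = \<infinity> then Max ((\<lambda>j. sob_seminorm j \<infinity> S f) ` {..k})
      else (\<Sum>j\<le>k. sob_seminorm j p S f powr real_of_ereal p) powr (1 / real_of_ereal p))"

text \<open>The portion \<open>\<sigma> ` space M\<close> of the boundary is parametrised by \<open>\<sigma>\<close>, with surface measure
  the image of \<open>M\<close>. The relation is the graph of the trace operator
  \<open>W\<^sup>1\<^sub>1(S) \<rightarrow> L\<^sup>1\<close>, the continuous extension of the restriction of smooth functions; on a bounded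
  domain it therefore covers \<open>W\<^sup>1\<^sub>p\<close> for all \<open>1 \<le> p \<le> \<infinity>\<close>.\<close>

definition has_trace :: "'a::euclidean_space set \<Rightarrow> 'b measure \<Rightarrow> ('b \<Rightarrow> 'a) \<Rightarrow>
    ('a \<Rightarrow> real) \<Rightarrow> ('b \<Rightarrow> real) \<Rightarrow> bool" where
  "has_trace S M \<sigma> f \<tau> \<longleftrightarrow> f \<in> sobolev 1 1 S \<and> \<tau> \<in> Lspace 1 M \<and>
     (\<exists>\<phi>. (\<forall>n::nat. smooth (\<phi> n) \<and> (\<lambda>t. \<phi> n (\<sigma> t)) \<in> Lspace 1 M) \<and>
        (\<lambda>n. sob_norm 1 1 S (\<lambda>x. \<phi> n x - f x)) \<longlonglongrightarrow> 0 \<and>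
        (\<lambda>n. Lnorm 1 M (\<lambda>t. \<phi> n (\<sigma> t) - \<tau> t)) \<longlonglongrightarrow> 0)"

section \<open>The domains\<close>

definition I :: "real set" where
  "I = {0<..<1}"

definition Omega :: "(real ^ 2) set" where
  "Omega = {x. \<forall>i. 0 < x $ i \<and> x $ i < 1}"

text \<open>\<open>top_side\<close> parametrises \<open>\<Gamma>\<close>; the three maps in \<open>Sigma_sides\<close> parametrise \<open>\<Sigma>\<close> up to corner
  points.\<close>

definition top_side :: "real \<Rightarrow> real ^ 2" where
  "top_side t = vector [t, 1]"

definition Sigma_sides :: "(real \<Rightarrow> real ^ 2) set" where
  "Sigma_sides = {\<lambda>t. vector [t, 0], \<lambda>t. vector [0, t], \<lambda>t. vector [1, t]}"

definition sobolev0_I :: "ereal \<Rightarrow> (real \<Rightarrow> real) set" where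
  "sobolev0_I p = {f \<in> sobolev 1 p I. has_trace I (count_space {0, 1}) (\<lambda>t. t) f (\<lambda>t. 0)}"

definition sobolev0_Omega :: "ereal \<Rightarrow> (real ^ 2 \<Rightarrow> real) set" where
  "sobolev0_Omega p = {f \<in> sobolev 1 p Omega.
     \<forall>\<sigma>\<in>insert top_side Sigma_sides. has_trace Omega (lebesgue_on I) \<sigma> f (\<lambda>t. 0)}"

definition d1 :: "(real \<Rightarrow> real) \<Rightarrow> real \<Rightarrow> real" where
  "d1 f = wderiv I [1] f"

definition d2 :: "(real \<Rightarrow> real) \<Rightarrow> real \<Rightarrow> real" where
  "d2 f = wderiv I [1, 1] f"

definition grad :: "(real ^ 2 \<Rightarrow> real) \<Rightarrow> real ^ 2 \<Rightarrow> real ^ 2" where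
  "grad f x = (\<chi> i. wderiv Omega [axis i 1] f x)"

section \<open>Bilinear forms and the operator A\<close>

definition B_Gamma :: "real \<Rightarrow> (real \<Rightarrow> real) \<Rightarrow> (real \<Rightarrow> real) \<Rightarrow> real" where
  "B_Gamma \<kappa> \<gamma> \<xi> = \<kappa> * (LINT t|lebesgue_on I. d1 \<gamma> t * d1 \<xi> t)"

definition B_Omega ::
    "(real ^ 2 \<Rightarrow> real) \<Rightarrow> (real ^ 2 \<Rightarrow> real) \<Rightarrow> (real ^ 2 \<Rightarrow> real ^ 2 ^ 2) \<Rightarrow> real" where
  "B_Omega y z M = (LINT x|lebesgue_on Omega. (M x *v grad y x) \<bullet> grad z x)"

definition A_mat :: "real \<Rightarrow> real \<Rightarrow> real \<Rightarrow> real ^ 2 ^ 2" where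
  "A_mat s r b = vector [vector [1 + s, - r * b], vector [- r * b, (1 + (r * b)\<^sup>2) / (1 + s)]]"

definition A :: "(real \<Rightarrow> real) \<Rightarrow> real ^ 2 \<Rightarrow> real ^ 2 ^ 2" where
  "A \<gamma> x = A_mat (\<gamma> (x $ 1)) (d1 \<gamma> (x $ 1)) (x $ 2)"

text \<open>First and second derivative of the operator \<open>\<gamma> \<mapsto> A \<gamma>\<close> at \<open>\<gamma>\<close> in directions \<open>h\<close> and \<open>h, k\<close>.
  The derivative of \<open>\<gamma> + \<tau> h\<close> is written \<open>d1 \<gamma> + \<tau> * d1 h\<close>, since \<open>d1 (\<gamma> + \<tau> h)\<close> would select a
  separate representative for every \<open>\<tau>\<close>, so that differentiating pointwise in \<open>\<tau>\<close> would be
  meaningless.\<close>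

definition DA :: "(real \<Rightarrow> real) \<Rightarrow> (real \<Rightarrow> real) \<Rightarrow> real ^ 2 \<Rightarrow> real ^ 2 ^ 2" where
  "DA \<gamma> h x = vector_derivative (\<lambda>\<tau>.
     A_mat (\<gamma> (x $ 1) + \<tau> * h (x $ 1)) (d1 \<gamma> (x $ 1) + \<tau> * d1 h (x $ 1)) (x $ 2)) (at 0)"

definition D2A :: "(real \<Rightarrow> real) \<Rightarrow> (real \<Rightarrow> real) \<Rightarrow> (real \<Rightarrow> real) \<Rightarrow> real ^ 2 \<Rightarrow> real ^ 2 ^ 2" where
  "D2A \<gamma> h k x = vector_derivative (\<lambda>\<rho>. vector_derivative (\<lambda>\<tau>.
     A_mat (\<gamma> (x $ 1) + \<rho> * k (x $ 1) + \<tau> * h (x $ 1))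
       (d1 \<gamma> (x $ 1) + \<rho> * d1 k (x $ 1) + \<tau> * d1 h (x $ 1)) (x $ 2)) (at 0)) (at 0)"

section \<open>The constants\<close>

text \<open>The suprema are taken in \<open>ereal\<close>.\<close>

definition inf_sup_Gamma :: "real \<Rightarrow> real \<Rightarrow> bool" where
  "inf_sup_Gamma \<kappa> \<alpha> \<longleftrightarrow> 0 < \<alpha> \<and>
     (\<forall>\<gamma>\<in>sobolev0_I \<infinity>. ereal (sob_seminorm 1 \<infinity> I \<gamma>) \<le> ereal \<alpha> *
        (SUP \<xi> \<in> {\<xi> \<in> sobolev0_I 1. \<not> (AE t in lebesgue_on I. \<xi> t = 0)}.
           ereal (B_Gamma \<kappa> \<gamma> \<xi> / sob_seminorm 1 1 I \<xi>)))"

definition inf_sup_Omega :: "real \<Rightarrow> real \<Rightarrow> real \<Rightarrow> bool" where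
  "inf_sup_Omega p q \<beta> \<longleftrightarrow> 0 < \<beta> \<and>
     (\<forall>y\<in>sobolev0_Omega (ereal p). \<forall>\<gamma>\<in>sobolev0_I \<infinity>. sob_seminorm 1 \<infinity> I \<gamma> \<le> 1 \<longrightarrow>
        ereal (sob_seminorm 1 (ereal p) Omega y) \<le> ereal \<beta> *
          (SUP z \<in> {z \<in> sobolev0_Omega (ereal q). \<not> (AE x in lebesgue_on Omega. z x = 0)}.
             ereal (B_Omega y z (A \<gamma>) / sob_seminorm 1 (ereal q) Omega z)))"

definition extension_operator :: "real \<Rightarrow> ((real \<Rightarrow> real) \<Rightarrow> real ^ 2 \<Rightarrow> real) \<Rightarrow> real \<Rightarrow> bool" where
  "extension_operator q E C\<^sub>E \<longleftrightarrow> 0 < C\<^sub>E \<and>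
     (\<forall>\<xi>\<in>sobolev0_I 1. \<forall>\<eta>\<in>sobolev0_I 1. \<forall>a b.
        AE x in lebesgue_on Omega. E (\<lambda>t. a * \<xi> t + b * \<eta> t) x = a * E \<xi> x + b * E \<eta> x) \<and>
     (\<forall>\<xi>\<in>sobolev0_I 1. E \<xi> \<in> sobolev 1 (ereal q) Omega \<and>
        has_trace Omega (lebesgue_on I) top_side (E \<xi>) \<xi> \<and>
        (\<forall>\<sigma>\<in>Sigma_sides. has_trace Omega (lebesgue_on I) \<sigma> (E \<xi>) (\<lambda>t. 0)) \<and>
        sob_seminorm 1 (ereal q) Omega (E \<xi>) \<le> C\<^sub>E * sob_seminorm 1 1 I \<xi>)"

definition A_bound :: "real \<Rightarrow> bool" where
  "A_bound C\<^sub>A \<longleftrightarrow> 0 < C\<^sub>A \<and>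
     (\<forall>\<gamma>\<in>sobolev0_I \<infinity>. sob_seminorm 1 \<infinity> I \<gamma> \<le> 1 \<longrightarrow>
        (AE x in lebesgue_on Omega. norm (A \<gamma> x) \<le> C\<^sub>A) \<and>
        (\<forall>h\<in>sobolev0_I \<infinity>. AE x in lebesgue_on Omega.
           norm (DA \<gamma> h x) \<le> C\<^sub>A * sob_seminorm 1 \<infinity> I h) \<and>
        (\<forall>h\<in>sobolev0_I \<infinity>. \<forall>k\<in>sobolev0_I \<infinity>. AE x in lebesgue_on Omega.
           norm (D2A \<gamma> h k x) \<le> C\<^sub>A * sob_seminorm 1 \<infinity> I h * sob_seminorm 1 \<infinity> I k))"

definition regular_gammas :: "(real \<Rightarrow> real) set" where
  "regular_gammas = {\<gamma> \<in> sobolev 2 \<infinity> I \<inter> sobolev0_I \<infinity>.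
     sob_seminorm 1 \<infinity> I \<gamma> \<le> 1 \<and> sob_seminorm 2 \<infinity> I \<gamma> \<le> 1}"

text \<open>\<open>- div (A[\<gamma>] \<nabla>w) = f\<close> with homogeneous boundary values.\<close>

definition elliptic_solution ::
    "real \<Rightarrow> (real \<Rightarrow> real) \<Rightarrow> (real ^ 2 \<Rightarrow> real) \<Rightarrow> (real ^ 2 \<Rightarrow> real) \<Rightarrow> bool" where
  "elliptic_solution p \<gamma> f w \<longleftrightarrow>
     w \<in> sobolev 2 (ereal p) Omega \<inter> sobolev0_Omega (ereal p) \<and>
     has_weak_div Omega (\<lambda>x. A \<gamma> x *v grad w x) (\<lambda>x. - f x)"

definition elliptic_estimate :: "real \<Rightarrow> real \<Rightarrow> bool" where
  "elliptic_estimate p C \<longleftrightarrow> 0 < C \<and>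
     (\<forall>\<gamma>\<in>regular_gammas. \<forall>f\<in>Lspace (ereal p) (lebesgue_on Omega). \<forall>w.
        elliptic_solution p \<gamma> f w \<longrightarrow>
        sob_norm 2 (ereal p) Omega w \<le> C * Lnorm (ereal p) (lebesgue_on Omega) f)"

text \<open>Existence of strong solutions, which is what requires \<open>p\<close> to be close enough to 2 and makes
  the operator \<open>T\<close> below well defined; uniqueness follows from the a priori estimate.\<close>

definition elliptic_solvable :: "real \<Rightarrow> bool" where
  "elliptic_solvable p \<longleftrightarrow>
     (\<forall>\<gamma>\<in>regular_gammas. \<forall>f\<in>Lspace (ereal p) (lebesgue_on Omega). \<exists>w. elliptic_solution p \<gamma> f w)"

definition sobolev_embedding_constant :: "real \<Rightarrow> real \<Rightarrow> bool" where
  "sobolev_embedding_constant p C\<^sub>S \<longleftrightarrow> 0 < C\<^sub>S \<and>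
     (\<forall>w\<in>sobolev 2 (ereal p) Omega. w \<in> sobolev 1 \<infinity> Omega \<and>
        sob_norm 1 \<infinity> Omega w \<le> C\<^sub>S * sob_norm 2 (ereal p) Omega w)"

section \<open>Spaces, sets and the operator T\<close>

type_synonym state = "(real \<Rightarrow> real) \<times> (real ^ 2 \<Rightarrow> real)"

definition U_ad :: "real \<Rightarrow> real \<Rightarrow> (real \<Rightarrow> real) set" where
  "U_ad \<alpha> \<theta>\<^sub>1 = {u \<in> Lspace 2 (lebesgue_on I). Lnorm 2 (lebesgue_on I) u \<le> \<theta>\<^sub>1 / (2 * \<alpha>)}"

definition W22_space :: "real \<Rightarrow> state set" where
  "W22_space p = (sobolev0_I \<infinity> \<times> sobolev0_Omega (ereal p))
     \<inter> (sobolev 2 \<infinity> I \<times> sobolev 2 (ereal p) Omega)"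

definition W22_norm :: "real \<Rightarrow> real \<Rightarrow> real \<Rightarrow> (real ^ 2 \<Rightarrow> real) \<Rightarrow> state \<Rightarrow> real" where
  "W22_norm p C\<^sub>A C v = (\<lambda>(\<gamma>, y).
     (1 + 2 * C\<^sub>A * C) * sob_norm 2 (ereal p) Omega v * sob_norm 2 \<infinity> I \<gamma>
       + sob_norm 2 (ereal p) Omega y)"

definition state_diff :: "state \<Rightarrow> state \<Rightarrow> state" where
  "state_diff a b = (\<lambda>t. fst a t - fst b t, \<lambda>x. snd a x - snd b x)"

definition B1 :: "real \<Rightarrow> real \<Rightarrow> real \<Rightarrow> (real ^ 2 \<Rightarrow> real) \<Rightarrow> state set" where
  "B1 p \<beta> C\<^sub>A v = {(\<gamma>, y) \<in> sobolev0_I \<infinity> \<times> sobolev0_Omega (ereal p).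
     sob_seminorm 1 (ereal p) Omega y \<le> \<beta> * C\<^sub>A * sob_seminorm 1 (ereal p) Omega v \<and>
     sob_seminorm 1 \<infinity> I \<gamma> \<le> 1}"

definition B2 :: "real \<Rightarrow> real \<Rightarrow> real \<Rightarrow> real \<Rightarrow> (real ^ 2 \<Rightarrow> real) \<Rightarrow> state set" where
  "B2 p \<beta> C\<^sub>A C v = {(\<gamma>, y) \<in> B1 p \<beta> C\<^sub>A v \<inter> W22_space p.
     sob_norm 2 (ereal p) Omega y \<le> 2 * C\<^sub>A * C * sob_norm 2 (ereal p) Omega v \<and>
     sob_seminorm 2 \<infinity> I \<gamma> \<le> 1}"

text \<open>On \<open>\<Gamma>\<close> the outer unit normal is \<open>axis 2 1\<close>, and the gradient is evaluated through its
  trace \<open>G\<close>.\<close>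

definition T_equations :: "real \<Rightarrow> real \<Rightarrow> (real ^ 2 \<Rightarrow> real) \<Rightarrow> (real \<Rightarrow> real) \<Rightarrow> state \<Rightarrow> state \<Rightarrow> bool"
  where
  "T_equations p \<kappa> v u = (\<lambda>(\<gamma>, y) (\<gamma>', y').
     \<gamma>' \<in> sobolev 2 \<infinity> I \<inter> sobolev0_I \<infinity> \<and>
     (\<exists>G :: real \<Rightarrow> real ^ 2.
        (\<forall>i. has_trace Omega (lebesgue_on I) top_side
               (\<lambda>x. grad (\<lambda>x. y x + v x) x $ i) (\<lambda>t. G t $ i)) \<and>
        (AE t in lebesgue_on I.
           - \<kappa> * d2 \<gamma>' t = (A \<gamma> (top_side t) *v G t) \<bullet> axis 2 1 + u t)) \<and>
     (\<exists>g. has_weak_div Omega (\<lambda>x. A \<gamma>' x *v grad v x) g \<and> elliptic_solution p \<gamma>' g y'))"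

definition T :: "real \<Rightarrow> real \<Rightarrow> (real ^ 2 \<Rightarrow> real) \<Rightarrow> (real \<Rightarrow> real) \<Rightarrow> state \<Rightarrow> state" where
  "T p \<kappa> v u a = (SOME b. T_equations p \<kappa> v u a b)"

text \<open>A contraction on \<open>B\<close> maps \<open>B\<close> into itself.\<close>

definition contraction_on :: "('s \<Rightarrow> 's \<Rightarrow> real) \<Rightarrow> 's set \<Rightarrow> ('s \<Rightarrow> 's) \<Rightarrow> real \<Rightarrow> bool" where
  "contraction_on d B F c \<longleftrightarrow> 0 \<le> c \<and> c < 1 \<and> F ` B \<subseteq> B \<and>
     (\<forall>a\<in>B. \<forall>b\<in>B. d (F a) (F b) \<le> c * d a b)"

end

theory Submission
  imports Defs "HOL-Computational_Algebra.Polynomial"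
begin

text \<open>
Write \<open>(\<eta>, z) = T(\<gamma>, y)\<close>. Elements of \<open>B2\<close> are regular: since \<open>\<gamma>\<close> vanishes at both ends and \<open>\<bar>\<gamma>''\<bar> \<le> 1\<close>,
one has \<open>\<bar>\<gamma>'\<bar> \<le> 1/2\<close> and \<open>\<bar>\<gamma>\<bar> \<le> 1/4\<close> (\<open>zero_trace_second_order_bounds\<close>). The first column of \<open>A[\<gamma>]\<close> is
divergence free, so \<open>div (A[\<gamma>] \<nabla>w)\<close> is a second-order operator \<open>ellip \<gamma> w\<close> with bounded coefficients
(\<open>divergence_formula\<close>). Elementary estimates give \<open>9/4\<close> as a bound for the matrix and for the first-order
coefficient, and \<open>9/2\<close> times the supremum of \<open>\<bar>\<gamma>1'' - \<gamma>2''\<bar>\<close> for the sum of the two differences. On the other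
hand \<open>9/4 \<le> C\<^sub>A\<close>, as \<open>A_bound\<close> applied to \<open>\<gamma>(t) = t\<^sup>2 - t\<close> near the corner \<open>(0, 1)\<close> shows (\<open>A_bound_lower\<close>). Hence
in \<open>L\<^sup>p\<close> the operator and its variation with \<open>\<gamma>\<close> are both bounded with the factor \<open>2 C\<^sub>A\<close>.

The trace of \<open>\<nabla>(y + v)\<close> on \<open>\<Gamma>\<close> is bounded by its supremum in the square (\<open>trace_top_bound\<close>), which the Sobolev
embedding controls by \<open>C\<^sub>S (1 + 2 C\<^sub>A C\<^sub>H) \<parallel>v\<parallel>\<close>. So the smallness of \<open>v\<close> and \<open>u\<close> gives \<open>\<bar>\<eta>''\<bar> \<le> 1\<close>, and for
two arguments at distance \<open>d\<close> the second derivatives \<open>\<eta>1''\<close> and \<open>\<eta>2''\<close> differ by at most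
\<open>D = C\<^sub>A C\<^sub>S d / \<kappa>\<close>. The a priori estimate for \<open>z\<close> yields \<open>\<parallel>z\<parallel> \<le> 2 C\<^sub>A C\<^sub>H \<parallel>v\<parallel>\<close>. Since
\<open>ellip \<eta>1 (z1 - z2)\<close> is minus the difference of the operators for \<open>\<eta>1\<close> and \<open>\<eta>2\<close> at \<open>v + z2\<close>, it also yields
\<open>\<parallel>z1 - z2\<parallel> \<le> 2 C\<^sub>A C\<^sub>H D (1 + 2 C\<^sub>A C\<^sub>H) \<parallel>v\<parallel>\<close>. Adding the two parts of the norm, the distance of the images is at
most \<open>(1 + 2 C\<^sub>A C\<^sub>H)\<^sup>2 \<parallel>v\<parallel> D = \<Lambda> \<parallel>v\<parallel> d\<close>.

That \<open>z\<close> also satisfies the first-order bound in \<open>B1\<close> follows from the inf-sup condition once the equation may be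
tested with functions of zero trace, whereas the weak divergence only tests with compactly supported ones
(\<open>flux_against_zero_trace\<close>, \<open>energy_bound\<close>). As \<open>T\<close> chooses a solution, all of this holds for every solution, and one
exists (\<open>T_exists\<close>). The tools are developed from the definitions: density of smooth functions
in \<open>W\<^sup>1\<^sub>1\<close> of a convex domain, a product rule, traces, and Fubini on the square.
\<close>

abbreviation (input) leb where "leb \<equiv> lebesgue_on"

abbreviation (input) L1_dist :: "'a measure \<Rightarrow> ('a \<Rightarrow> real) \<Rightarrow> ('a \<Rightarrow> real) \<Rightarrow> real" where
  "L1_dist M f g \<equiv> LINT x|M. \<bar>f x - g x\<bar>"

abbreviation (input) L1_tendsto :: "'a measure \<Rightarrow> (nat \<Rightarrow> 'a \<Rightarrow> real) \<Rightarrow> ('a \<Rightarrow> real) \<Rightarrow> bool" where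
  "L1_tendsto M f g \<equiv> (\<lambda>n. L1_dist M (f n) g) \<longlonglongrightarrow> 0"

section \<open>Smooth functions\<close>

lemma iter_partial_Nil [simp]: "iter_partial [] f = f"
  and iter_partial_Cons [simp]: "iter_partial (i # is) f = dpartial i (iter_partial is f)"
  by (simp_all add: iter_partial_def)

lemma iter_partial_append: "iter_partial (is @ js) f = iter_partial is (iter_partial js f)"
  by (simp add: iter_partial_def)

lemma dpartial_eqI: "(f has_derivative D) (at x) \<Longrightarrow> dpartial i f x = D i"
  by (metis dpartial_def frechet_derivative_at)

lemma dpartial_realI: "(f has_real_derivative d) (at x) \<Longrightarrow> dpartial 1 f x = d"
  by (simp add: dpartial_eqI[of _ "(*) d"] has_field_derivative_def)

text \<open>Smoothness is the largest class of differentiable functions that is closed under partial derivatives.\<close>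

lemma smooth_coinduct:
  assumes f: "F f" and diff: "\<And>g x. F g \<Longrightarrow> g differentiable (at x)"
    and closed: "\<And>g i. F g \<Longrightarrow> i \<in> Basis \<Longrightarrow> F (dpartial i g)"
  shows "smooth f"
proof -
  have F: "F (iter_partial is f)" if "is \<in> lists Basis" for "is"
    using that
  proof (induction "is")
    case Nil
    show ?case using f by simp
  next
    case (Cons i "is")
    then show ?case using closed by simp
  qed
  show ?thesis
    unfolding smooth_def differentiable_on_def
  proof (intro ballI)
    fix "is" :: "'a list" and x :: 'a assume "is \<in> lists Basis"
    from diff[OF F[OF this]] show "iter_partial is f differentiable at x within UNIV" .
  qed
qed

lemma smooth_dpartial: assumes "smooth f" "i \<in> Basis" shows "smooth (dpartial i f)"
  unfolding smooth_def
proof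
  fix js :: "'a list" assume "js \<in> lists Basis"
  then have "js @ [i] \<in> lists Basis"
    using assms(2) by simp
  with assms(1) have "iter_partial (js @ [i]) f differentiable_on UNIV"
    unfolding smooth_def by blast
  then show "iter_partial js (dpartial i f) differentiable_on UNIV"
    by (simp add: iter_partial_append)
qed

lemma smooth_differentiable: "smooth f \<Longrightarrow> f differentiable (at x)"
  unfolding smooth_def by (metis differentiable_on_def iter_partial_Nil lists.Nil UNIV_I)

lemma smooth_continuous_on: "smooth f \<Longrightarrow> continuous_on S f"
  using smooth_differentiable differentiable_imp_continuous_within
  by (metis continuous_at_imp_continuous_on)

lemma smooth_has_derivative:
  assumes "smooth f"
  shows "(f has_derivative (\<lambda>h. \<Sum>i\<in>Basis. (h \<bullet> i) * dpartial i f x)) (at x)"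
proof -
  obtain D where D: "(f has_derivative D) (at x)"
    using smooth_differentiable[OF assms] unfolding differentiable_def by blast
  then interpret bounded_linear D by (rule has_derivative_bounded_linear)
  have "D h = (\<Sum>i\<in>Basis. (h \<bullet> i) * dpartial i f x)" for h
  proof -
    have "D h = D (\<Sum>i\<in>Basis. (h \<bullet> i) *\<^sub>R i)"
      by (simp add: euclidean_representation)
    also have "\<dots> = (\<Sum>i\<in>Basis. (h \<bullet> i) * D i)"
      by (simp add: sum scaleR)
    finally show ?thesis using D by (simp add: dpartial_eqI)
  qed
  then have "D = (\<lambda>h. \<Sum>i\<in>Basis. (h \<bullet> i) * dpartial i f x)" by (rule ext)
  with D show ?thesis by simp
qed

lemma smooth_DERIV: "smooth f \<Longrightarrow> (f has_real_derivative dpartial 1 f x) (at x)"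
  unfolding has_field_derivative_def
  by (rule has_derivative_eq_rhs[OF smooth_has_derivative]) (simp_all add: fun_eq_iff)

lemma dpartial_add: "f differentiable (at x) \<Longrightarrow> g differentiable (at x) \<Longrightarrow>
    dpartial i (\<lambda>x. f x + g x) x = dpartial i f x + dpartial i g x"
  unfolding frechet_derivative_works
  by (drule (1) has_derivative_add) (simp add: dpartial_eqI, simp add: dpartial_def)

lemma dpartial_mult: "f differentiable (at x) \<Longrightarrow> g differentiable (at x) \<Longrightarrow>
    dpartial i (\<lambda>x. f x * g x) x = f x * dpartial i g x + dpartial i f x * g x"
  unfolding frechet_derivative_works
  by (drule (1) has_derivative_mult) (simp add: dpartial_eqI, simp add: dpartial_def)

lemma dpartial_inverse: "f differentiable (at x) \<Longrightarrow> f x \<noteq> 0 \<Longrightarrow>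
    dpartial i (\<lambda>x. inverse (f x)) x = (- 1) * (dpartial i f x * (inverse (f x) * inverse (f x)))"
  unfolding frechet_derivative_works
  by (drule (1) Deriv.has_derivative_inverse, subst dpartial_eqI, assumption)
    (simp add: dpartial_def mult_ac)

lemma dpartial_const [simp]: "dpartial i (\<lambda>x. c) = (\<lambda>x. 0)"
  by (rule ext, rule dpartial_eqI[of _ "\<lambda>_. 0", THEN trans]) auto

text \<open>The least algebra that contains the smooth functions and reciprocals of its zero-free members
  is closed under differentiation, hence consists of smooth functions; this gives all the closure
  properties at once.\<close>

inductive smooth_alg :: "('a::euclidean_space \<Rightarrow> real) \<Rightarrow> bool" where
  "smooth f \<Longrightarrow> smooth_alg f"
| "smooth_alg f \<Longrightarrow> smooth_alg g \<Longrightarrow> smooth_alg (\<lambda>x. f x + g x)"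
| "smooth_alg f \<Longrightarrow> smooth_alg g \<Longrightarrow> smooth_alg (\<lambda>x. f x * g x)"
| "smooth_alg f \<Longrightarrow> (\<And>x. f x \<noteq> 0) \<Longrightarrow> smooth_alg (\<lambda>x. inverse (f x))"

lemma smooth_const: "smooth (\<lambda>x. c)"
  by (rule smooth_coinduct[of "\<lambda>f. \<exists>c. f = (\<lambda>x. c)"]) auto

lemma smooth_alg_differentiable: "smooth_alg f \<Longrightarrow> f differentiable (at x)"
  by (induction rule: smooth_alg.induct)
    (auto intro: smooth_differentiable differentiable_add differentiable_mult differentiable_inverse)

lemma smooth_alg_dpartial: "smooth_alg f \<Longrightarrow> i \<in> Basis \<Longrightarrow> smooth_alg (dpartial i f)"
proof (induction rule: smooth_alg.induct)
  case (2 f g)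
  then have "dpartial i (\<lambda>x. f x + g x) = (\<lambda>x. dpartial i f x + dpartial i g x)"
    by (auto simp: smooth_alg_differentiable dpartial_add)
  with 2 show ?case by (auto intro: smooth_alg.intros)
next
  case (3 f g)
  then have "dpartial i (\<lambda>x. f x * g x) = (\<lambda>x. f x * dpartial i g x + dpartial i f x * g x)"
    by (auto simp: smooth_alg_differentiable dpartial_mult)
  with 3 show ?case by (auto intro!: smooth_alg.intros(2,3))
next
  case (4 f)
  then have "dpartial i (\<lambda>x. inverse (f x))
      = (\<lambda>x. (- 1) * (dpartial i f x * (inverse (f x) * inverse (f x))))"
    by (intro ext dpartial_inverse) (auto simp: smooth_alg_differentiable)
  moreover have "smooth_alg (\<lambda>x. (- 1) * (dpartial i f x * (inverse (f x) * inverse (f x))))"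
    by (intro smooth_alg.intros(3)) (use 4 in \<open>auto intro: smooth_alg.intros smooth_const\<close>)
  ultimately show ?case by simp
qed (auto intro: smooth_alg.intros smooth_dpartial)

lemma smooth_alg_smooth: "smooth_alg f \<Longrightarrow> smooth f"
  by (rule smooth_coinduct[of smooth_alg])
    (auto intro: smooth_alg_differentiable smooth_alg_dpartial)

lemma smooth_add: "smooth f \<Longrightarrow> smooth g \<Longrightarrow> smooth (\<lambda>x. f x + g x)"
  and smooth_mult: "smooth f \<Longrightarrow> smooth g \<Longrightarrow> smooth (\<lambda>x. f x * g x)"
  and smooth_inverse: "smooth f \<Longrightarrow> (\<And>x. f x \<noteq> 0) \<Longrightarrow> smooth (\<lambda>x. inverse (f x))"
  by (auto intro!: smooth_alg_smooth intro: smooth_alg.intros)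

lemma smooth_cmult: "smooth f \<Longrightarrow> smooth (\<lambda>x. c * f x)"
  by (intro smooth_mult smooth_const)

lemma smooth_diff: "smooth f \<Longrightarrow> smooth g \<Longrightarrow> smooth (\<lambda>x. f x - g x)"
  using smooth_add[of f "\<lambda>x. (-1) * g x"] smooth_cmult[of g "-1"] by simp

lemma dpartial_diff: "smooth f \<Longrightarrow> smooth g \<Longrightarrow> dpartial i (\<lambda>x. f x - g x) = (\<lambda>x. dpartial i f x - dpartial i g x)"
  using smooth_differentiable[of f] smooth_differentiable[of g] unfolding frechet_derivative_works
  by (intro ext dpartial_eqI[THEN trans, OF has_derivative_diff]) (auto simp: dpartial_def)

lemma smooth_prod: "finite F \<Longrightarrow> (\<And>i. i \<in> F \<Longrightarrow> smooth (f i)) \<Longrightarrow> smooth (\<lambda>x. \<Prod>i\<in>F. f i x)"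
  by (induction rule: finite_induct) (auto intro: smooth_const smooth_mult)

lemma smooth_inner: "smooth (\<lambda>x. x \<bullet> b)"
proof (rule smooth_coinduct[of "\<lambda>f. f = (\<lambda>x. x \<bullet> b) \<or> (\<exists>c. f = (\<lambda>x. c))"])
  have "dpartial i (\<lambda>x. x \<bullet> b) = (\<lambda>_. i \<bullet> b)" for i
    by (rule ext, rule dpartial_eqI) (auto intro!: derivative_eq_intros)
  then show "dpartial i g = (\<lambda>x. x \<bullet> b) \<or> (\<exists>c. dpartial i g = (\<lambda>x. c))"
    if "g = (\<lambda>x. x \<bullet> b) \<or> (\<exists>c. g = (\<lambda>x. c))" for i g
    using that by auto
qed auto

lemma has_derivative_affine:
  assumes "smooth f"
  shows "((\<lambda>x. f (a + r *\<^sub>R x)) has_derivative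
      (\<lambda>h. r * frechet_derivative f (at (a + r *\<^sub>R x)) h)) (at x)"
proof -
  have "((\<lambda>x. f (a + r *\<^sub>R x)) has_derivative
      (\<lambda>h. frechet_derivative f (at (a + r *\<^sub>R x)) (r *\<^sub>R h))) (at x)"
    using smooth_differentiable[OF assms] unfolding frechet_derivative_works
    by (intro has_derivative_compose[of "\<lambda>x. a + r *\<^sub>R x" _ _ _ f]) (auto intro!: derivative_eq_intros)
  moreover have "linear (frechet_derivative f (at (a + r *\<^sub>R x)))"
    using assms by (simp add: linear_frechet_derivative smooth_differentiable)
  ultimately show ?thesis by (simp add: linear_cmul)
qed

lemma dpartial_affine:
  "smooth f \<Longrightarrow> dpartial i (\<lambda>x. f (a + r *\<^sub>R x)) x = r * dpartial i f (a + r *\<^sub>R x)"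
  by (simp add: dpartial_eqI[OF has_derivative_affine]) (simp add: dpartial_def)

lemma smooth_affine:
  assumes "smooth f" shows "smooth (\<lambda>x. f (a + r *\<^sub>R x))"
proof (rule smooth_coinduct[of "\<lambda>h. \<exists>k g. smooth g \<and> h = (\<lambda>x. k * g (a + r *\<^sub>R x))"])
  have "(\<lambda>x. f (a + r *\<^sub>R x)) = (\<lambda>x. 1 * f (a + r *\<^sub>R x))" by simp
  with assms show "\<exists>k g. smooth g \<and> (\<lambda>x. f (a + r *\<^sub>R x)) = (\<lambda>x. k * g (a + r *\<^sub>R x))"
    by metis
next
  have diff: "(\<lambda>x. g (a + r *\<^sub>R x)) differentiable (at x)" if "smooth g" for g :: "'a \<Rightarrow> real" and x
    using has_derivative_affine[OF that] unfolding differentiable_def by metis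
  show "h differentiable (at x)"
    if h: "\<exists>k g. smooth g \<and> h = (\<lambda>x. k * g (a + r *\<^sub>R x))" for h x
  proof -
    obtain k g where g: "smooth g" "h = (\<lambda>x. k * g (a + r *\<^sub>R x))" using h by blast
    show ?thesis unfolding g(2) by (rule differentiable_mult[OF differentiable_const diff[OF g(1)]])
  qed
  show "\<exists>k g. smooth g \<and> dpartial i h = (\<lambda>x. k * g (a + r *\<^sub>R x))"
    if h: "\<exists>k g. smooth g \<and> h = (\<lambda>x. k * g (a + r *\<^sub>R x))" and i: "i \<in> Basis" for h i
  proof -
    obtain k g where g: "smooth g" "h = (\<lambda>x. k * g (a + r *\<^sub>R x))" using h by blast
    have "dpartial i h = (\<lambda>x. k * r * dpartial i g (a + r *\<^sub>R x))"
      unfolding g(2) by (rule ext) (simp add: dpartial_mult[OF _ diff[OF g(1)]] dpartial_affine g(1))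
    then show ?thesis using smooth_dpartial[OF g(1) i] by blast
  qed
qed

lemma has_derivative_ridge:
  fixes g :: "real \<Rightarrow> real"
  assumes "smooth g"
  shows "((\<lambda>x. g (c + x \<bullet> b)) has_derivative (\<lambda>h. dpartial 1 g (c + x \<bullet> b) * (h \<bullet> b))) (at x)"
  using smooth_DERIV[OF assms, of "c + x \<bullet> b"] unfolding has_field_derivative_def
  by (intro has_derivative_compose[of "\<lambda>x. c + x \<bullet> b" _ _ _ g]) (auto intro!: derivative_eq_intros)

lemma dpartial_ridge:
  fixes g :: "real \<Rightarrow> real"
  shows "smooth g \<Longrightarrow> dpartial i (\<lambda>x. g (c + x \<bullet> b)) x = (i \<bullet> b) * dpartial 1 g (c + x \<bullet> b)"
  by (simp add: dpartial_eqI[OF has_derivative_ridge])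

lemma smooth_ridge:
  fixes g :: "real \<Rightarrow> real" and b :: "'a::euclidean_space"
  assumes "smooth g" shows "smooth (\<lambda>x. g (c + x \<bullet> b))"
proof (rule smooth_coinduct[of "\<lambda>h. \<exists>k g. smooth g \<and> h = (\<lambda>x. k * g (c + x \<bullet> b))"])
  have "(\<lambda>x. g (c + x \<bullet> b)) = (\<lambda>x. 1 * g (c + x \<bullet> b))" by simp
  with assms show "\<exists>k h. smooth h \<and> (\<lambda>x. g (c + x \<bullet> b)) = (\<lambda>x. k * h (c + x \<bullet> b))"
    by metis
next
  have diff: "(\<lambda>x. g (c + x \<bullet> b)) differentiable (at x)" if "smooth g" for g x
    using has_derivative_ridge[OF that] unfolding differentiable_def by metis
  show "h differentiable (at x)"
    if h: "\<exists>k g. smooth g \<and> h = (\<lambda>x. k * g (c + x \<bullet> b))" for h x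
  proof -
    obtain k g where g: "smooth g" "h = (\<lambda>x. k * g (c + x \<bullet> b))" using h by blast
    show ?thesis unfolding g(2) by (rule differentiable_mult[OF differentiable_const diff[OF g(1)]])
  qed
  show "\<exists>k g. smooth g \<and> dpartial i h = (\<lambda>x. k * g (c + x \<bullet> b))"
    if h: "\<exists>k g. smooth g \<and> h = (\<lambda>x. k * g (c + x \<bullet> b))" and i: "i \<in> Basis" for h i
  proof -
    obtain k g where g: "smooth g" "h = (\<lambda>x. k * g (c + x \<bullet> b))" using h by blast
    have *: "dpartial i h = (\<lambda>x. (k * (i \<bullet> b)) * dpartial 1 g (c + x \<bullet> b))"
      unfolding g(2) by (rule ext) (simp add: dpartial_mult[OF _ diff[OF g(1)]] dpartial_ridge g(1))
    show ?thesis
      by (rule exI, rule exI, rule conjI[OF smooth_dpartial[OF g(1)] *]) simp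
  qed
qed

subsection \<open>Cutoff functions\<close>

text \<open>The family \<open>p(1/x) e\<^sup>-\<^sup>1\<^sup>/\<^sup>x\<close> is closed under differentiation, whence coinduction shows that all
  its members are smooth.\<close>

definition flat_exp :: "real poly \<Rightarrow> real \<Rightarrow> real" where
  "flat_exp p x = (if x > 0 then poly p (1 / x) * exp (- (1 / x)) else 0)"

lemma poly_exp_tendsto_0: "((\<lambda>y. poly p y * exp (- y)) \<longlongrightarrow> (0::real)) at_top"
proof -
  have "((\<lambda>y. \<Sum>i\<le>degree p. coeff p i * (y ^ i / exp y)) \<longlongrightarrow> (\<Sum>i\<le>degree p. coeff p i * 0)) at_top"
    by (intro tendsto_intros tendsto_power_div_exp_0)
  then show ?thesis
    by (simp add: poly_altdef exp_minus divide_inverse sum_distrib_right mult.assoc)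
qed

lemma flat_exp_DERIV:
  "(flat_exp p has_real_derivative flat_exp ([:0, 0, 1:] * (p - pderiv p)) x) (at x)"
proof (cases x "0::real" rule: linorder_cases)
  case less
  then have "(flat_exp p has_real_derivative 0) (at x) \<longleftrightarrow> ((\<lambda>_. 0) has_real_derivative 0) (at x)"
    by (intro DERIV_cong_ev eventually_mono[OF eventually_nhds_in_open[of "{..<0}"]])
      (auto simp: flat_exp_def)
  with less show ?thesis by (simp add: flat_exp_def)
next
  case greater
  then have "((\<lambda>x. poly p (1 / x) * exp (- (1 / x))) has_real_derivative
      flat_exp ([:0, 0, 1:] * (p - pderiv p)) x) (at x)"
    by (auto intro!: derivative_eq_intros poly_DERIV[THEN DERIV_chain2]
        simp: flat_exp_def field_simps power2_eq_square)
  moreover have "(flat_exp p has_real_derivative D) (at x) \<longleftrightarrow>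
      ((\<lambda>x. poly p (1 / x) * exp (- (1 / x))) has_real_derivative D) (at x)" for D
    using greater
    by (intro DERIV_cong_ev eventually_mono[OF eventually_nhds_in_open[of "{0<..}"]])
      (auto simp: flat_exp_def)
  ultimately show ?thesis by simp
next
  case equal
  have "((\<lambda>y. poly (pCons 0 p) (inverse y) * exp (- inverse y)) \<longlongrightarrow> 0) (at_right 0)"
    by (rule filterlim_compose[OF poly_exp_tendsto_0 filterlim_inverse_at_top_right])
  then have "((\<lambda>h. flat_exp p h / h) \<longlongrightarrow> 0) (at_right 0)"
    by (rule Lim_transform_eventually)
      (auto simp: flat_exp_def eventually_at_filter field_simps)
  moreover have "((\<lambda>h. flat_exp p h / h) \<longlongrightarrow> 0) (at_left 0)"
    by (rule Lim_transform_eventually[OF tendsto_const])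
      (auto simp: flat_exp_def eventually_at_filter)
  ultimately have "((\<lambda>h. flat_exp p h / h) \<longlongrightarrow> 0) (at 0)"
    by (rule filterlim_split_at[rotated])
  with equal show ?thesis by (simp add: DERIV_def flat_exp_def)
qed

lemma smooth_flat_exp: "smooth (flat_exp p)"
proof (rule smooth_coinduct[of "\<lambda>f. \<exists>p. f = flat_exp p"])
  have "dpartial 1 (flat_exp p) = flat_exp ([:0, 0, 1:] * (p - pderiv p))" for p
    by (rule ext) (rule dpartial_realI[OF flat_exp_DERIV])
  then show "\<exists>p. dpartial i g = flat_exp p" if "\<exists>p. g = flat_exp p" "i \<in> Basis" for g and i :: real
    using that by auto
  show "g differentiable (at x)" if "\<exists>p. g = flat_exp p" for g x
    using that flat_exp_DERIV real_differentiable_def by blast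
qed auto

text \<open>The standard smooth transition from \<open>0\<close> on \<open>x \<le> 0\<close> to \<open>1\<close> on \<open>x \<ge> 1\<close>.\<close>

definition step :: "real \<Rightarrow> real" where
  "step x = flat_exp 1 x * inverse (flat_exp 1 x + flat_exp 1 (1 - x))"

lemma step_denominator: "0 < flat_exp 1 x + flat_exp 1 (1 - x)"
  by (auto simp: flat_exp_def add_pos_pos intro: add_nonneg_pos)

lemma step_nonneg: "0 \<le> step x" and step_le_1: "step x \<le> 1"
  and step_eq_0: "x \<le> 0 \<Longrightarrow> step x = 0" and step_eq_1: "1 \<le> x \<Longrightarrow> step x = 1"
  using step_denominator[of x] by (auto simp: step_def flat_exp_def divide_simps split: if_splits)

lemma smooth_step: "smooth step"
proof -
  have "smooth (\<lambda>x. flat_exp 1 (1 + (-1) *\<^sub>R x))"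
    by (intro smooth_affine smooth_flat_exp)
  then show ?thesis
    unfolding step_def[abs_def] using step_denominator
    by (intro smooth_mult smooth_inverse smooth_add smooth_flat_exp) (auto simp: less_imp_neq[symmetric])
qed

lemma step_deriv_outside: assumes "x < 0 \<or> 1 < x" shows "dpartial 1 step x = 0"
proof -
  have "(step has_real_derivative 0) (at x)"
  proof (cases "x < 0")
    case True
    then have "(step has_real_derivative 0) (at x) \<longleftrightarrow> ((\<lambda>_. 0) has_real_derivative 0) (at x)"
      by (intro DERIV_cong_ev eventually_mono[OF eventually_nhds_in_open[of "{..<0}"]])
        (auto simp: step_eq_0)
    then show ?thesis by simp
  next
    case False
    then have "(step has_real_derivative 0) (at x) \<longleftrightarrow> ((\<lambda>_. 1) has_real_derivative 0) (at x)"
      using assms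
      by (intro DERIV_cong_ev eventually_mono[OF eventually_nhds_in_open[of "{1<..}"]])
        (auto simp: step_eq_1)
    then show ?thesis by simp
  qed
  then show ?thesis by (rule dpartial_realI)
qed

lemma step_deriv_bounded: obtains C where "0 < C" "\<And>x. \<bar>dpartial 1 step x\<bar> \<le> C"
proof -
  have "compact (dpartial 1 step ` {0..1})"
    by (intro compact_continuous_image smooth_continuous_on smooth_dpartial smooth_step) auto
  then obtain C where C: "0 < C" "\<And>x. x \<in> {0..1} \<Longrightarrow> \<bar>dpartial 1 step x\<bar> \<le> C"
    using compact_imp_bounded bounded_pos[of "dpartial 1 step ` {0..1}"] by auto
  have "\<bar>dpartial 1 step x\<bar> \<le> C" for x
    using C step_deriv_outside[of x] by (cases "x \<in> {0..1}") (auto simp: not_le)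
  with C that show ?thesis by blast
qed

text \<open>The arguments of \<open>step\<close> are \<open>n (x\<^sub>i - a\<^sub>i) - 1\<close> and \<open>n (b\<^sub>i - x\<^sub>i) - 1\<close>, in the form to which \<open>smooth_ridge\<close>
  applies: the function is \<open>1\<close> at distance \<open>2/n\<close> from the faces of the box and \<open>0\<close> at distance \<open>1/n\<close>.\<close>

definition box_cutoff :: "'a::euclidean_space \<Rightarrow> 'a \<Rightarrow> nat \<Rightarrow> 'a \<Rightarrow> real" where
  "box_cutoff a b n x = (\<Prod>i\<in>Basis. step ((- real n * (a \<bullet> i) - 1) + x \<bullet> (real n *\<^sub>R i))
     * step ((real n * (b \<bullet> i) - 1) + x \<bullet> (- real n *\<^sub>R i)))"

lemma smooth_box_cutoff: "smooth (box_cutoff a b n)"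
  unfolding box_cutoff_def[abs_def]
  by (intro smooth_prod smooth_mult smooth_ridge smooth_step) auto

lemma box_cutoff_nonneg: "0 \<le> box_cutoff a b n x"
  and box_cutoff_le_1: "box_cutoff a b n x \<le> 1"
  by (auto simp: box_cutoff_def step_nonneg step_le_1 intro!: prod_nonneg prod_le_1 mult_le_one)

lemma box_cutoff_eq_0:
  assumes "i \<in> Basis" "real n * (x \<bullet> i - a \<bullet> i) \<le> 1 \<or> real n * (b \<bullet> i - x \<bullet> i) \<le> 1"
  shows "box_cutoff a b n x = 0"
proof -
  have "step ((- real n * (a \<bullet> i) - 1) + x \<bullet> (real n *\<^sub>R i))
     * step ((real n * (b \<bullet> i) - 1) + x \<bullet> (- real n *\<^sub>R i)) = 0"
    using assms(2) by (auto simp: algebra_simps intro: step_eq_0)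
  with assms(1) show ?thesis unfolding box_cutoff_def by (intro prod_zero) auto
qed

lemma box_cutoff_eq_1:
  assumes "\<And>i. i \<in> Basis \<Longrightarrow> 2 \<le> real n * (x \<bullet> i - a \<bullet> i) \<and> 2 \<le> real n * (b \<bullet> i - x \<bullet> i)"
  shows "box_cutoff a b n x = 1"
  unfolding box_cutoff_def
proof (rule prod.neutral, rule ballI)
  fix i :: 'a assume "i \<in> Basis"
  from assms[OF this] show "step ((- real n * (a \<bullet> i) - 1) + x \<bullet> (real n *\<^sub>R i))
     * step ((real n * (b \<bullet> i) - 1) + x \<bullet> (- real n *\<^sub>R i)) = 1"
    by (subst (1 2) step_eq_1) (auto simp: algebra_simps)
qed

lemma box_cutoff_support:
  assumes "0 < n" and "box_cutoff a b n x \<noteq> 0"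
  shows "x \<in> cbox (a + (1 / real n) *\<^sub>R One) (b - (1 / real n) *\<^sub>R One)"
proof -
  have "1 < real n * (x \<bullet> i - a \<bullet> i) \<and> 1 < real n * (b \<bullet> i - x \<bullet> i)" if "i \<in> Basis" for i
    using box_cutoff_eq_0[OF that, of n x a b] assms(2) by linarith
  then have "1 / real n < x \<bullet> i - a \<bullet> i \<and> 1 / real n < b \<bullet> i - x \<bullet> i" if "i \<in> Basis" for i
    using assms(1) that by (simp add: field_simps)
  then show ?thesis
    by (auto simp: mem_box inner_add_left inner_diff_left algebra_simps intro!: less_imp_le)
qed

lemma test_function_box_cutoff:
  assumes "0 < n" "box a b \<subseteq> S" shows "test_function S (box_cutoff a b n)"
  unfolding test_function_def
proof (intro conjI exI[of _ "cbox (a + (1 / real n) *\<^sub>R One) (b - (1 / real n) *\<^sub>R One)"] allI impI)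
  show "cbox (a + (1 / real n) *\<^sub>R One) (b - (1 / real n) *\<^sub>R One) \<subseteq> S"
  proof -
    have "0 < 1 / real n" using assms by simp
    then have "cbox (a + (1 / real n) *\<^sub>R One) (b - (1 / real n) *\<^sub>R One) \<subseteq> box a b"
      by (auto simp: mem_box inner_add_left inner_diff_left simp del: zero_less_divide_iff; smt)
    with assms(2) show ?thesis by blast
  qed
qed (use box_cutoff_support[OF assms(1)] smooth_box_cutoff in auto)

lemma box_cutoff_tendsto: "(\<lambda>n. box_cutoff a b n x) \<longlonglongrightarrow> indicator (box a b) x"
proof (rule tendsto_eventually)
  show "eventually (\<lambda>n. box_cutoff a b n x = indicator (box a b) x) sequentially"
  proof (cases "x \<in> box a b")
    case True
    have "eventually (\<lambda>n. 2 \<le> real n * (x \<bullet> i - a \<bullet> i) \<and> 2 \<le> real n * (b \<bullet> i - x \<bullet> i)) sequentially"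
      if "i \<in> Basis" for i
    proof -
      have "0 < x \<bullet> i - a \<bullet> i" "0 < b \<bullet> i - x \<bullet> i" using True that by (auto simp: mem_box)
      then have *: "filterlim (\<lambda>n. real n * (x \<bullet> i - a \<bullet> i)) at_top sequentially"
        "filterlim (\<lambda>n. real n * (b \<bullet> i - x \<bullet> i)) at_top sequentially"
        by (auto intro!: filterlim_at_top_mult_tendsto_pos[OF tendsto_const] filterlim_real_sequentially)
      show ?thesis
        using *[THEN filterlim_at_top[THEN iffD1], rule_format, of 2] by (rule eventually_conj)
    qed
    then have "eventually (\<lambda>n. \<forall>i\<in>Basis. 2 \<le> real n * (x \<bullet> i - a \<bullet> i) \<and> 2 \<le> real n * (b \<bullet> i - x \<bullet> i))
        sequentially"
      by (simp add: eventually_ball_finite_distrib)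
    then show ?thesis
      by (rule eventually_mono) (use True in \<open>simp add: box_cutoff_eq_1\<close>)
  next
    case False
    then obtain i where i: "i \<in> Basis" "x \<bullet> i - a \<bullet> i \<le> 0 \<or> b \<bullet> i - x \<bullet> i \<le> 0"
      by (force simp: mem_box not_less)
    then have "real n * (x \<bullet> i - a \<bullet> i) \<le> 1 \<or> real n * (b \<bullet> i - x \<bullet> i) \<le> 1" for n
      by (meson mult_nonneg_nonpos of_nat_0_le_iff order_trans zero_le_one)
    then show ?thesis using False box_cutoff_eq_0[OF i(1)] by auto
  qed
qed

section \<open>Weak derivatives\<close>

lemma integrable_times_bounded:
  fixes f g :: "'a \<Rightarrow> real"
  assumes "integrable M f" and "g \<in> borel_measurable M" and "AE x in M. \<bar>g x\<bar> \<le> C"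
  shows "integrable M (\<lambda>x. f x * g x)"
proof (rule Bochner_Integration.integrable_bound)
  show "integrable M (\<lambda>x. C * f x)" using assms(1) by simp
  show "(\<lambda>x. f x * g x) \<in> borel_measurable M" using assms by measurable
  show "AE x in M. norm (f x * g x) \<le> norm (C * f x)"
    using assms(3)
  proof eventually_elim
    case (elim x)
    then have "\<bar>g x\<bar> * \<bar>f x\<bar> \<le> \<bar>C\<bar> * \<bar>f x\<bar>" by (intro mult_right_mono) auto
    then show ?case by (simp add: abs_mult mult.commute)
  qed
qed

lemma integral_lincomb_times:
  fixes f g h :: "'a \<Rightarrow> real"
  assumes "integrable M (\<lambda>x. f x * h x)" "integrable M (\<lambda>x. g x * h x)"
  shows "(LINT x|M. (a * f x + b * g x) * h x) = a * (LINT x|M. f x * h x) + b * (LINT x|M. g x * h x)"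
proof -
  have "(LINT x|M. (a * f x + b * g x) * h x) = (LINT x|M. a * (f x * h x) + b * (g x * h x))"
    by (simp add: distrib_right mult.assoc)
  also have "\<dots> = (LINT x|M. a * (f x * h x)) + (LINT x|M. b * (g x * h x))"
    using assms by (intro Bochner_Integration.integral_add integrable_mult_right)
  finally show ?thesis by simp
qed

lemma compact_support_bounded:
  fixes g :: "'a::euclidean_space \<Rightarrow> real"
  assumes "continuous_on UNIV g" "compact K" "\<And>x. x \<notin> K \<Longrightarrow> g x = 0"
  obtains C where "0 < C" "\<And>x. \<bar>g x\<bar> \<le> C"
proof -
  have "compact (g ` K)"
    using assms by (intro compact_continuous_image) (auto intro: continuous_on_subset)
  then obtain C where C: "0 < C" "\<And>x. x \<in> K \<Longrightarrow> \<bar>g x\<bar> \<le> C"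
    using compact_imp_bounded bounded_pos[of "g ` K"] by auto
  have "\<bar>g x\<bar> \<le> C" for x using C assms(3)[of x] by (cases "x \<in> K") auto
  with C(1) that show ?thesis by blast
qed

lemma continuous_lebesgue_measurable:
  fixes g :: "'a::euclidean_space \<Rightarrow> 'b::topological_space"
  shows "continuous_on UNIV g \<Longrightarrow> g \<in> borel_measurable lebesgue"
    and "continuous_on UNIV g \<Longrightarrow> g \<in> borel_measurable (leb S)"
  by (simp_all add: borel_measurable_continuous_onI measurable_completion measurable_restrict_space1)

lemma loc_integrableD: "loc_integrable S f \<Longrightarrow> compact K \<Longrightarrow> K \<subseteq> S \<Longrightarrow> integrable (leb K) f"
  by (simp add: loc_integrable_def)

lemma loc_integrable_times:
  fixes f g :: "'a::euclidean_space \<Rightarrow> real"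
  assumes f: "loc_integrable S f" and S: "open S"
    and g: "continuous_on UNIV g" "compact K" "K \<subseteq> S" "\<And>x. x \<notin> K \<Longrightarrow> g x = 0"
  shows "integrable (leb S) (\<lambda>x. f x * g x)"
proof -
  obtain C where C: "\<And>x. \<bar>g x\<bar> \<le> C" using compact_support_bounded[OF g(1,2,4)] by blast
  have K: "K \<in> sets lebesgue" using g(2) by (simp add: borel_compact)
  have "integrable (leb K) f" using f g(2,3) by (rule loc_integrableD)
  then have "integrable lebesgue (\<lambda>x. indicator K x *\<^sub>R f x)"
    using K by (simp add: integrable_restrict_space)
  then have "integrable lebesgue (\<lambda>x. (indicator K x *\<^sub>R f x) * g x)"
    using g(1) C by (intro integrable_times_bounded[where C = C] continuous_lebesgue_measurable) auto
  also have "(\<lambda>x. (indicator K x *\<^sub>R f x) * g x) = (\<lambda>x. indicator S x *\<^sub>R (f x * g x))"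
    using g(3,4) by (auto simp: fun_eq_iff indicator_def)
  finally show ?thesis using S by (simp add: integrable_restrict_space)
qed

lemma dpartial_support:
  assumes "closed K" "\<And>x. x \<notin> K \<Longrightarrow> f x = 0" "x \<notin> K"
  shows "dpartial i f x = 0"
proof -
  have "(f has_derivative (\<lambda>_. 0)) (at x)"
    by (rule has_derivative_transform_within_open[of "\<lambda>_. 0" _ _ _ "- K"])
      (use assms in \<open>auto simp: open_Compl\<close>)
  then show ?thesis by (simp add: dpartial_eqI)
qed

lemma test_function_smooth: "test_function S \<phi> \<Longrightarrow> smooth \<phi>"
  by (simp add: test_function_def)

lemma test_function_dpartial: "test_function S \<phi> \<Longrightarrow> i \<in> Basis \<Longrightarrow> test_function S (dpartial i \<phi>)"
  unfolding test_function_def using smooth_dpartial dpartial_support compact_imp_closed by metis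

lemma test_function_mult: "test_function S \<phi> \<Longrightarrow> smooth f \<Longrightarrow> test_function S (\<lambda>x. f x * \<phi> x)"
  unfolding test_function_def using smooth_mult mult_zero_right by metis

lemma integrable_times_test:
  fixes f :: "'a::euclidean_space \<Rightarrow> real"
  assumes "loc_integrable S f" "open S" "test_function S \<phi>"
  shows "integrable (leb S) (\<lambda>x. f x * \<phi> x)"
proof -
  obtain K where K: "compact K" "K \<subseteq> S" "\<forall>x. x \<notin> K \<longrightarrow> \<phi> x = 0"
    using assms(3) unfolding test_function_def by blast
  show ?thesis
    using loc_integrable_times[OF assms(1,2) smooth_continuous_on[OF test_function_smooth[OF assms(3)]] K(1,2)] K(3)
    by blast
qed

lemma test_function_iter_partial:
  "test_function S \<phi> \<Longrightarrow> is \<in> lists Basis \<Longrightarrow> test_function S (iter_partial is \<phi>)"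
  by (induction "is") (auto intro: test_function_dpartial)

lemma integrable_times_iter_partial:
  fixes f :: "'a::euclidean_space \<Rightarrow> real"
  shows "loc_integrable S f \<Longrightarrow> open S \<Longrightarrow> test_function S \<phi> \<Longrightarrow> is \<in> lists Basis \<Longrightarrow>
    integrable (leb S) (\<lambda>x. f x * iter_partial is \<phi> x)"
  by (rule integrable_times_test[OF _ _ test_function_iter_partial])

subsection \<open>The fundamental lemma of the calculus of variations\<close>

lemma integral_box_zero:
  fixes f :: "'a::euclidean_space \<Rightarrow> real"
  assumes f: "loc_integrable S f" and S: "open S" and box: "cbox a b \<subseteq> S"
    and zero: "\<And>\<phi>. test_function S \<phi> \<Longrightarrow> (LINT x|leb S. f x * \<phi> x) = 0"
  shows "(LINT x|lebesgue. indicator (box a b) x * f x) = 0"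
proof -
  let ?\<phi> = "\<lambda>n. box_cutoff a b (Suc n)"
  have int: "integrable lebesgue (\<lambda>x. indicator (cbox a b) x * f x)"
  proof -
    have "integrable (leb (cbox a b)) f" using f box by (rule loc_integrableD[OF _ compact_cbox])
    then show ?thesis by (simp add: integrable_restrict_space)
  qed
  have meas: "?\<phi> n \<in> borel_measurable lebesgue" for n
    by (intro continuous_lebesgue_measurable smooth_continuous_on smooth_box_cutoff)
  have supp: "?\<phi> n x = indicator (cbox a b) x * ?\<phi> n x" for n x
  proof (cases "?\<phi> n x = 0")
    case False
    have "0 \<le> 1 / real (Suc n)" by simp
    then have "cbox (a + (1 / real (Suc n)) *\<^sub>R One) (b - (1 / real (Suc n)) *\<^sub>R One) \<subseteq> cbox a b"
      unfolding subset_box by (auto simp: inner_add_left inner_diff_left simp del: of_nat_Suc)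
    then show ?thesis using box_cutoff_support[OF _ False] by (auto simp: indicator_def)
  qed simp
  have "(LINT x|lebesgue. indicator (cbox a b) x * f x * ?\<phi> n x) = 0" for n
  proof -
    have "test_function S (?\<phi> n)"
      using box box_subset_cbox by (intro test_function_box_cutoff) (auto intro: order_trans)
    then have "0 = (LINT x|leb S. f x * ?\<phi> n x)" by (simp add: zero)
    also have "\<dots> = (LINT x|lebesgue. indicator S x * (f x * ?\<phi> n x))"
      using S by (subst integral_restrict_space) auto
    also have "(\<lambda>x. indicator S x * (f x * ?\<phi> n x)) = (\<lambda>x. indicator (cbox a b) x * f x * ?\<phi> n x)"
    proof
      fix x show "indicator S x * (f x * ?\<phi> n x) = indicator (cbox a b) x * f x * ?\<phi> n x"
        using box by (subst supp) (auto simp: indicator_def)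
    qed
    finally show ?thesis by simp
  qed
  moreover have "(\<lambda>n. LINT x|lebesgue. indicator (cbox a b) x * f x * ?\<phi> n x)
      \<longlonglongrightarrow> (LINT x|lebesgue. indicator (cbox a b) x * f x * indicator (box a b) x)"
  proof (rule integral_dominated_convergence)
    show "(\<lambda>x. indicator (cbox a b) x * f x * indicator (box a b) x) \<in> borel_measurable lebesgue"
      by (rule borel_measurable_times[OF borel_measurable_integrable[OF int] borel_measurable_indicator])
        simp
    show "(\<lambda>x. indicator (cbox a b) x * f x * ?\<phi> n x) \<in> borel_measurable lebesgue" for n
      by (rule borel_measurable_times[OF borel_measurable_integrable[OF int] meas])
    show "integrable lebesgue (\<lambda>x. \<bar>indicator (cbox a b) x * f x\<bar>)" using int by simp
    show "AE x in lebesgue. (\<lambda>n. indicator (cbox a b) x * f x * ?\<phi> n x)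
        \<longlonglongrightarrow> indicator (cbox a b) x * f x * indicator (box a b) x"
      using LIMSEQ_Suc[OF box_cutoff_tendsto] by (intro AE_I2 tendsto_intros) auto
    show "AE x in lebesgue. norm (indicator (cbox a b) x * f x * ?\<phi> n x) \<le> \<bar>indicator (cbox a b) x * f x\<bar>" for n
    proof (intro AE_I2)
      fix x
      have "\<bar>indicator (cbox a b) x * f x\<bar> * \<bar>?\<phi> n x\<bar> \<le> \<bar>indicator (cbox a b) x * f x\<bar> * 1"
        using box_cutoff_nonneg[of a b "Suc n" x] box_cutoff_le_1[of a b "Suc n" x]
        by (intro mult_left_mono) auto
      then show "norm (indicator (cbox a b) x * f x * ?\<phi> n x) \<le> \<bar>indicator (cbox a b) x * f x\<bar>"
        by (simp only: real_norm_def abs_mult mult_1_right)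
    qed
  qed
  ultimately have "(LINT x|lebesgue. indicator (cbox a b) x * f x * indicator (box a b) x) = 0"
    by (simp add: LIMSEQ_const_iff)
  moreover have "(\<lambda>x. indicator (cbox a b) x * f x * indicator (box a b) x) = (\<lambda>x. indicator (box a b) x * f x)"
    using box_subset_cbox by (auto simp: indicator_def fun_eq_iff)
  ultimately show ?thesis by simp
qed

text \<open>Test with the sets where a Borel representative is positive and negative.\<close>

lemma AE_zero_if_set_integrals_zero:
  fixes F :: "'a::euclidean_space \<Rightarrow> real"
  assumes int: "integrable lebesgue F"
    and zero: "\<And>A. A \<in> sets borel \<Longrightarrow> (LINT x|lebesgue. indicator A x * F x) = 0"
  shows "AE x in lebesgue. F x = 0"
proof -
  obtain G where G[measurable]: "G \<in> borel_measurable borel" and FG: "AE x in lborel. F x = G x"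
    using completion_ex_borel_measurable_real[OF borel_measurable_integrable[OF int]] by auto
  have FG': "AE x in lebesgue. F x = G x" using FG by (rule AE_completion)
  have *: "AE x in lebesgue. indicator A x * G x = 0"
    if A[measurable]: "A \<in> sets borel" and sgn: "(\<And>x. x \<in> A \<Longrightarrow> 0 \<le> s * G x)" "s \<noteq> 0" for A s
  proof -
    have m: "indicat_real A \<in> borel_measurable lebesgue" "G \<in> borel_measurable lebesgue"
      by (auto intro!: measurable_completion)
    have i: "integrable lebesgue (\<lambda>x. indicator A x * F x)"
      using int that(1) by (simp add: integrable_mult_indicator[where 'b=real, simplified])
    have ae: "AE x in lebesgue. indicator A x * F x = indicator A x * G x"
      using FG' by eventually_elim simp
    have "integrable lebesgue (\<lambda>x. indicator A x * G x)"
      using integrable_cong_AE[OF _ _ ae] i m borel_measurable_integrable[OF i] by auto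
    moreover have "(LINT x|lebesgue. indicator A x * G x) = 0"
      using integral_cong_AE[OF _ _ ae] m borel_measurable_integrable[OF i] zero[OF A] by auto
    ultimately have "integrable lebesgue (\<lambda>x. s * (indicator A x * G x))"
      "(LINT x|lebesgue. s * (indicator A x * G x)) = 0" by auto
    then have "AE x in lebesgue. s * (indicator A x * G x) = 0"
      using sgn by (subst (asm) integral_nonneg_eq_0_iff_AE) (auto simp: indicator_def)
    then show ?thesis using sgn by simp
  qed
  have "{x. G x > 0} \<in> sets borel" "{x. G x < 0} \<in> sets borel" by measurable
  then have "AE x in lebesgue. indicator {x. G x > 0} x * G x = 0"
    "AE x in lebesgue. indicator {x. G x < 0} x * G x = 0"
    using *[of "{x. G x > 0}" 1] *[of "{x. G x < 0}" "-1"] by auto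
  with FG' show ?thesis
    by eventually_elim (auto simp: indicator_def split: if_splits)
qed

lemma set_integrals_zero_if_box:
  fixes F :: "'a::euclidean_space \<Rightarrow> real"
  assumes int: "integrable lebesgue F" and tot: "(LINT x|lebesgue. F x) = 0"
    and zero: "\<And>a b. (LINT x|lebesgue. indicator (box a b) x * F x) = 0"
    and X: "X \<in> sets borel"
  shows "(LINT x|lebesgue. indicator X x * F x) = 0"
proof -
  have ind: "integrable lebesgue (\<lambda>x. indicator A x * F x)" if "A \<in> sets borel" for A
    using int that by (simp add: integrable_mult_indicator[where 'b=real, simplified])
  have "Int_stable (range (\<lambda>(a, b). box a b :: 'a set))"
    by (auto simp: Int_stable_def box_Int_box)
  moreover have "range (\<lambda>(a, b). box a b :: 'a set) \<subseteq> Pow UNIV" by simp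
  moreover have "X \<in> sigma_sets UNIV (range (\<lambda>(a, b). box a b :: 'a set))"
    using X by (simp add: borel_eq_box)
  ultimately show ?thesis
  proof (induction X rule: sigma_sets_induct_disjoint)
    case (basic A)
    then show ?case using zero by auto
  next
    case (compl A)
    then have A: "A \<in> sets borel" by (simp add: borel_eq_box)
    have "(LINT x|lebesgue. indicator (UNIV - A) x * F x)
        = (LINT x|lebesgue. F x - indicator A x * F x)"
      by (intro Bochner_Integration.integral_cong) (auto simp: indicator_def)
    also have "\<dots> = 0" using compl tot by (simp add: int ind[OF A])
    finally show ?case .
  next
    case (union A)
    then have A: "A i \<in> sets borel" for i by (auto simp: borel_eq_box)
    have "set_lebesgue_integral lebesgue (\<Union>i. A i) F = (\<Sum>i. set_lebesgue_integral lebesgue (A i) F)"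
    proof (rule lebesgue_integral_countable_add)
      show "set_integrable lebesgue (\<Union>i. A i) F"
        unfolding set_integrable_def using ind[of "\<Union>i. A i"] A by auto
    qed (use union A in \<open>auto simp: disjoint_family_on_def\<close>)
    then show ?case using union by (simp add: set_lebesgue_integral_def)
  qed (simp_all add: zero)
qed

text \<open>Cutoffs of boxes converge to their indicators, so that the integral of \<open>f\<close> over every box
  vanishes; boxes form a generator of the Borel sets that is closed under intersection.\<close>

lemma fundamental_lemma:
  fixes f :: "'a::euclidean_space \<Rightarrow> real"
  assumes f: "loc_integrable S f" and S: "open S"
    and zero: "\<And>\<phi>. test_function S \<phi> \<Longrightarrow> (LINT x|leb S. f x * \<phi> x) = 0"
  shows "AE x in leb S. f x = 0"
proof -
  have box: "AE x in lebesgue. x \<in> cbox c d \<longrightarrow> f x = 0" if cd: "cbox c d \<subseteq> S" for c d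
  proof -
    have "integrable lebesgue (\<lambda>x. indicator (cbox c d) x * f x)"
    proof -
      have "integrable (leb (cbox c d)) f" using f cd by (rule loc_integrableD[OF _ compact_cbox])
      then show ?thesis by (simp add: integrable_restrict_space)
    qed
    from integrable_mult_indicator[OF _ this, of "box c d"]
    have "integrable lebesgue (\<lambda>x. indicator (box c d) x *\<^sub>R (indicator (cbox c d) x * f x))" by simp
    also have "(\<lambda>x. indicator (box c d) x *\<^sub>R (indicator (cbox c d) x * f x))
        = (\<lambda>x. indicator (box c d) x * f x)"
      using box_subset_cbox[of c d] by (auto simp: fun_eq_iff indicator_def)
    finally have int: "integrable lebesgue (\<lambda>x. indicator (box c d) x * f x)" .
    have zero_box: "(LINT x|lebesgue. indicator (box a b) x * (indicator (box c d) x * f x)) = 0" for a b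
    proof -
      obtain e g where eg: "box a b \<inter> box c d = box e g" by (auto simp: box_Int_box)
      have "(LINT x|lebesgue. indicator (box e g) x * f x) = 0"
      proof (cases "box e g = {}")
        case False
        then have "cbox e g = closure (box e g)" by (simp add: closure_box)
        also have "\<dots> \<subseteq> cbox c d"
          by (rule closure_minimal) (use eg box_subset_cbox in auto)
        finally show ?thesis using cd by (intro integral_box_zero[OF f S _ zero]) auto
      qed simp
      moreover have "(\<lambda>x. indicator (box a b) x * (indicator (box c d) x * f x))
          = (\<lambda>x. indicator (box e g) x * f x)"
        by (simp add: eg[symmetric] indicator_inter_arith mult.assoc)
      ultimately show ?thesis by simp
    qed
    have "AE x in lebesgue. indicator (box c d) x * f x = 0"
      by (rule AE_zero_if_set_integrals_zero[OF int])
        (rule set_integrals_zero_if_box[OF int integral_box_zero[OF f S cd zero] zero_box])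
    moreover have "AE x in lebesgue. x \<notin> cbox c d - box c d"
      using negligible_frontier_interval[of c d] by (intro AE_not_in) (simp add: negligible_iff_null_sets)
    ultimately show ?thesis by eventually_elim (auto simp: indicator_def)
  qed
  obtain D where D: "countable D" "\<And>X. X \<in> D \<Longrightarrow> X \<subseteq> S" "\<And>X. X \<in> D \<Longrightarrow> \<exists>a b. X = cbox a b" "\<Union>D = S"
    by (rule open_countable_Union_open_cbox[OF S]) (rule that, auto)
  have "AE x in lebesgue. x \<in> X \<longrightarrow> f x = 0" if X: "X \<in> D" for X
  proof -
    obtain a b where "X = cbox a b" using D(3)[OF X] by blast
    with box[of a b] D(2)[OF X] show ?thesis by simp
  qed
  then have "AE x in lebesgue. \<forall>X\<in>D. x \<in> X \<longrightarrow> f x = 0"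
    using D(1) by (rule AE_ball_countable')
  then have "AE x in lebesgue. x \<in> S \<longrightarrow> f x = 0"
    unfolding D(4)[symmetric] by (rule eventually_mono) blast
  then show ?thesis using S by (simp add: AE_restrict_space_iff)
qed

subsection \<open>Calculus of weak derivatives\<close>

lemma weak_derivD:
  assumes "weak_deriv S is f g"
  shows "loc_integrable S f" "loc_integrable S g"
    and "test_function S \<phi> \<Longrightarrow> (LINT x|leb S. f x * iter_partial is \<phi> x)
      = (- 1) ^ length is * (LINT x|leb S. g x * \<phi> x)"
  using assms by (simp_all add: weak_deriv_def)

lemma loc_integrable_diff:
  fixes f g :: "'a::euclidean_space \<Rightarrow> real"
  shows "loc_integrable S f \<Longrightarrow> loc_integrable S g \<Longrightarrow> loc_integrable S (\<lambda>x. f x - g x)"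
  unfolding loc_integrable_def by auto

lemma loc_integrable_lincomb:
  fixes f g :: "'a::euclidean_space \<Rightarrow> real"
  shows "loc_integrable S f \<Longrightarrow> loc_integrable S g \<Longrightarrow> loc_integrable S (\<lambda>x. a * f x + b * g x)"
  unfolding loc_integrable_def by auto

lemma AE_eq_if_equal_against_tests:
  fixes f g :: "'a::euclidean_space \<Rightarrow> real"
  assumes "loc_integrable S f" "loc_integrable S g" "open S"
    and eq: "\<And>\<phi>. test_function S \<phi> \<Longrightarrow> (LINT x|leb S. f x * \<phi> x) = (LINT x|leb S. g x * \<phi> x)"
  shows "AE x in leb S. f x = g x"
proof -
  have "AE x in leb S. f x - g x = 0"
  proof (rule fundamental_lemma[OF loc_integrable_diff[OF assms(1,2)] assms(3)])
    fix \<phi> assume \<phi>: "test_function S \<phi>"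
    have "(LINT x|leb S. (f x - g x) * \<phi> x)
        = (LINT x|leb S. f x * \<phi> x) - (LINT x|leb S. g x * \<phi> x)"
      using integral_lincomb_times[OF integrable_times_test[OF assms(1,3) \<phi>]
        integrable_times_test[OF assms(2,3) \<phi>], of 1 "-1"] by simp
    then show "(LINT x|leb S. (f x - g x) * \<phi> x) = 0" using eq[OF \<phi>] by simp
  qed
  then show ?thesis by simp
qed

lemma weak_deriv_unique:
  assumes "weak_deriv S is f g" "weak_deriv S is f h" "open S"
  shows "AE x in leb S. g x = h x"
proof (rule AE_eq_if_equal_against_tests)
  fix \<phi> assume \<phi>: "test_function S \<phi>"
  have "(- 1) ^ length is * (LINT x|leb S. g x * \<phi> x)
      = (- 1) ^ length is * (LINT x|leb S. h x * \<phi> x)"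
    using weak_derivD(3)[OF assms(1) \<phi>] weak_derivD(3)[OF assms(2) \<phi>] by linarith
  then show "(LINT x|leb S. g x * \<phi> x) = (LINT x|leb S. h x * \<phi> x)"
    by simp
qed (use assms in \<open>auto simp: weak_deriv_def\<close>)

lemma weak_deriv_wderiv: "weak_deriv S is f g \<Longrightarrow> weak_deriv S is f (wderiv S is f)"
  unfolding wderiv_def by (rule someI[where P = "weak_deriv S is f"])

lemma wderiv_AE_eq: "weak_deriv S is f g \<Longrightarrow> open S \<Longrightarrow> AE x in leb S. wderiv S is f x = g x"
  by (rule weak_deriv_unique[OF weak_deriv_wderiv])

lemma weak_deriv_Nil: "loc_integrable S f \<Longrightarrow> weak_deriv S [] f f"
  by (simp add: weak_deriv_def)

lemma weak_deriv_Nil_AE: "weak_deriv S [] f g \<Longrightarrow> open S \<Longrightarrow> AE x in leb S. g x = f x"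
  by (rule weak_deriv_unique[OF _ weak_deriv_Nil]) (auto simp: weak_deriv_def)

lemma weak_deriv_lincomb:
  assumes "weak_deriv S is f g" "weak_deriv S is f' g'" "open S" "is \<in> lists Basis"
  shows "weak_deriv S is (\<lambda>x. a * f x + b * f' x) (\<lambda>x. a * g x + b * g' x)"
  unfolding weak_deriv_def
proof (intro conjI allI impI)
  have l: "loc_integrable S f" "loc_integrable S f'" "loc_integrable S g" "loc_integrable S g'"
    using assms by (auto simp: weak_deriv_def)
  then show "loc_integrable S (\<lambda>x. a * f x + b * f' x)" "loc_integrable S (\<lambda>x. a * g x + b * g' x)"
    by (auto intro: loc_integrable_lincomb)
  fix \<phi> assume \<phi>: "test_function S \<phi>"
  note int = integrable_times_iter_partial[OF l(1) assms(3) \<phi> assms(4)]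
    integrable_times_iter_partial[OF l(2) assms(3) \<phi> assms(4)]
    integrable_times_test[OF l(3) assms(3) \<phi>] integrable_times_test[OF l(4) assms(3) \<phi>]
  have "(LINT x|leb S. (a * f x + b * f' x) * iter_partial is \<phi> x)
      = a * (LINT x|leb S. f x * iter_partial is \<phi> x)
        + b * (LINT x|leb S. f' x * iter_partial is \<phi> x)"
    by (rule integral_lincomb_times[OF int(1,2)])
  also have "\<dots> = a * ((- 1) ^ length is * (LINT x|leb S. g x * \<phi> x))
        + b * ((- 1) ^ length is * (LINT x|leb S. g' x * \<phi> x))"
    by (simp only: weak_derivD(3)[OF assms(1) \<phi>] weak_derivD(3)[OF assms(2) \<phi>])
  also have "\<dots> = (- 1) ^ length is * (a * (LINT x|leb S. g x * \<phi> x)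
        + b * (LINT x|leb S. g' x * \<phi> x))"
    by (simp add: algebra_simps)
  also have "a * (LINT x|leb S. g x * \<phi> x) + b * (LINT x|leb S. g' x * \<phi> x)
      = (LINT x|leb S. (a * g x + b * g' x) * \<phi> x)"
    by (rule integral_lincomb_times[OF int(3,4), symmetric])
  finally show "(LINT x|leb S. (a * f x + b * f' x) * iter_partial is \<phi> x)
      = (- 1) ^ length is * (LINT x|leb S. (a * g x + b * g' x) * \<phi> x)" .
qed

lemma weak_deriv_diff:
  "weak_deriv S is f g \<Longrightarrow> weak_deriv S is f' g' \<Longrightarrow> open S \<Longrightarrow> is \<in> lists Basis \<Longrightarrow>
    weak_deriv S is (\<lambda>x. f x - f' x) (\<lambda>x. g x - g' x)"
  using weak_deriv_lincomb[of S "is" f g f' g' 1 "-1"] by simp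

lemma weak_deriv_add:
  "weak_deriv S is f g \<Longrightarrow> weak_deriv S is f' g' \<Longrightarrow> open S \<Longrightarrow> is \<in> lists Basis \<Longrightarrow>
    weak_deriv S is (\<lambda>x. f x + f' x) (\<lambda>x. g x + g' x)"
  using weak_deriv_lincomb[of S "is" f g f' g' 1 "1"] by simp

text \<open>Test the first identity with \<open>\<partial>\<^sub>j \<phi>\<close>, which is a test function again.\<close>

lemma weak_deriv_step:
  assumes "weak_deriv S [i] f g" "weak_deriv S [i, j] f h" "j \<in> Basis"
  shows "weak_deriv S [j] g h"
  unfolding weak_deriv_def
proof (intro conjI allI impI)
  fix \<phi> assume \<phi>: "test_function S \<phi>"
  from assms(1) test_function_dpartial[OF this assms(3)]
  have "(LINT x|leb S. f x * dpartial i (dpartial j \<phi>) x)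
      = - (LINT x|leb S. g x * dpartial j \<phi> x)"
    unfolding weak_deriv_def by simp
  moreover from assms(2) \<phi> have "(LINT x|leb S. f x * dpartial i (dpartial j \<phi>) x)
      = (LINT x|leb S. h x * \<phi> x)"
    unfolding weak_deriv_def by simp
  ultimately show "(LINT x|leb S. g x * iter_partial [j] \<phi> x)
      = (- 1) ^ length [j] * (LINT x|leb S. h x * \<phi> x)" by simp
qed (use assms in \<open>auto simp: weak_deriv_def\<close>)

lemma weak_deriv_Cons:
  assumes "weak_deriv S [i] f g" "weak_deriv S [j] g h" "j \<in> Basis"
  shows "weak_deriv S [i, j] f h"
  unfolding weak_deriv_def
proof (intro conjI allI impI)
  fix \<phi> assume \<phi>: "test_function S \<phi>"
  from assms(1) test_function_dpartial[OF this assms(3)]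
  have "(LINT x|leb S. f x * dpartial i (dpartial j \<phi>) x)
      = - (LINT x|leb S. g x * dpartial j \<phi> x)"
    unfolding weak_deriv_def by simp
  moreover from assms(2) \<phi> have "(LINT x|leb S. g x * dpartial j \<phi> x)
      = - (LINT x|leb S. h x * \<phi> x)"
    unfolding weak_deriv_def by simp
  ultimately show "(LINT x|leb S. f x * iter_partial [i, j] \<phi> x)
      = (- 1) ^ length [i, j] * (LINT x|leb S. h x * \<phi> x)" by simp
qed (use assms in \<open>auto simp: weak_deriv_def\<close>)

section \<open>Approximation by smooth functions\<close>

definition conv :: "('a::euclidean_space \<Rightarrow> real) \<Rightarrow> ('a \<Rightarrow> real) \<Rightarrow> 'a \<Rightarrow> real" where
  "conv F g x = (LINT y|lborel. F y * g (x - y))"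

definition bump :: "('a::euclidean_space \<Rightarrow> real) \<Rightarrow> bool" where
  "bump g \<longleftrightarrow> smooth g \<and> (\<exists>K. compact K \<and> (\<forall>x. x \<notin> K \<longrightarrow> g x = 0))"

lemma bump_dpartial: "bump g \<Longrightarrow> i \<in> Basis \<Longrightarrow> bump (dpartial i g)"
  unfolding bump_def using smooth_dpartial dpartial_support compact_imp_closed by metis

lemma bump_smooth: "bump g \<Longrightarrow> smooth g"
  by (simp add: bump_def)

lemma bump_bounded: assumes "bump g" obtains C where "0 < C" "\<And>x. \<bar>g x\<bar> \<le> C"
  using assms compact_support_bounded[of g] smooth_continuous_on unfolding bump_def by metis

lemma smooth_borel_measurable: "smooth g \<Longrightarrow> g \<in> borel_measurable borel"
  by (intro borel_measurable_continuous_onI smooth_continuous_on)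

lemma bump_uniformly_continuous:
  assumes "bump g" "0 < e"
  obtains d where "0 < d" "\<And>x y. norm (y - x) < d \<Longrightarrow> \<bar>g y - g x\<bar> < e"
proof -
  obtain K where K: "compact K" "\<And>x. x \<notin> K \<Longrightarrow> g x = 0" using assms(1) unfolding bump_def by blast
  obtain R where R: "0 < R" "\<And>x. x \<in> K \<Longrightarrow> norm x \<le> R"
    using compact_imp_bounded[OF K(1)] bounded_pos by metis
  have "uniformly_continuous_on (cball 0 (R + 1)) g"
    using bump_smooth[OF assms(1)] by (intro compact_uniformly_continuous smooth_continuous_on) auto
  then obtain d where d: "0 < d"
      "\<And>x y. x \<in> cball 0 (R + 1) \<Longrightarrow> y \<in> cball 0 (R + 1) \<Longrightarrow> dist y x < d \<Longrightarrow> dist (g y) (g x) < e"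
    using assms(2) unfolding uniformly_continuous_on_def by metis
  have "\<bar>g y - g x\<bar> < e" if xy: "norm (y - x) < min d 1" for x y
  proof (cases "x \<in> K \<or> y \<in> K")
    case True
    have "norm y \<le> norm x + norm (y - x)" "norm x \<le> norm y + norm (y - x)"
      by norm+
    then have "x \<in> cball 0 (R + 1)" "y \<in> cball 0 (R + 1)"
      using True R(2) xy by (fastforce simp: min_def split: if_splits)+
    then show ?thesis using d(2)[of x y] xy by (simp add: dist_norm)
  next
    case False
    then show ?thesis using K(2) assms(2) by simp
  qed
  with d(1) that[of "min d 1"] show ?thesis by simp
qed

lemma smooth_line_DERIV:
  assumes "smooth g"
  shows "((\<lambda>t. g (x + t *\<^sub>R h)) has_real_derivative (\<Sum>i\<in>Basis. (h \<bullet> i) * dpartial i g (x + t *\<^sub>R h))) (at t)"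
proof -
  have "((\<lambda>t. g (x + t *\<^sub>R h)) has_derivative
      (\<lambda>s. \<Sum>i\<in>Basis. ((s *\<^sub>R h) \<bullet> i) * dpartial i g (x + t *\<^sub>R h))) (at t)"
    by (rule has_derivative_compose[of "\<lambda>t. x + t *\<^sub>R h" _ _ _ g, OF _ smooth_has_derivative[OF assms]])
      (auto intro!: derivative_eq_intros)
  then show ?thesis
    unfolding has_field_derivative_def
    by (rule has_derivative_eq_rhs) (simp add: fun_eq_iff sum_distrib_left sum_distrib_right mult_ac)
qed

lemma smooth_mean_value:
  assumes "smooth g"
  obtains t where "0 < t" "t < 1" "g (x + h) - g x = (\<Sum>i\<in>Basis. (h \<bullet> i) * dpartial i g (x + t *\<^sub>R h))"
proof -
  have "\<exists>t>0. t < 1 \<and> g (x + 1 *\<^sub>R h) - g (x + 0 *\<^sub>R h)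
      = (1 - 0) * (\<Sum>i\<in>Basis. (h \<bullet> i) * dpartial i g (x + t *\<^sub>R h))"
    by (rule MVT2) (use smooth_line_DERIV[OF assms] in auto)
  with that show ?thesis by auto
qed

text \<open>Uniformity in the base point is what allows differentiation under the integral in a convolution.\<close>

lemma bump_uniformly_differentiable:
  fixes g :: "'a::euclidean_space \<Rightarrow> real"
  assumes g: "bump g" and e: "0 < e"
  obtains d where "0 < d"
    "\<And>x h. norm h < d \<Longrightarrow> \<bar>g (x + h) - g x - (\<Sum>i\<in>Basis. (h \<bullet> i) * dpartial i g x)\<bar> \<le> e * norm h"
proof -
  define e' where "e' = e / DIM('a)"
  have e': "0 < e'" using e by (simp add: e'_def)
  have "\<exists>d>0. \<forall>x y. norm (y - x) < d \<longrightarrow> \<bar>dpartial i g y - dpartial i g x\<bar> < e'" if "i \<in> Basis" for i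
    using bump_uniformly_continuous[OF bump_dpartial[OF g that] e'] by metis
  then obtain d where d: "\<And>i. i \<in> Basis \<Longrightarrow> 0 < d i"
      "\<And>i x y. i \<in> Basis \<Longrightarrow> norm (y - x) < d i \<Longrightarrow> \<bar>dpartial i g y - dpartial i g x\<bar> < e'"
    by metis
  show ?thesis
  proof (rule that)
    show "0 < Min (d ` Basis)" using d(1) by simp
    fix x h :: 'a assume h: "norm h < Min (d ` Basis)"
    obtain t where t: "0 < t" "t < 1" "g (x + h) - g x = (\<Sum>i\<in>Basis. (h \<bullet> i) * dpartial i g (x + t *\<^sub>R h))"
      using smooth_mean_value[OF bump_smooth[OF g]] by metis
    have "g (x + h) - g x - (\<Sum>i\<in>Basis. (h \<bullet> i) * dpartial i g x)
        = (\<Sum>i\<in>Basis. (h \<bullet> i) * (dpartial i g (x + t *\<^sub>R h) - dpartial i g x))"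
      unfolding t(3) by (simp add: right_diff_distrib sum_subtractf)
    also have "\<bar>\<dots>\<bar> \<le> (\<Sum>i\<in>(Basis::'a set). norm h * e')"
    proof (rule order_trans[OF sum_abs sum_mono])
      fix i :: 'a assume i: "i \<in> Basis"
      have "t * norm h \<le> 1 * norm h" using t by (intro mult_right_mono) auto
      also have "\<dots> < d i" using h i by simp
      finally have "norm (x + t *\<^sub>R h - x) < d i" using t by simp
      from d(2)[OF i this] show "\<bar>(h \<bullet> i) * (dpartial i g (x + t *\<^sub>R h) - dpartial i g x)\<bar> \<le> norm h * e'"
        unfolding abs_mult using Basis_le_norm[OF i, of h] by (intro mult_mono) auto
    qed
    also have "\<dots> = e * norm h" by (simp add: e'_def)
    finally show "\<bar>g (x + h) - g x - (\<Sum>i\<in>Basis. (h \<bullet> i) * dpartial i g x)\<bar> \<le> e * norm h" .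
  qed
qed

lemma conv_integrable:
  assumes F: "integrable lborel F" and g: "bump g"
  shows "integrable lborel (\<lambda>y. F y * g (x - y))"
proof -
  obtain C where C: "0 < C" "\<And>x. \<bar>g x\<bar> \<le> C" using bump_bounded[OF g] by metis
  have [measurable]: "g \<in> borel_measurable borel" by (rule smooth_borel_measurable[OF bump_smooth[OF g]])
  show ?thesis
    by (rule integrable_times_bounded[OF F, where C = C]) (use C in auto)
qed

lemma conv_has_derivative:
  fixes g :: "'a::euclidean_space \<Rightarrow> real"
  assumes F: "integrable lborel F" and g: "bump g"
  shows "(conv F g has_derivative (\<lambda>h. \<Sum>i\<in>Basis. (h \<bullet> i) * conv F (dpartial i g) x)) (at x)"
  unfolding has_derivative_at_alt
proof (intro conjI allI impI)
  show "bounded_linear (\<lambda>h. \<Sum>i\<in>Basis. (h \<bullet> i) * conv F (dpartial i g) x)"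
    by (intro bounded_linear_sum bounded_linear_mult_const bounded_linear_inner_left)
  fix e :: real assume e: "0 < e"
  define c where "c = (LINT y|lborel. \<bar>F y\<bar>)"
  have c: "0 \<le> c" by (simp add: c_def)
  obtain d where d: "0 < d"
    "\<And>x h. norm h < d \<Longrightarrow> \<bar>g (x + h) - g x - (\<Sum>i\<in>Basis. (h \<bullet> i) * dpartial i g x)\<bar> \<le> e / (c + 1) * norm h"
    by (rule bump_uniformly_differentiable[OF g, of "e / (c + 1)"]) (use e c in auto)
  have "norm (conv F g y - conv F g x - (\<Sum>i\<in>Basis. ((y - x) \<bullet> i) * conv F (dpartial i g) x)) \<le> e * norm (y - x)"
    if y: "norm (y - x) < d" for y
  proof -
    define R where "R z = g (y - z) - g (x - z) - (\<Sum>i\<in>Basis. ((y - x) \<bullet> i) * dpartial i g (x - z))" for z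
    have R: "\<bar>R z\<bar> \<le> e / (c + 1) * norm (y - x)" for z
      using d(2)[OF y, of "x - z"] by (simp add: R_def algebra_simps)
    have FR: "(\<lambda>z. F z * R z) = (\<lambda>z. F z * g (y - z) - F z * g (x - z)
        - (\<Sum>i\<in>Basis. ((y - x) \<bullet> i) * (F z * dpartial i g (x - z))))"
      by (simp add: R_def fun_eq_iff right_diff_distrib sum_distrib_left mult_ac)
    note ints = conv_integrable[OF F g] conv_integrable[OF F bump_dpartial[OF g]]
    have int: "integrable lborel (\<lambda>z. F z * R z)"
      unfolding FR using ints by (intro Bochner_Integration.integrable_diff Bochner_Integration.integrable_sum
        integrable_mult_right) auto
    have "conv F g y - conv F g x - (\<Sum>i\<in>Basis. ((y - x) \<bullet> i) * conv F (dpartial i g) x) = (LINT z|lborel. F z * R z)"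
      unfolding FR conv_def using ints
      by (subst Bochner_Integration.integral_diff) (auto simp: Bochner_Integration.integral_sum)
    also have "norm \<dots> \<le> (LINT z|lborel. \<bar>F z\<bar> * (e / (c + 1) * norm (y - x)))"
    proof (rule order_trans[OF integral_norm_bound integral_mono])
      show "norm (F z * R z) \<le> \<bar>F z\<bar> * (e / (c + 1) * norm (y - x))" for z
        unfolding real_norm_def abs_mult[of "F z"] by (rule mult_left_mono[OF R]) simp
    qed (use int F in auto)
    also have "\<dots> = c / (c + 1) * (e * norm (y - x))" by (simp add: c_def)
    also have "\<dots> \<le> 1 * (e * norm (y - x))" using c e by (intro mult_right_mono) auto
    finally show ?thesis by simp
  qed
  with d(1) show "\<exists>d>0. \<forall>y. norm (y - x) < d \<longrightarrow>
      norm (conv F g y - conv F g x - (\<Sum>i\<in>Basis. ((y - x) \<bullet> i) * conv F (dpartial i g) x)) \<le> e * norm (y - x)"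
    by blast
qed

lemma dpartial_conv:
  assumes "integrable lborel F" "bump g" "i \<in> Basis"
  shows "dpartial i (conv F g) x = conv F (dpartial i g) x"
proof -
  have "dpartial i (conv F g) x = (\<Sum>j\<in>Basis. (i \<bullet> j) * conv F (dpartial j g) x)"
    by (rule dpartial_eqI[OF conv_has_derivative[OF assms(1,2)]])
  also have "\<dots> = (\<Sum>j\<in>Basis. if i = j then conv F (dpartial j g) x else 0)"
    by (intro sum.cong) (use assms(3) in \<open>auto simp: inner_Basis\<close>)
  finally show ?thesis using assms(3) by simp
qed

lemma smooth_conv:
  assumes F: "integrable lborel F" and g: "bump g"
  shows "smooth (conv F g)"
proof (rule smooth_coinduct[of "\<lambda>h. \<exists>g. bump g \<and> h = conv F g"])
  show "\<exists>ga. bump ga \<and> conv F g = conv F ga" using g by blast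
  show "h differentiable (at x)" if "\<exists>g. bump g \<and> h = conv F g" for h x
    using that conv_has_derivative[OF F] differentiable_def by blast
  show "\<exists>g. bump g \<and> dpartial i h = conv F g" if h: "\<exists>g. bump g \<and> h = conv F g" and i: "i \<in> Basis" for h i
  proof -
    obtain g where g: "bump g" "h = conv F g" using h by blast
    have "dpartial i h = conv F (dpartial i g)"
      unfolding g(2) by (rule ext) (rule dpartial_conv[OF F g(1) i])
    with bump_dpartial[OF g(1) i] show ?thesis by blast
  qed
qed

text \<open>The cutoff of a small box around the origin, sharp enough to have positive integral, divided by that integral.\<close>

lemma exists_mollifier:
  fixes d :: real
  assumes "0 < d"
  obtains g :: "'a::euclidean_space \<Rightarrow> real" where "bump g" "\<And>x. 0 \<le> g x"
    "integrable lborel g" "(LINT x|lborel. g x) = 1" "\<And>x. d \<le> norm x \<Longrightarrow> g x = 0"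
proof -
  obtain a b :: 'a where ab: "0 \<in> box a b" "box a b \<subseteq> ball 0 d"
    using rational_boxes[OF assms, of 0] by metis
  let ?h = "\<lambda>n. box_cutoff a b (Suc n)"
  have tf: "test_function (box a b) (?h n)" for n by (intro test_function_box_cutoff) auto
  have supp: "?h n x = 0" if "x \<notin> box a b" for n x
    using tf[of n] that unfolding test_function_def by blast
  have h: "bump (?h n)" for n
    using tf[of n] unfolding test_function_def bump_def by blast
  have [measurable]: "?h n \<in> borel_measurable borel" for n
    by (rule smooth_borel_measurable[OF smooth_box_cutoff])
  have ind: "integrable lborel (indicat_real (box a b))"
    by (rule integrable_real_indicator) (auto simp: emeasure_lborel_box_eq)
  have le: "norm (?h n x) \<le> indicator (box a b) x" for n x
    using box_cutoff_nonneg[of a b "Suc n" x] box_cutoff_le_1[of a b "Suc n" x] supp[of x n]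
    by (auto simp: indicator_def)
  have lim: "(\<lambda>n. ?h n x) \<longlonglongrightarrow> indicator (box a b) x" for x
    by (rule LIMSEQ_Suc[OF box_cutoff_tendsto])
  have int: "integrable lborel (?h n)" for n
    by (rule Bochner_Integration.integrable_bound[OF ind]) (use le in auto)
  have "(\<lambda>n. LINT x|lborel. ?h n x) \<longlonglongrightarrow> (LINT x|lborel. indicator (box a b) x)"
    by (rule integral_dominated_convergence[where w = "indicator (box a b)"])
      (use ind le lim in auto)
  moreover have "0 < (LINT x|lborel. indicat_real (box a b) x)"
  proof -
    have "a \<bullet> i < b \<bullet> i" if "i \<in> Basis" for i
      using ab(1) that by (force simp: mem_box)
    then show ?thesis
      by (simp add: measure_lborel_box_eq less_imp_le inner_diff_left prod_pos)
  qed
  ultimately obtain n where n: "0 < (LINT x|lborel. ?h n x)"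
    using order_tendstoD(1)[THEN eventually_happens] by fastforce
  show ?thesis
  proof (rule that[of "\<lambda>x. inverse (LINT x|lborel. ?h n x) * ?h n x"])
    obtain K where K: "compact K" "\<And>x. x \<notin> K \<Longrightarrow> ?h n x = 0" using h[of n] unfolding bump_def by blast
    show "bump (\<lambda>x. inverse (LINT x|lborel. ?h n x) * ?h n x)"
      unfolding bump_def using smooth_cmult[OF smooth_box_cutoff] K by (metis mult_zero_right)
    show "0 \<le> inverse (LINT x|lborel. ?h n x) * ?h n x" for x
      using n box_cutoff_nonneg by (intro mult_nonneg_nonneg) auto
    show "inverse (LINT x|lborel. ?h n x) * ?h n x = 0" if "d \<le> norm x" for x
    proof -
      have "x \<notin> box a b" using ab(2) that by (meson mem_ball_0 not_le subsetD)
      then show ?thesis by (simp add: supp)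
    qed
  qed (use int n in auto)
qed

subsection \<open>Continuity of affine substitutions in \<open>L\<^sup>1\<close>\<close>

lemma nn_integral_affine:
  fixes b :: "'a::euclidean_space"
  assumes [measurable]: "f \<in> borel_measurable borel" and a: "0 < a"
  shows "(\<integral>\<^sup>+x. f (b + a *\<^sub>R x) \<partial>lborel) = ennreal (1 / a ^ DIM('a)) * (\<integral>\<^sup>+x. f x \<partial>lborel)"
proof -
  have "(\<integral>\<^sup>+x. f x \<partial>lborel)
      = (\<integral>\<^sup>+x. f x \<partial>density (distr lborel borel (\<lambda>x. b + a *\<^sub>R x)) (\<lambda>_. \<bar>a\<bar> ^ DIM('a)))"
    using lborel_affine[of a b] a by simp
  also have "\<dots> = ennreal (a ^ DIM('a)) * (\<integral>\<^sup>+x. f (b + a *\<^sub>R x) \<partial>lborel)"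
    using a by (simp add: nn_integral_density nn_integral_distr nn_integral_cmult)
  finally show ?thesis
    using a by (simp add: mult.assoc[symmetric] ennreal_mult[symmetric])
qed

text \<open>Continuity in \<open>L\<^sup>1\<close> under translations combined with contractions, since approximation up to the boundary
  first shrinks the domain.\<close>

definition L1_continuous :: "('a::euclidean_space \<Rightarrow> real) \<Rightarrow> bool" where
  "L1_continuous F \<longleftrightarrow> (\<forall>e>0. \<exists>d>0. \<forall>a b. 1 - d < a \<longrightarrow> a \<le> 1 \<longrightarrow> norm b < d \<longrightarrow>
     (\<integral>\<^sup>+x. \<bar>F (b + a *\<^sub>R x) - F x\<bar> \<partial>lborel) \<le> ennreal e)"

lemma L1_continuousD:
  assumes "L1_continuous F" "0 < e"
  obtains d where "0 < d" "d \<le> 1 / 2" "\<And>a b. 1 - d < a \<Longrightarrow> a \<le> 1 \<Longrightarrow> norm b < d \<Longrightarrow>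
     (\<integral>\<^sup>+x. \<bar>F (b + a *\<^sub>R x) - F x\<bar> \<partial>lborel) \<le> ennreal e"
proof -
  obtain d where d: "0 < d" "\<And>a b. 1 - d < a \<Longrightarrow> a \<le> 1 \<Longrightarrow> norm b < d \<Longrightarrow>
     (\<integral>\<^sup>+x. \<bar>F (b + a *\<^sub>R x) - F x\<bar> \<partial>lborel) \<le> ennreal e"
    using assms unfolding L1_continuous_def by metis
  show ?thesis by (rule that[of "min d (1/2)"]) (use d in auto)
qed

lemma inverse_power_half_bound: "1 / 2 < a \<Longrightarrow> 1 / a ^ n \<le> 2 ^ n" for a :: real
proof -
  assume a: "1 / 2 < a"
  then have "(1 / a) ^ n \<le> 2 ^ n" by (intro power_mono) (auto simp: field_simps)
  then show ?thesis by (simp add: power_divide)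
qed

lemma inner_compact:
  fixes A :: "'a::euclidean_space set" and e :: real
  assumes A[measurable]: "A \<in> sets borel" and fin: "emeasure lborel A < \<infinity>" and e: "0 < e"
  obtains K where "compact K" "K \<subseteq> A" "emeasure lborel (A - K) < ennreal e"
proof -
  let ?M = "density lborel (indicator A)"
  have M: "emeasure ?M X = emeasure lborel X" if "X \<in> sets borel" "X \<subseteq> A" for X
    using that by (simp add: emeasure_density indicator_inter_arith[symmetric] Int_absorb1)
  have sp: "emeasure ?M (space ?M) \<noteq> \<infinity>"
    using fin by (simp add: emeasure_density)
  have "emeasure ?M A = (SUP K \<in> {K. K \<subseteq> A \<and> compact K}. emeasure ?M K)"
    by (rule inner_regular) (use sp in auto)
  then have "\<exists>K\<in>{K. K \<subseteq> A \<and> compact K}. emeasure ?M A < emeasure ?M K + e"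
    by (rule SUP_approx_ennreal[rotated 2]) (use e fin M[of A] in \<open>auto simp: less_top\<close>)
  then obtain K where K: "K \<subseteq> A" "compact K" and lt: "emeasure ?M A < emeasure ?M K + ennreal e"
    by blast
  have Kb: "K \<in> sets borel" using K by (simp add: borel_compact)
  have "emeasure lborel A < emeasure lborel K + ennreal e" using lt M Kb K A by auto
  moreover have "emeasure lborel K < \<infinity>"
    using emeasure_mono[OF K(1), of lborel] fin by (auto intro: le_less_trans)
  moreover have "emeasure lborel (A - K) = emeasure lborel A - emeasure lborel K"
    using K Kb calculation(2) by (intro emeasure_Diff) auto
  ultimately have "emeasure lborel (A - K) < ennreal e"
    using minus_less_iff_ennreal[of "emeasure lborel K" "emeasure lborel A" "ennreal e"]
      emeasure_mono[OF K(1), of lborel] by (auto simp: add.commute)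
  with K that show ?thesis by blast
qed

text \<open>Squeeze \<open>A\<close> between a compact and an open set of nearly the same measure; a small displacement of the
  compact set stays within the open one.\<close>

lemma L1_continuous_indicator:
  fixes A :: "'a::euclidean_space set"
  assumes A[measurable]: "A \<in> sets borel" and fin: "emeasure lborel A < \<infinity>"
  shows "L1_continuous (indicator A)"
  unfolding L1_continuous_def
proof (intro allI impI)
  fix e :: real assume e: "0 < e"
  define e' where "e' = e / (1 + 2 ^ DIM('a))"
  have p: "0 < (1 + 2 ^ DIM('a) :: real)" by (simp add: add_pos_pos)
  have e': "0 < e'" using e p by (simp add: e'_def)
  obtain U where U: "open U" "A \<subseteq> U" "emeasure lebesgue (U - A) < ennreal (e' / 2)"
    using sets_lebesgue_outer_open[of A "e' / 2"] e' by (metis A half_gt_zero sets_completionI_sets sets_lborel)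
  obtain K where K: "compact K" "K \<subseteq> A" "emeasure lborel (A - K) < ennreal (e' / 2)"
    using inner_compact[OF A fin, of "e' / 2"] e' by (metis half_gt_zero)
  have meas[measurable]: "U \<in> sets borel" "K \<in> sets borel" using U K by (auto simp: borel_compact)
  have UK: "emeasure lborel (U - K) \<le> ennreal e'"
  proof -
    have "emeasure lborel (U - K) = emeasure lborel ((U - A) \<union> (A - K))"
      using U K by (intro arg_cong[where f="emeasure lborel"]) auto
    also have "\<dots> \<le> emeasure lborel (U - A) + emeasure lborel (A - K)"
      by (rule emeasure_subadditive) auto
    also have "\<dots> \<le> ennreal (e' / 2) + ennreal (e' / 2)"
      using U(3) K(3) by (intro add_mono) (auto simp: less_imp_le)
    also have "\<dots> = ennreal e'" using e' by (simp add: ennreal_plus[symmetric] del: ennreal_plus)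
    finally show ?thesis .
  qed
  obtain R where R: "0 < R" "\<And>x. x \<in> K \<Longrightarrow> norm x \<le> R"
    using compact_imp_bounded[OF K(1)] bounded_pos by metis
  obtain r where r: "0 < r" "\<And>x y. x \<in> K \<Longrightarrow> y \<notin> U \<Longrightarrow> r \<le> dist x y"
    using separate_compact_closed[OF K(1), of "- U"] U K by (auto simp: closed_Compl) blast
  define d where "d = min (1 / 2) (r / (2 * R + 3))"
  have d: "0 < d" "d \<le> 1 / 2" "d * (2 * R + 3) \<le> r"
  proof -
    have "0 < 2 * R + 3" using R by simp
    moreover have "d \<le> r / (2 * R + 3)" by (simp add: d_def)
    ultimately show "d * (2 * R + 3) \<le> r" by (simp add: pos_le_divide_eq)
    show "d \<le> 1 / 2" unfolding d_def by (rule min.cobounded1)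
  qed (use r R in \<open>simp add: d_def\<close>)
  show "\<exists>d>0. \<forall>a b. 1 - d < a \<longrightarrow> a \<le> 1 \<longrightarrow> norm b < d \<longrightarrow>
     (\<integral>\<^sup>+x. ennreal \<bar>indicat_real A (b + a *\<^sub>R x) - indicat_real A x\<bar> \<partial>lborel) \<le> ennreal e"
  proof (intro exI[of _ d] conjI d(1) allI impI)
    fix a :: real and b :: 'a assume ab: "1 - d < a" "a \<le> 1" "norm b < d"
    have a: "1 / 2 < a" using ab d by simp
    have near: "dist x (b + a *\<^sub>R x) < r" if "norm x \<le> 2 * R + 1" for x
    proof -
      have "dist x (b + a *\<^sub>R x) = norm ((1 - a) *\<^sub>R x - b)" by (simp add: dist_norm algebra_simps)
      also have "\<dots> \<le> (1 - a) * norm x + norm b"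
        using norm_triangle_ineq4[of "(1 - a) *\<^sub>R x" b] ab by simp
      also have "\<dots> < d * (2 * R + 1) + d"
        using ab that d R by (intro add_le_less_mono mult_mono) auto
      also have "\<dots> \<le> d * (2 * R + 3)" using d(1) by (simp add: algebra_simps)
      finally show ?thesis using d by simp
    qed
    have "ennreal \<bar>indicat_real A (b + a *\<^sub>R x) - indicat_real A x\<bar>
        \<le> indicator (U - K) x + indicator (U - K) (b + a *\<^sub>R x)" for x
    proof -
      have 1: "b + a *\<^sub>R x \<in> U" if "x \<in> K"
      proof -
        have "norm x \<le> 2 * R + 1" using R that by fastforce
        then show ?thesis using near r(2)[OF that, of "b + a *\<^sub>R x"] by fastforce
      qed
      have 2: "x \<in> U" if K: "b + a *\<^sub>R x \<in> K"
      proof -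
        have "a * norm x = norm ((b + a *\<^sub>R x) - b)" using a by simp
        also have "\<dots> \<le> R + 1 / 2"
          using norm_triangle_ineq4[of "b + a *\<^sub>R x" b] R(2)[OF K] ab(3) d(2) by linarith
        finally have "a * norm x \<le> R + 1 / 2" .
        moreover have "1 / 2 * norm x \<le> a * norm x" using a by (intro mult_right_mono) auto
        ultimately have "norm x \<le> 2 * R + 1" by simp
        then show ?thesis using near r(2)[OF K, of x] by (fastforce simp: dist_commute)
      qed
      show ?thesis using 1 2 U(2) K(2) by (auto simp: indicator_def)
    qed
    then have "(\<integral>\<^sup>+x. ennreal \<bar>indicat_real A (b + a *\<^sub>R x) - indicat_real A x\<bar> \<partial>lborel)
        \<le> (\<integral>\<^sup>+x. indicator (U - K) x + indicator (U - K) (b + a *\<^sub>R x) \<partial>lborel)"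
      by (intro nn_integral_mono) auto
    also have "\<dots> = emeasure lborel (U - K) + ennreal (1 / a ^ DIM('a)) * emeasure lborel (U - K)"
      using a by (simp add: nn_integral_add nn_integral_affine)
    also have "\<dots> \<le> ennreal e' + ennreal (2 ^ DIM('a)) * ennreal e'"
      using UK inverse_power_half_bound[OF a, of "DIM('a)"]
      by (intro add_mono mult_mono ennreal_leI) auto
    also have "\<dots> = ennreal (e' + 2 ^ DIM('a) * e')"
      using e' by (simp add: ennreal_mult[symmetric] ennreal_plus[symmetric] del: ennreal_plus)
    also have "e' + 2 ^ DIM('a) * e' = e"
    proof -
      have "e' + 2 ^ DIM('a) * e' = (1 + 2 ^ DIM('a)) * e'" by (simp add: distrib_right)
      also have "\<dots> = e" using p by (simp add: e'_def)
      finally show ?thesis .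
    qed
    finally show "(\<integral>\<^sup>+x. ennreal \<bar>indicat_real A (b + a *\<^sub>R x) - indicat_real A x\<bar> \<partial>lborel) \<le> ennreal e" .
  qed
qed

lemma L1_continuous_cmult:
  fixes F :: "'a::euclidean_space \<Rightarrow> real"
  assumes F: "L1_continuous F" and [measurable]: "F \<in> borel_measurable borel"
  shows "L1_continuous (\<lambda>x. F x * c)"
  unfolding L1_continuous_def
proof (intro allI impI)
  fix e :: real assume e: "0 < e"
  obtain d where d: "0 < d" "\<And>a b. 1 - d < a \<Longrightarrow> a \<le> 1 \<Longrightarrow> norm b < d \<Longrightarrow>
     (\<integral>\<^sup>+x. \<bar>F (b + a *\<^sub>R x) - F x\<bar> \<partial>lborel) \<le> ennreal (e / (\<bar>c\<bar> + 1))"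
  proof (rule L1_continuousD[OF F, of "e / (\<bar>c\<bar> + 1)"])
    show "0 < e / (\<bar>c\<bar> + 1)" using e by (auto simp: add_nonneg_pos)
  qed (rule that)
  show "\<exists>d>0. \<forall>a b. 1 - d < a \<longrightarrow> a \<le> 1 \<longrightarrow> norm b < d \<longrightarrow>
     (\<integral>\<^sup>+x. \<bar>F (b + a *\<^sub>R x) * c - F x * c\<bar> \<partial>lborel) \<le> ennreal e"
  proof (intro exI[of _ d] conjI d(1) allI impI)
    fix a :: real and b :: 'a assume ab: "1 - d < a" "a \<le> 1" "norm b < d"
    have "(\<integral>\<^sup>+x. \<bar>F (b + a *\<^sub>R x) * c - F x * c\<bar> \<partial>lborel)
        = (\<integral>\<^sup>+x. ennreal \<bar>c\<bar> * ennreal \<bar>F (b + a *\<^sub>R x) - F x\<bar> \<partial>lborel)"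
      by (intro nn_integral_cong)
        (simp add: ennreal_mult[symmetric] abs_mult[symmetric] algebra_simps)
    also have "\<dots> \<le> ennreal \<bar>c\<bar> * ennreal (e / (\<bar>c\<bar> + 1))"
      using d(2)[OF ab] by (subst nn_integral_cmult) (auto intro: mult_left_mono)
    also have "\<dots> = ennreal (\<bar>c\<bar> / (\<bar>c\<bar> + 1) * e)" using e by (simp add: ennreal_mult[symmetric])
    also have "\<dots> \<le> ennreal (1 * e)" using e by (intro ennreal_leI mult_right_mono) auto
    finally show "(\<integral>\<^sup>+x. \<bar>F (b + a *\<^sub>R x) * c - F x * c\<bar> \<partial>lborel) \<le> ennreal e" by simp
  qed
qed

lemma L1_continuous_approx:
  fixes F :: "'a::euclidean_space \<Rightarrow> real"
  assumes [measurable]: "F \<in> borel_measurable borel"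
    and approx: "\<And>e. 0 < e \<Longrightarrow> \<exists>G. G \<in> borel_measurable borel \<and> L1_continuous G
      \<and> (\<integral>\<^sup>+x. \<bar>G x - F x\<bar> \<partial>lborel) \<le> ennreal e"
  shows "L1_continuous F"
  unfolding L1_continuous_def
proof (intro allI impI)
  fix e :: real assume e: "0 < e"
  define e' where "e' = e / (2 + 2 ^ DIM('a))"
  have p: "0 < (2 + 2 ^ DIM('a) :: real)" by (simp add: add_pos_pos)
  have e': "0 < e'" using e p by (simp add: e'_def)
  obtain G where G[measurable]: "G \<in> borel_measurable borel" and cG: "L1_continuous G"
    and FG: "(\<integral>\<^sup>+x. \<bar>G x - F x\<bar> \<partial>lborel) \<le> ennreal e'"
    using approx[OF e'] by blast
  obtain d where d: "0 < d" "d \<le> 1 / 2" "\<And>a b. 1 - d < a \<Longrightarrow> a \<le> 1 \<Longrightarrow> norm b < d \<Longrightarrow>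
     (\<integral>\<^sup>+x. \<bar>G (b + a *\<^sub>R x) - G x\<bar> \<partial>lborel) \<le> ennreal e'"
    using L1_continuousD[OF cG e'] by metis
  show "\<exists>d>0. \<forall>a b. 1 - d < a \<longrightarrow> a \<le> 1 \<longrightarrow> norm b < d \<longrightarrow>
     (\<integral>\<^sup>+x. \<bar>F (b + a *\<^sub>R x) - F x\<bar> \<partial>lborel) \<le> ennreal e"
  proof (intro exI[of _ d] conjI d(1) allI impI)
    fix a :: real and b :: 'a assume ab: "1 - d < a" "a \<le> 1" "norm b < d"
    have a: "1 / 2 < a" using ab d by simp
    have "(\<integral>\<^sup>+x. \<bar>F (b + a *\<^sub>R x) - F x\<bar> \<partial>lborel)
        \<le> (\<integral>\<^sup>+x. ennreal \<bar>G (b + a *\<^sub>R x) - F (b + a *\<^sub>R x)\<bar>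
             + ennreal \<bar>G (b + a *\<^sub>R x) - G x\<bar> + ennreal \<bar>G x - F x\<bar> \<partial>lborel)"
      by (intro nn_integral_mono) (simp add: ennreal_plus[symmetric] del: ennreal_plus)
    also have "\<dots> = (\<integral>\<^sup>+x. \<bar>G (b + a *\<^sub>R x) - F (b + a *\<^sub>R x)\<bar> \<partial>lborel)
        + (\<integral>\<^sup>+x. \<bar>G (b + a *\<^sub>R x) - G x\<bar> \<partial>lborel) + (\<integral>\<^sup>+x. \<bar>G x - F x\<bar> \<partial>lborel)"
      by (subst nn_integral_add; simp)+
    also have "(\<integral>\<^sup>+x. \<bar>G (b + a *\<^sub>R x) - F (b + a *\<^sub>R x)\<bar> \<partial>lborel)
        = ennreal (1 / a ^ DIM('a)) * (\<integral>\<^sup>+x. \<bar>G x - F x\<bar> \<partial>lborel)"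
      using a by (subst nn_integral_affine[of "\<lambda>x. ennreal \<bar>G x - F x\<bar>"]) auto
    also have "\<dots> + (\<integral>\<^sup>+x. \<bar>G (b + a *\<^sub>R x) - G x\<bar> \<partial>lborel) + (\<integral>\<^sup>+x. \<bar>G x - F x\<bar> \<partial>lborel)
        \<le> ennreal (2 ^ DIM('a)) * ennreal e' + ennreal e' + ennreal e'"
      using FG d(3)[OF ab] inverse_power_half_bound[OF a, of "DIM('a)"]
      by (intro add_mono mult_mono ennreal_leI) auto
    also have "\<dots> = ennreal (2 ^ DIM('a) * e' + e' + e')"
      using e' by (simp add: ennreal_mult[symmetric] ennreal_plus[symmetric] del: ennreal_plus)
    also have "2 ^ DIM('a) * e' + e' + e' = e"
    proof -
      have "2 ^ DIM('a) * e' + e' + e' = (2 + 2 ^ DIM('a)) * e'" by (simp add: distrib_right)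
      also have "\<dots> = e" using p by (simp add: e'_def)
      finally show ?thesis .
    qed
    finally show "(\<integral>\<^sup>+x. \<bar>F (b + a *\<^sub>R x) - F x\<bar> \<partial>lborel) \<le> ennreal e" .
  qed
qed

lemma L1_continuous_add:
  fixes F G :: "'a::euclidean_space \<Rightarrow> real"
  assumes F: "L1_continuous F" and [measurable]: "F \<in> borel_measurable borel"
    and G: "L1_continuous G" and [measurable]: "G \<in> borel_measurable borel"
  shows "L1_continuous (\<lambda>x. F x + G x)"
  unfolding L1_continuous_def
proof (intro allI impI)
  fix e :: real assume e: "0 < e"
  obtain d where d: "0 < d" "\<And>a b. 1 - d < a \<Longrightarrow> a \<le> 1 \<Longrightarrow> norm b < d \<Longrightarrow>
     (\<integral>\<^sup>+x. \<bar>F (b + a *\<^sub>R x) - F x\<bar> \<partial>lborel) \<le> ennreal (e / 2)"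
    by (rule L1_continuousD[OF F half_gt_zero[OF e]]) (rule that)
  obtain d' where d': "0 < d'" "\<And>a b. 1 - d' < a \<Longrightarrow> a \<le> 1 \<Longrightarrow> norm b < d' \<Longrightarrow>
     (\<integral>\<^sup>+x. \<bar>G (b + a *\<^sub>R x) - G x\<bar> \<partial>lborel) \<le> ennreal (e / 2)"
    by (rule L1_continuousD[OF G half_gt_zero[OF e]]) (rule that)
  show "\<exists>d>0. \<forall>a b. 1 - d < a \<longrightarrow> a \<le> 1 \<longrightarrow> norm b < d \<longrightarrow>
     (\<integral>\<^sup>+x. \<bar>F (b + a *\<^sub>R x) + G (b + a *\<^sub>R x) - (F x + G x)\<bar> \<partial>lborel) \<le> ennreal e"
  proof (intro exI[of _ "min d d'"] conjI allI impI)
    show "0 < min d d'" using d d' by simp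
    fix a :: real and b :: 'a assume ab: "1 - min d d' < a" "a \<le> 1" "norm b < min d d'"
    have "(\<integral>\<^sup>+x. \<bar>F (b + a *\<^sub>R x) + G (b + a *\<^sub>R x) - (F x + G x)\<bar> \<partial>lborel)
        \<le> (\<integral>\<^sup>+x. ennreal \<bar>F (b + a *\<^sub>R x) - F x\<bar> + ennreal \<bar>G (b + a *\<^sub>R x) - G x\<bar> \<partial>lborel)"
      by (intro nn_integral_mono) (simp add: ennreal_plus[symmetric] del: ennreal_plus)
    also have "\<dots> \<le> ennreal (e / 2) + ennreal (e / 2)"
      using d(2)[of a b] d'(2)[of a b] ab by (subst nn_integral_add) (auto intro: add_mono)
    also have "\<dots> = ennreal e" using e by (simp add: ennreal_plus[symmetric] del: ennreal_plus)
    finally show "(\<integral>\<^sup>+x. \<bar>F (b + a *\<^sub>R x) + G (b + a *\<^sub>R x) - (F x + G x)\<bar> \<partial>lborel) \<le> ennreal e" .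
  qed
qed

lemma integrable_L1_continuous:
  fixes F :: "'a::euclidean_space \<Rightarrow> real"
  assumes "integrable lborel F"
  shows "L1_continuous F"
  using assms
proof (induct rule: integrable_induct)
  case (base A c)
  then have "L1_continuous (\<lambda>x. indicat_real A x * c)"
    by (intro L1_continuous_cmult L1_continuous_indicator) auto
  then show ?case by simp
next
  case (add f g)
  then show ?case by (intro L1_continuous_add) auto
next
  case (lim f s)
  then have [measurable]: "f \<in> borel_measurable borel" "\<And>i. s i \<in> borel_measurable borel" by auto
  show ?case
  proof (rule L1_continuous_approx)
    fix e :: real assume e: "0 < e"
    have "(\<lambda>i. \<integral>\<^sup>+x. ennreal (norm (s i x - f x)) \<partial>lborel) \<longlonglongrightarrow> (\<integral>\<^sup>+x. 0 \<partial>(lborel :: 'a measure))"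
    proof (rule nn_integral_dominated_convergence[where w = "\<lambda>x. ennreal (3 * norm (f x))"])
      show "AE x in lborel. ennreal (norm (s j x - f x)) \<le> ennreal (3 * norm (f x))" for j
      proof (intro AE_I2 ennreal_leI)
        fix x show "norm (s j x - f x) \<le> 3 * norm (f x)"
          using norm_triangle_ineq4[of "s j x" "f x"] lim(4)[of x j] by simp
      qed
      show "(\<integral>\<^sup>+x. ennreal (3 * norm (f x)) \<partial>lborel) < \<infinity>"
      proof -
        have "integrable lborel (\<lambda>x. 3 * f x)" using lim(5) by simp
        from iffD1[OF integrable_iff_bounded this] show ?thesis by (simp add: abs_mult)
      qed
      show "AE x in lborel. (\<lambda>i. ennreal (norm (s i x - f x))) \<longlonglongrightarrow> 0"
      proof (intro AE_I2)
        fix x :: 'a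
        have "(\<lambda>i. norm (s i x - f x)) \<longlonglongrightarrow> norm (f x - f x)"
          using lim(3)[of x] by (intro tendsto_intros) auto
        from tendsto_ennrealI[OF this] show "(\<lambda>i. ennreal (norm (s i x - f x))) \<longlonglongrightarrow> 0" by simp
      qed
    qed auto
    then have "eventually (\<lambda>i. (\<integral>\<^sup>+x. ennreal (norm (s i x - f x)) \<partial>lborel) < ennreal e) sequentially"
      using e by (intro order_tendstoD(2)[where y = 0]) auto
    then obtain i where "(\<integral>\<^sup>+x. ennreal (norm (s i x - f x)) \<partial>lborel) < ennreal e"
      using eventually_happens' sequentially_bot by blast
    then show "\<exists>G. G \<in> borel_measurable borel \<and> L1_continuous G \<and> (\<integral>\<^sup>+x. \<bar>G x - f x\<bar> \<partial>lborel) \<le> ennreal e"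
      using lim(2) by (intro exI[of _ "s i"]) auto
  qed auto
qed

subsection \<open>Density of smooth functions\<close>

lemma conv_eq_shifted:
  fixes F g :: "'a::euclidean_space \<Rightarrow> real"
  assumes [measurable]: "F \<in> borel_measurable borel" "g \<in> borel_measurable borel"
  shows "conv F g p = (LINT z|lborel. F (p - z) * g z)"
proof -
  have "conv F g p = (LINT y|density (distr lborel borel (\<lambda>z. p + (-1) *\<^sub>R z)) (\<lambda>_. ennreal (\<bar>-1\<bar> ^ DIM('a))). F y * g (p - y))"
    unfolding conv_def using lborel_affine[of "-1" p] by simp
  also have "\<dots> = (LINT z|lborel. F (p - z) * g z)"
    by (simp add: density_1 integral_distr)
  finally show ?thesis .
qed

text \<open>The mollified function is the average of \<open>F (p - z)\<close> over \<open>z\<close> in a small ball, and each of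
  these affine substitutions moves \<open>F\<close> by little in \<open>L\<^sup>1\<close>.\<close>

lemma conv_L1_close:
  fixes F g :: "'a::euclidean_space \<Rightarrow> real"
  assumes F: "integrable lborel F" and g: "bump g" "\<And>x. 0 \<le> g x" "integrable lborel g" "(LINT x|lborel. g x) = 1"
    and close: "\<And>z. g z \<noteq> 0 \<Longrightarrow> (\<integral>\<^sup>+x. \<bar>F ((b - z) + a *\<^sub>R x) - F x\<bar> \<partial>lborel) \<le> ennreal e"
  shows "(\<integral>\<^sup>+x. \<bar>conv F g (b + a *\<^sub>R x) - F x\<bar> \<partial>lborel) \<le> ennreal e"
proof -
  have [measurable]: "F \<in> borel_measurable borel" "g \<in> borel_measurable borel" using F g(3) by auto
  have "ennreal \<bar>conv F g (b + a *\<^sub>R x) - F x\<bar>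
      \<le> (\<integral>\<^sup>+z. ennreal (\<bar>F ((b - z) + a *\<^sub>R x) - F x\<bar> * g z) \<partial>lborel)" for x
  proof -
    have i: "integrable lborel (\<lambda>z. F (b + a *\<^sub>R x - z) * g z)"
    proof -
      obtain C where C: "\<And>x. \<bar>g x\<bar> \<le> C" using bump_bounded[OF g(1)] by blast
      have "integrable lborel (\<lambda>z. F ((b + a *\<^sub>R x) + (-1) *\<^sub>R z))"
        unfolding integrable_iff_bounded
      proof
        show "(\<integral>\<^sup>+z. ennreal (norm (F (b + a *\<^sub>R x + - 1 *\<^sub>R z))) \<partial>lborel) < \<infinity>"
        proof -
          have "(\<integral>\<^sup>+z. ennreal (norm (F z)) \<partial>lborel)
              = (\<integral>\<^sup>+z. ennreal (norm (F z)) \<partial>density (distr lborel borel (\<lambda>z. (b + a *\<^sub>R x) + (-1) *\<^sub>R z)) (\<lambda>_. ennreal (\<bar>-1\<bar> ^ DIM('a))))"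
            using lborel_affine[of "-1" "b + a *\<^sub>R x"] by simp
          also have "\<dots> = (\<integral>\<^sup>+z. ennreal (norm (F (b + a *\<^sub>R x + - 1 *\<^sub>R z))) \<partial>lborel)"
            by (simp add: density_1 nn_integral_distr)
          finally show ?thesis using F by (simp add: integrable_iff_bounded)
        qed
      qed measurable
      then have "integrable lborel (\<lambda>z. F (b + a *\<^sub>R x - z))" by simp
      then show ?thesis by (rule integrable_times_bounded[where C = C]) (use C in auto)
    qed
    have "conv F g (b + a *\<^sub>R x) - F x
        = (LINT z|lborel. F (b + a *\<^sub>R x - z) * g z) - (LINT z|lborel. F x * g z)"
      using g(4) by (simp add: conv_eq_shifted)
    also have "\<dots> = (LINT z|lborel. F (b + a *\<^sub>R x - z) * g z - F x * g z)"
      by (rule Bochner_Integration.integral_diff[symmetric, OF i]) (use g(3) in simp)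
    finally have "ennreal \<bar>conv F g (b + a *\<^sub>R x) - F x\<bar>
        = ennreal (norm (LINT z|lborel. F (b + a *\<^sub>R x - z) * g z - F x * g z))" by simp
    also have "\<dots> \<le> (\<integral>\<^sup>+z. ennreal (norm (F (b + a *\<^sub>R x - z) * g z - F x * g z)) \<partial>lborel)"
      by (rule integral_norm_bound_ennreal) (use i g(3) in simp)
    also have "\<dots> = (\<integral>\<^sup>+z. ennreal (\<bar>F ((b - z) + a *\<^sub>R x) - F x\<bar> * g z) \<partial>lborel)"
    proof (rule nn_integral_cong)
      fix z
      have eq: "b + a *\<^sub>R x - z = (b - z) + a *\<^sub>R x" by simp
      show "ennreal (norm (F (b + a *\<^sub>R x - z) * g z - F x * g z))
          = ennreal (\<bar>F ((b - z) + a *\<^sub>R x) - F x\<bar> * g z)"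
        unfolding eq using g(2)[of z] by (simp add: left_diff_distrib[symmetric] abs_mult)
    qed
    finally show ?thesis .
  qed
  then have "(\<integral>\<^sup>+x. ennreal \<bar>conv F g (b + a *\<^sub>R x) - F x\<bar> \<partial>lborel)
      \<le> (\<integral>\<^sup>+x. (\<integral>\<^sup>+z. ennreal (\<bar>F ((b - z) + a *\<^sub>R x) - F x\<bar> * g z) \<partial>lborel) \<partial>lborel)"
    by (rule nn_integral_mono)
  also have "\<dots> = (\<integral>\<^sup>+z. (\<integral>\<^sup>+x. ennreal (\<bar>F ((b - z) + a *\<^sub>R x) - F x\<bar> * g z) \<partial>lborel) \<partial>lborel)"
    by (rule lborel_pair.Fubini'[symmetric]) measurable
  also have "\<dots> \<le> (\<integral>\<^sup>+z. ennreal e * ennreal (g z) \<partial>lborel)"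
  proof (rule nn_integral_mono)
    fix z
    have "(\<integral>\<^sup>+x. ennreal (\<bar>F ((b - z) + a *\<^sub>R x) - F x\<bar> * g z) \<partial>lborel)
        = (\<integral>\<^sup>+x. ennreal \<bar>F ((b - z) + a *\<^sub>R x) - F x\<bar> * ennreal (g z) \<partial>lborel)"
      using g(2) by (simp add: ennreal_mult)
    also have "\<dots> = (\<integral>\<^sup>+x. ennreal \<bar>F ((b - z) + a *\<^sub>R x) - F x\<bar> \<partial>lborel) * ennreal (g z)"
      by (rule nn_integral_multc) measurable
    also have "\<dots> \<le> ennreal e * ennreal (g z)"
      using close[of z] by (cases "g z = 0") (auto intro: mult_right_mono)
    finally show "(\<integral>\<^sup>+x. ennreal (\<bar>F ((b - z) + a *\<^sub>R x) - F x\<bar> * g z) \<partial>lborel) \<le> ennreal e * ennreal (g z)" .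
  qed
  also have "\<dots> = ennreal e * ennreal (LINT z|lborel. g z)"
    using g(2,3) by (simp add: nn_integral_cmult nn_integral_eq_integral)
  finally show ?thesis using g(4) by simp
qed

lemma zero_extension:
  fixes f :: "'a::euclidean_space \<Rightarrow> real"
  assumes "integrable (leb S) f" "S \<in> sets borel"
  obtains F where "integrable lborel F" "AE x in lborel. F x = indicator S x * f x"
proof -
  have int: "integrable lebesgue (\<lambda>x. indicator S x * f x)"
    using assms by (simp add: integrable_restrict_space)
  obtain F where F[measurable]: "F \<in> borel_measurable lborel" and ae: "AE x in lborel. indicator S x * f x = F x"
    using completion_ex_borel_measurable_real[OF borel_measurable_integrable[OF int]] by blast
  have "integrable lebesgue F"
    using integrable_cong_AE[THEN iffD1, OF _ _ AE_completion[OF ae] int] borel_measurable_integrable[OF int]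
      measurable_completion[OF F] by blast
  then have "integrable lborel F" using F by (simp add: integrable_completion)
  with that[of F] ae show ?thesis by (simp add: eq_commute)
qed

lemma integral_lborel_eq_lebesgue_on:
  fixes f g :: "'a::euclidean_space \<Rightarrow> real"
  assumes F: "integrable lborel F" and ae: "AE x in lborel. F x = indicator S x * f x"
    and S: "S \<in> sets borel" and f: "f \<in> borel_measurable (leb S)" and h[measurable]: "h \<in> borel_measurable borel"
  shows "(LINT x|lborel. F x * h x) = (LINT x|leb S. f x * h x)"
proof -
  have [measurable]: "F \<in> borel_measurable borel" using F by auto
  have "(LINT x|lborel. F x * h x) = (LINT x|lebesgue. F x * h x)"
    by (rule integral_completion[symmetric]) measurable
  also have "\<dots> = (LINT x|lebesgue. indicator S x *\<^sub>R (f x * h x))"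
  proof (rule integral_cong_AE)
    have fm: "(\<lambda>x. indicator S x *\<^sub>R f x) \<in> borel_measurable lebesgue"
      using f S by (subst borel_measurable_restrict_space_iff[symmetric]) auto
    have "(\<lambda>x. (indicator S x *\<^sub>R f x) * h x) \<in> borel_measurable lebesgue"
      by (rule borel_measurable_times[OF fm measurable_completion]) simp
    then show "(\<lambda>x. indicator S x *\<^sub>R (f x * h x)) \<in> borel_measurable lebesgue"
      by (simp add: mult.assoc)
    show "(\<lambda>x. F x * h x) \<in> borel_measurable lebesgue" by (rule measurable_completion) measurable
    show "AE x in lebesgue. F x * h x = indicator S x *\<^sub>R (f x * h x)"
      using AE_completion[OF ae] by eventually_elim simp
  qed
  also have "\<dots> = (LINT x|leb S. f x * h x)"
    using S by (subst integral_restrict_space) auto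
  finally show ?thesis .
qed

lemma lebesgue_on_L1_le:
  fixes f h :: "'a::euclidean_space \<Rightarrow> real"
  assumes ae: "AE x in lborel. F x = indicator S x * f x" and S: "S \<in> sets borel"
    and [measurable]: "F \<in> borel_measurable borel" "h \<in> borel_measurable borel"
    and f: "f \<in> borel_measurable (leb S)" and e: "0 \<le> e"
    and le: "(\<integral>\<^sup>+x. \<bar>h x - F x\<bar> \<partial>lborel) \<le> ennreal e"
  shows "L1_dist (leb S) h f \<le> e"
proof -
  have hm: "h \<in> borel_measurable (leb S)"
    by (intro measurable_restrict_space1 measurable_completion) simp
  have eq: "L1_dist (leb S) h f = enn2real (\<integral>\<^sup>+x. ennreal \<bar>h x - f x\<bar> \<partial>leb S)"
    using f hm by (intro integral_eq_nn_integral) auto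
  have "(\<integral>\<^sup>+x. ennreal \<bar>h x - f x\<bar> \<partial>leb S)
      = (\<integral>\<^sup>+x. ennreal \<bar>h x - f x\<bar> * indicator S x \<partial>lebesgue)"
    using S by (subst nn_integral_restrict_space) auto
  also have "\<dots> \<le> (\<integral>\<^sup>+x. ennreal \<bar>h x - F x\<bar> \<partial>lebesgue)"
    by (rule nn_integral_mono_AE)
      (use AE_completion[OF ae] in \<open>eventually_elim, auto simp: indicator_def\<close>)
  also have "\<dots> = (\<integral>\<^sup>+x. ennreal \<bar>h x - F x\<bar> \<partial>lborel)"
    by (rule nn_integral_completion)
  also note le
  finally show ?thesis unfolding eq by (rule enn2real_leI[OF e])
qed

text \<open>Shrinking towards an interior point moves every point of a convex set away from its boundary,
  so that after it a mollifier of small support is an admissible test function and mollification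
  commutes with weak differentiation.\<close>

lemma conv_weak_derivative:
  fixes f fi :: "'a::euclidean_space \<Rightarrow> real"
  assumes w: "weak_deriv S [i] f fi" and i: "i \<in> Basis" and S: "open S"
    and F: "integrable lborel F" "AE x in lborel. F x = indicator S x * f x"
    and Fi: "integrable lborel Fi" "AE x in lborel. Fi x = indicator S x * fi x"
    and g: "bump g" "\<And>x. d \<le> norm x \<Longrightarrow> g x = 0" and p: "cball p d \<subseteq> S"
  shows "conv F (dpartial i g) p = conv Fi g p"
proof -
  define \<phi> where "\<phi> y = g (p + (-1) *\<^sub>R y)" for y
  have \<phi>: "test_function S \<phi>"
    unfolding test_function_def
  proof (intro conjI exI[of _ "cball p d"] allI impI)
    show "smooth \<phi>" unfolding \<phi>_def[abs_def] by (rule smooth_affine[OF bump_smooth[OF g(1)]])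
    show "\<phi> x = 0" if "x \<notin> cball p d" for x
      using that g(2)[of "p - x"] by (simp add: \<phi>_def dist_norm)
  qed (use p in auto)
  have d\<phi>: "dpartial i \<phi> y = (-1) * dpartial i g (p - y)" for y
    unfolding \<phi>_def[abs_def] using dpartial_affine[OF bump_smooth[OF g(1)], of i p "-1" y] by simp
  have [measurable]: "\<phi> \<in> borel_measurable borel" "dpartial i \<phi> \<in> borel_measurable borel"
    using test_function_smooth[OF \<phi>] smooth_dpartial[OF test_function_smooth[OF \<phi>] i]
    by (auto intro: smooth_borel_measurable)
  have m: "f \<in> borel_measurable (leb S)" "fi \<in> borel_measurable (leb S)"
    using weak_derivD(1,2)[OF w] by (auto simp: loc_integrable_def)
  have "conv F (dpartial i g) p = (LINT y|lborel. - (F y * dpartial i \<phi> y))"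
    unfolding conv_def by (simp add: d\<phi>)
  also have "\<dots> = - (LINT y|leb S. f y * dpartial i \<phi> y)"
    using integral_lborel_eq_lebesgue_on[OF F _ m(1), of "dpartial i \<phi>"] S by simp
  also have "\<dots> = (LINT y|leb S. fi y * \<phi> y)"
    using weak_derivD(3)[OF w \<phi>] by simp
  also have "\<dots> = (LINT y|lborel. Fi y * \<phi> y)"
    using integral_lborel_eq_lebesgue_on[OF Fi _ m(2), of \<phi>] S by simp
  also have "\<dots> = conv Fi g p" unfolding conv_def by (simp add: \<phi>_def)
  finally show ?thesis .
qed

text \<open>The approximation is \<open>x \<mapsto> (F * g)(\<mu> c + (1 - \<mu>) x)\<close> with \<open>F\<close> the extension of \<open>f\<close> by zero and \<open>g\<close> a mollifier.
  Its derivatives carry an additional factor \<open>1 - \<mu>\<close>, which accounts for the term \<open>\<mu> N\<close>.\<close>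

lemma smooth_approx_step:
  fixes S :: "'a::euclidean_space set"
  assumes S: "open S" "convex S" "S \<noteq> {}"
    and f: "integrable (leb S) f"
    and h: "\<And>i. i \<in> Basis \<Longrightarrow> weak_deriv S [i] f (h i)"
    and hint: "\<And>i. i \<in> Basis \<Longrightarrow> integrable (leb S) (h i)"
    and e: "0 < e"
  shows "\<exists>\<phi>. smooth \<phi> \<and> L1_dist (leb S) \<phi> f \<le> e
    \<and> (\<forall>i\<in>Basis. L1_dist (leb S) (dpartial i \<phi>) (h i) \<le> e)"
proof -
  have Sb: "S \<in> sets borel" using S(1) by simp
  obtain c r where cr: "0 < r" "cball c r \<subseteq> S"
    using S open_contains_cball by (metis all_not_in_conv)
  obtain F where F: "integrable lborel F" "AE x in lborel. F x = indicator S x * f x"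
    by (rule zero_extension[OF f Sb])
  have "\<exists>H. integrable lborel H \<and> (AE x in lborel. H x = indicator S x * h i x)" if "i \<in> Basis" for i
    by (rule zero_extension[OF hint[OF that] Sb]) blast
  then obtain H where H: "\<And>i. i \<in> Basis \<Longrightarrow> integrable lborel (H i)"
    "\<And>i. i \<in> Basis \<Longrightarrow> AE x in lborel. H i x = indicator S x * h i x" by metis
  define N where "N = (\<Sum>i\<in>(Basis::'a set). LINT x|lborel. \<bar>H i x\<bar>)"
  have N: "(LINT x|lborel. \<bar>H i x\<bar>) \<le> N" if "i \<in> Basis" for i
    unfolding N_def by (rule member_le_sum[OF that]) auto
  have N0: "0 \<le> N" unfolding N_def by (intro sum_nonneg) auto
  define P where "P G d \<longleftrightarrow> 0 < d \<and> (\<forall>a b. 1 - d < a \<longrightarrow> a \<le> 1 \<longrightarrow> norm b < d \<longrightarrow>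
     (\<integral>\<^sup>+x. \<bar>G (b + a *\<^sub>R x) - G x\<bar> \<partial>lborel) \<le> ennreal (e / 2))" for G :: "'a \<Rightarrow> real" and d
  have L1: "\<exists>d. P G d" if "integrable lborel G" for G
    using integrable_L1_continuous[OF that] half_gt_zero[OF e] unfolding L1_continuous_def P_def by blast
  obtain d0 where d0P: "P F d0"
    using L1[OF F(1)] by blast
  have d0: "0 < d0" "\<And>a b. 1 - d0 < a \<Longrightarrow> a \<le> 1 \<Longrightarrow> norm b < d0 \<Longrightarrow>
     (\<integral>\<^sup>+x. \<bar>F (b + a *\<^sub>R x) - F x\<bar> \<partial>lborel) \<le> ennreal (e / 2)"
    using d0P by (auto simp: P_def)
  obtain d1 where d1P: "\<And>i. i \<in> Basis \<Longrightarrow> P (H i) (d1 i)"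
    using L1[OF H(1)] by metis
  have d1: "\<And>i. i \<in> Basis \<Longrightarrow> 0 < d1 i"
    "\<And>i a b. i \<in> Basis \<Longrightarrow> 1 - d1 i < a \<Longrightarrow> a \<le> 1 \<Longrightarrow> norm b < d1 i \<Longrightarrow>
     (\<integral>\<^sup>+x. \<bar>H i (b + a *\<^sub>R x) - H i x\<bar> \<partial>lborel) \<le> ennreal (e / 2)"
    using d1P by (auto simp: P_def)
  define d where "d = Min (insert d0 (d1 ` Basis))"
  have d: "0 < d" "d \<le> d0" "\<And>i. i \<in> Basis \<Longrightarrow> d \<le> d1 i"
    using d0(1) d1(1) unfolding d_def by (simp, simp, intro Min_le, auto)
  define \<mu> where "\<mu> = min (1 / 2) (min (d / (2 * (norm c + 1))) (e / (2 * (N + 1))))"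
  have \<mu>: "0 < \<mu>" "\<mu> < 1" "\<mu> * norm c < d / 2" "\<mu> * N \<le> e / 2" "\<mu> < d"
  proof -
    have nc: "0 < 2 * (norm c + 1)" by (simp add: add_nonneg_pos)
    show "0 < \<mu>" "\<mu> < 1" using d(1) e N0 nc by (auto simp: \<mu>_def)
    have "\<mu> \<le> d / (2 * (norm c + 1))" by (simp add: \<mu>_def)
    then have "\<mu> * (2 * (norm c + 1)) \<le> d" using nc by (simp add: pos_le_divide_eq)
    then have *: "2 * (\<mu> * norm c) + 2 * \<mu> \<le> d" by (simp add: algebra_simps)
    moreover have "0 \<le> \<mu> * norm c" using \<open>0 < \<mu>\<close> by simp
    ultimately show "\<mu> * norm c < d / 2" "\<mu> < d" using \<open>0 < \<mu>\<close> by linarith+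
    have "\<mu> \<le> e / (2 * (N + 1))" by (simp add: \<mu>_def)
    then have "\<mu> * (2 * (N + 1)) \<le> e" using N0 by (simp add: pos_le_divide_eq)
    then show "\<mu> * N \<le> e / 2" using \<open>0 < \<mu>\<close> by (simp add: algebra_simps)
  qed
  define a where "a = 1 - \<mu>"
  define b where "b = \<mu> *\<^sub>R c"
  define \<delta> where "\<delta> = min (d / 2) (\<mu> * r)"
  have \<delta>: "0 < \<delta>" "\<delta> \<le> d / 2" "\<delta> \<le> \<mu> * r" using d \<mu> cr by (auto simp: \<delta>_def)
  obtain g :: "'a \<Rightarrow> real" where g: "bump g" "\<And>x. 0 \<le> g x" "integrable lborel g" "(LINT x|lborel. g x) = 1"
    "\<And>x. \<delta> \<le> norm x \<Longrightarrow> g x = 0"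
    by (rule exists_mollifier[OF \<delta>(1)]) (rule that)
  have inside: "cball (b + a *\<^sub>R x) \<delta> \<subseteq> S" if x: "x \<in> S" for x
  proof
    fix y assume "y \<in> cball (b + a *\<^sub>R x) \<delta>"
    then have ny: "norm (y - (b + a *\<^sub>R x)) \<le> \<mu> * r" using \<delta>(3) by (simp add: dist_norm norm_minus_commute)
    define w where "w = c + (1 / \<mu>) *\<^sub>R (y - (b + a *\<^sub>R x))"
    have "norm (w - c) \<le> r"
      using ny \<mu>(1) by (simp add: w_def pos_divide_le_eq mult.commute)
    then have "w \<in> S" using cr(2) by (auto simp: dist_norm norm_minus_commute)
    moreover have "y = (1 - \<mu>) *\<^sub>R x + \<mu> *\<^sub>R w"
      using \<mu>(1) by (simp add: w_def a_def b_def algebra_simps)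
    ultimately show "y \<in> S" using convexD_alt[OF S(2) x _ _ _, of w \<mu>] \<mu> by simp
  qed
  have shift: "norm (b - z) < d" if "g z \<noteq> 0" for z
  proof -
    have "norm z < \<delta>" using g(5)[of z] that by linarith
    moreover have "norm b < d / 2" using \<mu> by (simp add: b_def)
    ultimately show ?thesis using norm_triangle_ineq4[of b z] \<delta>(2) by linarith
  qed
  have a: "1 - d < a" "a \<le> 1" "0 < a" using \<mu> by (auto simp: a_def)
  define \<phi> where "\<phi> x = conv F g (b + a *\<^sub>R x)" for x
  have sm: "smooth (conv F g)" by (rule smooth_conv[OF F(1) g(1)])
  have \<phi>: "smooth \<phi>" unfolding \<phi>_def[abs_def] by (rule smooth_affine[OF sm])
  have "L1_dist (leb S) \<phi> f \<le> e"
  proof (rule lebesgue_on_L1_le[OF F(2) Sb])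
    have "(\<integral>\<^sup>+x. \<bar>conv F g (b + a *\<^sub>R x) - F x\<bar> \<partial>lborel) \<le> ennreal (e / 2)"
    proof (rule conv_L1_close[OF F(1) g(1-4)])
      fix z assume "g z \<noteq> 0"
      from shift[OF this] show "(\<integral>\<^sup>+x. \<bar>F ((b - z) + a *\<^sub>R x) - F x\<bar> \<partial>lborel) \<le> ennreal (e / 2)"
        using a d by (intro d0(2)) auto
    qed
    also have "\<dots> \<le> ennreal e" using e by (intro ennreal_leI) simp
    finally show "(\<integral>\<^sup>+x. \<bar>\<phi> x - F x\<bar> \<partial>lborel) \<le> ennreal e" by (simp add: \<phi>_def)
  qed (use F \<phi> f e in \<open>auto intro: smooth_borel_measurable\<close>)
  moreover have "L1_dist (leb S) (dpartial i \<phi>) (h i) \<le> e" if i: "i \<in> Basis" for i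
  proof -
    have smH: "smooth (conv (H i) g)" by (rule smooth_conv[OF H(1)[OF i] g(1)])
    have [measurable]: "conv (H i) g \<in> borel_measurable borel" by (rule smooth_borel_measurable[OF smH])
    have [measurable]: "H i \<in> borel_measurable borel" using H(1)[OF i] by auto
    let ?k = "\<lambda>x. a * conv (H i) g (b + a *\<^sub>R x)"
    have "L1_dist (leb S) (dpartial i \<phi>) (h i) = L1_dist (leb S) ?k (h i)"
    proof (rule Bochner_Integration.integral_cong[OF refl])
      fix x assume "x \<in> space (leb S)"
      then have x: "x \<in> S" by simp
      have "dpartial i \<phi> x = a * conv F (dpartial i g) (b + a *\<^sub>R x)"
        unfolding \<phi>_def[abs_def] by (simp add: dpartial_affine[OF sm] dpartial_conv[OF F(1) g(1) i])
      also have "conv F (dpartial i g) (b + a *\<^sub>R x) = conv (H i) g (b + a *\<^sub>R x)"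
        by (rule conv_weak_derivative[OF h[OF i] i S(1) F H(1)[OF i] H(2)[OF i] g(1) g(5) inside[OF x]])
      finally show "\<bar>dpartial i \<phi> x - h i x\<bar> = \<bar>?k x - h i x\<bar>" by simp
    qed
    also have "\<dots> \<le> e"
    proof (rule lebesgue_on_L1_le[OF H(2)[OF i] Sb])
      have *: "(\<integral>\<^sup>+x. \<bar>conv (H i) g (b + a *\<^sub>R x) - H i x\<bar> \<partial>lborel) \<le> ennreal (e / 2)"
      proof (rule conv_L1_close[OF H(1)[OF i] g(1-4)])
        fix z assume "g z \<noteq> 0"
        from shift[OF this] show "(\<integral>\<^sup>+x. \<bar>H i ((b - z) + a *\<^sub>R x) - H i x\<bar> \<partial>lborel) \<le> ennreal (e / 2)"
          using a d(3)[OF i] by (intro d1(2)[OF i]) auto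
      qed
      have "(\<integral>\<^sup>+x. \<bar>?k x - H i x\<bar> \<partial>lborel)
          \<le> (\<integral>\<^sup>+x. ennreal \<bar>conv (H i) g (b + a *\<^sub>R x) - H i x\<bar> + ennreal \<mu> * ennreal \<bar>H i x\<bar> \<partial>lborel)"
      proof (rule nn_integral_mono)
        fix x
        have "?k x - H i x = a * (conv (H i) g (b + a *\<^sub>R x) - H i x) - \<mu> * H i x"
          by (simp add: a_def algebra_simps)
        then have "\<bar>?k x - H i x\<bar> \<le> a * \<bar>conv (H i) g (b + a *\<^sub>R x) - H i x\<bar> + \<mu> * \<bar>H i x\<bar>"
          using a \<mu> abs_triangle_ineq4[of "a * (conv (H i) g (b + a *\<^sub>R x) - H i x)" "\<mu> * H i x"]
          by (simp add: abs_mult)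
        also have "\<dots> \<le> 1 * \<bar>conv (H i) g (b + a *\<^sub>R x) - H i x\<bar> + \<mu> * \<bar>H i x\<bar>"
          using a by (intro add_mono mult_right_mono) auto
        finally show "ennreal \<bar>?k x - H i x\<bar>
            \<le> ennreal \<bar>conv (H i) g (b + a *\<^sub>R x) - H i x\<bar> + ennreal \<mu> * ennreal \<bar>H i x\<bar>"
          using \<mu> by (simp add: ennreal_mult[symmetric] ennreal_plus[symmetric] ennreal_leI del: ennreal_plus)
      qed
      also have "\<dots> = (\<integral>\<^sup>+x. \<bar>conv (H i) g (b + a *\<^sub>R x) - H i x\<bar> \<partial>lborel) + ennreal \<mu> * (\<integral>\<^sup>+x. \<bar>H i x\<bar> \<partial>lborel)"
        by (subst nn_integral_add) (simp_all add: nn_integral_cmult)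
      also have "(\<integral>\<^sup>+x. \<bar>H i x\<bar> \<partial>lborel) = ennreal (LINT x|lborel. \<bar>H i x\<bar>)"
        using H(1)[OF i] by (intro nn_integral_eq_integral) auto
      also have "(\<integral>\<^sup>+x. \<bar>conv (H i) g (b + a *\<^sub>R x) - H i x\<bar> \<partial>lborel) + ennreal \<mu> * \<dots>
          \<le> ennreal (e / 2) + ennreal (\<mu> * N)"
        using * N[OF i] \<mu> by (intro add_mono) (auto simp: ennreal_mult[symmetric] intro!: ennreal_leI mult_left_mono)
      also have "\<dots> \<le> ennreal (e / 2) + ennreal (e / 2)"
        using \<mu> by (intro add_mono ennreal_leI) auto
      also have "\<dots> = ennreal e" using e by (simp add: ennreal_plus[symmetric] del: ennreal_plus)
      finally show "(\<integral>\<^sup>+x. \<bar>?k x - H i x\<bar> \<partial>lborel) \<le> ennreal e" .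
    qed (use H(1)[OF i] hint[OF i] e in auto)
    finally show ?thesis .
  qed
  ultimately show ?thesis using \<phi> by blast
qed

text \<open>Meyers--Serrin on convex domains, with approximants that are smooth on the whole space.\<close>

proposition smooth_dense_W11:
  fixes S :: "'a::euclidean_space set"
  assumes "open S" "convex S" "S \<noteq> {}"
    and "integrable (leb S) f"
    and "\<And>i. i \<in> Basis \<Longrightarrow> weak_deriv S [i] f (h i)"
    and "\<And>i. i \<in> Basis \<Longrightarrow> integrable (leb S) (h i)"
  obtains \<phi> where "\<And>n::nat. smooth (\<phi> n)" "L1_tendsto (leb S) \<phi> f"
    "\<And>i. i \<in> Basis \<Longrightarrow> L1_tendsto (leb S) (\<lambda>n. dpartial i (\<phi> n)) (h i)"
proof -
  define Q where "Q n \<phi> \<longleftrightarrow> smooth \<phi> \<and> L1_dist (leb S) \<phi> f \<le> 1 / real (Suc n)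
    \<and> (\<forall>i\<in>Basis. L1_dist (leb S) (dpartial i \<phi>) (h i) \<le> 1 / real (Suc n))" for n \<phi>
  have "\<exists>\<phi>. Q n \<phi>" for n
    unfolding Q_def by (rule smooth_approx_step[OF assms]) auto
  then obtain \<phi> where Q: "\<And>n. Q n (\<phi> n)" by metis
  have \<phi>: "\<And>n. smooth (\<phi> n)"
    "\<And>n. L1_dist (leb S) (\<phi> n) f \<le> 1 / real (Suc n)"
    "\<And>n i. i \<in> Basis \<Longrightarrow> L1_dist (leb S) (dpartial i (\<phi> n)) (h i) \<le> 1 / real (Suc n)"
    using Q unfolding Q_def by blast+
  have lim: "u \<longlonglongrightarrow> 0" if "\<And>n. 0 \<le> u n" "\<And>n. u n \<le> 1 / real (Suc n)" for u :: "nat \<Rightarrow> real"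
    by (rule tendsto_sandwich[OF _ _ tendsto_const LIMSEQ_inverse_real_of_nat])
      (use that in \<open>auto simp: inverse_eq_divide\<close>)
  show ?thesis
  proof (rule that[of \<phi>])
    show "L1_tendsto (leb S) \<phi> f" by (rule lim) (use \<phi>(2) in auto)
    show "L1_tendsto (leb S) (\<lambda>n. dpartial i (\<phi> n)) (h i)" if "i \<in> Basis" for i
      by (rule lim) (use \<phi>(3)[OF that] in auto)
  qed (rule \<phi>(1))
qed

section \<open>First-order Sobolev calculus\<close>

lemma borel_set_lebesgue [simp]: "S \<in> sets borel \<Longrightarrow> S \<in> sets lebesgue"
  by simp

lemma compact_integrable_continuous:
  fixes f :: "'a::euclidean_space \<Rightarrow> real"
  assumes "compact K" "continuous_on UNIV f"
  shows "integrable (leb K) f"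
proof -
  have "integrable lborel (\<lambda>x. indicator K x *\<^sub>R f x)"
    using assms by (intro borel_integrable_compact) (auto intro: continuous_on_subset)
  then have "integrable lebesgue (\<lambda>x. indicator K x *\<^sub>R f x)"
    by (subst integrable_completion) auto
  then show ?thesis using assms(1) by (subst integrable_restrict_space) (auto simp: borel_compact)
qed

lemma integrable_lebesgue_on_subset:
  fixes f :: "'a::euclidean_space \<Rightarrow> 'b::euclidean_space"
  assumes "integrable (leb S) f" "X \<subseteq> S" "X \<in> sets borel" "S \<in> sets borel"
  shows "integrable (leb X) f"
proof -
  have "integrable lebesgue (\<lambda>x. indicator S x *\<^sub>R f x)"
    using assms by (simp add: integrable_restrict_space)
  from integrable_mult_indicator[OF _ this, of X]
  have "integrable lebesgue (\<lambda>x. indicator X x *\<^sub>R (indicator S x *\<^sub>R f x))" using assms(3) by simp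
  also have "(\<lambda>x. indicator X x *\<^sub>R (indicator S x *\<^sub>R f x)) = (\<lambda>x. indicator X x *\<^sub>R f x)"
    using assms(2) by (auto simp: fun_eq_iff indicator_def)
  finally show ?thesis using assms(3) by (simp add: integrable_restrict_space)
qed

lemma integrable_imp_loc_integrable:
  fixes f :: "'a::euclidean_space \<Rightarrow> 'b::euclidean_space"
  assumes "integrable (leb S) f" "S \<in> sets borel"
  shows "loc_integrable S f"
  unfolding loc_integrable_def
proof (intro conjI allI impI)
  show "f \<in> borel_measurable (leb S)" using assms(1) by (rule borel_measurable_integrable)
  fix K assume "compact K \<and> K \<subseteq> S"
  then show "integrable (leb K) f"
    by (intro integrable_lebesgue_on_subset[OF assms(1)] assms(2)) (auto simp: borel_compact)
qed

lemma smooth_integrable: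
  fixes f :: "'a::euclidean_space \<Rightarrow> real"
  assumes "smooth f" "bounded S" "S \<in> sets borel"
  shows "integrable (leb S) f"
proof (rule integrable_lebesgue_on_subset[OF _ closure_subset assms(3)])
  show "integrable (leb (closure S)) f"
    using assms by (intro compact_integrable_continuous smooth_continuous_on) auto
qed auto

lemma smooth_loc_integrable:
  fixes f :: "'a::euclidean_space \<Rightarrow> real"
  shows "smooth f \<Longrightarrow> loc_integrable S f"
  unfolding loc_integrable_def
  by (simp add: continuous_lebesgue_measurable compact_integrable_continuous smooth_continuous_on)

text \<open>Convolution with the indicator of a large ball is constant near the origin, and its derivative there is
  the integral in question.\<close>

lemma integral_dpartial_bump:
  fixes g :: "'a::euclidean_space \<Rightarrow> real"
  assumes g: "bump g" and i: "i \<in> Basis"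
  shows "(LINT x|lborel. dpartial i g x) = 0"
proof -
  obtain K where K: "compact K" "\<And>x. x \<notin> K \<Longrightarrow> g x = 0" using g unfolding bump_def by blast
  obtain R where R: "\<And>x. x \<in> K \<Longrightarrow> norm x \<le> R" using compact_imp_bounded[OF K(1)] bounded_pos by metis
  let ?F = "indicator (cball 0 (R + 1)) :: 'a \<Rightarrow> real"
  have F: "integrable lborel ?F"
    by (intro integrable_real_indicator) (use emeasure_lborel_cball_finite in auto)
  have eq: "conv ?F h x = (LINT z|lborel. h z)"
    if h: "bump h" "\<And>z. z \<notin> K \<Longrightarrow> h z = 0" and x: "norm x \<le> 1" for h x
  proof -
    have "?F (x - z) * h z = h z" for z
      using h(2)[of z] R[of z] x norm_triangle_ineq4[of x z] by (cases "z \<in> K") (auto simp: indicator_def)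
    moreover have "?F \<in> borel_measurable borel" "h \<in> borel_measurable borel"
      using borel_measurable_integrable[OF F] smooth_borel_measurable[OF bump_smooth[OF h(1)]] by auto
    ultimately show ?thesis by (simp only: conv_eq_shifted)
  qed
  have "(conv ?F g has_derivative (\<lambda>_. 0)) (at 0)"
    by (rule has_derivative_transform_within_open[OF has_derivative_const open_ball centre_in_ball[THEN iffD2, OF zero_less_one]])
      (simp add: eq[OF g K(2)])
  then have "0 = conv ?F (dpartial i g) 0" by (simp add: dpartial_eqI flip: dpartial_conv[OF F g i])
  also have "\<dots> = (LINT x|lborel. dpartial i g x)"
    by (rule eq[OF bump_dpartial[OF g i] dpartial_support[OF compact_imp_closed[OF K(1)] K(2)]]) simp_all
  finally show ?thesis by simp
qed

lemma weak_deriv_smooth: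
  fixes f :: "'a::euclidean_space \<Rightarrow> real"
  assumes f: "smooth f" and i: "i \<in> Basis" and S: "open S"
  shows "weak_deriv S [i] f (dpartial i f)"
  unfolding weak_deriv_def
proof (intro conjI allI impI)
  show l: "loc_integrable S f" "loc_integrable S (dpartial i f)"
    using f i by (auto intro: smooth_loc_integrable smooth_dpartial)
  fix \<phi> assume \<phi>: "test_function S \<phi>"
  have b: "test_function S (\<lambda>x. f x * \<phi> x)" by (rule test_function_mult[OF \<phi> f])
  then have bump: "bump (\<lambda>x. f x * \<phi> x)" unfolding test_function_def bump_def by blast
  have d: "dpartial i (\<lambda>x. f x * \<phi> x) x = f x * dpartial i \<phi> x + dpartial i f x * \<phi> x" for x
    by (rule dpartial_mult) (intro smooth_differentiable f test_function_smooth[OF \<phi>])+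
  have t: "test_function S (dpartial i (\<lambda>x. f x * \<phi> x))" by (rule test_function_dpartial[OF b i])
  then have supp: "dpartial i (\<lambda>x. f x * \<phi> x) x = 0" if "x \<notin> S" for x
    using that unfolding test_function_def by blast
  have m: "dpartial i (\<lambda>x. f x * \<phi> x) \<in> borel_measurable borel"
    by (rule smooth_borel_measurable[OF test_function_smooth[OF t]])
  have "(LINT x|leb S. f x * dpartial i \<phi> x) + (LINT x|leb S. dpartial i f x * \<phi> x)
      = (LINT x|leb S. f x * dpartial i \<phi> x + dpartial i f x * \<phi> x)"
    by (rule Bochner_Integration.integral_add[symmetric])
      (intro integrable_times_test[OF _ S] l test_function_dpartial \<phi> i)+
  also have "\<dots> = (LINT x|leb S. dpartial i (\<lambda>x. f x * \<phi> x) x)" by (simp add: d)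
  also have "\<dots> = (LINT x|lebesgue. indicator S x *\<^sub>R dpartial i (\<lambda>x. f x * \<phi> x) x)"
    using S by (subst integral_restrict_space) auto
  also have "(\<lambda>x. indicator S x *\<^sub>R dpartial i (\<lambda>x. f x * \<phi> x) x) = dpartial i (\<lambda>x. f x * \<phi> x)"
    using supp by (auto simp: fun_eq_iff indicator_def)
  also have "(LINT x|lebesgue. dpartial i (\<lambda>x. f x * \<phi> x) x) = 0"
    using integral_dpartial_bump[OF bump i] m by (simp add: integral_completion)
  finally show "(LINT x|leb S. f x * iter_partial [i] \<phi> x)
      = (- 1) ^ length [i] * (LINT x|leb S. dpartial i f x * \<phi> x)" by simp
qed

lemma L1_tendsto_times_bounded:
  fixes f :: "nat \<Rightarrow> 'a \<Rightarrow> real"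
  assumes f: "\<And>n. integrable M (f n)" "integrable M g" and lim: "L1_tendsto M f g"
    and h: "h \<in> borel_measurable M" "AE x in M. \<bar>h x\<bar> \<le> C"
  shows "(\<lambda>n. LINT x|M. f n x * h x) \<longlonglongrightarrow> (LINT x|M. g x * h x)"
proof (rule LIM_zero_cancel, rule Lim_null_comparison)
  show "(\<lambda>n. \<bar>C\<bar> * L1_dist M (f n) g) \<longlonglongrightarrow> 0"
    using tendsto_mult_left[OF lim, of "\<bar>C\<bar>"] by simp
  show "\<forall>\<^sub>F n in sequentially. norm ((LINT x|M. f n x * h x) - (LINT x|M. g x * h x)) \<le> \<bar>C\<bar> * L1_dist M (f n) g"
  proof (intro always_eventually allI)
    fix n
    have i: "integrable M (\<lambda>x. f n x * h x)" "integrable M (\<lambda>x. g x * h x)"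
      by (intro integrable_times_bounded[OF _ h] f)+
    have "(LINT x|M. f n x * h x) - (LINT x|M. g x * h x) = (LINT x|M. (f n x - g x) * h x)"
      using integral_lincomb_times[OF i, of 1 "-1"] by simp
    also have "norm \<dots> \<le> (LINT x|M. \<bar>C\<bar> * \<bar>f n x - g x\<bar>)"
    proof (rule order_trans[OF integral_norm_bound integral_mono_AE])
      show "integrable M (\<lambda>x. norm ((f n x - g x) * h x))"
        using i by (simp add: left_diff_distrib)
      show "integrable M (\<lambda>x. \<bar>C\<bar> * \<bar>f n x - g x\<bar>)" using f by auto
      show "AE x in M. norm ((f n x - g x) * h x) \<le> \<bar>C\<bar> * \<bar>f n x - g x\<bar>"
        using h(2)
      proof eventually_elim
        case (elim x)
        then have "\<bar>h x\<bar> * \<bar>f n x - g x\<bar> \<le> \<bar>C\<bar> * \<bar>f n x - g x\<bar>" by (intro mult_right_mono) auto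
        then show ?case by (simp add: abs_mult mult.commute)
      qed
    qed
    finally show "norm ((LINT x|M. f n x * h x) - (LINT x|M. g x * h x)) \<le> \<bar>C\<bar> * L1_dist M (f n) g"
      by simp
  qed
qed

lemma test_function_bounded:
  assumes "test_function S \<phi>" obtains C where "0 < C" "\<And>x. \<bar>\<phi> x\<bar> \<le> C"
  using assms bump_bounded[of \<phi>] unfolding test_function_def bump_def by blast

lemma test_function_measurable:
  fixes \<phi> :: "'a::euclidean_space \<Rightarrow> real"
  shows "test_function S \<phi> \<Longrightarrow> \<phi> \<in> borel_measurable (leb X)"
  by (intro continuous_lebesgue_measurable smooth_continuous_on test_function_smooth)

lemma weak_deriv_limit:
  fixes f :: "nat \<Rightarrow> 'a::euclidean_space \<Rightarrow> real"
  assumes S: "open S" and i: "i \<in> Basis" and w: "\<And>n. weak_deriv S [i] (f n) (g n)"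
    and f: "\<And>n. integrable (leb S) (f n)" "integrable (leb S) F"
      "L1_tendsto (leb S) f F"
    and g: "\<And>n. integrable (leb S) (g n)" "integrable (leb S) G"
      "L1_tendsto (leb S) g G"
  shows "weak_deriv S [i] F G"
  unfolding weak_deriv_def
proof (intro conjI allI impI)
  show "loc_integrable S F" "loc_integrable S G"
    using f(2) g(2) S by (auto intro: integrable_imp_loc_integrable)
  fix \<phi> assume \<phi>: "test_function S \<phi>"
  obtain C where C: "\<And>x. \<bar>\<phi> x\<bar> \<le> C" using test_function_bounded[OF \<phi>] by blast
  obtain D where D: "\<And>x. \<bar>dpartial i \<phi> x\<bar> \<le> D"
    using test_function_bounded[OF test_function_dpartial[OF \<phi> i]] by blast
  have "(\<lambda>n. LINT x|leb S. f n x * dpartial i \<phi> x) \<longlonglongrightarrow> (LINT x|leb S. F x * dpartial i \<phi> x)"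
    by (rule L1_tendsto_times_bounded[OF f test_function_measurable[OF test_function_dpartial[OF \<phi> i]]])
      (use D in auto)
  moreover have "(\<lambda>n. - (LINT x|leb S. g n x * \<phi> x)) \<longlonglongrightarrow> - (LINT x|leb S. G x * \<phi> x)"
    by (rule tendsto_minus, rule L1_tendsto_times_bounded[OF g test_function_measurable[OF \<phi>]])
      (use C in auto)
  moreover have "(LINT x|leb S. f n x * dpartial i \<phi> x) = - (LINT x|leb S. g n x * \<phi> x)" for n
    using weak_derivD(3)[OF w \<phi>] by simp
  ultimately have "(LINT x|leb S. F x * dpartial i \<phi> x) = - (LINT x|leb S. G x * \<phi> x)"
    using LIMSEQ_unique by fastforce
  then show "(LINT x|leb S. F x * iter_partial [i] \<phi> x)
      = (- 1) ^ length [i] * (LINT x|leb S. G x * \<phi> x)" by simp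
qed

text \<open>For smooth \<open>f\<close> test the weak derivative of \<open>a\<close> with \<open>f \<phi>\<close>; the general case is a limit of smooth approximations of \<open>f\<close>,
  against which \<open>a\<close> and \<open>a'\<close> are bounded.\<close>

lemma weak_deriv_mult:
  fixes S :: "'a::euclidean_space set"
  assumes S: "open S" "convex S" "bounded S" "S \<noteq> {}" and i: "i \<in> Basis"
    and a: "weak_deriv S [i] a a'" "AE x in leb S. \<bar>a x\<bar> \<le> C" "AE x in leb S. \<bar>a' x\<bar> \<le> C"
    and f: "integrable (leb S) f" "\<And>j. j \<in> Basis \<Longrightarrow> weak_deriv S [j] f (h j)"
      "\<And>j. j \<in> Basis \<Longrightarrow> integrable (leb S) (h j)"
  shows "weak_deriv S [i] (\<lambda>x. f x * a x) (\<lambda>x. f x * a' x + h i x * a x)"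
    and "integrable (leb S) (\<lambda>x. f x * a x)"
    and "integrable (leb S) (\<lambda>x. f x * a' x + h i x * a x)"
proof -
  let ?M = "leb S"
  have Sb: "S \<in> sets borel" using S(1) by simp
  have am: "a \<in> borel_measurable ?M" "a' \<in> borel_measurable ?M"
    using weak_derivD(1,2)[OF a(1)] by (auto simp: loc_integrable_def)
  have int: "integrable ?M (\<lambda>x. f x * a x)" "integrable ?M (\<lambda>x. f x * a' x)" "integrable ?M (\<lambda>x. h i x * a x)"
    using f i am a by (auto intro: integrable_times_bounded)
  show "integrable ?M (\<lambda>x. f x * a x)" "integrable ?M (\<lambda>x. f x * a' x + h i x * a x)"
    using int by auto
  obtain u where u: "\<And>n::nat. smooth (u n)" "L1_tendsto ?M u f"
    "\<And>i. i \<in> Basis \<Longrightarrow> L1_tendsto ?M (\<lambda>n. dpartial i (u n)) (h i)"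
    by (rule smooth_dense_W11[OF S(1,2,4) f]) (assumption | rule that)+
  have ui: "integrable ?M (u n)" "integrable ?M (dpartial i (u n))" for n
    using u(1) i S(3) Sb by (auto intro: smooth_integrable smooth_dpartial)
  show "weak_deriv S [i] (\<lambda>x. f x * a x) (\<lambda>x. f x * a' x + h i x * a x)"
    unfolding weak_deriv_def
  proof (intro conjI allI impI)
    show "loc_integrable S (\<lambda>x. f x * a x)" "loc_integrable S (\<lambda>x. f x * a' x + h i x * a x)"
      using int Sb by (auto intro: integrable_imp_loc_integrable)
    fix \<phi> assume \<phi>: "test_function S \<phi>"
    have d\<phi>: "test_function S (dpartial i \<phi>)" by (rule test_function_dpartial[OF \<phi> i])
    obtain K where K: "0 < K" "\<And>x. \<bar>\<phi> x\<bar> \<le> K" using test_function_bounded[OF \<phi>] by blast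
    obtain D where D: "0 < D" "\<And>x. \<bar>dpartial i \<phi> x\<bar> \<le> D" using test_function_bounded[OF d\<phi>] by blast
    have \<phi>m: "\<phi> \<in> borel_measurable ?M" "dpartial i \<phi> \<in> borel_measurable ?M"
      by (rule test_function_measurable[OF \<phi>], rule test_function_measurable[OF d\<phi>])
    have bd: "AE x in ?M. \<bar>a x * dpartial i \<phi> x\<bar> \<le> \<bar>C\<bar> * D" "AE x in ?M. \<bar>a' x * \<phi> x\<bar> \<le> \<bar>C\<bar> * K"
      "AE x in ?M. \<bar>a x * \<phi> x\<bar> \<le> \<bar>C\<bar> * K"
      using a(2,3) by (eventually_elim, use K D in \<open>auto simp: abs_mult intro!: mult_mono\<close>)+
    have meas: "(\<lambda>x. a x * dpartial i \<phi> x) \<in> borel_measurable ?M" "(\<lambda>x. a' x * \<phi> x) \<in> borel_measurable ?M"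
      "(\<lambda>x. a x * \<phi> x) \<in> borel_measurable ?M"
      using am \<phi>m by (auto intro: borel_measurable_times)
    have 1: "(\<lambda>n. LINT x|?M. u n x * (a x * dpartial i \<phi> x)) \<longlonglongrightarrow> (LINT x|?M. f x * (a x * dpartial i \<phi> x))"
      by (rule L1_tendsto_times_bounded[OF ui(1) f(1) u(2) meas(1) bd(1)])
    have 2: "(\<lambda>n. LINT x|?M. u n x * (a' x * \<phi> x)) \<longlonglongrightarrow> (LINT x|?M. f x * (a' x * \<phi> x))"
      by (rule L1_tendsto_times_bounded[OF ui(1) f(1) u(2) meas(2) bd(2)])
    have 3: "(\<lambda>n. LINT x|?M. dpartial i (u n) x * (a x * \<phi> x)) \<longlonglongrightarrow> (LINT x|?M. h i x * (a x * \<phi> x))"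
      by (rule L1_tendsto_times_bounded[OF ui(2) f(3)[OF i] u(3)[OF i] meas(3) bd(3)])
    have eq: "(LINT x|?M. u n x * (a x * dpartial i \<phi> x))
        = - ((LINT x|?M. u n x * (a' x * \<phi> x)) + (LINT x|?M. dpartial i (u n) x * (a x * \<phi> x)))" for n
    proof -
      have t: "test_function S (\<lambda>x. u n x * \<phi> x)" by (rule test_function_mult[OF \<phi> u(1)])
      have dt: "dpartial i (\<lambda>x. u n x * \<phi> x) x = u n x * dpartial i \<phi> x + dpartial i (u n) x * \<phi> x" for x
        by (rule dpartial_mult) (intro smooth_differentiable u(1) test_function_smooth[OF \<phi>])+
      have "(LINT x|?M. a x * dpartial i (\<lambda>x. u n x * \<phi> x) x) = - (LINT x|?M. a' x * (u n x * \<phi> x))"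
        using weak_derivD(3)[OF a(1) t] by simp
      moreover have "(LINT x|?M. a x * dpartial i (\<lambda>x. u n x * \<phi> x) x)
          = (LINT x|?M. u n x * (a x * dpartial i \<phi> x) + dpartial i (u n) x * (a x * \<phi> x))"
        unfolding dt by (simp add: algebra_simps)
      moreover have "\<dots> = (LINT x|?M. u n x * (a x * dpartial i \<phi> x)) + (LINT x|?M. dpartial i (u n) x * (a x * \<phi> x))"
        by (rule Bochner_Integration.integral_add)
          (rule integrable_times_bounded[OF ui(1) meas(1) bd(1)], rule integrable_times_bounded[OF ui(2) meas(3) bd(3)])
      moreover have "(LINT x|?M. a' x * (u n x * \<phi> x)) = (LINT x|?M. u n x * (a' x * \<phi> x))"
        by (simp add: mult_ac)
      ultimately show ?thesis by simp
    qed
    have "(LINT x|?M. f x * (a x * dpartial i \<phi> x)) = - ((LINT x|?M. f x * (a' x * \<phi> x)) + (LINT x|?M. h i x * (a x * \<phi> x)))"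
      by (rule LIMSEQ_unique[OF 1]) (unfold eq, intro tendsto_minus tendsto_add 2 3)
    also have "(LINT x|?M. f x * (a' x * \<phi> x)) + (LINT x|?M. h i x * (a x * \<phi> x))
        = (LINT x|?M. f x * (a' x * \<phi> x) + h i x * (a x * \<phi> x))"
      by (rule Bochner_Integration.integral_add[symmetric])
        (rule integrable_times_bounded[OF f(1) meas(2) bd(2)], rule integrable_times_bounded[OF f(3)[OF i] meas(3) bd(3)])
    finally show "(LINT x|?M. f x * a x * iter_partial [i] \<phi> x)
        = (- 1) ^ length [i] * (LINT x|?M. (f x * a' x + h i x * a x) * \<phi> x)"
      by (simp add: algebra_simps)
  qed
qed

section \<open>Lebesgue and Sobolev norms\<close>

lemma Lspace_measurable: "f \<in> Lspace p M \<Longrightarrow> f \<in> borel_measurable M"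
  by (simp add: Lspace_def)

lemma Lspace_AE_cong:
  assumes "f \<in> Lspace p M" "AE x in M. f x = g x" "g \<in> borel_measurable M"
  shows "g \<in> Lspace p M"
proof (cases "p = \<infinity>")
  case True
  then obtain C where "AE x in M. norm (f x) \<le> C" using assms(1) by (auto simp: Lspace_def)
  with assms(2) have "AE x in M. norm (g x) \<le> C" by eventually_elim simp
  with True assms(3) show ?thesis by (auto simp: Lspace_def)
next
  case False
  have [measurable]: "f \<in> borel_measurable M" "g \<in> borel_measurable M"
    using assms by (auto simp: Lspace_def)
  have "integrable M (\<lambda>x. norm (f x) powr real_of_ereal p) \<longleftrightarrow> integrable M (\<lambda>x. norm (g x) powr real_of_ereal p)"
  proof (rule integrable_cong_AE)
    show "AE x in M. norm (f x) powr real_of_ereal p = norm (g x) powr real_of_ereal p"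
      using assms(2) by eventually_elim simp
  qed measurable
  with False assms show ?thesis by (simp add: Lspace_def)
qed

lemma Lnorm_one: "Lnorm 1 M f = (LINT x|M. norm (f x))"
  by (simp add: Lnorm_def)

lemma Lspace_one_iff:
  fixes f :: "'a \<Rightarrow> 'b::{real_normed_vector,banach,second_countable_topology}"
  shows "f \<in> Lspace 1 M \<longleftrightarrow> integrable M f"
  by (auto simp: Lspace_def intro: integrable_norm_cancel)

lemma Lspace_infinity_bound:
  assumes "f \<in> Lspace \<infinity> M"
  shows "AE x in M. norm (f x) \<le> Lnorm \<infinity> M f"
proof -
  obtain C where C: "AE x in M. norm (f x) \<le> C" and [measurable]: "f \<in> borel_measurable M"
    using assms by (auto simp: Lspace_def)
  let ?e = "esssup M (\<lambda>x. ereal (norm (f x)))"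
  have "?e \<le> ereal C" using C by (intro esssup_I) auto
  moreover have ae: "AE x in M. ereal (norm (f x)) \<le> ?e" by (rule esssup_AE)
  ultimately show ?thesis by (cases ?e) (auto simp: Lnorm_def)
qed

lemma Lnorm_infinity_le:
  assumes [measurable]: "f \<in> borel_measurable M" and "AE x in M. norm (f x) \<le> C" "0 \<le> C"
  shows "Lnorm \<infinity> M f \<le> C"
proof -
  have "esssup M (\<lambda>x. ereal (norm (f x))) \<le> ereal C" using assms by (intro esssup_I) auto
  then show ?thesis using assms(3)
    by (cases "esssup M (\<lambda>x. ereal (norm (f x)))") (auto simp: Lnorm_def)
qed

lemma Lnorm_nonneg:
  assumes "p \<noteq> \<infinity>" shows "0 \<le> Lnorm p M f"
  using assms by (simp add: Lnorm_def)

lemma Lnorm_powr: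
  assumes "0 < p" shows "Lnorm (ereal p) M f powr p = (LINT x|M. norm (f x) powr p)"
  using assms by (simp add: Lnorm_def powr_powr)

lemma Lspace_ereal_iff: "f \<in> Lspace (ereal p) M \<longleftrightarrow> f \<in> borel_measurable M \<and> integrable M (\<lambda>x. norm (f x) powr p)"
  by (auto simp: Lspace_def)

text \<open>On a finite measure space \<open>\<bar>f\<bar> \<le> 1 + \<bar>f\<bar>\<^sup>p\<close>.\<close>

lemma Lspace_integrable:
  fixes f :: "'a \<Rightarrow> real"
  assumes "f \<in> Lspace p M" "finite_measure M" "1 \<le> p"
  shows "integrable M f"
proof (cases p)
  case (real r)
  interpret finite_measure M by fact
  have f: "f \<in> borel_measurable M" "integrable M (\<lambda>x. norm (f x) powr r)"
    using assms(1) real by (auto simp: Lspace_ereal_iff)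
  have r: "1 \<le> r" using assms(3) real by simp
  show ?thesis
  proof (rule Bochner_Integration.integrable_bound)
    show "integrable M (\<lambda>x. 1 + norm (f x) powr r)" using f(2) by auto
    show "AE x in M. norm (f x) \<le> norm (1 + norm (f x) powr r)"
    proof (rule AE_I2)
      fix x
      have "\<bar>f x\<bar> \<le> 1 + \<bar>f x\<bar> powr r"
      proof (cases "\<bar>f x\<bar> \<le> 1")
        case False
        then have "\<bar>f x\<bar> powr 1 \<le> \<bar>f x\<bar> powr r" using r by (intro powr_mono) auto
        then show ?thesis using False by simp
      qed (simp add: add_increasing2)
      then show "norm (f x) \<le> norm (1 + norm (f x) powr r)" by simp
    qed
  qed (rule f(1))
next
  case PInf
  interpret finite_measure M by fact
  obtain C where C: "AE x in M. norm (f x) \<le> C" and "f \<in> borel_measurable M"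
    using assms(1) PInf by (auto simp: Lspace_def)
  then show ?thesis by (intro integrable_const_bound) auto
qed (use assms in simp)

lemma sobolev_weak_deriv:
  assumes "f \<in> sobolev k p S" "open S" "is \<in> lists Basis" "length is \<le> k"
  shows "weak_deriv S is f (wderiv S is f)" and "wderiv S is f \<in> Lspace p (leb S)"
proof -
  obtain g where g: "g \<in> Lspace p (leb S)" "weak_deriv S is f g"
    using assms(1,3,4) by (auto simp: sobolev_def)
  show w: "weak_deriv S is f (wderiv S is f)" using g(2) by (rule weak_deriv_wderiv)
  have ae: "AE x in leb S. g x = wderiv S is f x" using weak_deriv_unique[OF g(2) w assms(2)] .
  have m: "wderiv S is f \<in> borel_measurable (leb S)"
    using weak_derivD(2)[OF w] by (simp add: loc_integrable_def)
  show "wderiv S is f \<in> Lspace p (leb S)" by (rule Lspace_AE_cong[OF g(1) ae m])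
qed

lemma sobolev_Lspace:
  assumes "f \<in> sobolev k p S" "open S"
  shows "f \<in> Lspace p (leb S)"
proof -
  have w: "weak_deriv S [] f (wderiv S [] f)" "wderiv S [] f \<in> Lspace p (leb S)"
    using sobolev_weak_deriv[OF assms, of "[]"] by auto
  have m: "f \<in> borel_measurable (leb S)" using weak_derivD(1)[OF w(1)] by (simp add: loc_integrable_def)
  show ?thesis by (rule Lspace_AE_cong[OF w(2) weak_deriv_Nil_AE[OF w(1) assms(2)] m])
qed

lemma sobolev_mono: "f \<in> sobolev k p S \<Longrightarrow> j \<le> k \<Longrightarrow> f \<in> sobolev j p S"
  by (auto simp: sobolev_def)

lemma multi_indices_0: "{is \<in> lists Basis. length is = 0} = {[]}"
  by auto

lemma multi_indices_1: "{is \<in> lists (B :: 'a set). length is = Suc 0} = (\<lambda>i. [i]) ` B"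
  by (auto simp: length_Suc_conv)

lemma multi_indices_2: "{is \<in> lists (B :: 'a set). length is = 2} = (\<lambda>(i, j). [i, j]) ` (B \<times> B)"
  by (auto simp: length_Suc_conv numeral_2_eq_2)

lemma finite_multi_indices: "finite {is \<in> lists (Basis :: 'a::euclidean_space set). length is = j}"
proof -
  have "{is \<in> lists (Basis :: 'a set). length is = j} = {is. set is \<subseteq> Basis \<and> length is = j}" by auto
  then show ?thesis by (simp add: finite_lists_length_eq)
qed

text \<open>Sobolev seminorms are the Lebesgue norms of this function, so that pointwise estimates transfer to them.\<close>

definition Dlen :: "nat \<Rightarrow> 'a::euclidean_space set \<Rightarrow> ('a \<Rightarrow> real) \<Rightarrow> 'a \<Rightarrow> real" where
  "Dlen j S f x = L2_set (\<lambda>is. wderiv S is f x) {is \<in> lists Basis. length is = j}"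

lemma sob_seminorm_Dlen: "sob_seminorm j p S f = Lnorm p (leb S) (Dlen j S f)"
  by (simp add: sob_seminorm_def Dlen_def[abs_def] L2_set_def)

lemma Dlen_nonneg: "0 \<le> Dlen j S f x"
  by (simp add: Dlen_def)

lemma Dlen_0: "Dlen 0 S f x = \<bar>wderiv S [] f x\<bar>"
  unfolding Dlen_def multi_indices_0 by (simp add: L2_set_def)

lemma Dlen_measurable:
  assumes "f \<in> sobolev k p S" "open S" "j \<le> k"
  shows "Dlen j S f \<in> borel_measurable (leb S)"
proof -
  have "wderiv S is f \<in> borel_measurable (leb S)" if "is \<in> lists Basis \<and> length is = j" for "is"
    using sobolev_weak_deriv(2)[OF assms(1,2)] that assms(3) by (auto intro: Lspace_measurable)
  then show ?thesis unfolding Dlen_def[abs_def] L2_set_def by measurable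
qed

lemma Dlen_AE_eq:
  assumes "open S" "\<And>is. is \<in> lists Basis \<Longrightarrow> length is = j \<Longrightarrow> weak_deriv S is f (h is)"
  shows "AE x in leb S. Dlen j S f x = L2_set (\<lambda>is. h is x) {is \<in> lists Basis. length is = j}"
proof -
  have "AE x in leb S. \<forall>is\<in>{is \<in> lists Basis. length is = j}. wderiv S is f x = h is x"
    by (rule AE_finite_allI[OF finite_multi_indices]) (use assms in \<open>auto intro: wderiv_AE_eq\<close>)
  then show ?thesis
    by eventually_elim (auto simp: Dlen_def intro!: L2_set_cong)
qed

lemma Dlen_triangle:
  assumes f: "f \<in> sobolev k p S" and g: "g \<in> sobolev k' p' S" and S: "open S" and j: "j \<le> k" "j \<le> k'"
  shows "AE x in leb S. Dlen j S (\<lambda>x. f x + g x) x \<le> Dlen j S f x + Dlen j S g x"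
    and "AE x in leb S. Dlen j S (\<lambda>x. f x - g x) x \<le> Dlen j S f x + Dlen j S g x"
proof -
  let ?B = "{is \<in> lists (Basis::'a set). length is = j}"
  have "AE x in leb S. Dlen j S (\<lambda>x. f x + g x) x = L2_set (\<lambda>is. wderiv S is f x + wderiv S is g x) ?B"
    by (rule Dlen_AE_eq[OF S], rule weak_deriv_add[OF _ _ S])
      (use sobolev_weak_deriv(1)[OF f S] sobolev_weak_deriv(1)[OF g S] j in auto)
  then show "AE x in leb S. Dlen j S (\<lambda>x. f x + g x) x \<le> Dlen j S f x + Dlen j S g x"
    by eventually_elim (simp add: Dlen_def L2_set_triangle_ineq)
  have "AE x in leb S. Dlen j S (\<lambda>x. f x - g x) x = L2_set (\<lambda>is. wderiv S is f x - wderiv S is g x) ?B"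
    by (rule Dlen_AE_eq[OF S], rule weak_deriv_diff[OF _ _ S])
      (use sobolev_weak_deriv(1)[OF f S] sobolev_weak_deriv(1)[OF g S] j in auto)
  then show "AE x in leb S. Dlen j S (\<lambda>x. f x - g x) x \<le> Dlen j S f x + Dlen j S g x"
  proof eventually_elim
    case (elim x)
    have "L2_set (\<lambda>is. wderiv S is f x + - wderiv S is g x) ?B
        \<le> L2_set (\<lambda>is. wderiv S is f x) ?B + L2_set (\<lambda>is. - wderiv S is g x) ?B"
      by (rule L2_set_triangle_ineq)
    with elim show ?case by (simp add: Dlen_def L2_set_def)
  qed
qed

section \<open>Convergence in \<open>W\<^sup>1\<^sub>1\<close> and traces\<close>

lemma sobolev_1I:
  assumes S: "open S" and f: "f \<in> Lspace p (leb S)" "loc_integrable S f"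
    and h: "\<And>i. i \<in> Basis \<Longrightarrow> weak_deriv S [i] f (h i)"
      "\<And>i. i \<in> Basis \<Longrightarrow> h i \<in> Lspace p (leb S)"
  shows "f \<in> sobolev 1 p S"
  unfolding sobolev_def
proof (intro CollectI ballI impI)
  fix js :: "'a list" assume js: "js \<in> lists Basis" "length js \<le> 1"
  then consider "js = []" | i where "js = [i]" "i \<in> Basis"
    by (cases js) auto
  then show "\<exists>g\<in>Lspace p (leb S). weak_deriv S js f g"
    by cases (use f h weak_deriv_Nil in blast)+
qed

lemma sobolev_2I:
  assumes S: "open S" and f: "f \<in> Lspace p (leb S)" "loc_integrable S f"
    and h: "\<And>i. i \<in> Basis \<Longrightarrow> weak_deriv S [i] f (h i)"
      "\<And>i. i \<in> Basis \<Longrightarrow> h i \<in> Lspace p (leb S)"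
    and k: "\<And>i j. i \<in> Basis \<Longrightarrow> j \<in> Basis \<Longrightarrow> weak_deriv S [j] (h i) (k i j)"
      "\<And>i j. i \<in> Basis \<Longrightarrow> j \<in> Basis \<Longrightarrow> k i j \<in> Lspace p (leb S)"
  shows "f \<in> sobolev 2 p S"
  unfolding sobolev_def
proof (intro CollectI ballI impI)
  fix js :: "'a list" assume js: "js \<in> lists Basis" "length js \<le> 2"
  then consider "js = []" | i where "js = [i]" "i \<in> Basis" | i j where "js = [i, j]" "i \<in> Basis" "j \<in> Basis"
    by (cases js; cases "tl js") auto
  then show "\<exists>g\<in>Lspace p (leb S). weak_deriv S js f g"
  proof cases
    case 1
    then show ?thesis using f weak_deriv_Nil by blast
  next
    case 2
    then show ?thesis using h by blast
  next
    case 3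
    then show ?thesis using weak_deriv_Cons[OF h(1) k(1)] k(2) by blast
  qed
qed

lemma sobolev_11I:
  assumes S: "open S" and f: "integrable (leb S) f"
    and h: "\<And>i. i \<in> Basis \<Longrightarrow> weak_deriv S [i] f (h i)"
      "\<And>i. i \<in> Basis \<Longrightarrow> integrable (leb S) (h i)"
  shows "f \<in> sobolev 1 1 S"
proof (rule sobolev_1I[OF S _ _ h(1)])
  show "loc_integrable S f" using f S by (intro integrable_imp_loc_integrable) auto
qed (use f h in \<open>auto simp: Lspace_one_iff\<close>)

lemma sobolev_11D:
  assumes "f \<in> sobolev 1 1 S" "open S"
  shows "integrable (leb S) f"
    and "i \<in> Basis \<Longrightarrow> weak_deriv S [i] f (wderiv S [i] f)"
    and "i \<in> Basis \<Longrightarrow> integrable (leb S) (wderiv S [i] f)"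
proof -
  show "integrable (leb S) f" using sobolev_Lspace[OF assms] by (simp add: Lspace_one_iff)
  show "weak_deriv S [i] f (wderiv S [i] f)" "integrable (leb S) (wderiv S [i] f)" if "i \<in> Basis"
    using sobolev_weak_deriv[OF assms, of "[i]"] that by (auto simp: Lspace_one_iff)
qed

text \<open>The norm in the definition of traces is that of weak derivatives chosen by \<open>wderiv\<close>; it may be computed from
  any representatives.\<close>

lemma sob_norm_11:
  assumes S: "open S" and f: "integrable (leb S) f"
    and h: "\<And>i. i \<in> Basis \<Longrightarrow> weak_deriv S [i] f (h i)"
      "\<And>i. i \<in> Basis \<Longrightarrow> integrable (leb S) (h i)"
  shows "sob_norm 1 1 S f = (LINT x|leb S. \<bar>f x\<bar>) + (LINT x|leb S. L2_set (\<lambda>i. h i x) Basis)"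
    and "integrable (leb S) (\<lambda>x. L2_set (\<lambda>i. h i x) Basis)"
proof -
  let ?M = "leb S"
  have s: "f \<in> sobolev 1 1 S" by (rule sobolev_11I[OF S f h])
  have fl: "loc_integrable S f" using f S by (intro integrable_imp_loc_integrable) auto
  have [measurable]: "f \<in> borel_measurable ?M" using f by auto
  have hm: "h i \<in> borel_measurable ?M" if "i \<in> Basis" for i using h(2)[OF that] by auto
  have Lm: "(\<lambda>x. L2_set (\<lambda>i. h i x) Basis) \<in> borel_measurable ?M"
    unfolding L2_set_def using hm by measurable
  have "sob_seminorm 0 1 S f = (LINT x|?M. \<bar>Dlen 0 S f x\<bar>)"
    by (simp add: sob_seminorm_Dlen Lnorm_one)
  also have "\<dots> = (LINT x|?M. \<bar>f x\<bar>)"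
  proof (rule integral_cong_AE)
    show "(\<lambda>x. \<bar>Dlen 0 S f x\<bar>) \<in> borel_measurable ?M"
      using Dlen_measurable[OF s S, of 0] by measurable
    show "AE x in ?M. \<bar>Dlen 0 S f x\<bar> = \<bar>f x\<bar>"
      using wderiv_AE_eq[OF weak_deriv_Nil[OF fl] S] by eventually_elim (simp add: Dlen_0)
  qed measurable
  finally have 0: "sob_seminorm 0 1 S f = (LINT x|?M. \<bar>f x\<bar>)" .
  have "sob_seminorm 1 1 S f = (LINT x|?M. \<bar>Dlen 1 S f x\<bar>)"
    by (simp add: sob_seminorm_Dlen Lnorm_one)
  also have "\<dots> = (LINT x|?M. L2_set (\<lambda>i. h i x) Basis)"
  proof (rule integral_cong_AE)
    show "(\<lambda>x. \<bar>Dlen 1 S f x\<bar>) \<in> borel_measurable ?M"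
      using Dlen_measurable[OF s S, of 1] by measurable
    have "AE x in ?M. Dlen 1 S f x = L2_set (\<lambda>js. h (hd js) x) {js \<in> lists Basis. length js = 1}"
    proof (rule Dlen_AE_eq[OF S])
      fix js :: "'a list" assume "js \<in> lists Basis" "length js = 1"
      then obtain i where "js = [i]" "i \<in> Basis" by (cases js) auto
      then show "weak_deriv S js f (h (hd js))" using h(1) by simp
    qed
    then show "AE x in ?M. \<bar>Dlen 1 S f x\<bar> = L2_set (\<lambda>i. h i x) Basis"
    proof eventually_elim
      case (elim x)
      have "L2_set (\<lambda>js. h (hd js) x) {js \<in> lists (Basis::'a set). length js = 1} = L2_set (\<lambda>i. h i x) Basis"
        unfolding One_nat_def multi_indices_1 L2_set_def by (subst sum.reindex) (auto simp: inj_on_def)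
      with elim show ?case by simp
    qed
  qed (rule Lm)
  finally have 1: "sob_seminorm 1 1 S f = (LINT x|?M. L2_set (\<lambda>i. h i x) Basis)" .
  have "{..Suc 0} = {0, 1}" by auto
  then have "(\<Sum>j\<le>1. sob_seminorm j 1 S f) = sob_seminorm 0 1 S f + sob_seminorm 1 1 S f" by simp
  moreover have "0 \<le> sob_seminorm j 1 S f" for j
    by (simp add: sob_seminorm_Dlen Lnorm_nonneg)
  ultimately show "sob_norm 1 1 S f = (LINT x|?M. \<bar>f x\<bar>) + (LINT x|?M. L2_set (\<lambda>i. h i x) Basis)"
    using 0 1 by (simp add: sob_norm_def)
  show "integrable ?M (\<lambda>x. L2_set (\<lambda>i. h i x) Basis)"
  proof (rule Bochner_Integration.integrable_bound)
    show "integrable ?M (\<lambda>x. \<Sum>i\<in>Basis. \<bar>h i x\<bar>)" using h(2) by auto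
    show "AE x in ?M. norm (L2_set (\<lambda>i. h i x) Basis) \<le> norm (\<Sum>i\<in>Basis. \<bar>h i x\<bar>)"
      using L2_set_le_sum_abs by (auto simp: sum_nonneg)
  qed (rule Lm)
qed

lemma sob_norm_11_bounds:
  assumes S: "open S" and f: "integrable (leb S) f"
    and h: "\<And>i. i \<in> Basis \<Longrightarrow> weak_deriv S [i] f (h i)"
      "\<And>i. i \<in> Basis \<Longrightarrow> integrable (leb S) (h i)"
  shows "(LINT x|leb S. \<bar>f x\<bar>) \<le> sob_norm 1 1 S f"
    and "i \<in> Basis \<Longrightarrow> (LINT x|leb S. \<bar>h i x\<bar>) \<le> sob_norm 1 1 S f"
    and "sob_norm 1 1 S f \<le> (LINT x|leb S. \<bar>f x\<bar>) + (\<Sum>i\<in>Basis. LINT x|leb S. \<bar>h i x\<bar>)"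
proof -
  let ?M = "leb S"
  have eq: "sob_norm 1 1 S f = (LINT x|?M. \<bar>f x\<bar>) + (LINT x|?M. L2_set (\<lambda>i. h i x) Basis)"
    "integrable ?M (\<lambda>x. L2_set (\<lambda>i. h i x) Basis)"
    by (rule sob_norm_11[OF S f h]; assumption)+
  have nn: "0 \<le> (LINT x|?M. L2_set (\<lambda>i. h i x) Basis)" "0 \<le> (LINT x|?M. \<bar>f x\<bar>)"
    by (auto intro!: Bochner_Integration.integral_nonneg)
  show "(LINT x|?M. \<bar>f x\<bar>) \<le> sob_norm 1 1 S f" unfolding eq(1) using nn by linarith
  show "(LINT x|?M. \<bar>h i x\<bar>) \<le> sob_norm 1 1 S f" if i: "i \<in> Basis"
  proof -
    have "(LINT x|?M. \<bar>h i x\<bar>) \<le> (LINT x|?M. L2_set (\<lambda>i. h i x) Basis)"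
    proof (rule integral_mono[OF _ eq(2)])
      show "integrable ?M (\<lambda>x. \<bar>h i x\<bar>)" using h(2)[OF i] by auto
      show "\<bar>h i x\<bar> \<le> L2_set (\<lambda>i. h i x) Basis" for x
      proof -
        have "L2_set (\<lambda>i. h i x) {i} \<le> L2_set (\<lambda>i. h i x) Basis"
          unfolding L2_set_def using i by (intro real_sqrt_le_mono sum_mono2) auto
        then show ?thesis by (simp add: L2_set_def)
      qed
    qed
    then show ?thesis unfolding eq(1) using nn by linarith
  qed
  have "(LINT x|?M. L2_set (\<lambda>i. h i x) Basis) \<le> (LINT x|?M. (\<Sum>i\<in>Basis. \<bar>h i x\<bar>))"
    using h(2) by (intro integral_mono[OF eq(2)]) (auto simp: L2_set_le_sum_abs)
  also have "\<dots> = (\<Sum>i\<in>Basis. LINT x|?M. \<bar>h i x\<bar>)"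
    using h(2) by (intro Bochner_Integration.integral_sum) auto
  finally show "sob_norm 1 1 S f \<le> (LINT x|?M. \<bar>f x\<bar>) + (\<Sum>i\<in>Basis. LINT x|?M. \<bar>h i x\<bar>)"
    unfolding eq(1) by linarith
qed

lemma smooth_minus_W11:
  assumes S: "open S" "bounded S" and \<phi>: "smooth \<phi>" and f: "integrable (leb S) f"
    and h: "\<And>i. i \<in> Basis \<Longrightarrow> weak_deriv S [i] f (h i)"
      "\<And>i. i \<in> Basis \<Longrightarrow> integrable (leb S) (h i)"
  shows "integrable (leb S) (\<lambda>x. \<phi> x - f x)"
    and "i \<in> Basis \<Longrightarrow> weak_deriv S [i] (\<lambda>x. \<phi> x - f x) (\<lambda>x. dpartial i \<phi> x - h i x)"
    and "i \<in> Basis \<Longrightarrow> integrable (leb S) (\<lambda>x. dpartial i \<phi> x - h i x)"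
proof -
  have "integrable (leb S) \<phi>" using smooth_integrable[OF \<phi> S(2)] S(1) by simp
  then show "integrable (leb S) (\<lambda>x. \<phi> x - f x)" using f by simp
  assume i: "i \<in> Basis"
  have "integrable (leb S) (dpartial i \<phi>)"
    using smooth_integrable[OF smooth_dpartial[OF \<phi> i] S(2)] S(1) by simp
  then show "integrable (leb S) (\<lambda>x. dpartial i \<phi> x - h i x)" using h(2)[OF i] by simp
  show "weak_deriv S [i] (\<lambda>x. \<phi> x - f x) (\<lambda>x. dpartial i \<phi> x - h i x)"
    using i by (intro weak_deriv_diff[OF weak_deriv_smooth[OF \<phi> i S(1)] h(1)[OF i] S(1)]) auto
qed

lemma has_trace_approx:
  assumes tr: "has_trace S M \<sigma> f \<tau>" and S: "open S" "bounded S"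
  obtains \<phi> where "\<And>n::nat. smooth (\<phi> n)" "\<And>n. integrable M (\<lambda>t. \<phi> n (\<sigma> t))"
    "L1_tendsto (leb S) \<phi> f"
    "\<And>i. i \<in> Basis \<Longrightarrow> L1_tendsto (leb S) (\<lambda>n. dpartial i (\<phi> n)) (wderiv S [i] f)"
    "(\<lambda>n. LINT t|M. \<bar>\<phi> n (\<sigma> t) - \<tau> t\<bar>) \<longlonglongrightarrow> 0"
proof -
  have f: "f \<in> sobolev 1 1 S" using tr unfolding has_trace_def by blast
  obtain \<phi> where \<phi>: "\<And>n::nat. smooth (\<phi> n)" "\<And>n. (\<lambda>t. \<phi> n (\<sigma> t)) \<in> Lspace 1 M"
    "(\<lambda>n. sob_norm 1 1 S (\<lambda>x. \<phi> n x - f x)) \<longlonglongrightarrow> 0" "(\<lambda>n. Lnorm 1 M (\<lambda>t. \<phi> n (\<sigma> t) - \<tau> t)) \<longlonglongrightarrow> 0"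
    using tr unfolding has_trace_def by blast
  have b: "L1_dist (leb S) (\<phi> n) f \<le> sob_norm 1 1 S (\<lambda>x. \<phi> n x - f x)"
    "i \<in> Basis \<Longrightarrow> L1_dist (leb S) (dpartial i (\<phi> n)) (wderiv S [i] f)
      \<le> sob_norm 1 1 S (\<lambda>x. \<phi> n x - f x)" for n i
    by (rule sob_norm_11_bounds[OF S(1) smooth_minus_W11[OF S \<phi>(1) sobolev_11D[OF f S(1)]]]; assumption)+
  have sq: "u \<longlonglongrightarrow> 0" if "\<And>n. 0 \<le> u n" "\<And>n. u n \<le> sob_norm 1 1 S (\<lambda>x. \<phi> n x - f x)" for u :: "nat \<Rightarrow> real"
    by (rule tendsto_sandwich[OF _ _ tendsto_const \<phi>(3)]) (use that in auto)
  show ?thesis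
  proof (rule that[OF \<phi>(1)])
    show "integrable M (\<lambda>t. \<phi> n (\<sigma> t))" for n using \<phi>(2)[of n] by (simp add: Lspace_one_iff)
    show "L1_tendsto (leb S) \<phi> f" by (rule sq[OF _ b(1)]) simp
    show "L1_tendsto (leb S) (\<lambda>n. dpartial i (\<phi> n)) (wderiv S [i] f)" if "i \<in> Basis" for i
      by (rule sq[OF _ b(2)[OF that]]) simp
    show "(\<lambda>n. LINT t|M. \<bar>\<phi> n (\<sigma> t) - \<tau> t\<bar>) \<longlonglongrightarrow> 0" using \<phi>(4) by (simp add: Lnorm_one)
  qed
qed

lemma has_traceI:
  assumes S: "open S" "bounded S" and f: "integrable (leb S) f"
    and h: "\<And>i. i \<in> Basis \<Longrightarrow> weak_deriv S [i] f (h i)"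
      "\<And>i. i \<in> Basis \<Longrightarrow> integrable (leb S) (h i)"
    and \<tau>: "integrable M \<tau>"
    and \<phi>: "\<And>n::nat. smooth (\<phi> n)" "\<And>n. integrable M (\<lambda>t. \<phi> n (\<sigma> t))"
    "L1_tendsto (leb S) \<phi> f"
    "\<And>i. i \<in> Basis \<Longrightarrow> L1_tendsto (leb S) (\<lambda>n. dpartial i (\<phi> n)) (h i)"
    "(\<lambda>n. LINT t|M. \<bar>\<phi> n (\<sigma> t) - \<tau> t\<bar>) \<longlonglongrightarrow> 0"
  shows "has_trace S M \<sigma> f \<tau>"
  unfolding has_trace_def
proof (intro conjI exI[of _ \<phi>] allI)
  show "f \<in> sobolev 1 1 S" by (rule sobolev_11I[OF S(1) f h])
  note w = smooth_minus_W11[OF S \<phi>(1) f h]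
  have le: "sob_norm 1 1 S (\<lambda>x. \<phi> n x - f x) \<le> L1_dist (leb S) (\<phi> n) f
      + (\<Sum>i\<in>Basis. L1_dist (leb S) (dpartial i (\<phi> n)) (h i))" for n
    by (rule sob_norm_11_bounds(3)[OF S(1) w])
  have lim: "(\<lambda>n. L1_dist (leb S) (\<phi> n) f
      + (\<Sum>i\<in>Basis. L1_dist (leb S) (dpartial i (\<phi> n)) (h i))) \<longlonglongrightarrow> 0 + (\<Sum>i\<in>(Basis::'a set). 0)"
    by (intro tendsto_add tendsto_sum \<phi>)
  have ge: "0 \<le> sob_norm 1 1 S (\<lambda>x. \<phi> n x - f x)" for n
    by (simp add: sob_norm_def)
  show "(\<lambda>n. sob_norm 1 1 S (\<lambda>x. \<phi> n x - f x)) \<longlonglongrightarrow> 0"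
    by (rule tendsto_sandwich[OF _ _ tendsto_const lim[simplified]]) (use le ge in auto)
qed (use \<tau> \<phi> in \<open>auto simp: Lspace_one_iff Lnorm_one\<close>)

section \<open>The unit interval\<close>

lemma open_I [simp]: "open I" and convex_I: "convex I" and bounded_I: "bounded I"
  and I_nonempty: "I \<noteq> {}" and I_borel [simp]: "I \<in> sets borel"
  by (auto simp: I_def)

lemma finite_measure_I: "finite_measure (leb I)"
  by (rule finite_measure_lebesgue_on) (simp add: I_def lmeasurable_interval)

lemma measure_I: "measure (leb I) I = 1"
  by (subst measure_restrict_space) (auto simp: I_def)

lemma integrable_I_const [simp]: "integrable (leb I) (\<lambda>t. c::real)"
  by (rule finite_measure.integrable_const[OF finite_measure_I])

lemma integrable_I_bounded:
  fixes f :: "real \<Rightarrow> real"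
  shows "f \<in> borel_measurable (leb I) \<Longrightarrow> AE t in leb I. \<bar>f t\<bar> \<le> C \<Longrightarrow> integrable (leb I) f"
  by (intro finite_measure.integrable_const_bound[OF finite_measure_I]) auto

lemma AE_I_not_point: "AE s in leb I. s \<noteq> (t::real)"
proof -
  have "AE s in lborel. s \<noteq> t" by (rule AE_lborel_singleton)
  then have "AE s in lebesgue. s \<in> I \<longrightarrow> s \<noteq> t"
    by (intro AE_completion) (auto elim: eventually_mono)
  then show ?thesis by (subst AE_restrict_space_iff) auto
qed

text \<open>Integrating over all of \<open>I\<close> makes this the primitive that vanishes at \<open>0\<close>, constant outside the interval.\<close>

definition prim :: "(real \<Rightarrow> real) \<Rightarrow> real \<Rightarrow> real" where
  "prim g t = (LINT s|leb I. indicator {..t} s * g s)"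

lemma indicator_lebesgue_on [measurable]: "indicator {..t::real} \<in> borel_measurable (leb S)"
  by (intro borel_measurable_indicator measurable_restrict_space1) (auto simp: sets_restrict_space)

lemma prim_integrable:
  fixes g :: "real \<Rightarrow> real"
  assumes "integrable (leb I) g"
  shows "integrable (leb I) (\<lambda>s. indicator {..t} s * g s)"
  using integrable_times_bounded[OF assms, of "indicator {..t}" 1] by (simp add: mult.commute indicator_def)

lemma LINT_I_FTC:
  fixes F f :: "real \<Rightarrow> real"
  assumes F: "\<And>x. (F has_real_derivative f x) (at x)" and f: "continuous_on UNIV f" and t: "0 \<le> t" "t \<le> 1"
  shows "prim f t = F t - F 0"
proof -
  have "prim f t = (LINT s|lebesgue. indicator I s *\<^sub>R (indicator {..t} s * f s))"
    unfolding prim_def by (subst integral_restrict_space) auto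
  also have "\<dots> = (LINT s|lebesgue. indicator {0..t} s *\<^sub>R f s)"
  proof (rule integral_cong_AE)
    have fm: "f \<in> borel_measurable lebesgue" by (rule continuous_lebesgue_measurable(1)[OF f])
    show "(\<lambda>s. indicator I s *\<^sub>R (indicator {..t} s * f s)) \<in> borel_measurable lebesgue"
      "(\<lambda>s. indicator {0..t} s *\<^sub>R f s) \<in> borel_measurable lebesgue"
      using fm by (auto intro!: borel_measurable_times borel_measurable_scaleR borel_measurable_indicator)
    have "AE s in lborel. s \<noteq> 0" "AE s in lborel. s \<noteq> (1::real)" by (rule AE_lborel_singleton)+
    then have "AE s in lborel. indicator I s *\<^sub>R (indicator {..t} s * f s) = indicator {0..t} s *\<^sub>R f s"
      by eventually_elim (use t in \<open>auto simp: I_def indicator_def\<close>)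
    then show "AE s in lebesgue. indicator I s *\<^sub>R (indicator {..t} s * f s) = indicator {0..t} s *\<^sub>R f s"
      by (rule AE_completion)
  qed
  also have "\<dots> = (LINT s|lborel. indicator {0..t} s *\<^sub>R f s)"
    by (rule integral_completion)
      (use f borel_measurable_continuous_onI[of f] in measurable)
  also have "\<dots> = F t - F 0"
  proof (rule integral_FTC_Icc[OF t(1)])
    show "(F has_vector_derivative f x) (at x within {0..t})" for x
      using F by (auto simp: has_real_derivative_iff_has_vector_derivative intro: has_vector_derivative_at_within)
  qed (rule continuous_on_subset[OF f], simp)
  finally show ?thesis .
qed

lemma prim_smooth: "smooth \<phi> \<Longrightarrow> 0 \<le> t \<Longrightarrow> t \<le> 1 \<Longrightarrow> prim (dpartial 1 \<phi>) t = \<phi> t - \<phi> 0"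
  by (intro LINT_I_FTC smooth_DERIV smooth_continuous_on smooth_dpartial) auto

lemma prim_one: "prim g 1 = (LINT s|leb I. g s)"
  unfolding prim_def by (intro Bochner_Integration.integral_cong) (auto simp: I_def)

lemma prim_diff_le:
  assumes f: "integrable (leb I) f" and g: "integrable (leb I) g"
  shows "\<bar>prim f t - prim g t\<bar> \<le> L1_dist (leb I) f g"
proof -
  have "prim f t - prim g t = (LINT s|leb I. indicator {..t} s * f s - indicator {..t} s * g s)"
    unfolding prim_def by (rule Bochner_Integration.integral_diff[symmetric]) (intro prim_integrable f g)+
  also have "norm \<dots> \<le> L1_dist (leb I) f g"
  proof (rule order_trans[OF integral_norm_bound integral_mono])
    show "integrable (leb I) (\<lambda>s. norm (indicator {..t} s * f s - indicator {..t} s * g s))"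
      by (intro integrable_norm Bochner_Integration.integrable_diff prim_integrable f g)
    show "norm (indicator {..t} s * f s - indicator {..t} s * g s) \<le> \<bar>f s - g s\<bar>" for s
      by (simp add: indicator_def)
  qed (use f g in auto)
  finally show ?thesis by simp
qed

lemma prim_continuous:
  assumes g: "integrable (leb I) g"
  shows "continuous_on UNIV (prim g)"
proof (rule continuous_on_sequentiallyI)
  fix u :: "nat \<Rightarrow> real" and a assume u: "u \<longlonglongrightarrow> a"
  show "(\<lambda>n. prim g (u n)) \<longlonglongrightarrow> prim g a"
    unfolding prim_def
  proof (rule integral_dominated_convergence)
    show "integrable (leb I) (\<lambda>s. \<bar>g s\<bar>)" using g by simp
    show "AE s in leb I. (\<lambda>n. indicator {..u n} s * g s) \<longlonglongrightarrow> indicator {..a} s * g s"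
      using AE_I_not_point[of a]
    proof eventually_elim
      case (elim s)
      have "eventually (\<lambda>n. indicator {..u n} s * g s = indicator {..a} s * g s) sequentially"
      proof (cases "s < a")
        case True
        show ?thesis
          by (rule eventually_mono[OF order_tendstoD(1)[OF u True]]) (use True in \<open>auto simp: indicator_def\<close>)
      next
        case False
        then have "a < s" using elim by simp
        show ?thesis
          by (rule eventually_mono[OF order_tendstoD(2)[OF u \<open>a < s\<close>]]) (use \<open>a < s\<close> in \<open>auto simp: indicator_def\<close>)
      qed
      then show ?case by (rule tendsto_eventually)
    qed
    show "AE s in leb I. norm (indicator {..u n} s * g s) \<le> \<bar>g s\<bar>" for n
      by (auto simp: indicator_def)
  qed (use prim_integrable[OF g] in auto)
qed

lemma prim_measurable: "integrable (leb I) g \<Longrightarrow> prim g \<in> borel_measurable (leb X)"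
  by (rule continuous_lebesgue_measurable(2)[OF prim_continuous])

lemma prim_bounded: "integrable (leb I) g \<Longrightarrow> \<bar>prim g t\<bar> \<le> (LINT s|leb I. \<bar>g s\<bar>)"
  using prim_diff_le[of g "\<lambda>_. 0" t] by (simp add: prim_def)

lemma integrable_prim: "integrable (leb I) g \<Longrightarrow> integrable (leb I) (prim g)"
  by (rule integrable_I_bounded[OF prim_measurable]) (use prim_bounded in auto)

text \<open>Elements of \<open>W\<^sup>1\<^sub>1(0,1)\<close> are primitives; the additive constant is the limit at \<open>0\<close> of any smooth
  approximation.\<close>

lemma W11_I_primitive:
  assumes f: "integrable (leb I) f" and g: "integrable (leb I) g"
    and \<phi>: "\<And>n::nat. smooth (\<phi> n)" "L1_tendsto (leb I) \<phi> f"
    "L1_tendsto (leb I) (\<lambda>n. dpartial 1 (\<phi> n)) g"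
  obtains c where "AE t in leb I. f t = c + prim g t" "(\<lambda>n. \<phi> n 0) \<longlonglongrightarrow> c"
    "(\<lambda>n. \<phi> n 1) \<longlonglongrightarrow> c + (LINT t|leb I. g t)"
proof -
  let ?M = "leb I"
  define c where "c = (LINT t|?M. f t - prim g t)"
  define e where "e n = L1_dist ?M (\<phi> n) f + L1_dist ?M (dpartial 1 (\<phi> n)) g" for n
  have e: "e \<longlonglongrightarrow> 0" unfolding e_def[abs_def] using tendsto_add[OF \<phi>(2,3)] by simp
  have int: "integrable ?M (\<lambda>t. f t - prim g t)" using f integrable_prim[OF g] by simp
  have \<phi>i: "integrable ?M (\<phi> n)" "integrable ?M (dpartial 1 (\<phi> n))" for n
    by (intro smooth_integrable \<phi>(1) smooth_dpartial bounded_I I_borel; simp)+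
  have close: "(LINT t|?M. \<bar>f t - prim g t - \<phi> n 0\<bar>) \<le> e n" for n
  proof -
    have "(LINT t|?M. \<bar>f t - prim g t - \<phi> n 0\<bar>)
        \<le> (LINT t|?M. \<bar>\<phi> n t - f t\<bar> + L1_dist ?M (dpartial 1 (\<phi> n)) g)"
    proof (rule integral_mono_AE)
      show "AE t in ?M. \<bar>f t - prim g t - \<phi> n 0\<bar> \<le> \<bar>\<phi> n t - f t\<bar> + L1_dist ?M (dpartial 1 (\<phi> n)) g"
      proof (rule AE_I2)
        fix t assume "t \<in> space ?M"
        then have "prim (dpartial 1 (\<phi> n)) t = \<phi> n t - \<phi> n 0"
          by (intro prim_smooth \<phi>(1)) (auto simp: I_def)
        then show "\<bar>f t - prim g t - \<phi> n 0\<bar> \<le> \<bar>\<phi> n t - f t\<bar> + L1_dist ?M (dpartial 1 (\<phi> n)) g"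
          using prim_diff_le[OF \<phi>i(2) g, of n t] by linarith
      qed
    qed (use int \<phi>i f in auto)
    also have "\<dots> = e n"
      using \<phi>i f by (simp add: e_def measure_I)
    finally show ?thesis .
  qed
  have \<phi>0: "(\<lambda>n. \<phi> n 0) \<longlonglongrightarrow> c"
  proof (rule LIM_zero_cancel, rule Lim_null_comparison[OF _ e], intro always_eventually allI)
    fix n
    have "c - \<phi> n 0 = (LINT t|?M. f t - prim g t - \<phi> n 0)"
      unfolding c_def using int by (simp add: measure_I)
    also have "norm \<dots> \<le> (LINT t|?M. \<bar>f t - prim g t - \<phi> n 0\<bar>)"
      using integral_norm_bound[of ?M "\<lambda>t. f t - prim g t - \<phi> n 0"] by simp
    finally show "norm (\<phi> n 0 - c) \<le> e n" using close[of n] by simp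
  qed
  have "(LINT t|?M. \<bar>f t - prim g t - c\<bar>) \<le> 0"
  proof (rule tendsto_lowerbound)
    show "(\<lambda>n. e n + \<bar>\<phi> n 0 - c\<bar>) \<longlonglongrightarrow> 0"
      using tendsto_add[OF e tendsto_rabs[OF LIM_zero[OF \<phi>0]]] by simp
    show "\<forall>\<^sub>F n in sequentially. (LINT t|?M. \<bar>f t - prim g t - c\<bar>) \<le> e n + \<bar>\<phi> n 0 - c\<bar>"
    proof (intro always_eventually allI)
      fix n
      have "(LINT t|?M. \<bar>f t - prim g t - c\<bar>) \<le> (LINT t|?M. \<bar>f t - prim g t - \<phi> n 0\<bar> + \<bar>\<phi> n 0 - c\<bar>)"
        by (rule integral_mono) (use int in auto)
      also have "\<dots> = (LINT t|?M. \<bar>f t - prim g t - \<phi> n 0\<bar>) + \<bar>\<phi> n 0 - c\<bar>"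
        using int by (simp add: measure_I)
      finally show "(LINT t|?M. \<bar>f t - prim g t - c\<bar>) \<le> e n + \<bar>\<phi> n 0 - c\<bar>" using close[of n] by simp
    qed
  qed simp
  moreover have ic: "integrable ?M (\<lambda>t. \<bar>f t - prim g t - c\<bar>)"
    using int by simp
  ultimately have "(LINT t|?M. \<bar>f t - prim g t - c\<bar>) = 0"
    by (intro antisym Bochner_Integration.integral_nonneg) auto
  then have "AE t in ?M. \<bar>f t - prim g t - c\<bar> = 0"
    using integral_nonneg_eq_0_iff_AE[OF ic] by simp
  then have 1: "AE t in ?M. f t = c + prim g t" by eventually_elim simp
  have "(\<lambda>n. \<phi> n 0 + prim (dpartial 1 (\<phi> n)) 1) \<longlonglongrightarrow> c + prim g 1"
  proof (rule tendsto_add[OF \<phi>0])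
    show "(\<lambda>n. prim (dpartial 1 (\<phi> n)) 1) \<longlonglongrightarrow> prim g 1"
      by (rule LIM_zero_cancel, rule Lim_null_comparison[OF _ \<phi>(3)], intro always_eventually allI)
        (simp add: prim_diff_le[OF \<phi>i(2) g])
  qed
  then have "(\<lambda>n. \<phi> n 1) \<longlonglongrightarrow> c + (LINT t|?M. g t)"
    using prim_smooth[OF \<phi>(1), of 1] by (simp add: prim_one[of g])
  with 1 \<phi>0 that show ?thesis by blast
qed

lemma W11_I_approx:
  assumes f: "integrable (leb I) f" and g: "integrable (leb I) g" "weak_deriv I [1] f g"
  obtains \<phi> where "\<And>n::nat. smooth (\<phi> n)" "L1_tendsto (leb I) \<phi> f"
    "L1_tendsto (leb I) (\<lambda>n. dpartial 1 (\<phi> n)) g"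
proof (rule smooth_dense_W11[OF open_I convex_I I_nonempty f, of "\<lambda>_. g"])
  fix \<phi> :: "nat \<Rightarrow> real \<Rightarrow> real"
  assume "\<And>n. smooth (\<phi> n)" "L1_tendsto (leb I) \<phi> f"
    "\<And>i. i \<in> Basis \<Longrightarrow> L1_tendsto (leb I) (\<lambda>n. dpartial i (\<phi> n)) g"
  then show thesis by (intro that) auto
qed (use g in auto)

lemma LINT_endpoints: "(LINT t|count_space {0, 1}. (h (t::real) :: real)) = h 0 + h 1"
  by (subst lebesgue_integral_count_space_finite) auto

lemma integrable_endpoints: "integrable (count_space {0, 1::real}) (h :: real \<Rightarrow> real)"
  by (rule integrable_count_space) simp

text \<open>Zero trace means that the constant in \<open>W11_I_primitive\<close> and the total integral vanish.\<close>

lemma zero_trace_I_iff: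
  assumes f: "integrable (leb I) f" and g: "integrable (leb I) g" "weak_deriv I [1] f g"
  shows "has_trace I (count_space {0, 1}) (\<lambda>t. t) f (\<lambda>t. 0) \<longleftrightarrow>
    (AE t in leb I. f t = prim g t) \<and> (LINT t|leb I. g t) = 0"
proof
  assume tr: "has_trace I (count_space {0, 1}) (\<lambda>t. t) f (\<lambda>t. 0)"
  obtain \<phi> where \<phi>: "\<And>n::nat. smooth (\<phi> n)"
    "L1_tendsto (leb I) \<phi> f"
    "\<And>i. i \<in> Basis \<Longrightarrow> L1_tendsto (leb I) (\<lambda>n. dpartial i (\<phi> n)) (wderiv I [i] f)"
    "(\<lambda>n. LINT t|count_space {0, 1}. \<bar>\<phi> n t - 0\<bar>) \<longlonglongrightarrow> 0"
    by (rule has_trace_approx[OF tr open_I bounded_I]) (rule that)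
  have fs: "f \<in> sobolev 1 1 I" using tr unfolding has_trace_def by blast
  have wi: "integrable (leb I) (wderiv I [1] f)" by (rule sobolev_11D(3)[OF fs open_I]) simp
  have ae: "AE t in leb I. wderiv I [1] f t = g t" by (rule wderiv_AE_eq[OF g(2) open_I])
  obtain c where c: "AE t in leb I. f t = c + prim (wderiv I [1] f) t" "(\<lambda>n. \<phi> n 0) \<longlonglongrightarrow> c"
    "(\<lambda>n. \<phi> n 1) \<longlonglongrightarrow> c + (LINT t|leb I. wderiv I [1] f t)"
    by (rule W11_I_primitive[OF f wi \<phi>(1,2) \<phi>(3)]) (simp, rule that)
  have lim: "(\<lambda>n. \<bar>\<phi> n 0\<bar> + \<bar>\<phi> n 1\<bar>) \<longlonglongrightarrow> 0" using \<phi>(4) by (simp add: LINT_endpoints)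
  have "(\<lambda>n. \<phi> n 0) \<longlonglongrightarrow> 0" "(\<lambda>n. \<phi> n 1) \<longlonglongrightarrow> 0"
    by (rule Lim_null_comparison[OF _ lim], simp)+
  then have c0: "c = 0" "c + (LINT t|leb I. wderiv I [1] f t) = 0"
    using c(2,3) LIMSEQ_unique by blast+
  have "prim (wderiv I [1] f) t = prim g t" for t
    unfolding prim_def
    by (rule integral_cong_AE)
      (use ae prim_integrable[OF wi] prim_integrable[OF g(1)] in \<open>auto elim: eventually_mono\<close>)
  moreover have "(LINT t|leb I. wderiv I [1] f t) = (LINT t|leb I. g t)"
    by (rule integral_cong_AE) (use ae wi g in auto)
  ultimately show "(AE t in leb I. f t = prim g t) \<and> (LINT t|leb I. g t) = 0"
    using c(1) c0 by simp
next
  assume R: "(AE t in leb I. f t = prim g t) \<and> (LINT t|leb I. g t) = 0"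
  obtain \<phi> where \<phi>: "\<And>n::nat. smooth (\<phi> n)" "L1_tendsto (leb I) \<phi> f"
    "L1_tendsto (leb I) (\<lambda>n. dpartial 1 (\<phi> n)) g"
    by (rule W11_I_approx[OF f g]) (rule that)
  obtain c where c: "AE t in leb I. f t = c + prim g t" "(\<lambda>n. \<phi> n 0) \<longlonglongrightarrow> c"
    "(\<lambda>n. \<phi> n 1) \<longlonglongrightarrow> c + (LINT t|leb I. g t)"
    by (rule W11_I_primitive[OF f g(1) \<phi>]) (rule that)
  have "AE t in leb I. c = 0" using c(1) conjunct1[OF R] by eventually_elim simp
  moreover have "emeasure (leb I) I \<noteq> 0"
    using measure_I by (metis enn2real_0 measure_def zero_neq_one)
  ultimately have "c = 0" using ae_filter_eq_bot_iff[of "leb I"] by (auto simp: eventually_const_iff)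
  then have "(\<lambda>n. \<bar>\<phi> n 0\<bar> + \<bar>\<phi> n 1\<bar>) \<longlonglongrightarrow> \<bar>0\<bar> + \<bar>0\<bar>"
    using c(2,3) R by (intro tendsto_add tendsto_rabs) auto
  then have "(\<lambda>n. LINT t|count_space {0, 1}. \<bar>\<phi> n t - 0\<bar>) \<longlonglongrightarrow> 0" by (simp add: LINT_endpoints)
  then show "has_trace I (count_space {0, 1}) (\<lambda>t. t) f (\<lambda>t. 0)"
    using \<phi> g by (intro has_traceI[where h = "\<lambda>_. g" and \<phi> = \<phi>] open_I bounded_I f integrable_endpoints) auto
qed

text \<open>Exchange the order of integration; the test function vanishes at both ends.\<close>

lemma weak_deriv_prim:
  assumes k: "integrable (leb I) k"
  shows "weak_deriv I [1] (prim k) k"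
  unfolding weak_deriv_def
proof (intro conjI allI impI)
  show "loc_integrable I (prim k)" "loc_integrable I k"
    using k integrable_prim[OF k] by (auto intro: integrable_imp_loc_integrable)
  fix \<phi> :: "real \<Rightarrow> real" assume \<phi>: "test_function I \<phi>"
  let ?M = "leb I"
  have d\<phi>: "test_function I (dpartial 1 \<phi>)" by (rule test_function_dpartial[OF \<phi>]) simp
  obtain D where D: "0 < D" "\<And>x. \<bar>dpartial 1 \<phi> x\<bar> \<le> D" using test_function_bounded[OF d\<phi>] by blast
  interpret pair_sigma_finite ?M ?M
    by (intro pair_sigma_finite.intro finite_measure.axioms(1)[OF finite_measure_I])
  let ?F = "\<lambda>(s, t). indicator {s..} t * k s * dpartial 1 \<phi> t"
  have [measurable]: "k \<in> borel_measurable ?M" using k by auto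
  have [measurable]: "dpartial 1 \<phi> \<in> borel_measurable ?M" by (rule test_function_measurable[OF d\<phi>])
  have id[measurable]: "(\<lambda>x. x) \<in> ?M \<rightarrow>\<^sub>M borel"
    by (rule continuous_lebesgue_measurable(2)) simp
  have Fm: "?F \<in> borel_measurable (?M \<Otimes>\<^sub>M ?M)"
  proof -
    have "(\<lambda>z. (if fst z \<le> snd z then 1 else 0) * k (fst z) * dpartial 1 \<phi> (snd z)) \<in> borel_measurable (?M \<Otimes>\<^sub>M ?M)"
      by measurable
    also have "(\<lambda>z. (if fst z \<le> snd z then 1 else 0) * k (fst z) * dpartial 1 \<phi> (snd z)) = ?F"
      by (auto simp: fun_eq_iff indicator_def)
    finally show ?thesis .
  qed
  have inner: "integrable ?M (\<lambda>t. ?F (s, t))" for s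
  proof -
    have "integrable ?M (\<lambda>t. (indicator {s..} t * k s) * dpartial 1 \<phi> t)"
      using D
      by (intro integrable_I_bounded[where C = "\<bar>k s\<bar> * D"])
        (auto simp: abs_mult indicator_def intro!: mult_mono measurable_If)
    then show ?thesis by simp
  qed
  have int: "integrable (?M \<Otimes>\<^sub>M ?M) ?F"
  proof (rule Fubini_integrable[OF Fm])
    show "integrable ?M (\<lambda>s. LINT t|?M. norm (?F (s, t)))"
    proof (rule Bochner_Integration.integrable_bound)
      show "integrable ?M (\<lambda>s. D * k s)" using k by simp
      show "(\<lambda>s. LINT t|?M. norm (?F (s, t))) \<in> borel_measurable ?M"
        using Fm by (intro sigma_finite_measure.borel_measurable_lebesgue_integral
            finite_measure.axioms(1)[OF finite_measure_I]) simp
      show "AE s in ?M. norm (LINT t|?M. norm (?F (s, t))) \<le> norm (D * k s)"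
      proof (rule AE_I2)
        fix s
        have "(LINT t|?M. norm (?F (s, t))) \<le> (LINT t|?M. D * \<bar>k s\<bar>)"
        proof (rule integral_mono)
          show "integrable ?M (\<lambda>t. norm (?F (s, t)))" by (rule integrable_norm[OF inner])
          show "norm (?F (s, t)) \<le> D * \<bar>k s\<bar>" for t
            using mult_mono[OF order_refl D(2)[of t], of "\<bar>k s\<bar>"] D(1)
            by (auto simp: indicator_def abs_mult mult.commute)
        qed (rule finite_measure.integrable_const[OF finite_measure_I])
        then show "norm (LINT t|?M. norm (?F (s, t))) \<le> norm (D * k s)"
          using D(1) by (simp add: measure_I abs_mult)
      qed
    qed
  qed (use inner in auto)
  obtain K where K: "compact K" "K \<subseteq> I" "\<forall>x. x \<notin> K \<longrightarrow> \<phi> x = 0"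
    using \<phi> unfolding test_function_def by blast
  have \<phi>1: "\<phi> 0 = 0" "\<phi> 1 = 0" using K by (auto simp: I_def)
  have tail: "(LINT t|?M. indicator {s..} t * k s * dpartial 1 \<phi> t) = - (k s * \<phi> s)" if "s \<in> I" for s
  proof -
    have "(LINT t|?M. indicator {s..} t * k s * dpartial 1 \<phi> t)
        = (LINT t|?M. k s * (dpartial 1 \<phi> t - indicator {..s} t * dpartial 1 \<phi> t))"
    proof (rule integral_cong_AE)
      show "AE t in ?M. indicator {s..} t * k s * dpartial 1 \<phi> t
          = k s * (dpartial 1 \<phi> t - indicator {..s} t * dpartial 1 \<phi> t)"
        using AE_I_not_point[of s] by eventually_elim (auto simp: indicator_def)
    qed (use inner[of s] in \<open>auto dest: borel_measurable_integrable\<close>)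
    also have "\<dots> = k s * ((LINT t|?M. dpartial 1 \<phi> t) - prim (dpartial 1 \<phi>) s)"
    proof -
      have i: "integrable ?M (dpartial 1 \<phi>)" using D by (intro integrable_I_bounded[where C = D]) auto
      show ?thesis unfolding prim_def using i prim_integrable[OF i, of s] by simp
    qed
    also have "\<dots> = - (k s * \<phi> s)"
      using that \<phi>1 prim_smooth[OF test_function_smooth[OF \<phi>], of s]
        prim_smooth[OF test_function_smooth[OF \<phi>], of 1] by (simp add: prim_one I_def)
    finally show ?thesis .
  qed
  have "(LINT t|?M. prim k t * dpartial 1 \<phi> t) = (LINT t|?M. LINT s|?M. indicator {s..} t * k s * dpartial 1 \<phi> t)"
  proof (rule Bochner_Integration.integral_cong[OF refl])
    fix t
    have "prim k t * dpartial 1 \<phi> t = (LINT s|?M. (indicator {..t} s * k s) * dpartial 1 \<phi> t)"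
      unfolding prim_def by (rule integral_mult_left_zero[symmetric])
    also have "(\<lambda>s. (indicator {..t} s * k s) * dpartial 1 \<phi> t) = (\<lambda>s. indicator {s..} t * k s * dpartial 1 \<phi> t)"
      by (auto simp: fun_eq_iff indicator_def)
    finally show "prim k t * dpartial 1 \<phi> t = (LINT s|?M. indicator {s..} t * k s * dpartial 1 \<phi> t)" .
  qed
  also have "\<dots> = (LINT s|?M. LINT t|?M. indicator {s..} t * k s * dpartial 1 \<phi> t)"
    by (rule Fubini_integral) (use int in simp)
  also have "\<dots> = (LINT s|?M. - (k s * \<phi> s))"
    by (rule Bochner_Integration.integral_cong[OF refl]) (simp add: tail)
  finally show "(LINT t|?M. prim k t * iter_partial [1] \<phi> t) = (- 1) ^ length [1::real] * (LINT t|?M. k t * \<phi> t)"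
    by simp
qed

text \<open>Subtract the approximating sequences.\<close>

lemma has_trace_diff:
  assumes f: "has_trace S M \<sigma> f \<tau>" and g: "has_trace S M \<sigma> g \<tau>'" and S: "open S" "bounded S"
  shows "has_trace S M \<sigma> (\<lambda>x. f x - g x) (\<lambda>t. \<tau> t - \<tau>' t)"
proof -
  let ?L = "leb S"
  have fs: "f \<in> sobolev 1 1 S" "integrable M \<tau>" and gs: "g \<in> sobolev 1 1 S" "integrable M \<tau>'"
    using f g unfolding has_trace_def by (auto simp: Lspace_one_iff)
  obtain \<phi> where \<phi>: "\<And>n::nat. smooth (\<phi> n)" "\<And>n. integrable M (\<lambda>t. \<phi> n (\<sigma> t))"
    "L1_tendsto ?L \<phi> f"
    "\<And>i. i \<in> Basis \<Longrightarrow> L1_tendsto ?L (\<lambda>n. dpartial i (\<phi> n)) (wderiv S [i] f)"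
    "(\<lambda>n. LINT t|M. \<bar>\<phi> n (\<sigma> t) - \<tau> t\<bar>) \<longlonglongrightarrow> 0"
    by (rule has_trace_approx[OF f S]) (rule that)
  obtain \<psi> where \<psi>: "\<And>n::nat. smooth (\<psi> n)" "\<And>n. integrable M (\<lambda>t. \<psi> n (\<sigma> t))"
    "L1_tendsto ?L \<psi> g"
    "\<And>i. i \<in> Basis \<Longrightarrow> L1_tendsto ?L (\<lambda>n. dpartial i (\<psi> n)) (wderiv S [i] g)"
    "(\<lambda>n. LINT t|M. \<bar>\<psi> n (\<sigma> t) - \<tau>' t\<bar>) \<longlonglongrightarrow> 0"
    by (rule has_trace_approx[OF g S]) (rule that)
  have sq: "(\<lambda>n. LINT x|N. \<bar>(u n x - u' n x) - (a x - a' x)\<bar>) \<longlonglongrightarrow> 0"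
    if "\<And>n. integrable N (u n)" "\<And>n. integrable N (u' n)" "integrable N a" "integrable N a'"
      "L1_tendsto N u a" "L1_tendsto N (\<lambda>n. u' n) a'"
    for N :: "'z measure" and u u' :: "nat \<Rightarrow> 'z \<Rightarrow> real" and a a'
  proof (rule tendsto_sandwich[OF _ _ tendsto_const])
    show "(\<lambda>n. L1_dist N (u n) a + L1_dist N (u' n) a') \<longlonglongrightarrow> 0"
      using tendsto_add[OF that(5,6)] by simp
    show "\<forall>\<^sub>F n in sequentially. (LINT x|N. \<bar>(u n x - u' n x) - (a x - a' x)\<bar>)
        \<le> L1_dist N (u n) a + L1_dist N (u' n) a'"
    proof (intro always_eventually allI)
      fix n
      have "(LINT x|N. \<bar>(u n x - u' n x) - (a x - a' x)\<bar>) \<le> (LINT x|N. \<bar>u n x - a x\<bar> + \<bar>u' n x - a' x\<bar>)"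
        by (rule integral_mono) (use that in auto)
      also have "\<dots> = L1_dist N (u n) a + L1_dist N (u' n) a'"
        by (rule Bochner_Integration.integral_add) (use that in auto)
      finally show "(LINT x|N. \<bar>(u n x - u' n x) - (a x - a' x)\<bar>)
        \<le> L1_dist N (u n) a + L1_dist N (u' n) a'" .
    qed
  qed auto
  have Sb: "S \<in> sets borel" using S by simp
  have dd: "dpartial i (\<lambda>x. \<phi> n x - \<psi> n x) x = dpartial i (\<phi> n) x - dpartial i (\<psi> n) x" for i n x by (simp add: dpartial_diff \<phi>(1) \<psi>(1))
  show ?thesis
  proof (rule has_traceI[OF S, where h = "\<lambda>i x. wderiv S [i] f x - wderiv S [i] g x" and \<phi> = "\<lambda>n x. \<phi> n x - \<psi> n x"])
    show "integrable ?L (\<lambda>x. f x - g x)" using sobolev_11D(1)[OF fs(1) S(1)] sobolev_11D(1)[OF gs(1) S(1)] by simp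
    show "weak_deriv S [i] (\<lambda>x. f x - g x) (\<lambda>x. wderiv S [i] f x - wderiv S [i] g x)" if "i \<in> Basis" for i
      using sobolev_11D(2)[OF fs(1) S(1) that] sobolev_11D(2)[OF gs(1) S(1) that] that S(1)
      by (intro weak_deriv_diff) auto
    show "integrable ?L (\<lambda>x. wderiv S [i] f x - wderiv S [i] g x)" if "i \<in> Basis" for i
      using sobolev_11D(3)[OF fs(1) S(1) that] sobolev_11D(3)[OF gs(1) S(1) that] by simp
    show "smooth (\<lambda>x. \<phi> n x - \<psi> n x)" for n by (intro smooth_diff \<phi> \<psi>)
    show "integrable M (\<lambda>t. \<tau> t - \<tau>' t)" using fs gs by simp
    show "integrable M (\<lambda>t. \<phi> n (\<sigma> t) - \<psi> n (\<sigma> t))" for n using \<phi>(2) \<psi>(2) by simp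
    show "(\<lambda>n. LINT x|?L. \<bar>(\<phi> n x - \<psi> n x) - (f x - g x)\<bar>) \<longlonglongrightarrow> 0"
      by (rule sq) (intro smooth_integrable \<phi> \<psi> S Sb sobolev_11D(1) fs gs)+
    show "(\<lambda>n. LINT x|?L. \<bar>dpartial i (\<lambda>x. \<phi> n x - \<psi> n x) x - (wderiv S [i] f x - wderiv S [i] g x)\<bar>) \<longlonglongrightarrow> 0"
      if i: "i \<in> Basis" for i
      unfolding dd by (rule sq) (intro smooth_integrable smooth_dpartial \<phi> \<psi> S Sb sobolev_11D(3) fs gs i)+
    show "(\<lambda>n. LINT t|M. \<bar>(\<phi> n (\<sigma> t) - \<psi> n (\<sigma> t)) - (\<tau> t - \<tau>' t)\<bar>) \<longlonglongrightarrow> 0"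
      by (rule sq) (intro \<phi> \<psi> fs gs)+
  qed
qed

lemma Lspace_diff:
  fixes f g :: "'a \<Rightarrow> real"
  assumes f: "f \<in> Lspace p M" and g: "g \<in> Lspace p M" and p: "1 \<le> p"
  shows "(\<lambda>x. f x - g x) \<in> Lspace p M" and "(\<lambda>x. f x + g x) \<in> Lspace p M"
proof -
  have m[measurable]: "f \<in> borel_measurable M" "g \<in> borel_measurable M" using f g by (auto intro: Lspace_measurable)
  have "(\<lambda>x. f x - g x) \<in> Lspace p M \<and> (\<lambda>x. f x + g x) \<in> Lspace p M"
  proof (cases p)
    case PInf
    obtain C where "AE x in M. norm (f x) \<le> C" using f PInf by (auto simp: Lspace_def)
    moreover obtain D where "AE x in M. norm (g x) \<le> D" using g PInf by (auto simp: Lspace_def)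
    ultimately have "AE x in M. norm (f x - g x) \<le> C + D \<and> norm (f x + g x) \<le> C + D" by eventually_elim auto
    then show ?thesis using m PInf by (auto simp: Lspace_def)
  next
    case (real r)
    then have r: "1 \<le> r" using p by simp
    have i: "integrable M (\<lambda>x. norm (f x) powr r)" "integrable M (\<lambda>x. norm (g x) powr r)"
      using f g real by (auto simp: Lspace_ereal_iff)
    have b: "\<bar>a + s * b\<bar> powr r \<le> 2 powr r * (\<bar>a\<bar> powr r + \<bar>b\<bar> powr r)" if "\<bar>s\<bar> = 1" for a b s :: real
    proof -
      have "\<bar>a + s * b\<bar> \<le> 2 * max \<bar>a\<bar> \<bar>b\<bar>"
        using abs_triangle_ineq[of a "s * b"] that by (simp add: abs_mult)
      then have "\<bar>a + s * b\<bar> powr r \<le> (2 * max \<bar>a\<bar> \<bar>b\<bar>) powr r" using r by (intro powr_mono2) auto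
      also have "\<dots> = 2 powr r * max \<bar>a\<bar> \<bar>b\<bar> powr r" by (simp add: powr_mult)
      also have "max \<bar>a\<bar> \<bar>b\<bar> powr r \<le> \<bar>a\<bar> powr r + \<bar>b\<bar> powr r" by (auto simp: max_def)
      finally show ?thesis by simp
    qed
    have dom: "integrable M (\<lambda>x. 2 powr r * (norm (f x) powr r + norm (g x) powr r))" using i by simp
    have "integrable M (\<lambda>x. norm (f x + s * g x) powr r)" if "\<bar>s\<bar> = 1" for s
      by (rule Bochner_Integration.integrable_bound[OF dom]) (use b[OF that] in auto)
    from this[of 1] this[of "-1"] show ?thesis using m real by (simp add: Lspace_ereal_iff)
  qed (use p in simp)
  then show "(\<lambda>x. f x - g x) \<in> Lspace p M" "(\<lambda>x. f x + g x) \<in> Lspace p M" by auto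
qed

lemma sobolev_diff:
  assumes f: "f \<in> sobolev k p S" and g: "g \<in> sobolev k p S" and S: "open S" and p: "1 \<le> p"
  shows "(\<lambda>x. f x - g x) \<in> sobolev k p S" and "(\<lambda>x. f x + g x) \<in> sobolev k p S"
proof -
  have w: "weak_deriv S is f (wderiv S is f)" "weak_deriv S is g (wderiv S is g)"
    "wderiv S is f \<in> Lspace p (leb S)" "wderiv S is g \<in> Lspace p (leb S)"
    if "is \<in> lists Basis" "length is \<le> k" for "is"
    using sobolev_weak_deriv[OF f S that] sobolev_weak_deriv[OF g S that] by auto
  show "(\<lambda>x. f x - g x) \<in> sobolev k p S" unfolding sobolev_def
    using weak_deriv_diff[OF w(1,2) S] Lspace_diff(1)[OF w(3,4) p] by blast
  show "(\<lambda>x. f x + g x) \<in> sobolev k p S" unfolding sobolev_def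
    using weak_deriv_add[OF w(1,2) S] Lspace_diff(2)[OF w(3,4) p] by blast
qed

lemma sobolev0_I_diff:
  assumes "f \<in> sobolev0_I p" "g \<in> sobolev0_I p" "1 \<le> p"
  shows "(\<lambda>t. f t - g t) \<in> sobolev0_I p"
  using assms sobolev_diff(1)[of f 1 p I g] has_trace_diff[OF _ _ open_I bounded_I, of _ _ f "\<lambda>t. 0" g "\<lambda>t. 0"]
  by (auto simp: sobolev0_I_def)

subsection \<open>Second derivatives on the unit interval\<close>

text \<open>On the interval, \<open>d2\<close> is the weak derivative of \<open>d1\<close>.\<close>

lemma I_derivs:
  assumes "\<gamma> \<in> sobolev 2 p I"
  shows "weak_deriv I [1] \<gamma> (d1 \<gamma>)" "weak_deriv I [1, 1] \<gamma> (d2 \<gamma>)" "weak_deriv I [1] (d1 \<gamma>) (d2 \<gamma>)"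
    and "d1 \<gamma> \<in> Lspace p (leb I)" "d2 \<gamma> \<in> Lspace p (leb I)"
proof -
  show 1: "weak_deriv I [1] \<gamma> (d1 \<gamma>)" "d1 \<gamma> \<in> Lspace p (leb I)"
    using sobolev_weak_deriv[OF assms open_I, of "[1]"] by (auto simp: d1_def)
  show 2: "weak_deriv I [1, 1] \<gamma> (d2 \<gamma>)" "d2 \<gamma> \<in> Lspace p (leb I)"
    using sobolev_weak_deriv[OF assms open_I, of "[1, 1]"] by (auto simp: d2_def)
  show "weak_deriv I [1] (d1 \<gamma>) (d2 \<gamma>)" by (rule weak_deriv_step[OF 1(1) 2(1)]) simp
qed

lemma prim_of_const: "0 \<le> t \<Longrightarrow> t \<le> 1 \<Longrightarrow> prim (\<lambda>_. c) t = c * t"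
  using LINT_I_FTC[of "\<lambda>t. c * t" "\<lambda>_. c" t] by (auto intro!: derivative_eq_intros)

lemma prim_lipschitz_aux:
  assumes g: "integrable (leb I) g" and D: "AE t in leb I. \<bar>g t\<bar> \<le> D"
    and st: "0 \<le> s" "s \<le> t" "t \<le> 1"
  shows "\<bar>prim g t - prim g s\<bar> \<le> D * (t - s)"
proof -
  let ?M = "leb I"
  have e: "prim h t - prim h s = (LINT r|?M. indicator {..t} r * h r - indicator {..s} r * h r)"
    if "integrable ?M h" for h
    unfolding prim_def by (rule Bochner_Integration.integral_diff[symmetric]) (intro prim_integrable that)+
  have i: "integrable ?M (\<lambda>r. indicator {..t} r * h r - indicator {..s} r * h r)" if "integrable ?M h" for h :: "real \<Rightarrow> real"
    by (intro Bochner_Integration.integrable_diff prim_integrable that)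
  have c: "integrable ?M (\<lambda>_. D)" by simp
  have "\<bar>prim g t - prim g s\<bar> \<le> (LINT r|?M. norm (indicator {..t} r * g r - indicator {..s} r * g r))"
    unfolding e[OF g] real_norm_def[symmetric] by (rule integral_norm_bound)
  also have "\<dots> \<le> (LINT r|?M. indicator {..t} r * D - indicator {..s} r * D)"
  proof (rule integral_mono_AE[OF integrable_norm[OF i[OF g]] i[OF c]])
    show "AE r in ?M. norm (indicator {..t} r * g r - indicator {..s} r * g r) \<le> indicator {..t} r * D - indicator {..s} r * D"
      using D by eventually_elim (use st in \<open>auto simp: indicator_def\<close>)
  qed
  also have "\<dots> = D * (t - s)"
    unfolding e[OF c, symmetric] using st by (simp add: prim_of_const right_diff_distrib)
  finally show ?thesis .
qed

lemma prim_lipschitz: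
  assumes g: "integrable (leb I) g" and D: "AE t in leb I. \<bar>g t\<bar> \<le> D"
    and st: "0 \<le> s" "s \<le> 1" "0 \<le> t" "t \<le> 1"
  shows "\<bar>prim g t - prim g s\<bar> \<le> D * \<bar>t - s\<bar>"
  using prim_lipschitz_aux[OF g D, of s t] prim_lipschitz_aux[OF g D, of t s] st
  by (cases "s \<le> t") (auto simp: abs_minus_commute)

text \<open>Convexity of \<open>\<lambda>s. \<bar>t - s\<bar>\<close> bounds it by its chord, whose mean is \<open>1/2\<close>.\<close>

lemma mean_zero_lipschitz_bound:
  assumes h: "integrable (leb I) h" "(LINT t|leb I. h t) = 0"
    and lip: "\<And>s t. s \<in> I \<Longrightarrow> t \<in> I \<Longrightarrow> \<bar>h t - h s\<bar> \<le> D * \<bar>t - s\<bar>" and D: "0 \<le> D" and t: "t \<in> I"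
  shows "\<bar>h t\<bar> \<le> D / 2"
proof -
  let ?M = "leb I"
  have t': "0 < t" "t < 1" using t by (auto simp: I_def)
  let ?P = "\<lambda>s. (1 - t) * s + t * (1 - s)"
  have iP: "integrable ?M ?P"
    by (rule integrable_lebesgue_on_subset[OF compact_integrable_continuous[of "{0..1}"]])
      (auto intro!: continuous_intros simp: I_def)
  have "h t = (LINT s|?M. h t - h s)"
    using h by (simp add: measure_I)
  also have "\<bar>\<dots>\<bar> \<le> (LINT s|?M. norm (h t - h s))"
    unfolding real_norm_def[symmetric] by (rule integral_norm_bound)
  also have "\<dots> \<le> (LINT s|?M. D * ?P s)"
  proof (rule integral_mono)
    fix s assume "s \<in> space ?M"
    then have s: "s \<in> I" "0 < s" "s < 1" by (auto simp: I_def)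
    have "\<bar>t - s\<bar> \<le> ?P s"
    proof -
      have "0 \<le> (1 - t) * s" "0 \<le> t * (1 - s)" using t' s by auto
      moreover have "?P s - (t - s) = 2 * ((1 - t) * s)" "?P s - (s - t) = 2 * (t * (1 - s))"
        by (auto simp: algebra_simps)
      ultimately show ?thesis by linarith
    qed
    then show "norm (h t - h s) \<le> D * ?P s"
      using lip[OF s(1) t] mult_left_mono[OF _ D] by fastforce
  qed (use h iP in auto)
  also have "\<dots> = D * (LINT s|?M. ?P s)" by simp
  also have "(LINT s|?M. ?P s) = prim ?P 1" by (simp add: prim_one)
  also have "prim ?P 1 = 1 / 2"
  proof -
    have "((\<lambda>s. (1 - 2 * t) * s\<^sup>2 / 2 + t * s) has_real_derivative ?P s) (at s)" for s
      by (rule derivative_eq_intros refl | simp)+ (simp add: algebra_simps)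
    then have "prim ?P 1 = ((1 - 2 * t) * 1\<^sup>2 / 2 + t * 1) - ((1 - 2 * t) * 0\<^sup>2 / 2 + t * 0)"
      by (rule LINT_I_FTC) (auto intro!: continuous_intros)
    then show ?thesis by (simp add: diff_divide_distrib)
  qed
  finally show ?thesis by simp
qed

text \<open>The derivative of \<open>\<gamma>\<close> is \<open>D\<close>-Lipschitz with mean zero, hence at most \<open>D/2\<close>; integrating from the nearer end point
  gives \<open>D/4\<close> for \<open>\<gamma>\<close>.\<close>

lemma zero_trace_second_order_bounds:
  assumes \<gamma>: "\<gamma> \<in> sobolev 2 \<infinity> I" "\<gamma> \<in> sobolev0_I \<infinity>" and D: "AE t in leb I. \<bar>d2 \<gamma> t\<bar> \<le> D" "0 \<le> D"
  shows "AE t in leb I. \<bar>d1 \<gamma> t\<bar> \<le> D / 2" and "AE t in leb I. \<bar>\<gamma> t\<bar> \<le> D / 4"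
proof -
  let ?M = "leb I"
  note w = I_derivs[OF \<gamma>(1)]
  have i: "integrable ?M \<gamma>" "integrable ?M (d1 \<gamma>)" "integrable ?M (d2 \<gamma>)"
    using w(4,5) sobolev_Lspace[OF \<gamma>(1) open_I] by (auto intro: Lspace_integrable finite_measure_I)
  have z: "AE t in ?M. \<gamma> t = prim (d1 \<gamma>) t" "(LINT t|?M. d1 \<gamma> t) = 0"
    using zero_trace_I_iff[OF i(1,2) w(1)] \<gamma>(2) by (auto simp: sobolev0_I_def)
  obtain \<phi> where \<phi>: "\<And>n::nat. smooth (\<phi> n)" "L1_tendsto ?M \<phi> (d1 \<gamma>)"
    "L1_tendsto ?M (\<lambda>n. dpartial 1 (\<phi> n)) (d2 \<gamma>)"
    by (rule W11_I_approx[OF i(2,3) w(3)]) (rule that)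
  obtain c where c: "AE t in ?M. d1 \<gamma> t = c + prim (d2 \<gamma>) t"
    by (rule W11_I_primitive[OF i(2,3) \<phi>]) (rule that)
  define h where "h t = c + prim (d2 \<gamma>) t" for t
  have hi: "integrable ?M h" unfolding h_def[abs_def] using integrable_prim[OF i(3)] by simp
  have "(LINT t|?M. h t) = (LINT t|?M. d1 \<gamma> t)"
  proof (rule integral_cong_AE[OF borel_measurable_integrable[OF hi] borel_measurable_integrable[OF i(2)]])
    show "AE t in ?M. h t = d1 \<gamma> t" using c by eventually_elim (simp add: h_def)
  qed
  then have h0: "(LINT t|?M. h t) = 0" using z(2) by simp
  have hb: "\<bar>h t\<bar> \<le> D / 2" if "t \<in> I" for t
  proof (rule mean_zero_lipschitz_bound[OF hi h0 _ D(2) that])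
    show "\<bar>h t - h s\<bar> \<le> D * \<bar>t - s\<bar>" if "s \<in> I" "t \<in> I" for s t
      using prim_lipschitz[OF i(3) D(1), of s t] that by (auto simp: h_def I_def)
  qed
  have "AE t in ?M. t \<in> I" by (rule AE_I2) simp
  with c show 1: "AE t in ?M. \<bar>d1 \<gamma> t\<bar> \<le> D / 2"
    by eventually_elim (use hb in \<open>auto simp: h_def\<close>)
  have pb: "\<bar>prim (d1 \<gamma>) t\<bar> \<le> D / 4" if "t \<in> I" for t
  proof -
    have t: "0 \<le> t" "t \<le> 1" using that by (auto simp: I_def)
    have "prim (d1 \<gamma>) 0 = 0"
    proof -
      have "prim (d1 \<gamma>) 0 = (LINT s|?M. 0)"
        unfolding prim_def by (intro Bochner_Integration.integral_cong) (auto simp: I_def)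
      then show ?thesis by simp
    qed
    then have "\<bar>prim (d1 \<gamma>) t\<bar> \<le> D / 2 * t"
      using prim_lipschitz[OF i(2) 1, of 0 t] t by simp
    moreover have "\<bar>prim (d1 \<gamma>) t\<bar> \<le> D / 2 * (1 - t)"
      using prim_lipschitz[OF i(2) 1, of 1 t] t z(2) by (simp add: prim_one)
    ultimately have "2 * \<bar>prim (d1 \<gamma>) t\<bar> \<le> D / 2 * t + D / 2 * (1 - t)" by linarith
    also have "\<dots> = D / 2" by (simp add: distrib_left[symmetric])
    finally show ?thesis by simp
  qed
  have "AE t in ?M. t \<in> I" by (rule AE_I2) simp
  with z(1) show "AE t in ?M. \<bar>\<gamma> t\<bar> \<le> D / 4"
    by eventually_elim (use pb in auto)
qed

text \<open>Integrate twice, subtracting the mean of the first primitive so that the second one vanishes at \<open>1\<close>.\<close>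

lemma exists_zero_trace_second_primitive:
  assumes k: "k \<in> borel_measurable (leb I)" "AE t in leb I. \<bar>k t\<bar> \<le> C"
  obtains \<gamma> where "\<gamma> \<in> sobolev 2 \<infinity> I" "\<gamma> \<in> sobolev0_I \<infinity>" "AE t in leb I. d2 \<gamma> t = k t"
proof -
  let ?M = "leb I"
  have ki: "integrable ?M k" by (rule integrable_I_bounded[OF k])
  define m where "m = (LINT t|?M. prim k t)"
  define h where "h t = prim k t - m" for t
  have hi: "integrable ?M h" unfolding h_def[abs_def] using integrable_prim[OF ki] by simp
  have h0: "(LINT t|?M. h t) = 0"
    unfolding h_def using integrable_prim[OF ki] by (simp add: measure_I m_def)
  have "weak_deriv I [1] (\<lambda>_. m) (dpartial 1 (\<lambda>_. m))"
    by (rule weak_deriv_smooth[OF smooth_const]) auto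
  then have wm: "weak_deriv I [1] (\<lambda>_::real. m) (\<lambda>_. 0)" by simp
  have wh: "weak_deriv I [1] h k"
    using weak_deriv_diff[OF weak_deriv_prim[OF ki] wm open_I] by (simp add: h_def[abs_def])
  have w\<gamma>: "weak_deriv I [1] (prim h) h" by (rule weak_deriv_prim[OF hi])
  have bounded: "u \<in> Lspace \<infinity> ?M" if "integrable ?M u" "\<And>t. \<bar>u t\<bar> \<le> B" for u :: "real \<Rightarrow> real" and B
    using that by (auto simp: Lspace_def)
  have L: "prim h \<in> Lspace \<infinity> ?M" "h \<in> Lspace \<infinity> ?M" "k \<in> Lspace \<infinity> ?M"
  proof -
    show "prim h \<in> Lspace \<infinity> ?M" by (rule bounded[OF integrable_prim[OF hi] prim_bounded[OF hi]])
    show "h \<in> Lspace \<infinity> ?M"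
    proof (rule bounded[OF hi])
      show "\<bar>h t\<bar> \<le> (LINT s|?M. \<bar>k s\<bar>) + \<bar>m\<bar>" for t
        using prim_bounded[OF ki, of t] by (simp add: h_def)
    qed
    show "k \<in> Lspace \<infinity> ?M" using k by (auto simp: Lspace_def)
  qed
  have l: "loc_integrable I (prim h)" using weak_derivD(1)[OF w\<gamma>] .
  have s2: "prim h \<in> sobolev 2 \<infinity> I"
    by (rule sobolev_2I[OF open_I L(1) l, where h = "\<lambda>_. h" and k = "\<lambda>_ _. k"]) (use w\<gamma> wh L in auto)
  have "has_trace I (count_space {0, 1}) (\<lambda>t. t) (prim h) (\<lambda>t. 0)"
    using zero_trace_I_iff[OF integrable_prim[OF hi] hi w\<gamma>] h0 by simp
  moreover have "prim h \<in> sobolev 1 \<infinity> I" by (rule sobolev_mono[OF s2]) simp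
  ultimately have s0: "prim h \<in> sobolev0_I \<infinity>" by (simp add: sobolev0_I_def)
  have "weak_deriv I [1, 1] (prim h) k" by (rule weak_deriv_Cons[OF w\<gamma> wh]) simp
  then have "AE t in ?M. d2 (prim h) t = k t" unfolding d2_def by (rule wderiv_AE_eq) simp
  with s2 s0 that show ?thesis by blast
qed

section \<open>Integration over the unit square\<close>

lemma R2_Basis: "(Basis :: (real ^ 2) set) = {axis 1 1, axis 2 1}"
  by (auto simp: Basis_vec_def UNIV_2)

lemma R2_eq_iff: "(x = y) = (x $ 1 = y $ 1 \<and> x $ 2 = y $ 2)" for x y :: "'a ^ 2"
  by (auto simp: vec_eq_iff forall_2)

lemma inner_axis_R2 [simp]: "x \<bullet> axis i 1 = x $ i" "axis i 1 \<bullet> x = x $ i" for x :: "real ^ 2"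
  by (auto simp: inner_axis inner_commute)

lemma open_Omega [simp]: "open Omega" and convex_Omega: "convex Omega" and bounded_Omega: "bounded Omega"
  and Omega_nonempty: "Omega \<noteq> {}"
proof -
  have eq: "Omega = box 0 (\<chi> i. 1)"
    by (auto simp: Omega_def mem_box_cart)
  show "open Omega" "convex Omega" "bounded Omega" unfolding eq by (auto simp: open_box)
  have "(\<chi> i. 1/2) \<in> Omega" by (simp add: Omega_def)
  then show "Omega \<noteq> {}" by blast
qed

lemma Omega_borel [simp]: "Omega \<in> sets borel"
  by simp

lemma mem_Omega_vector: "vector [s, t] \<in> Omega \<longleftrightarrow> s \<in> I \<and> t \<in> I"
  by (auto simp: Omega_def I_def forall_2)

lemma vector_measurable [measurable]:
  assumes [measurable]: "f \<in> borel_measurable M" "g \<in> borel_measurable M"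
  shows "(\<lambda>x. vector [f x, g x] :: real ^ 2) \<in> borel_measurable M"
proof -
  have "(\<lambda>x. vector [f x, g x] :: real ^ 2) = (\<lambda>x. f x *\<^sub>R axis 1 1 + g x *\<^sub>R axis 2 1)"
    by (auto simp: fun_eq_iff R2_eq_iff axis_def)
  then show ?thesis by simp
qed

lemma continuous_vector [continuous_intros]:
  assumes "continuous_on X f" "continuous_on X g"
  shows "continuous_on X (\<lambda>x. vector [f x, g x] :: real ^ 2)"
proof -
  have "(\<lambda>x. vector [f x, g x] :: real ^ 2) = (\<lambda>x. f x *\<^sub>R axis 1 1 + g x *\<^sub>R axis 2 1)"
    by (auto simp: fun_eq_iff R2_eq_iff axis_def)
  then show ?thesis by (simp only:) (intro continuous_intros assms)
qed

lemma component_measurable [measurable]: "(\<lambda>x :: real ^ 2. x $ i) \<in> borel_measurable borel"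
  by (intro borel_measurable_continuous_onI continuous_intros)

text \<open>Both sides agree on boxes. This is what makes Fubini available for functions on \<open>real ^ 2\<close>.\<close>

lemma lborel_R2: "(lborel :: (real ^ 2) measure) = distr (lborel \<Otimes>\<^sub>M lborel) borel (\<lambda>(s, t). vector [s, t])"
proof (rule lborel_eqI)
  fix l u :: "real ^ 2" assume le: "\<And>b. b \<in> Basis \<Longrightarrow> l \<bullet> b \<le> u \<bullet> b"
  have le': "l $ 1 \<le> u $ 1" "l $ 2 \<le> u $ 2" using le[of "axis 1 1"] le[of "axis 2 1"] by (auto simp: R2_Basis)
  have pre: "(\<lambda>(s, t). vector [s, t]) -` box l u = {l $ 1 <..< u $ 1} \<times> {l $ 2 <..< u $ 2}"
    by (auto simp: mem_box_cart forall_2)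
  have m: "(\<lambda>(s::real, t::real). vector [s, t] :: real ^ 2) \<in> lborel \<Otimes>\<^sub>M lborel \<rightarrow>\<^sub>M borel"
    unfolding case_prod_beta by measurable
  have ne: "axis 1 1 \<noteq> (axis 2 1 :: real ^ 2)" by (simp add: axis_eq_axis)
  have "emeasure (distr (lborel \<Otimes>\<^sub>M lborel) borel (\<lambda>(s, t). vector [s, t] :: real ^ 2)) (box l u)
      = emeasure (lborel \<Otimes>\<^sub>M lborel) ({l $ 1 <..< u $ 1} \<times> {l $ 2 <..< u $ 2})"
    using m by (subst emeasure_distr) (auto simp: pre space_pair_measure)
  also have "\<dots> = emeasure lborel {l $ 1 <..< u $ 1} * emeasure lborel {l $ 2 <..< u $ 2}"
    by (rule lborel.emeasure_pair_measure_Times) auto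
  also have "\<dots> = ennreal (\<Prod>b\<in>Basis. (u - l) \<bullet> b)"
    using le' ne by (simp add: R2_Basis ennreal_mult[symmetric])
  finally show "emeasure (distr (lborel \<Otimes>\<^sub>M lborel) borel (\<lambda>(s, t). vector [s, t] :: real ^ 2)) (box l u)
      = ennreal (\<Prod>b\<in>Basis. (u - l) \<bullet> b)" .
qed simp

lemma nn_integral_lebesgue_on_borel:
  fixes f :: "'a::euclidean_space \<Rightarrow> ennreal"
  assumes "S \<in> sets borel"
  shows "(\<integral>\<^sup>+x. f x \<partial>leb S) = (\<integral>\<^sup>+x. f x * indicator S x \<partial>lborel)"
  using assms by (simp add: nn_integral_restrict_space nn_integral_completion)

lemma nn_integral_Omega:
  assumes f[measurable]: "f \<in> borel_measurable borel"
  shows "(\<integral>\<^sup>+x. f x \<partial>leb Omega) = (\<integral>\<^sup>+s. (\<integral>\<^sup>+t. f (vector [s, t]) \<partial>leb I) \<partial>leb I)"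
proof -
  have m: "(\<lambda>(s::real, t::real). vector [s, t] :: real ^ 2) \<in> lborel \<Otimes>\<^sub>M lborel \<rightarrow>\<^sub>M borel"
    unfolding case_prod_beta by measurable
  have "(\<integral>\<^sup>+x. f x \<partial>leb Omega)
      = (\<integral>\<^sup>+x. f x * indicator Omega x \<partial>distr (lborel \<Otimes>\<^sub>M lborel) borel (\<lambda>(s, t). vector [s, t]))"
    unfolding lborel_R2[symmetric] by (rule nn_integral_lebesgue_on_borel) simp
  also have "\<dots> = (\<integral>\<^sup>+z. f (vector [fst z, snd z]) * indicator Omega (vector [fst z, snd z]) \<partial>(lborel \<Otimes>\<^sub>M lborel))"
    using m by (subst nn_integral_distr) (auto simp: case_prod_beta)
  also have "\<dots> = (\<integral>\<^sup>+s. (\<integral>\<^sup>+t. f (vector [s, t]) * indicator Omega (vector [s, t]) \<partial>lborel) \<partial>lborel)"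
  proof (subst lborel.nn_integral_fst[symmetric])
    have "(\<lambda>x. f x * indicator Omega x) \<in> borel_measurable borel" by simp
    from measurable_compose[OF m this]
    show "(\<lambda>z. f (vector [fst z, snd z]) * indicator Omega (vector [fst z, snd z])) \<in> borel_measurable (lborel \<Otimes>\<^sub>M lborel)"
      by (simp add: case_prod_beta)
  qed simp
  also have "\<dots> = (\<integral>\<^sup>+s. (\<integral>\<^sup>+t. f (vector [s, t]) * indicator I t \<partial>lborel) * indicator I s \<partial>lborel)"
  proof (rule nn_integral_cong)
    fix s :: real
    have "(\<integral>\<^sup>+t. f (vector [s, t]) * indicator Omega (vector [s, t]) \<partial>lborel)
        = (\<integral>\<^sup>+t. (f (vector [s, t]) * indicator I t) * indicator I s \<partial>lborel)"
      by (intro nn_integral_cong) (auto simp: indicator_def mem_Omega_vector)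
    also have "\<dots> = (\<integral>\<^sup>+t. f (vector [s, t]) * indicator I t \<partial>lborel) * indicator I s"
      by (rule nn_integral_multc) auto
    finally show "(\<integral>\<^sup>+t. f (vector [s, t]) * indicator Omega (vector [s, t]) \<partial>lborel)
        = (\<integral>\<^sup>+t. f (vector [s, t]) * indicator I t \<partial>lborel) * indicator I s" .
  qed
  also have "\<dots> = (\<integral>\<^sup>+s. (\<integral>\<^sup>+t. f (vector [s, t]) \<partial>leb I) \<partial>leb I)"
    by (simp add: nn_integral_lebesgue_on_borel)
  finally show ?thesis .
qed

lemma borel_lebesgue_on: "f \<in> borel_measurable borel \<Longrightarrow> f \<in> borel_measurable (leb S)"
  by (intro measurable_restrict_space1 measurable_completion) simp

lemma id_lebesgue_on [measurable]: "(\<lambda>x. x) \<in> leb (S :: 'a::euclidean_space set) \<rightarrow>\<^sub>M borel"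
  by (rule continuous_lebesgue_measurable(2)) simp

lemma pair_vector_measurable [measurable]:
  "(\<lambda>(s, t). vector [s, t] :: real ^ 2) \<in> leb I \<Otimes>\<^sub>M leb I \<rightarrow>\<^sub>M borel"
  unfolding case_prod_beta by measurable

lemma distr_Omega:
  "distr (leb I \<Otimes>\<^sub>M leb I) borel (\<lambda>(s, t). vector [s, t]) = distr (leb Omega) borel (\<lambda>x. x)"
proof (rule measure_eqI)
  fix X :: "(real ^ 2) set" assume "X \<in> sets (distr (leb I \<Otimes>\<^sub>M leb I) borel (\<lambda>(s, t). vector [s, t]))"
  then have X[measurable]: "X \<in> sets borel" by simp
  interpret finite_measure "leb I" by (rule finite_measure_I)
  have "emeasure (distr (leb I \<Otimes>\<^sub>M leb I) borel (\<lambda>(s, t). vector [s, t])) X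
      = (\<integral>\<^sup>+z. indicator X z \<partial>distr (leb I \<Otimes>\<^sub>M leb I) borel (\<lambda>(s, t). vector [s, t]))"
    by simp
  also have "\<dots> = (\<integral>\<^sup>+z. indicator X (vector [fst z, snd z]) \<partial>(leb I \<Otimes>\<^sub>M leb I))"
    by (subst nn_integral_distr) (auto simp: case_prod_beta)
  also have "\<dots> = (\<integral>\<^sup>+s. (\<integral>\<^sup>+t. indicator X (vector [s, t]) \<partial>leb I) \<partial>leb I)"
    by (subst nn_integral_fst[symmetric]) auto
  also have "\<dots> = (\<integral>\<^sup>+x. indicator X x \<partial>leb Omega)"
    by (rule nn_integral_Omega[symmetric]) simp
  also have "\<dots> = (\<integral>\<^sup>+x. indicator X x \<partial>distr (leb Omega) borel (\<lambda>x. x))"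
    by (subst nn_integral_distr) auto
  also have "\<dots> = emeasure (distr (leb Omega) borel (\<lambda>x. x)) X" by simp
  finally show "emeasure (distr (leb I \<Otimes>\<^sub>M leb I) borel (\<lambda>(s, t). vector [s, t])) X
      = emeasure (distr (leb Omega) borel (\<lambda>x. x)) X" .
qed simp

lemma LINT_Omega_pair:
  fixes f :: "real ^ 2 \<Rightarrow> real"
  assumes [measurable]: "f \<in> borel_measurable borel"
  shows "integrable (leb Omega) f \<longleftrightarrow> integrable (leb I \<Otimes>\<^sub>M leb I) (\<lambda>(s, t). f (vector [s, t]))"
    and "(LINT x|leb Omega. f x) = (LINT z|(leb I \<Otimes>\<^sub>M leb I). (\<lambda>(s, t). f (vector [s, t])) z)"
proof -
  have "integrable (leb Omega) f \<longleftrightarrow> integrable (distr (leb Omega) borel (\<lambda>x. x)) f"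
    by (subst integrable_distr_eq) auto
  also have "\<dots> \<longleftrightarrow> integrable (leb I \<Otimes>\<^sub>M leb I) (\<lambda>(s, t). f (vector [s, t]))"
    unfolding distr_Omega[symmetric]
    by (subst integrable_distr_eq[OF pair_vector_measurable]) (simp_all add: case_prod_unfold)
  finally show "integrable (leb Omega) f \<longleftrightarrow> integrable (leb I \<Otimes>\<^sub>M leb I) (\<lambda>(s, t). f (vector [s, t]))" .
  have "(LINT x|leb Omega. f x) = (LINT x|distr (leb Omega) borel (\<lambda>x. x). f x)"
    by (subst integral_distr) auto
  also have "\<dots> = (LINT z|(leb I \<Otimes>\<^sub>M leb I). (\<lambda>(s, t). f (vector [s, t])) z)"
    unfolding distr_Omega[symmetric]
    by (subst integral_distr[OF pair_vector_measurable]) (simp_all add: case_prod_unfold)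
  finally show "(LINT x|leb Omega. f x) = (LINT z|(leb I \<Otimes>\<^sub>M leb I). (\<lambda>(s, t). f (vector [s, t])) z)" .
qed

lemma pair_sigma_finite_I: "pair_sigma_finite (leb I) (leb I)"
  by (intro pair_sigma_finite.intro finite_measure.axioms(1)[OF finite_measure_I])

lemma Fubini_Omega:
  fixes f :: "real ^ 2 \<Rightarrow> real"
  assumes f: "f \<in> borel_measurable borel" "integrable (leb Omega) f"
  shows "(LINT x|leb Omega. f x) = (LINT s|leb I. LINT t|leb I. f (vector [s, t]))"
    and "(LINT x|leb Omega. f x) = (LINT t|leb I. LINT s|leb I. f (vector [s, t]))"
    and "AE s in leb I. integrable (leb I) (\<lambda>t. f (vector [s, t]))"
    and "integrable (leb I) (\<lambda>s. LINT t|leb I. f (vector [s, t]))"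
    and "integrable (leb I) (\<lambda>t. LINT s|leb I. f (vector [s, t]))"
proof -
  interpret pair_sigma_finite "leb I" "leb I" by (rule pair_sigma_finite_I)
  have i: "integrable (leb I \<Otimes>\<^sub>M leb I) (\<lambda>(s, t). f (vector [s, t]))"
    using f LINT_Omega_pair(1) by blast
  show 1: "(LINT x|leb Omega. f x) = (LINT s|leb I. LINT t|leb I. f (vector [s, t]))"
    unfolding LINT_Omega_pair(2)[OF f(1)] using integral_fst'[OF i] by simp
  show "(LINT x|leb Omega. f x) = (LINT t|leb I. LINT s|leb I. f (vector [s, t]))"
    unfolding 1 by (rule Fubini_integral[symmetric, OF i])
  show "AE s in leb I. integrable (leb I) (\<lambda>t. f (vector [s, t]))"
    using AE_integrable_fst[OF i] .
  show "integrable (leb I) (\<lambda>s. LINT t|leb I. f (vector [s, t]))"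
    using integrable_fst[OF i] .
  show "integrable (leb I) (\<lambda>t. LINT s|leb I. f (vector [s, t]))"
    using integrable_snd[OF i] .
qed

lemma finite_measure_Omega: "finite_measure (leb Omega)"
  using bounded_Omega by (intro finite_measure_lebesgue_on bounded_set_imp_lmeasurable) auto

lemma integrable_Omega_const [simp]: "integrable (leb Omega) (\<lambda>t. c::real)"
  by (rule finite_measure.integrable_const[OF finite_measure_Omega])

lemma integrable_Omega_bounded:
  fixes f :: "real ^ 2 \<Rightarrow> real"
  shows "f \<in> borel_measurable (leb Omega) \<Longrightarrow> AE t in leb Omega. \<bar>f t\<bar> \<le> C \<Longrightarrow> integrable (leb Omega) f"
  by (intro finite_measure.integrable_const_bound[OF finite_measure_Omega]) auto

subsection \<open>Functions of one coordinate\<close>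

lemma distr_first_coordinate: "distr (leb Omega) borel (\<lambda>x. x $ 1) = distr (leb I) borel (\<lambda>s. s)"
proof (rule measure_eqI)
  fix X :: "real set" assume "X \<in> sets (distr (leb Omega) borel (\<lambda>x. x $ 1))"
  then have X[measurable]: "X \<in> sets borel" by simp
  have cm[measurable]: "(\<lambda>x. x $ 1) \<in> borel_measurable (leb Omega)" by (rule borel_lebesgue_on) simp
  have "emeasure (distr (leb Omega) borel (\<lambda>x. x $ 1)) X = (\<integral>\<^sup>+x. indicator X (x $ 1) \<partial>leb Omega)"
    by (subst nn_integral_indicator[symmetric], simp, subst nn_integral_distr) auto
  also have "\<dots> = (\<integral>\<^sup>+s. (\<integral>\<^sup>+t. indicator X s \<partial>leb I) \<partial>leb I)"
    by (subst nn_integral_Omega) auto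
  also have "\<dots> = (\<integral>\<^sup>+s. indicator X s \<partial>leb I)"
    using measure_I finite_measure.emeasure_eq_measure[OF finite_measure_I, of I] by simp
  also have "\<dots> = emeasure (distr (leb I) borel (\<lambda>s. s)) X"
    by (subst nn_integral_indicator[symmetric, where M = "distr (leb I) borel (\<lambda>s. s)"], simp, subst nn_integral_distr) auto
  finally show "emeasure (distr (leb Omega) borel (\<lambda>x. x $ 1)) X = emeasure (distr (leb I) borel (\<lambda>s. s)) X" .
qed simp

lemma AE_lebesgue_on_null_borel:
  fixes S :: "'a::euclidean_space set"
  assumes "AE x in leb S. P x" "S \<in> sets borel"
  obtains N where "N \<in> sets borel" "AE x in leb S. x \<notin> N" "\<And>x. x \<in> S \<Longrightarrow> x \<notin> N \<Longrightarrow> P x"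
proof -
  have "AE x in lborel. x \<in> S \<longrightarrow> P x"
    using assms by (simp add: AE_restrict_space_iff AE_completion_iff)
  then obtain N where N: "N \<in> null_sets lborel" "{x \<in> space lborel. \<not> (x \<in> S \<longrightarrow> P x)} \<subseteq> N"
    unfolding eventually_ae_filter by blast
  have "AE x in lborel. x \<in> S \<longrightarrow> x \<notin> N" using AE_not_in[OF N(1)] by (auto elim: eventually_mono)
  then have "AE x in leb S. x \<notin> N"
    using assms(2) by (simp add: AE_restrict_space_iff AE_completion_iff)
  with N that show ?thesis by (auto simp: null_sets_def)
qed

lemma AE_first_coordinate:
  assumes "AE s in leb I. P s"
  shows "AE x in leb Omega. P (x $ 1)"
proof -
  obtain N where N[measurable]: "N \<in> sets borel" and ae: "AE s in leb I. s \<notin> N" and P: "\<And>s. s \<in> I \<Longrightarrow> s \<notin> N \<Longrightarrow> P s"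
    by (rule AE_lebesgue_on_null_borel[OF assms I_borel]) (rule that)
  have "AE s in distr (leb I) borel (\<lambda>s. s). s \<notin> N"
    using ae by (subst AE_distr_iff) auto
  then have "AE s in distr (leb Omega) borel (\<lambda>x. x $ 1). s \<notin> N" by (simp only: distr_first_coordinate)
  then have "AE x in leb Omega. x $ 1 \<notin> N"
    by (subst (asm) AE_distr_iff) (auto intro: borel_lebesgue_on)
  moreover have "AE x in leb Omega. x $ 1 \<in> I" by (rule AE_I2) (auto simp: Omega_def I_def)
  ultimately show ?thesis by eventually_elim (rule P)
qed

lemma AE_eq_borel_measurable:
  fixes f g :: "'a::euclidean_space \<Rightarrow> real"
  assumes "AE x in leb S. f x = g x" "g \<in> borel_measurable (leb S)" and S: "S \<in> sets borel"
  shows "f \<in> borel_measurable (leb S)"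
proof -
  obtain N where N: "N \<in> sets borel" "AE x in leb S. x \<notin> N" "\<And>x. x \<in> S \<Longrightarrow> x \<notin> N \<Longrightarrow> f x = g x"
    by (rule AE_lebesgue_on_null_borel[OF assms(1) S]) (rule that)
  have "AE x in lebesgue. x \<notin> N \<inter> S" using N(2) S by (auto simp: AE_restrict_space_iff elim: eventually_mono)
  then have null: "N \<inter> S \<in> null_sets lebesgue"
    using N(1) S by (subst AE_iff_null_sets) auto
  show ?thesis
  proof (rule borel_measurableI)
    fix Y :: "real set" assume "open Y"
    have "g -` Y \<inter> S \<in> sets (leb S)"
      using measurable_sets[OF assms(2), of Y] \<open>open Y\<close> by simp
    then have gY: "g -` Y \<inter> S \<in> sets lebesgue" using S by (auto simp: sets_restrict_space_iff)
    have sub: "f -` Y \<inter> (N \<inter> S) \<in> sets lebesgue"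
      by (rule completion.complete[OF _ null]) blast
    have "f -` Y \<inter> S = (g -` Y \<inter> S - N) \<union> (f -` Y \<inter> (N \<inter> S))"
      using N(3) by auto
    also have "\<dots> \<in> sets lebesgue" using N(1) by (intro sets.Un sets.Diff gY sub) simp
    finally show "f -` Y \<inter> space (leb S) \<in> sets (leb S)"
      using S by (auto simp: sets_restrict_space_iff)
  qed
qed

lemma first_coordinate_integrable:
  fixes u :: "real \<Rightarrow> real"
  assumes u: "integrable (leb I) u"
  shows "integrable (leb Omega) (\<lambda>x. u (x $ 1))"
    and "(LINT x|leb Omega. u (x $ 1)) = (LINT s|leb I. u s)"
proof -
  obtain U where U: "integrable lborel U" "AE x in lborel. U x = indicator I x * u x"
    by (rule zero_extension[OF u I_borel]) (rule that)
  have [measurable]: "U \<in> borel_measurable borel" using U(1) by auto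
  have ae: "AE s in leb I. U s = u s"
    using U(2) by (auto simp: AE_restrict_space_iff AE_completion_iff elim: eventually_mono)
  have ae2: "AE x in leb Omega. u (x $ 1) = U (x $ 1)"
    using AE_first_coordinate[OF ae] by eventually_elim simp
  have Um: "(\<lambda>x. U (x $ 1)) \<in> borel_measurable (leb Omega)" by (rule borel_lebesgue_on) simp
  have um: "(\<lambda>x. u (x $ 1)) \<in> borel_measurable (leb Omega)"
    by (rule AE_eq_borel_measurable[OF ae2 Um]) simp
  have cm[measurable]: "(\<lambda>x. x $ 1) \<in> borel_measurable (leb Omega)" by (rule borel_lebesgue_on) simp
  have Ui: "integrable (leb I) U"
    using integrable_cong_AE[OF borel_lebesgue_on borel_measurable_integrable[OF u] ae] u by simp
  then have "integrable (distr (leb Omega) borel (\<lambda>x. x $ 1)) U"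
    unfolding distr_first_coordinate by (subst integrable_distr_eq) auto
  then have i: "integrable (leb Omega) (\<lambda>x. U (x $ 1))"
    by (subst (asm) integrable_distr_eq) auto
  show "integrable (leb Omega) (\<lambda>x. u (x $ 1))"
    using integrable_cong_AE[OF um Um ae2] i by simp
  have "(LINT x|leb Omega. u (x $ 1)) = (LINT x|leb Omega. U (x $ 1))"
    by (rule integral_cong_AE[OF um Um ae2])
  also have "\<dots> = (LINT s|distr (leb Omega) borel (\<lambda>x. x $ 1). U s)"
    by (subst integral_distr) auto
  also have "\<dots> = (LINT s|leb I. U s)"
    unfolding distr_first_coordinate by (subst integral_distr) auto
  also have "\<dots> = (LINT s|leb I. u s)"
    by (rule integral_cong_AE) (use ae u Ui in auto)
  finally show "(LINT x|leb Omega. u (x $ 1)) = (LINT s|leb I. u s)" .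
qed

section \<open>Traces on the sides of the square\<close>

abbreviation (input) top_trace where "top_trace \<equiv> has_trace Omega (leb I) top_side"

abbreviation (input) ex :: "real ^ 2" where "ex \<equiv> axis 1 1"
abbreviation (input) ey :: "real ^ 2" where "ey \<equiv> axis 2 1"

lemma ex_Basis [simp]: "ex \<in> Basis" "ey \<in> Basis" and ex_neq_ey [simp]: "ex \<noteq> ey" "ey \<noteq> ex"
  by (auto simp: R2_Basis axis_eq_axis)

lemma vector_component_simps [simp]: "(vector [s, t] :: real ^ 2) $ 1 = s" "(vector [s, t] :: real ^ 2) $ 2 = t"
  by auto

lemma vector_sliceI: "vector [t, 0] + s *\<^sub>R ey = vector [t, s]" "vector [0, t] + s *\<^sub>R ex = vector [s, t]"
  by (auto simp: R2_eq_iff axis_def)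

lemma slice_DERIV:
  assumes "smooth (\<phi> :: real ^ 2 \<Rightarrow> real)"
  shows "((\<lambda>s. \<phi> (vector [t, s])) has_real_derivative dpartial ey \<phi> (vector [t, s])) (at s)"
    and "((\<lambda>s. \<phi> (vector [s, t])) has_real_derivative dpartial ex \<phi> (vector [s, t])) (at s)"
proof -
  have "(\<Sum>i\<in>Basis. (ey \<bullet> i) * dpartial i \<phi> x) = dpartial ey \<phi> x"
    "(\<Sum>i\<in>Basis. (ex \<bullet> i) * dpartial i \<phi> x) = dpartial ex \<phi> x" for x
    by (auto simp: inner_Basis if_distrib[of "\<lambda>c. c * _"] cong: if_cong simp del: inner_axis_R2)
  then show "((\<lambda>s. \<phi> (vector [t, s])) has_real_derivative dpartial ey \<phi> (vector [t, s])) (at s)"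
    "((\<lambda>s. \<phi> (vector [s, t])) has_real_derivative dpartial ex \<phi> (vector [s, t])) (at s)"
    using smooth_line_DERIV[OF assms, of "vector [t, 0]" ey s] smooth_line_DERIV[OF assms, of "vector [0, t]" ex s]
    by (simp_all add: vector_sliceI)
qed

text \<open>Sections of a function that is only Lebesgue measurable need not be measurable, so integration along lines is
  carried out for Borel representatives.\<close>

lemma borel_representative:
  fixes f :: "real ^ 2 \<Rightarrow> real"
  assumes "integrable (leb Omega) f"
  obtains F where "F \<in> borel_measurable borel" "integrable (leb Omega) F" "AE x in leb Omega. F x = f x"
proof -
  obtain F where F: "integrable lborel F" "AE x in lborel. F x = indicator Omega x * f x"
    by (rule zero_extension[OF assms Omega_borel]) (rule that)
  have m: "F \<in> borel_measurable borel" using F(1) by auto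
  have ae: "AE x in leb Omega. F x = f x"
    using F(2) by (auto simp: AE_restrict_space_iff AE_completion_iff elim: eventually_mono)
  have "integrable (leb Omega) F"
    using integrable_cong_AE[OF borel_lebesgue_on[OF m] borel_measurable_integrable[OF assms] ae] assms by simp
  with m ae that show ?thesis by blast
qed

definition slice :: "real \<Rightarrow> (real ^ 2 \<Rightarrow> real) \<Rightarrow> real \<Rightarrow> real" where
  "slice a h t = (LINT s|leb I. indicator {a<..} s * h (vector [t, s]))"

lemma slice_weight_integrable:
  fixes h :: "real ^ 2 \<Rightarrow> real"
  assumes "h \<in> borel_measurable borel" "integrable (leb Omega) h"
  shows "(\<lambda>x. indicator {a<..} (x $ 2) * h x) \<in> borel_measurable borel"
    and "integrable (leb Omega) (\<lambda>x. indicator {a<..} (x $ 2) * h x)"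
proof -
  have i: "(\<lambda>x :: real ^ 2. indicator {a<..} (x $ 2) :: real) \<in> borel_measurable borel"
    using measurable_compose[OF component_measurable[of 2], of "indicator {a<..}" borel] by simp
  then show m: "(\<lambda>x. indicator {a<..} (x $ 2) * h x) \<in> borel_measurable borel"
    using assms(1) by (rule borel_measurable_times)
  have "integrable (leb Omega) (\<lambda>x. h x * indicator {a<..} (x $ 2))"
    by (rule integrable_times_bounded[OF assms(2) borel_lebesgue_on[OF i], of 1]) (simp add: indicator_def)
  then show "integrable (leb Omega) (\<lambda>x. indicator {a<..} (x $ 2) * h x)" by (simp add: mult.commute)
qed

lemma slice_section_integrable:
  fixes h :: "real \<Rightarrow> real"
  assumes "integrable (leb I) h"
  shows "integrable (leb I) (\<lambda>s. indicator {a<..} s * h s)"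
proof -
  have "indicat_real {a<..} \<in> borel_measurable (leb I)" by (rule borel_lebesgue_on) simp
  from integrable_times_bounded[OF assms this, of 1] show ?thesis by (simp add: mult.commute indicator_def)
qed

lemma slice_integrable:
  assumes "h \<in> borel_measurable borel" "integrable (leb Omega) h"
  shows "integrable (leb I) (slice a h)"
  using Fubini_Omega(4)[OF slice_weight_integrable[OF assms, of a]] by (simp add: slice_def[abs_def])

lemma slice_L1_le:
  assumes h: "h \<in> borel_measurable borel" "integrable (leb Omega) h"
    and k: "k \<in> borel_measurable borel" "integrable (leb Omega) k"
  shows "L1_dist (leb I) (slice a h) (slice a k) \<le> L1_dist (leb Omega) h k"
proof -
  let ?d = "\<lambda>x. \<bar>h x - k x\<bar>"
  have d: "?d \<in> borel_measurable borel" "integrable (leb Omega) ?d" using h k by auto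
  have "L1_dist (leb I) (slice a h) (slice a k) \<le> (LINT t|leb I. LINT s|leb I. ?d (vector [t, s]))"
  proof (rule integral_mono_AE)
    show "integrable (leb I) (\<lambda>t. \<bar>slice a h t - slice a k t\<bar>)"
      using slice_integrable[OF h] slice_integrable[OF k] by simp
    show "integrable (leb I) (\<lambda>t. LINT s|leb I. ?d (vector [t, s]))"
      by (rule Fubini_Omega(4)[OF d])
    show "AE t in leb I. \<bar>slice a h t - slice a k t\<bar> \<le> (LINT s|leb I. ?d (vector [t, s]))"
      using Fubini_Omega(3)[OF h] Fubini_Omega(3)[OF k]
    proof eventually_elim
      case (elim t)
      note i = slice_section_integrable[OF elim(1), of a] slice_section_integrable[OF elim(2), of a]
      have "slice a h t - slice a k t = (LINT s|leb I. indicator {a<..} s * h (vector [t, s]) - indicator {a<..} s * k (vector [t, s]))"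
        unfolding slice_def by (rule Bochner_Integration.integral_diff[symmetric, OF i])
      also have "norm \<dots> \<le> (LINT s|leb I. ?d (vector [t, s]))"
      proof (rule order_trans[OF integral_norm_bound integral_mono])
        show "norm (indicator {a<..} s * h (vector [t, s]) - indicator {a<..} s * k (vector [t, s])) \<le> ?d (vector [t, s])" for s
          by (simp add: indicator_def)
      qed (use i elim in auto)
      finally show ?case by simp
    qed
  qed
  also have "\<dots> = (LINT x|leb Omega. ?d x)" by (rule Fubini_Omega(1)[OF d, symmetric])
  finally show ?thesis .
qed

text \<open>The derivative of \<open>(s - a) \<phi>(t, s)\<close> in \<open>s\<close>, integrated over \<open>(a, 1)\<close>, recovers the value on
  the top side; in this form the trace only involves \<open>\<phi>\<close> and \<open>\<partial>\<^sub>2 \<phi>\<close> on the square.\<close>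

lemma slice_smooth:
  assumes \<phi>: "smooth \<phi>" and a: "0 \<le> a" "a \<le> 1"
  shows "slice a (\<lambda>x. \<phi> x + (x $ 2 - a) * dpartial ey \<phi> x) t = (1 - a) * \<phi> (vector [t, 1])"
proof -
  let ?f = "\<lambda>s. \<phi> (vector [t, s]) + (s - a) * dpartial ey \<phi> (vector [t, s])"
  have D: "((\<lambda>s. (s - a) * \<phi> (vector [t, s])) has_real_derivative ?f s) (at s)" for s
    by (rule derivative_eq_intros slice_DERIV(1)[OF \<phi>] refl | simp)+
  have c: "continuous_on UNIV ?f"
    by (intro continuous_intros continuous_on_compose2[OF smooth_continuous_on[OF \<phi>, of UNIV]]
        continuous_on_compose2[OF smooth_continuous_on[OF smooth_dpartial[OF \<phi> ex_Basis(2)], of UNIV]]) auto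
  have i: "integrable (leb I) ?f"
    by (rule integrable_lebesgue_on_subset[OF compact_integrable_continuous[of "{0..1}" ?f]]) (use c in \<open>auto simp: I_def\<close>)
  have "slice a (\<lambda>x. \<phi> x + (x $ 2 - a) * dpartial ey \<phi> x) t = (LINT s|leb I. indicator {..1} s * ?f s - indicator {..a} s * ?f s)"
    unfolding slice_def by (intro Bochner_Integration.integral_cong) (auto simp: indicator_def I_def)
  also have "\<dots> = prim ?f 1 - prim ?f a"
    unfolding prim_def by (rule Bochner_Integration.integral_diff[OF prim_integrable[OF i] prim_integrable[OF i]])
  also have "\<dots> = (1 - a) * \<phi> (vector [t, 1])"
    using LINT_I_FTC[OF D c, of 1] LINT_I_FTC[OF D c, of a] a by simp
  finally show ?thesis .
qed

lemma slice_trace_close: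
  assumes \<phi>: "smooth \<phi>" and a: "0 \<le> a" "a \<le> 1"
    and F: "F \<in> borel_measurable borel" "integrable (leb Omega) F"
    and G: "G \<in> borel_measurable borel" "integrable (leb Omega) G"
  shows "(LINT t|leb I. \<bar>(1 - a) * \<phi> (vector [t, 1]) - slice a (\<lambda>x. F x + (x $ 2 - a) * G x) t\<bar>)
      \<le> L1_dist (leb Omega) \<phi> F + L1_dist (leb Omega) (dpartial ey \<phi>) G"
    and "integrable (leb I) (slice a (\<lambda>x. F x + (x $ 2 - a) * G x))"
proof -
  let ?N = "leb Omega"
  let ?W = "\<lambda>u w x. u x + (x $ 2 - a) * w x :: real"
  have W: "?W u w \<in> borel_measurable borel" "integrable ?N (?W u w)"
    if u: "u \<in> borel_measurable borel" "integrable ?N u" and w: "w \<in> borel_measurable borel" "integrable ?N w" for u w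
  proof -
    show "?W u w \<in> borel_measurable borel" using u(1) w(1) by measurable
    have m: "(\<lambda>x :: real ^ 2. x $ 2 - a) \<in> borel_measurable ?N" by (rule borel_lebesgue_on) measurable
    have "AE x in ?N. \<bar>x $ 2 - a\<bar> \<le> 1" using a by (intro AE_I2) (auto simp: Omega_def forall_2)
    from integrable_times_bounded[OF w(2) m this] have "integrable ?N (\<lambda>x. (x $ 2 - a) * w x)" by (simp add: mult.commute)
    then show "integrable ?N (?W u w)" using u(2) by simp
  qed
  have d\<phi>: "smooth (dpartial ey \<phi>)" by (rule smooth_dpartial[OF \<phi>]) simp
  have p: "\<phi> \<in> borel_measurable borel" "integrable ?N \<phi>" "dpartial ey \<phi> \<in> borel_measurable borel" "integrable ?N (dpartial ey \<phi>)"
    using \<phi> d\<phi> bounded_Omega by (auto intro: smooth_borel_measurable smooth_integrable)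
  show "integrable (leb I) (slice a (\<lambda>x. F x + (x $ 2 - a) * G x))"
    by (rule slice_integrable[OF W[OF F G]])
  have "(LINT t|leb I. \<bar>(1 - a) * \<phi> (vector [t, 1]) - slice a (?W F G) t\<bar>)
      = L1_dist (leb I) (slice a (?W \<phi> (dpartial ey \<phi>))) (slice a (?W F G))"
    by (simp add: slice_smooth[OF \<phi> a])
  also have "\<dots> \<le> L1_dist ?N (?W \<phi> (dpartial ey \<phi>)) (?W F G)"
    by (rule slice_L1_le[OF W[OF p] W[OF F G]])
  also have "\<dots> \<le> (LINT x|?N. \<bar>\<phi> x - F x\<bar> + \<bar>dpartial ey \<phi> x - G x\<bar>)"
  proof (rule integral_mono)
    fix x assume "x \<in> space ?N"
    then have "\<bar>x $ 2 - a\<bar> \<le> 1" using a by (auto simp: Omega_def forall_2)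
    from mult_right_mono[OF this, of "\<bar>dpartial ey \<phi> x - G x\<bar>"]
    have "\<bar>(x $ 2 - a) * (dpartial ey \<phi> x - G x)\<bar> \<le> \<bar>dpartial ey \<phi> x - G x\<bar>" by (simp add: abs_mult)
    moreover have "?W \<phi> (dpartial ey \<phi>) x - ?W F G x = (\<phi> x - F x) + (x $ 2 - a) * (dpartial ey \<phi> x - G x)"
      by (simp add: algebra_simps)
    ultimately show "\<bar>?W \<phi> (dpartial ey \<phi>) x - ?W F G x\<bar> \<le> \<bar>\<phi> x - F x\<bar> + \<bar>dpartial ey \<phi> x - G x\<bar>" by linarith
  next
    show "integrable ?N (\<lambda>x. \<bar>?W \<phi> (dpartial ey \<phi>) x - ?W F G x\<bar>)"
      by (rule integrable_abs[OF Bochner_Integration.integrable_diff[OF W(2)[OF p] W(2)[OF F G]]])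
  qed (use p F G in auto)
  also have "\<dots> = L1_dist ?N \<phi> F + L1_dist ?N (dpartial ey \<phi>) G"
    using p F G by (intro Bochner_Integration.integral_add) auto
  finally show "(LINT t|leb I. \<bar>(1 - a) * \<phi> (vector [t, 1]) - slice a (\<lambda>x. F x + (x $ 2 - a) * G x) t\<bar>)
      \<le> L1_dist ?N \<phi> F + L1_dist ?N (dpartial ey \<phi>) G" .
qed

lemma LINT_abs_diff_AE_cong:
  fixes f F u :: "'a \<Rightarrow> real"
  assumes "AE x in M. F x = f x" "f \<in> borel_measurable M" "F \<in> borel_measurable M" "u \<in> borel_measurable M"
  shows "L1_dist M u F = L1_dist M u f"
  by (rule integral_cong_AE) (use assms in \<open>auto elim: eventually_mono\<close>)

lemma smooth_top_integrable:
  fixes \<phi> :: "real ^ 2 \<Rightarrow> real"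
  assumes "smooth \<phi>" shows "integrable (leb I) (\<lambda>t. \<phi> (vector [t, c]))" "integrable (leb I) (\<lambda>t. \<phi> (vector [c, t]))"
proof -
  have c: "continuous_on UNIV (\<lambda>t. \<phi> (vector [t, c]))"
    by (rule continuous_on_compose2[OF smooth_continuous_on[OF assms, of UNIV]
        continuous_vector[OF continuous_on_id continuous_on_const]]) simp
  have c': "continuous_on UNIV (\<lambda>t. \<phi> (vector [c, t]))"
    by (rule continuous_on_compose2[OF smooth_continuous_on[OF assms, of UNIV]
        continuous_vector[OF continuous_on_const continuous_on_id]]) simp
  show "integrable (leb I) (\<lambda>t. \<phi> (vector [t, c]))" "integrable (leb I) (\<lambda>t. \<phi> (vector [c, t]))"
    by (rule integrable_lebesgue_on_subset[OF compact_integrable_continuous[of "{0..1}"]]; use c c' in \<open>auto simp: I_def\<close>)+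
qed

lemma LINT_abs_zero_AE_eq:
  fixes f g :: "'a \<Rightarrow> real"
  assumes "integrable M f" "integrable M g" and lim: "u \<longlonglongrightarrow> 0" and le: "\<And>n. L1_dist M f g \<le> u n"
  shows "AE x in M. f x = g x"
proof -
  have "L1_dist M f g \<le> 0"
    by (rule tendsto_lowerbound[OF lim]) (use le in auto)
  then have "L1_dist M f g = 0" by (intro antisym Bochner_Integration.integral_nonneg) auto
  then have "AE x in M. \<bar>f x - g x\<bar> = 0"
    using assms(1,2) by (subst (asm) integral_nonneg_eq_0_iff_AE) auto
  then show ?thesis by eventually_elim simp
qed

text \<open>Pass to the limit in \<open>slice_smooth\<close> along an approximating sequence.\<close>

lemma trace_top_formula:
  assumes tr: "top_trace f \<tau>"
    and F: "F \<in> borel_measurable borel" "integrable (leb Omega) F" "AE x in leb Omega. F x = f x"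
    and G: "G \<in> borel_measurable borel" "integrable (leb Omega) G" "AE x in leb Omega. G x = wderiv Omega [ey] f x"
    and a: "0 \<le> a" "a \<le> 1"
  shows "AE t in leb I. (1 - a) * \<tau> t = slice a (\<lambda>x. F x + (x $ 2 - a) * G x) t"
proof -
  let ?N = "leb Omega" and ?M = "leb I"
  have fs: "f \<in> sobolev 1 1 Omega" "integrable ?M \<tau>" using tr unfolding has_trace_def by (auto simp: Lspace_one_iff)
  note f = sobolev_11D[OF fs(1) open_Omega]
  obtain \<phi> where \<phi>: "\<And>n::nat. smooth (\<phi> n)"
    "L1_tendsto ?N \<phi> f"
    "\<And>i. i \<in> Basis \<Longrightarrow> L1_tendsto ?N (\<lambda>n. dpartial i (\<phi> n)) (wderiv Omega [i] f)"
    "(\<lambda>n. LINT t|?M. \<bar>\<phi> n (top_side t) - \<tau> t\<bar>) \<longlonglongrightarrow> 0"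
    by (rule has_trace_approx[OF tr open_Omega bounded_Omega]) (rule that)
  let ?s = "slice a (\<lambda>x. F x + (x $ 2 - a) * G x)"
  have si: "integrable ?M ?s" by (rule slice_trace_close(2)[OF \<phi>(1) a F(1,2) G(1,2)])
  show ?thesis
  proof (rule LINT_abs_zero_AE_eq[OF _ si])
    show "integrable ?M (\<lambda>t. (1 - a) * \<tau> t)" using fs by simp
    show "(\<lambda>n. (LINT t|?M. \<bar>\<phi> n (top_side t) - \<tau> t\<bar>) + (L1_dist ?N (\<phi> n) f + L1_dist ?N (dpartial ey (\<phi> n)) (wderiv Omega [ey] f))) \<longlonglongrightarrow> 0"
      using tendsto_add[OF \<phi>(4) tendsto_add[OF \<phi>(2) \<phi>(3)[OF ex_Basis(2)]]] by simp
    fix n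
    have ti: "integrable ?M (\<lambda>t. \<phi> n (top_side t))"
      unfolding top_side_def by (rule smooth_top_integrable(1)[OF \<phi>(1)])
    have m: "\<phi> n \<in> borel_measurable ?N" "dpartial ey (\<phi> n) \<in> borel_measurable ?N"
      using \<phi>(1) smooth_dpartial[OF \<phi>(1) ex_Basis(2)] by (auto intro: borel_lebesgue_on smooth_borel_measurable)
    have "(LINT t|?M. \<bar>(1 - a) * \<tau> t - ?s t\<bar>)
        \<le> (LINT t|?M. \<bar>\<phi> n (top_side t) - \<tau> t\<bar> + \<bar>(1 - a) * \<phi> n (vector [t, 1]) - ?s t\<bar>)"
    proof (rule integral_mono)
      fix t
      have "\<bar>(1 - a) * (\<phi> n (top_side t) - \<tau> t)\<bar> \<le> 1 * \<bar>\<phi> n (top_side t) - \<tau> t\<bar>"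
        unfolding abs_mult using a by (intro mult_right_mono) auto
      then have "\<bar>(1 - a) * \<phi> n (vector [t, 1]) - (1 - a) * \<tau> t\<bar> \<le> \<bar>\<phi> n (top_side t) - \<tau> t\<bar>"
        by (simp add: top_side_def right_diff_distrib)
      then show "\<bar>(1 - a) * \<tau> t - ?s t\<bar> \<le> \<bar>\<phi> n (top_side t) - \<tau> t\<bar> + \<bar>(1 - a) * \<phi> n (vector [t, 1]) - ?s t\<bar>"
        by linarith
    qed (use si fs ti in \<open>auto simp: top_side_def\<close>)
    also have "\<dots> = (LINT t|?M. \<bar>\<phi> n (top_side t) - \<tau> t\<bar>) + (LINT t|?M. \<bar>(1 - a) * \<phi> n (vector [t, 1]) - ?s t\<bar>)"
      by (rule Bochner_Integration.integral_add) (use si fs ti in \<open>auto simp: top_side_def\<close>)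
    also have "(LINT t|?M. \<bar>(1 - a) * \<phi> n (vector [t, 1]) - ?s t\<bar>) \<le> L1_dist ?N (\<phi> n) F + L1_dist ?N (dpartial ey (\<phi> n)) G"
      by (rule slice_trace_close(1)[OF \<phi>(1) a F(1,2) G(1,2)])
    also have "L1_dist ?N (\<phi> n) F = L1_dist ?N (\<phi> n) f"
      by (rule LINT_abs_diff_AE_cong[OF F(3) borel_measurable_integrable[OF f(1)] borel_measurable_integrable[OF F(2)] m(1)])
    also have "L1_dist ?N (dpartial ey (\<phi> n)) G = L1_dist ?N (dpartial ey (\<phi> n)) (wderiv Omega [ey] f)"
      by (rule LINT_abs_diff_AE_cong[OF G(3) borel_measurable_integrable[OF f(3)[OF ex_Basis(2)]] borel_measurable_integrable[OF G(2)] m(2)])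
    finally show "(LINT t|?M. \<bar>(1 - a) * \<tau> t - ?s t\<bar>) \<le> (LINT t|?M. \<bar>\<phi> n (top_side t) - \<tau> t\<bar>)
        + (L1_dist ?N (\<phi> n) f + L1_dist ?N (dpartial ey (\<phi> n)) (wderiv Omega [ey] f))" by simp
  qed
qed

text \<open>The formula in \<open>slice_smooth\<close> with \<open>a = 0\<close> defines the trace of \<open>f\<close>.\<close>

lemma exists_trace_top:
  assumes fs: "f \<in> sobolev 1 1 Omega"
  obtains \<tau> where "top_trace f \<tau>"
proof -
  let ?N = "leb Omega" and ?M = "leb I"
  note f = sobolev_11D[OF fs open_Omega]
  obtain F where F: "F \<in> borel_measurable borel" "integrable ?N F" "AE x in ?N. F x = f x"
    by (rule borel_representative[OF f(1)]) (rule that)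
  obtain G where G: "G \<in> borel_measurable borel" "integrable ?N G" "AE x in ?N. G x = wderiv Omega [ey] f x"
    by (rule borel_representative[OF f(3)[OF ex_Basis(2)]]) (rule that)
  obtain \<phi> where \<phi>: "\<And>n::nat. smooth (\<phi> n)" "L1_tendsto ?N \<phi> f"
    "\<And>i. i \<in> Basis \<Longrightarrow> L1_tendsto ?N (\<lambda>n. dpartial i (\<phi> n)) (wderiv Omega [i] f)"
    by (rule smooth_dense_W11[OF open_Omega convex_Omega Omega_nonempty f]) (assumption | rule that)+
  let ?s = "slice 0 (\<lambda>x. F x + (x $ 2 - 0) * G x)"
  have le: "(LINT t|?M. \<bar>\<phi> n (top_side t) - ?s t\<bar>) \<le> L1_dist ?N (\<phi> n) f + L1_dist ?N (dpartial ey (\<phi> n)) (wderiv Omega [ey] f)" for n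
  proof -
    have m: "\<phi> n \<in> borel_measurable ?N" "dpartial ey (\<phi> n) \<in> borel_measurable ?N"
      using \<phi>(1) smooth_dpartial[OF \<phi>(1) ex_Basis(2)] by (auto intro: borel_lebesgue_on smooth_borel_measurable)
    have "(LINT t|?M. \<bar>\<phi> n (top_side t) - ?s t\<bar>) = (LINT t|?M. \<bar>(1 - 0) * \<phi> n (vector [t, 1]) - ?s t\<bar>)"
      by (simp add: top_side_def)
    also have "\<dots> \<le> L1_dist ?N (\<phi> n) F + L1_dist ?N (dpartial ey (\<phi> n)) G"
      by (rule slice_trace_close(1)[OF \<phi>(1) _ _ F(1,2) G(1,2)]) auto
    also have "L1_dist ?N (\<phi> n) F = L1_dist ?N (\<phi> n) f"
      by (rule LINT_abs_diff_AE_cong[OF F(3) borel_measurable_integrable[OF f(1)] borel_measurable_integrable[OF F(2)] m(1)])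
    also have "L1_dist ?N (dpartial ey (\<phi> n)) G = L1_dist ?N (dpartial ey (\<phi> n)) (wderiv Omega [ey] f)"
      by (rule LINT_abs_diff_AE_cong[OF G(3) borel_measurable_integrable[OF f(3)[OF ex_Basis(2)]] borel_measurable_integrable[OF G(2)] m(2)])
    finally show ?thesis .
  qed
  have "(\<lambda>n. LINT t|?M. \<bar>\<phi> n (top_side t) - ?s t\<bar>) \<longlonglongrightarrow> 0"
  proof (rule tendsto_sandwich[OF _ _ tendsto_const])
    show "(\<lambda>n. L1_dist ?N (\<phi> n) f + L1_dist ?N (dpartial ey (\<phi> n)) (wderiv Omega [ey] f)) \<longlonglongrightarrow> 0"
      using tendsto_add[OF \<phi>(2) \<phi>(3)[OF ex_Basis(2)]] by simp
  qed (use le in auto)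
  moreover have "integrable ?M ?s" by (rule slice_trace_close(2)[OF \<phi>(1) _ _ F(1,2) G(1,2)]) auto
  moreover have "integrable ?M (\<lambda>t. \<phi> n (top_side t))" for n
    unfolding top_side_def by (rule smooth_top_integrable(1)[OF \<phi>(1)])
  ultimately have "has_trace Omega ?M top_side f ?s"
    by (intro has_traceI[OF open_Omega bounded_Omega f _ \<phi>(1) _ \<phi>(2,3)])
  with that show ?thesis by blast
qed

text \<open>Averaging over the strip of height \<open>1 - a\<close> below the top side, the trace is bounded by the
  supremum in the square plus the integral of \<open>\<bar>\<partial>\<^sub>2 f\<bar>\<close> along the strip, which vanishes as \<open>a \<rightarrow> 1\<close>.\<close>

lemma trace_top_bound:
  assumes tr: "\<And>i :: 2. top_trace (\<lambda>x. f x $ i) (\<lambda>t. \<tau> t $ i)"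
    and K: "AE x in leb Omega. norm (f x :: real ^ 2) \<le> K" "0 \<le> K"
  shows "AE t in leb I. norm (\<tau> t) \<le> K"
proof -
  let ?N = "leb Omega" and ?M = "leb I"
  have fs: "(\<lambda>x. f x $ i) \<in> sobolev 1 1 Omega" for i using tr[of i] unfolding has_trace_def by blast
  note f = sobolev_11D[OF fs open_Omega]
  have ex: "\<forall>i. \<exists>F. F \<in> borel_measurable borel \<and> integrable ?N F \<and> (AE x in ?N. F x = f x $ i)"
    by (rule allI, rule borel_representative[OF f(1)]) blast
  from choice[OF ex] obtain F' where "\<forall>i. F' i \<in> borel_measurable borel \<and> integrable ?N (F' i) \<and> (AE x in ?N. F' i x = f x $ i)"
    by blast
  then have F': "\<And>i. F' i \<in> borel_measurable borel" "\<And>i. integrable ?N (F' i)" "\<And>i. AE x in ?N. F' i x = f x $ i"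
    by blast+
  have ex: "\<forall>i. \<exists>G. G \<in> borel_measurable borel \<and> integrable ?N G \<and> (AE x in ?N. G x = wderiv Omega [ey] (\<lambda>x. f x $ i) x)"
    by (rule allI, rule borel_representative[OF f(3)[OF ex_Basis(2)]]) blast
  from choice[OF ex] obtain G where "\<forall>i. G i \<in> borel_measurable borel \<and> integrable ?N (G i)
      \<and> (AE x in ?N. G i x = wderiv Omega [ey] (\<lambda>x. f x $ i) x)"
    by blast
  then have G: "\<And>i. G i \<in> borel_measurable borel" "\<And>i. integrable ?N (G i)"
    "\<And>i. AE x in ?N. G i x = wderiv Omega [ey] (\<lambda>x. f x $ i) x"
    by blast+
  define F where "F i x = (if (F' 1 x)\<^sup>2 + (F' 2 x)\<^sup>2 \<le> K\<^sup>2 then F' i x else 0)" for i x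
  have Fm: "F i \<in> borel_measurable borel" for i
    unfolding F_def[abs_def] using F'(1) by measurable
  have FK: "(F 1 x)\<^sup>2 + (F 2 x)\<^sup>2 \<le> K\<^sup>2" for x by (simp add: F_def)
  have Fae: "AE x in ?N. F i x = f x $ i" for i
    using K(1) F'(3)[of 1] F'(3)[of 2] F'(3)[of i]
  proof eventually_elim
    case (elim x)
    have "(f x $ 1)\<^sup>2 + (f x $ 2)\<^sup>2 = (norm (f x))\<^sup>2"
      by (simp add: norm_vec_def L2_set_def sum_2)
    also have "\<dots> \<le> K\<^sup>2" using elim(1) by (intro power_mono) auto
    finally show ?case using elim by (simp add: F_def)
  qed
  have Fi: "integrable ?N (F i)" for i
    using integrable_cong_AE[OF borel_lebesgue_on[OF Fm] borel_measurable_integrable[OF f(1)] Fae] f(1) by simp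
  define a where "a n = 1 - 1 / real (Suc n)" for n
  have a: "0 \<le> a n" "a n \<le> 1" "a n < 1" for n by (auto simp: a_def)
  have alim: "a \<longlonglongrightarrow> 1"
    unfolding a_def[abs_def] using tendsto_diff[OF tendsto_const LIMSEQ_inverse_real_of_nat, of 1] by (simp add: inverse_eq_divide)
  have form: "AE t in ?M. \<forall>n i. (1 - a n) * \<tau> t $ i = slice (a n) (\<lambda>x. F i x + (x $ 2 - a n) * G i x) t"
    unfolding AE_all_countable
    by (intro allI trace_top_formula[OF tr Fm Fi Fae G a(1,2)])
  have secs: "AE t in ?M. \<forall>i. integrable ?M (\<lambda>s. F i (vector [t, s])) \<and> integrable ?M (\<lambda>s. G i (vector [t, s]))"
    unfolding AE_all_countable using Fubini_Omega(3)[OF Fm Fi] Fubini_Omega(3)[OF G(1,2)] by (auto intro: AE_conjI)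
  show ?thesis
    using form secs
  proof eventually_elim
    case (elim t)
    define g where "g s = \<bar>G 1 (vector [t, s])\<bar> + \<bar>G 2 (vector [t, s])\<bar>" for s
    have gi: "integrable ?M g" unfolding g_def[abs_def] using elim(2) by auto
    have le: "norm (\<tau> t) \<le> K + (LINT s|?M. indicator {a n<..} s * g s)" for n
    proof (cases "\<tau> t = 0")
      case True
      have "0 \<le> (LINT s|?M. indicator {a n<..} s * g s)"
        by (intro Bochner_Integration.integral_nonneg) (auto simp: g_def)
      then show ?thesis using True K(2) by simp
    next
      case False
      define r where "r = norm (\<tau> t)"
      have r: "0 < r" "r\<^sup>2 = (\<tau> t $ 1)\<^sup>2 + (\<tau> t $ 2)\<^sup>2"
        using False by (simp add: r_def) (simp add: r_def norm_vec_def L2_set_def sum_2)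
      have cs: "x * \<tau> t $ 1 + y * \<tau> t $ 2 \<le> sqrt (x\<^sup>2 + y\<^sup>2) * r" for x y
      proof -
        have "vector [x, y] \<bullet> \<tau> t \<le> norm (vector [x, y] :: real ^ 2) * norm (\<tau> t)"
          by (rule norm_cauchy_schwarz)
        then show ?thesis by (simp add: inner_vec_def sum_2 r_def norm_vec_def L2_set_def)
      qed
      let ?w = "\<lambda>i s. F i (vector [t, s]) + (s - a n) * G i (vector [t, s])"
      have wi: "integrable ?M (\<lambda>s. indicator {a n<..} s * ?w i s)" for i
      proof -
        have m: "(\<lambda>s. s - a n) \<in> borel_measurable ?M" by (rule borel_lebesgue_on) measurable
        have b: "AE s in ?M. \<bar>s - a n\<bar> \<le> 1" using a[of n] by (intro AE_I2) (auto simp: I_def)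
        have "integrable ?M (\<lambda>s. G i (vector [t, s]) * (s - a n))"
          by (rule integrable_times_bounded[OF _ m b]) (use elim(2) in blast)
        then have "integrable ?M (?w i)" using elim(2) by (simp add: mult.commute)
        then show ?thesis by (rule slice_section_integrable)
      qed
      have ii: "integrable ?M (\<lambda>s. indicator {a n<..} s * g s)" "integrable ?M (\<lambda>s. indicator {a n<..} s * c)" for c :: real
        by (intro slice_section_integrable gi integrable_I_const)+
      have ind1: "(LINT s|?M. indicator {a n<..} s * (1::real)) = 1 - a n"
      proof -
        have "(LINT s|?M. indicator {a n<..} s * (1::real)) = (LINT s|?M. indicator {..1} s * 1 - indicator {..a n} s * 1)"
          by (intro Bochner_Integration.integral_cong) (auto simp: indicator_def I_def)
        also have "\<dots> = prim (\<lambda>_. 1) 1 - prim (\<lambda>_. 1) (a n)"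
          unfolding prim_def by (intro Bochner_Integration.integral_diff prim_integrable integrable_I_const)
        finally show ?thesis using a[of n] by (simp add: prim_of_const)
      qed
      have "(1 - a n) * r\<^sup>2 = ((1 - a n) * \<tau> t $ 1) * \<tau> t $ 1 + ((1 - a n) * \<tau> t $ 2) * \<tau> t $ 2"
        unfolding r(2) by (simp add: power2_eq_square algebra_simps)
      also have "\<dots> = slice (a n) (\<lambda>x. F 1 x + (x $ 2 - a n) * G 1 x) t * \<tau> t $ 1 + slice (a n) (\<lambda>x. F 2 x + (x $ 2 - a n) * G 2 x) t * \<tau> t $ 2"
        using elim(1) by simp
      also have "\<dots> = (LINT s|?M. indicator {a n<..} s * ?w 1 s) * \<tau> t $ 1 + (LINT s|?M. indicator {a n<..} s * ?w 2 s) * \<tau> t $ 2"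
        by (simp add: slice_def)
      also have "\<dots> = (LINT s|?M. indicator {a n<..} s * ?w 1 s * \<tau> t $ 1 + indicator {a n<..} s * ?w 2 s * \<tau> t $ 2)"
        using wi by (subst Bochner_Integration.integral_add) auto
      also have "\<dots> \<le> (LINT s|?M. indicator {a n<..} s * (r * K) + (1 - a n) * r * (indicator {a n<..} s * g s))"
      proof (rule integral_mono)
        fix s assume "s \<in> space ?M"
        then have s: "s < 1" by (auto simp: I_def)
        show "indicator {a n<..} s * ?w 1 s * \<tau> t $ 1 + indicator {a n<..} s * ?w 2 s * \<tau> t $ 2
            \<le> indicator {a n<..} s * (r * K) + (1 - a n) * r * (indicator {a n<..} s * g s)"
        proof (cases "a n < s")
          case True
          let ?F1 = "F 1 (vector [t, s])" and ?F2 = "F 2 (vector [t, s])" and ?G1 = "G 1 (vector [t, s])" and ?G2 = "G 2 (vector [t, s])"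
          have "sqrt (?F1\<^sup>2 + ?F2\<^sup>2) \<le> sqrt (K\<^sup>2)" using FK by (rule real_sqrt_le_mono)
          then have "sqrt (?F1\<^sup>2 + ?F2\<^sup>2) * r \<le> K * r" using K(2) r(1) by (intro mult_right_mono) auto
          with cs[of ?F1 ?F2] have 1: "?F1 * \<tau> t $ 1 + ?F2 * \<tau> t $ 2 \<le> r * K" by (simp add: mult.commute)
          have "sqrt (?G1\<^sup>2 + ?G2\<^sup>2) * r \<le> g s * r"
            unfolding g_def using r(1) by (intro mult_right_mono sqrt_sum_squares_le_sum_abs) auto
          with cs[of ?G1 ?G2] have 2: "?G1 * \<tau> t $ 1 + ?G2 * \<tau> t $ 2 \<le> g s * r" by simp
          have "(s - a n) * (?G1 * \<tau> t $ 1 + ?G2 * \<tau> t $ 2) \<le> (s - a n) * (g s * r)"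
            using 2 True by (intro mult_left_mono) auto
          also have "\<dots> \<le> (1 - a n) * (g s * r)"
            using s r(1) by (intro mult_right_mono mult_nonneg_nonneg) (auto simp: g_def)
          finally have 3: "(s - a n) * (?G1 * \<tau> t $ 1 + ?G2 * \<tau> t $ 2) \<le> (1 - a n) * (g s * r)" .
          have "?w 1 s * \<tau> t $ 1 + ?w 2 s * \<tau> t $ 2
              = (?F1 * \<tau> t $ 1 + ?F2 * \<tau> t $ 2) + (s - a n) * (?G1 * \<tau> t $ 1 + ?G2 * \<tau> t $ 2)"
            by (simp add: algebra_simps)
          also have "\<dots> \<le> r * K + (1 - a n) * (g s * r)" using 1 3 by linarith
          finally show ?thesis using True by (simp add: mult_ac)
        qed simp
      qed (use wi ii in auto)
      also have "\<dots> = (1 - a n) * (r * K) + (1 - a n) * r * (LINT s|?M. indicator {a n<..} s * g s)"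
      proof -
        have "(LINT s|?M. indicator {a n<..} s * (r * K)) = (1 - a n) * (r * K)"
          using ind1 integral_mult_left_zero[of ?M "indicator {a n<..}" "r * K"] by simp
        then show ?thesis using ii by (subst Bochner_Integration.integral_add) auto
      qed
      finally have "((1 - a n) * r) * r \<le> ((1 - a n) * r) * (K + (LINT s|?M. indicator {a n<..} s * g s))"
        by (simp add: algebra_simps power2_eq_square)
      moreover have "0 < (1 - a n) * r" using a(3)[of n] r(1) by simp
      ultimately show ?thesis unfolding r_def[symmetric] by (simp only: mult_le_cancel_left_pos)
    qed
    have "(\<lambda>n. LINT s|?M. indicator {a n<..} s * g s) \<longlonglongrightarrow> (LINT s|?M. 0)"
    proof (rule integral_dominated_convergence[OF _ _ gi])
      show "AE s in ?M. (\<lambda>n. indicator {a n<..} s * g s) \<longlonglongrightarrow> 0"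
      proof (rule AE_I2)
        fix s assume "s \<in> space ?M"
        then have "s < 1" by (simp add: I_def)
        then show "(\<lambda>n. indicator {a n<..} s * g s) \<longlonglongrightarrow> 0"
          by (intro tendsto_eventually eventually_mono[OF order_tendstoD(1)[OF alim \<open>s < 1\<close>]]) (auto simp: indicator_def)
      qed
      show "AE s in ?M. norm (indicator {a n<..} s * g s) \<le> g s" for n
        by (intro AE_I2) (auto simp: g_def indicator_def)
    qed (use slice_section_integrable[OF gi] in auto)
    then have "(\<lambda>n. K + (LINT s|?M. indicator {a n<..} s * g s)) \<longlonglongrightarrow> K + 0"
      by (intro tendsto_add tendsto_const) simp
    then have "norm (\<tau> t) \<le> K + 0" by (rule tendsto_lowerbound) (use le in auto)
    then show "norm (\<tau> t) \<le> K" by simp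
  qed
qed

section \<open>Divergence-free fields and functions with zero trace\<close>

text \<open>The factors of \<open>box_cutoff 0 One n\<close> on the unit square.\<close>

definition cut :: "nat \<Rightarrow> real \<Rightarrow> real" where
  "cut n t = step (- 1 + t \<bullet> real n) * step ((real n - 1) + t \<bullet> (- real n))"

lemma smooth_cut: "smooth (cut n)"
  unfolding cut_def[abs_def] by (intro smooth_mult smooth_ridge smooth_step)

lemma cut_nonneg: "0 \<le> cut n t" and cut_le_1: "cut n t \<le> 1"
  by (auto simp: cut_def step_nonneg step_le_1 intro!: mult_le_one)

text \<open>The derivative of the cutoff is supported in two end strips of length \<open>2 / n\<close>.\<close>

definition end_strips :: "nat \<Rightarrow> real \<Rightarrow> real" where
  "end_strips n t = indicator {..2 / real n} t + indicator {1 - 2 / real n..} t"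

lemma end_strips_bounds: "0 \<le> end_strips n t" "end_strips n t \<le> 2"
  by (auto simp: end_strips_def indicator_def)

lemma end_strips_measurable [measurable]: "end_strips n \<in> borel_measurable borel"
  unfolding end_strips_def[abs_def] by measurable

lemma end_strips_integral:
  assumes n: "2 \<le> n"
  shows "(LINT t|leb I. end_strips n t) = 4 / real n"
proof -
  let ?M = "leb I"
  have r: "2 / real n \<le> 1" using n by (simp add: field_simps)
  have i: "integrable ?M (\<lambda>t. indicator {..c} t * (1::real))" for c by (rule prim_integrable) simp
  have "(LINT t|?M. end_strips n t)
      = (LINT t|?M. indicator {..2 / real n} t * 1 + (1 - indicator {..1 - 2 / real n} t * 1))"
  proof (rule integral_cong_AE)
    show "AE t in ?M. end_strips n t = indicator {..2 / real n} t * 1 + (1 - indicator {..1 - 2 / real n} t * 1)"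
      using AE_I_not_point[of "1 - 2 / real n"] by eventually_elim (auto simp: end_strips_def indicator_def)
  qed (auto intro: borel_lebesgue_on)
  also have "\<dots> = (LINT t|?M. indicator {..2 / real n} t * 1) + ((LINT t|?M. 1) - (LINT t|?M. indicator {..1 - 2 / real n} t * 1))"
    using i by (subst Bochner_Integration.integral_add, simp, simp, subst Bochner_Integration.integral_diff) auto
  also have "\<dots> = prim (\<lambda>_. 1) (2 / real n) + (1 - prim (\<lambda>_. 1) (1 - 2 / real n))"
    by (simp add: prim_def measure_I)
  also have "\<dots> = 4 / real n" using r by (simp add: prim_of_const)
  finally show ?thesis .
qed

lemma cut_deriv_bound:
  assumes L: "\<And>x. \<bar>dpartial 1 step x\<bar> \<le> L" and n: "0 < n"
  shows "\<bar>dpartial 1 (cut n) t\<bar> \<le> L * real n * end_strips n t"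
proof -
  let ?a = "step (- 1 + t \<bullet> real n)" and ?b = "step ((real n - 1) + t \<bullet> (- real n))"
  let ?a' = "dpartial 1 step (- 1 + t \<bullet> real n)" and ?b' = "dpartial 1 step ((real n - 1) + t \<bullet> (- real n))"
  have L0: "0 \<le> L" using L[of 0] by linarith
  have nn: "0 < real n" using n by simp
  have "dpartial 1 (cut n) t = ?a * dpartial 1 (\<lambda>t. step ((real n - 1) + t \<bullet> (- real n))) t
      + dpartial 1 (\<lambda>t. step (- 1 + t \<bullet> real n)) t * ?b"
    unfolding cut_def[abs_def] by (rule dpartial_mult) (intro smooth_differentiable smooth_ridge smooth_step)+
  also have "dpartial 1 (\<lambda>t. step ((real n - 1) + t \<bullet> (- real n))) t = (1 \<bullet> (- real n)) * ?b'"
    by (rule dpartial_ridge[OF smooth_step])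
  also have "dpartial 1 (\<lambda>t. step (- 1 + t \<bullet> real n)) t = (1 \<bullet> real n) * ?a'"
    by (rule dpartial_ridge[OF smooth_step])
  finally have "\<bar>dpartial 1 (cut n) t\<bar> \<le> \<bar>?a * ((1 \<bullet> (- real n)) * ?b')\<bar> + \<bar>((1 \<bullet> real n) * ?a') * ?b\<bar>"
    by (metis abs_triangle_ineq)
  moreover have "\<bar>?a * ((1 \<bullet> (- real n)) * ?b')\<bar> \<le> L * real n * indicator {1 - 2 / real n..} t"
  proof (cases "?b' = 0")
    case False
    then have "(real n - 1) + t \<bullet> (- real n) \<le> 1" using step_deriv_outside by force
    then have t: "1 - 2 / real n \<le> t" using nn by (simp add: field_simps)
    have "\<bar>?a * ((1 \<bullet> (- real n)) * ?b')\<bar> = \<bar>?a\<bar> * (real n * \<bar>?b'\<bar>)" by (simp add: abs_mult)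
    also have "\<dots> \<le> 1 * (real n * L)"
      using step_nonneg step_le_1 L by (intro mult_mono) auto
    finally show ?thesis using t by (simp add: mult.commute)
  qed (use L0 in simp)
  moreover have "\<bar>((1 \<bullet> real n) * ?a') * ?b\<bar> \<le> L * real n * indicator {..2 / real n} t"
  proof (cases "?a' = 0")
    case False
    then have "- 1 + t \<bullet> real n \<le> 1" using step_deriv_outside by force
    then have t: "t \<le> 2 / real n" using nn by (simp add: field_simps)
    have "\<bar>((1 \<bullet> real n) * ?a') * ?b\<bar> = (real n * \<bar>?a'\<bar>) * \<bar>?b\<bar>" by (simp add: abs_mult)
    also have "\<dots> \<le> (real n * L) * 1"
      using step_nonneg step_le_1 L L0 by (intro mult_mono) auto
    finally show ?thesis using t by (simp add: mult.commute)
  qed (use L0 in simp)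
  ultimately show ?thesis by (simp add: end_strips_def distrib_left)
qed

lemma axis_R2_simps [simp]: "ex $ 1 = 1" "ex $ 2 = 0" "ey $ 1 = 0" "ey $ 2 = 1"
  by (simp_all add: axis_def)

lemma One_inner_Basis:
  fixes b :: "'a::euclidean_space"
  assumes "b \<in> Basis" shows "One \<bullet> b = 1"
proof -
  have "One \<bullet> b = (\<Sum>i\<in>Basis. if i = b then 1 else 0)"
    unfolding inner_sum_left by (rule sum.cong) (use assms in \<open>auto simp: inner_Basis\<close>)
  then show ?thesis using assms by simp
qed

lemma box_cutoff_square: "box_cutoff 0 One n x = cut n (x $ 1) * cut n (x $ 2)" for x :: "real ^ 2"
proof -
  have "box_cutoff 0 One n x = (\<Prod>i\<in>Basis. cut n (x \<bullet> i))"
    unfolding box_cutoff_def cut_def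
    by (rule prod.cong[OF refl]) (simp only: One_inner_Basis inner_zero_left inner_scaleR_right inner_real_def,
        simp add: mult.commute)
  then show ?thesis by (simp add: R2_Basis)
qed

lemma dpartial_box_cutoff:
  "dpartial ex (box_cutoff 0 One n) x = dpartial 1 (cut n) (x $ 1) * cut n (x $ 2)"
  "dpartial ey (box_cutoff 0 One n) x = cut n (x $ 1) * dpartial 1 (cut n) (x $ 2)"
proof -
  have eq: "box_cutoff 0 One n = (\<lambda>x. cut n (0 + x \<bullet> ex) * cut n (0 + x \<bullet> ey))"
    by (simp add: fun_eq_iff box_cutoff_square)
  have d: "dpartial i (\<lambda>x. cut n (0 + x \<bullet> ex) * cut n (0 + x \<bullet> ey)) x
      = cut n (0 + x \<bullet> ex) * ((i \<bullet> ey) * dpartial 1 (cut n) (0 + x \<bullet> ey))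
        + ((i \<bullet> ex) * dpartial 1 (cut n) (0 + x \<bullet> ex)) * cut n (0 + x \<bullet> ey)" for i
    unfolding dpartial_ridge[OF smooth_cut, symmetric]
    by (rule dpartial_mult) (intro smooth_differentiable smooth_ridge smooth_cut)+
  show "dpartial ex (box_cutoff 0 One n) x = dpartial 1 (cut n) (x $ 1) * cut n (x $ 2)"
    "dpartial ey (box_cutoff 0 One n) x = cut n (x $ 1) * dpartial 1 (cut n) (x $ 2)"
    unfolding eq d by simp_all
qed

lemma Omega_eq_box: "Omega = box 0 One"
proof -
  have "box 0 One = {x :: real ^ 2. \<forall>i\<in>Basis. 0 < x \<bullet> i \<and> x \<bullet> i < 1}"
    by (rule set_eqI) (simp only: mem_box mem_Collect_eq inner_zero_left One_inner_Basis cong: ball_cong)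
  also have "\<dots> = Omega" by (auto simp: Omega_def R2_Basis forall_2)
  finally show ?thesis by simp
qed

lemma smooth_gradient_bound:
  assumes "smooth \<phi>"
  obtains B where "0 \<le> B" "\<And>s t. 0 \<le> s \<Longrightarrow> s \<le> 1 \<Longrightarrow> 0 \<le> t \<Longrightarrow> t \<le> 1 \<Longrightarrow>
    \<bar>dpartial ex \<phi> (vector [s, t])\<bar> \<le> B \<and> \<bar>dpartial ey \<phi> (vector [s, t])\<bar> \<le> B"
proof -
  let ?Q = "cbox 0 (\<chi> i. 1) :: (real ^ 2) set"
  have Q: "vector [s, t] \<in> ?Q" if "0 \<le> s" "s \<le> 1" "0 \<le> t" "t \<le> 1" for s t
    using that by (simp add: mem_box_cart forall_2)
  have "\<exists>B>0. \<forall>x\<in>?Q. \<bar>dpartial i \<phi> x\<bar> \<le> B" if "i \<in> Basis" for i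
  proof -
    have "compact (dpartial i \<phi> ` ?Q)"
      by (intro compact_continuous_image smooth_continuous_on smooth_dpartial assms that compact_cbox)
    then show ?thesis using compact_imp_bounded bounded_pos[of "dpartial i \<phi> ` ?Q"] by auto
  qed
  from this[OF ex_Basis(1)] this[OF ex_Basis(2)] obtain B1 B2 where
    "0 < B1" "\<forall>x\<in>?Q. \<bar>dpartial ex \<phi> x\<bar> \<le> B1" "0 < B2" "\<forall>x\<in>?Q. \<bar>dpartial ey \<phi> x\<bar> \<le> B2" by blast
  then show ?thesis using Q by (intro that[of "max B1 B2"]) (auto simp: le_max_iff_disj)
qed

text \<open>Near an end of the interval the value is that at the end point, up to a Lipschitz error.\<close>

lemma end_strips_estimate:
  fixes h :: "real \<Rightarrow> real"
  assumes D: "\<And>s. (h has_real_derivative h' s) (at s)" and B: "\<And>s. 0 \<le> s \<Longrightarrow> s \<le> 1 \<Longrightarrow> \<bar>h' s\<bar> \<le> B"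
    and s: "0 < s" "s < 1" and n: "0 < n"
  shows "\<bar>h s\<bar> * end_strips n s \<le> end_strips n s * (\<bar>h 0\<bar> + \<bar>h 1\<bar> + 2 * B / real n)"
proof -
  have B0: "0 \<le> B" using B[of 0] by simp
  have l: "\<bar>h s\<bar> \<le> \<bar>h 0\<bar> + B * s"
  proof -
    obtain z where "0 < z" "z < s" "h s - h 0 = (s - 0) * h' z" using MVT2[OF s(1) D] by blast
    moreover have "\<bar>s * h' z\<bar> \<le> s * B" unfolding abs_mult using B[of z] s calculation by (intro mult_mono) auto
    ultimately show ?thesis by (simp add: mult.commute)
  qed
  have r: "\<bar>h s\<bar> \<le> \<bar>h 1\<bar> + B * (1 - s)"
  proof -
    obtain z where "s < z" "z < 1" "h 1 - h s = (1 - s) * h' z" using MVT2[OF s(2) D] by blast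
    moreover have "\<bar>(1 - s) * h' z\<bar> \<le> (1 - s) * B" unfolding abs_mult using B[of z] s calculation by (intro mult_mono) auto
    ultimately show ?thesis by (simp add: mult.commute)
  qed
  have "\<bar>h s\<bar> \<le> \<bar>h 0\<bar> + \<bar>h 1\<bar> + 2 * B / real n" if "end_strips n s \<noteq> 0"
  proof -
    have "s \<le> 2 / real n \<or> 1 - s \<le> 2 / real n" using that by (auto simp: end_strips_def indicator_def split: if_splits)
    then have "B * s \<le> B * (2 / real n) \<or> B * (1 - s) \<le> B * (2 / real n)"
      using mult_left_mono[OF _ B0, of s "2 / real n"] mult_left_mono[OF _ B0, of "1 - s" "2 / real n"] by blast
    moreover have "B * (2 / real n) = 2 * B / real n" by simp
    ultimately show ?thesis using l r by linarith
  qed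
  then show ?thesis
    using mult_left_mono[OF _ end_strips_bounds(1)[of n s], of "\<bar>h s\<bar>" "\<bar>h 0\<bar> + \<bar>h 1\<bar> + 2 * B / real n"]
    by (cases "end_strips n s = 0") (simp_all add: mult.commute[of "\<bar>h s\<bar>"])
qed

lemma LINT_Omega_product:
  fixes u v :: "real \<Rightarrow> real"
  assumes u: "u \<in> borel_measurable borel" "\<And>s. s \<in> I \<Longrightarrow> \<bar>u s\<bar> \<le> C"
    and v: "v \<in> borel_measurable borel" "\<And>s. s \<in> I \<Longrightarrow> \<bar>v s\<bar> \<le> D"
  shows "integrable (leb Omega) (\<lambda>x. u (x $ 1) * v (x $ 2))"
    and "(LINT x|leb Omega. u (x $ 1) * v (x $ 2)) = (LINT s|leb I. u s) * (LINT s|leb I. v s)"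
proof -
  have m: "(\<lambda>x. u (x $ 1) * v (x $ 2)) \<in> borel_measurable borel"
    using u(1) v(1) by measurable
  show i: "integrable (leb Omega) (\<lambda>x. u (x $ 1) * v (x $ 2))"
  proof (rule integrable_Omega_bounded[OF borel_lebesgue_on[OF m]], rule AE_I2)
    fix x assume "x \<in> space (leb Omega)"
    then have "x $ 1 \<in> I" "x $ 2 \<in> I" by (auto simp: Omega_def I_def)
    then show "\<bar>u (x $ 1) * v (x $ 2)\<bar> \<le> C * D"
      unfolding abs_mult using u(2) v(2) by (intro mult_mono order_trans[OF abs_ge_zero u(2)]) auto
  qed
  show "(LINT x|leb Omega. u (x $ 1) * v (x $ 2)) = (LINT s|leb I. u s) * (LINT s|leb I. v s)"
    by (subst Fubini_Omega(1)[OF m i]) simp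
qed

text \<open>The \<open>L\<^sup>1\<close> norm over the boundary of the square.\<close>

definition side_integrals :: "(real ^ 2 \<Rightarrow> real) \<Rightarrow> real" where
  "side_integrals \<phi> = (LINT t|leb I. \<bar>\<phi> (vector [0, t])\<bar>) + (LINT t|leb I. \<bar>\<phi> (vector [1, t])\<bar>)
     + (LINT t|leb I. \<bar>\<phi> (vector [t, 0])\<bar>) + (LINT t|leb I. \<bar>\<phi> (vector [t, 1])\<bar>)"

text \<open>Testing with \<open>\<phi>\<close> times a cutoff \<open>\<eta>\<close> of the square leaves \<open>\<integral> \<phi> F \<bullet> \<nabla>\<eta>\<close>. The gradient of \<open>\<eta>\<close> is of size \<open>n\<close> in strips
  of width \<open>2 / n\<close> along the sides, where \<open>\<phi>\<close> is close to its boundary values.\<close>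

lemma boundary_flux_bound:
  fixes F1 F2 :: "real ^ 2 \<Rightarrow> real"
  assumes F: "F1 \<in> borel_measurable (leb Omega)" "F2 \<in> borel_measurable (leb Omega)"
    and K: "AE x in leb Omega. \<bar>F1 x\<bar> \<le> K" "AE x in leb Omega. \<bar>F2 x\<bar> \<le> K" "0 \<le> K"
    and div0: "\<And>\<psi>. test_function Omega \<psi> \<Longrightarrow> (LINT x|leb Omega. F1 x * dpartial ex \<psi> x + F2 x * dpartial ey \<psi> x) = 0"
  obtains C where "\<And>\<phi>. smooth \<phi> \<Longrightarrow> \<bar>LINT x|leb Omega. F1 x * dpartial ex \<phi> x + F2 x * dpartial ey \<phi> x\<bar> \<le> C * side_integrals \<phi>"
proof -
  let ?N = "leb Omega" and ?M = "leb I"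
  obtain L where L: "0 < L" "\<And>x. \<bar>dpartial 1 step x\<bar> \<le> L" by (rule step_deriv_bounded) (rule that)
  have *: "\<bar>LINT x|?N. F1 x * dpartial ex \<phi> x + F2 x * dpartial ey \<phi> x\<bar> \<le> 4 * K * L * side_integrals \<phi>"
    if \<phi>: "smooth \<phi>" for \<phi>
  proof -
    obtain B where B: "0 \<le> B" "\<And>s t. 0 \<le> s \<Longrightarrow> s \<le> 1 \<Longrightarrow> 0 \<le> t \<Longrightarrow> t \<le> 1 \<Longrightarrow>
        \<bar>dpartial ex \<phi> (vector [s, t])\<bar> \<le> B \<and> \<bar>dpartial ey \<phi> (vector [s, t])\<bar> \<le> B"
      by (rule smooth_gradient_bound[OF \<phi>]) (rule that)
    let ?\<eta> = "\<lambda>n. box_cutoff 0 One n :: real ^ 2 \<Rightarrow> real"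
    have sm: "smooth \<phi>" "smooth (dpartial ex \<phi>)" "smooth (dpartial ey \<phi>)" "smooth (?\<eta> n)" "smooth (dpartial ex (?\<eta> n))" "smooth (dpartial ey (?\<eta> n))" for n
      using \<phi> by (auto intro: smooth_dpartial smooth_box_cutoff)
    have si: "integrable ?N g" if "smooth g" for g using that bounded_Omega by (intro smooth_integrable) auto
    have Fg: "integrable ?N (\<lambda>x. F1 x * g x)" "integrable ?N (\<lambda>x. F2 x * g x)" if "smooth g" for g
      using integrable_times_bounded[OF si[OF that] F(1) K(1)] integrable_times_bounded[OF si[OF that] F(2) K(2)]
      by (simp_all add: mult.commute)
    define S where "S x = F1 x * dpartial ex \<phi> x + F2 x * dpartial ey \<phi> x" for x
    have Si: "integrable ?N S" unfolding S_def[abs_def] using Fg sm by simp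
    define v1 where "v1 t = \<bar>\<phi> (vector [0, t])\<bar> + \<bar>\<phi> (vector [1, t])\<bar>" for t
    define v2 where "v2 t = \<bar>\<phi> (vector [t, 0])\<bar> + \<bar>\<phi> (vector [t, 1])\<bar>" for t
    have vc: "continuous_on UNIV v1" "continuous_on UNIV v2"
      unfolding v1_def[abs_def] v2_def[abs_def]
      by (auto intro!: continuous_intros continuous_on_compose2[OF smooth_continuous_on[OF \<phi>, of UNIV]])
    have vm[measurable]: "v1 \<in> borel_measurable borel" "v2 \<in> borel_measurable borel"
      by (intro borel_measurable_continuous_onI vc)+
    have vi: "integrable ?M v1" "integrable ?M v2"
      unfolding v1_def[abs_def] v2_def[abs_def] using smooth_top_integrable[OF \<phi>] by auto
    have ex: "\<exists>V. \<forall>s\<in>{0..1}. \<bar>v s\<bar> \<le> V" if "continuous_on UNIV v" for v :: "real \<Rightarrow> real"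
    proof -
      have "compact (v ` {0..1})" by (intro compact_continuous_image continuous_on_subset[OF that]) auto
      then show ?thesis using compact_imp_bounded bounded_pos[of "v ` {0..1}"] by auto
    qed
    obtain V1 where V1: "\<forall>s\<in>{0..1}. \<bar>v1 s\<bar> \<le> V1" using ex[OF vc(1)] by blast
    obtain V2 where V2: "\<forall>s\<in>{0..1}. \<bar>v2 s\<bar> \<le> V2" using ex[OF vc(2)] by blast
    have V: "\<bar>v1 s\<bar> \<le> V1" "\<bar>v2 s\<bar> \<le> V2" if "s \<in> I" for s using V1 V2 that by (auto simp: I_def)
    have sides: "(LINT s|?M. v1 s) + (LINT s|?M. v2 s) = side_integrals \<phi>"
      unfolding v1_def v2_def side_integrals_def using smooth_top_integrable[OF \<phi>]
      by (subst (1 2) Bochner_Integration.integral_add) auto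
    have bound: "\<bar>LINT x|?N. S x * ?\<eta> n x\<bar> \<le> 4 * K * L * (side_integrals \<phi> + 4 * B / real n)" if n: "2 \<le> n" for n
    proof -
      have n0: "0 < n" using n by simp
      define W where "W x = end_strips n (x $ 1) * (v1 (x $ 2) + 2 * B / real n) + (v2 (x $ 1) + 2 * B / real n) * end_strips n (x $ 2)" for x :: "real ^ 2"
      have eb: "\<bar>end_strips n s\<bar> \<le> 2" for s using end_strips_bounds[of n s] by simp
      have vb: "\<bar>v1 s + 2 * B / real n\<bar> \<le> V1 + 2 * B / real n" "\<bar>v2 s + 2 * B / real n\<bar> \<le> V2 + 2 * B / real n" if "s \<in> I" for s
        using V(1)[OF that] V(2)[OF that] B(1) n0
        by (auto intro!: order_trans[OF abs_triangle_ineq])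
      note p1 = LINT_Omega_product[of "end_strips n" 2 "\<lambda>t. v1 t + 2 * B / real n" "V1 + 2 * B / real n"]
      note p2 = LINT_Omega_product[of "\<lambda>t. v2 t + 2 * B / real n" "V2 + 2 * B / real n" "end_strips n" 2]
      have W: "integrable ?N W" "(LINT x|?N. W x) = 4 / real n * (side_integrals \<phi> + 4 * B / real n)"
      proof -
        have i1: "integrable ?N (\<lambda>x. end_strips n (x $ 1) * (v1 (x $ 2) + 2 * B / real n))"
          by (rule p1(1)) (use eb vb in auto)
        have i2: "integrable ?N (\<lambda>x. (v2 (x $ 1) + 2 * B / real n) * end_strips n (x $ 2))"
          by (rule p2(1)) (use eb vb in auto)
        show "integrable ?N W" unfolding W_def[abs_def] by (rule Bochner_Integration.integrable_add[OF i1 i2])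
        have "(LINT x|?N. W x) = (LINT x|?N. end_strips n (x $ 1) * (v1 (x $ 2) + 2 * B / real n))
            + (LINT x|?N. (v2 (x $ 1) + 2 * B / real n) * end_strips n (x $ 2))"
          unfolding W_def by (rule Bochner_Integration.integral_add[OF i1 i2])
        also have "(LINT x|?N. end_strips n (x $ 1) * (v1 (x $ 2) + 2 * B / real n))
            = 4 / real n * ((LINT s|?M. v1 s) + 2 * B / real n)"
          by (subst p1(2)) (use eb vb vi in \<open>auto simp: end_strips_integral[OF n] measure_I\<close>)
        also have "(LINT x|?N. (v2 (x $ 1) + 2 * B / real n) * end_strips n (x $ 2))
            = ((LINT s|?M. v2 s) + 2 * B / real n) * (4 / real n)"
          by (subst p2(2)) (use eb vb vi in \<open>auto simp: end_strips_integral[OF n] measure_I\<close>)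
        also have "4 / real n * ((LINT s|?M. v1 s) + 2 * B / real n) + ((LINT s|?M. v2 s) + 2 * B / real n) * (4 / real n)
            = 4 / real n * (side_integrals \<phi> + 4 * B / real n)"
          unfolding sides[symmetric] by (simp add: algebra_simps)
        finally show "(LINT x|?N. W x) = 4 / real n * (side_integrals \<phi> + 4 * B / real n)" .
      qed
      have t: "test_function Omega (\<lambda>x. \<phi> x * ?\<eta> n x)"
        by (intro test_function_mult test_function_box_cutoff \<phi> n0) (simp add: Omega_eq_box)
      have d: "dpartial i (\<lambda>x. \<phi> x * ?\<eta> n x) x = \<phi> x * dpartial i (?\<eta> n) x + dpartial i \<phi> x * ?\<eta> n x" for i x
        by (rule dpartial_mult) (intro smooth_differentiable sm)+
      let ?R = "\<lambda>x. F1 x * (\<phi> x * dpartial ex (?\<eta> n) x) + F2 x * (\<phi> x * dpartial ey (?\<eta> n) x)"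
      have Ri: "integrable ?N ?R"
        by (intro Bochner_Integration.integrable_add Fg smooth_mult sm)
      have S\<eta>: "integrable ?N (\<lambda>x. S x * ?\<eta> n x)"
      proof (rule integrable_times_bounded[OF Si])
        show "?\<eta> n \<in> borel_measurable ?N" by (intro borel_lebesgue_on smooth_borel_measurable sm)
        show "AE x in ?N. \<bar>?\<eta> n x\<bar> \<le> 1" by (simp add: box_cutoff_nonneg box_cutoff_le_1)
      qed
      have "0 = (LINT x|?N. F1 x * dpartial ex (\<lambda>x. \<phi> x * ?\<eta> n x) x + F2 x * dpartial ey (\<lambda>x. \<phi> x * ?\<eta> n x) x)"
        by (rule div0[OF t, symmetric])
      also have "\<dots> = (LINT x|?N. ?R x + S x * ?\<eta> n x)"
        unfolding d S_def by (simp add: algebra_simps)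
      also have "\<dots> = (LINT x|?N. ?R x) + (LINT x|?N. S x * ?\<eta> n x)"
        by (rule Bochner_Integration.integral_add[OF Ri S\<eta>])
      finally have "\<bar>LINT x|?N. S x * ?\<eta> n x\<bar> = \<bar>LINT x|?N. ?R x\<bar>" by linarith
      also have "\<dots> \<le> (LINT x|?N. norm (?R x))" unfolding real_norm_def[symmetric] by (rule integral_norm_bound)
      also have "\<dots> \<le> (LINT x|?N. K * (L * real n) * W x)"
      proof (rule integral_mono_AE)
        show "integrable ?N (\<lambda>x. norm (?R x))" by (rule integrable_norm[OF Ri])
        show "integrable ?N (\<lambda>x. K * (L * real n) * W x)" using W(1) by simp
        have "AE x in ?N. x \<in> Omega" by (rule AE_I2) simp
        then show "AE x in ?N. norm (?R x) \<le> K * (L * real n) * W x"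
          using K(1,2)
        proof eventually_elim
          case (elim x)
          then have x: "0 < x $ 1" "x $ 1 < 1" "0 < x $ 2" "x $ 2 < 1" by (auto simp: Omega_def)
          have vx: "vector [x $ 1, x $ 2] = x" by (simp add: R2_eq_iff)
          have c: "\<bar>cut n s\<bar> \<le> 1" for s using cut_nonneg[of n s] cut_le_1[of n s] by simp
          have e1: "\<bar>\<phi> x\<bar> * end_strips n (x $ 1) \<le> end_strips n (x $ 1) * (v1 (x $ 2) + 2 * B / real n)"
            using end_strips_estimate[OF slice_DERIV(2)[OF \<phi>, of "x $ 2"], of B "x $ 1" n] B(2) x n0
            by (simp add: v1_def vx add.assoc)
          have e2: "\<bar>\<phi> x\<bar> * end_strips n (x $ 2) \<le> end_strips n (x $ 2) * (v2 (x $ 1) + 2 * B / real n)"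
            using end_strips_estimate[OF slice_DERIV(1)[OF \<phi>, of "x $ 1"], of B "x $ 2" n] B(2) x n0
            by (simp add: v2_def vx add.assoc)
          have d1: "\<bar>dpartial ex (?\<eta> n) x\<bar> \<le> (L * real n * end_strips n (x $ 1)) * 1"
            unfolding dpartial_box_cutoff abs_mult using cut_deriv_bound[OF L(2) n0, of "x $ 1"] c
            by (intro mult_mono) auto
          have d2: "\<bar>dpartial ey (?\<eta> n) x\<bar> \<le> 1 * (L * real n * end_strips n (x $ 2))"
            unfolding dpartial_box_cutoff abs_mult using cut_deriv_bound[OF L(2) n0, of "x $ 2"] c
            by (intro mult_mono) auto
          have "norm (?R x) \<le> \<bar>F1 x\<bar> * (\<bar>\<phi> x\<bar> * \<bar>dpartial ex (?\<eta> n) x\<bar>) + \<bar>F2 x\<bar> * (\<bar>\<phi> x\<bar> * \<bar>dpartial ey (?\<eta> n) x\<bar>)"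
            unfolding real_norm_def abs_mult[symmetric] by (rule abs_triangle_ineq)
          also have "\<dots> \<le> K * (\<bar>\<phi> x\<bar> * (L * real n * end_strips n (x $ 1))) + K * (\<bar>\<phi> x\<bar> * (L * real n * end_strips n (x $ 2)))"
            by (intro add_mono mult_mono[OF elim(2) mult_left_mono[OF d1[simplified] abs_ge_zero] K(3)]
                mult_mono[OF elim(3) mult_left_mono[OF d2[simplified] abs_ge_zero] K(3)]) auto
          also have "\<dots> = K * (L * real n) * (\<bar>\<phi> x\<bar> * end_strips n (x $ 1) + \<bar>\<phi> x\<bar> * end_strips n (x $ 2))"
            by (simp add: algebra_simps)
          also have "\<dots> \<le> K * (L * real n) * W x"
            using e1 e2 K(3) L(1) by (intro mult_left_mono) (auto simp: W_def mult.commute)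
          finally show ?case .
        qed
      qed
      also have "\<dots> = K * (L * real n) * (4 / real n * (side_integrals \<phi> + 4 * B / real n))"
        using W(2) by simp
      also have "\<dots> = 4 * K * L * (side_integrals \<phi> + 4 * B / real n)" using n0 by simp
      finally show ?thesis .
    qed
    have lim1: "(\<lambda>n. \<bar>LINT x|?N. S x * ?\<eta> n x\<bar>) \<longlonglongrightarrow> \<bar>LINT x|?N. S x\<bar>"
    proof (rule tendsto_rabs, rule integral_dominated_convergence)
      show "integrable ?N (\<lambda>x. \<bar>S x\<bar>)" using Si by simp
      show "AE x in ?N. (\<lambda>n. S x * ?\<eta> n x) \<longlonglongrightarrow> S x"
      proof (rule AE_I2)
        fix x assume "x \<in> space ?N"
        then have "(\<lambda>n. ?\<eta> n x) \<longlonglongrightarrow> 1" using box_cutoff_tendsto[of 0 One x] by (simp add: Omega_eq_box)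
        from tendsto_mult_left[OF this, of "S x"] show "(\<lambda>n. S x * ?\<eta> n x) \<longlonglongrightarrow> S x" by simp
      qed
      show "AE x in ?N. norm (S x * ?\<eta> n x) \<le> \<bar>S x\<bar>" for n
      proof (rule AE_I2)
        fix x
        have "\<bar>S x\<bar> * \<bar>?\<eta> n x\<bar> \<le> \<bar>S x\<bar> * 1"
          using box_cutoff_nonneg[of 0 One n x] box_cutoff_le_1[of 0 One n x] by (intro mult_left_mono) auto
        then show "norm (S x * ?\<eta> n x) \<le> \<bar>S x\<bar>" by (simp add: abs_mult)
      qed
      show "(\<lambda>x. S x * ?\<eta> n x) \<in> borel_measurable ?N" for n
        using Si borel_lebesgue_on[OF smooth_borel_measurable[OF sm(4)]] by (intro borel_measurable_times) auto
    qed (use Si in auto)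
    have "(\<lambda>n. 4 * B / real n) \<longlonglongrightarrow> 0" by (intro tendsto_divide_0[OF tendsto_const] filterlim_at_top_imp_at_infinity filterlim_real_sequentially)
    then have "(\<lambda>n. 4 * K * L * (side_integrals \<phi> + 4 * B / real n)) \<longlonglongrightarrow> 4 * K * L * (side_integrals \<phi> + 0)"
      by (intro tendsto_mult_left tendsto_add tendsto_const)
    moreover have "eventually (\<lambda>n. \<bar>LINT x|?N. S x * ?\<eta> n x\<bar> \<le> 4 * K * L * (side_integrals \<phi> + 4 * B / real n)) sequentially"
      by (rule eventually_mono[OF eventually_ge_at_top[of 2]]) (rule bound)
    ultimately have "\<bar>LINT x|?N. S x\<bar> \<le> 4 * K * L * (side_integrals \<phi> + 0)"
      using lim1 by (intro tendsto_le[of sequentially]) auto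
    then show ?thesis by (simp add: S_def)
  qed
  show ?thesis by (rule that[OF *])
qed

lemma endpoint_le_integral:
  fixes h :: "real \<Rightarrow> real"
  assumes D: "\<And>s. (h has_real_derivative h' s) (at s)" and c: "continuous_on UNIV h'" and b: "b = 0 \<or> b = 1"
  shows "\<bar>h b\<bar> \<le> (LINT s|leb I. \<bar>h s\<bar> + \<bar>h' s\<bar>)"
proof -
  let ?f = "\<lambda>s. h s + (s - (1 - b)) * h' s"
  have ch: "continuous_on UNIV h" by (intro continuous_at_imp_continuous_on ballI DERIV_isCont[OF D])
  have DD: "((\<lambda>s. (s - (1 - b)) * h s) has_real_derivative ?f s) (at s)" for s
    by (rule derivative_eq_intros D refl | simp)+
  have cf: "continuous_on UNIV ?f" by (intro continuous_intros ch c)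
  have int: "integrable (leb I) k" if "continuous_on UNIV k" for k :: "real \<Rightarrow> real"
    by (rule integrable_lebesgue_on_subset[OF compact_integrable_continuous[of "{0..1}" k]]) (use that in \<open>auto simp: I_def\<close>)
  have "h b = prim ?f 1" using LINT_I_FTC[OF DD cf, of 1] b by auto
  also have "\<dots> = (LINT s|leb I. ?f s)" by (rule prim_one)
  also have "\<bar>\<dots>\<bar> \<le> (LINT s|leb I. norm (?f s))"
    unfolding real_norm_def[symmetric] by (rule integral_norm_bound)
  also have "\<dots> \<le> (LINT s|leb I. \<bar>h s\<bar> + \<bar>h' s\<bar>)"
  proof (rule integral_mono)
    show "integrable (leb I) (\<lambda>s. norm (?f s))" by (rule integrable_norm[OF int[OF cf]])
    show "integrable (leb I) (\<lambda>s. \<bar>h s\<bar> + \<bar>h' s\<bar>)" by (intro int continuous_intros ch c)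
    fix s assume "s \<in> space (leb I)"
    then have "\<bar>s - (1 - b)\<bar> \<le> 1" using b by (auto simp: I_def)
    from mult_right_mono[OF this, of "\<bar>h' s\<bar>"] have "\<bar>(s - (1 - b)) * h' s\<bar> \<le> \<bar>h' s\<bar>" by (simp add: abs_mult)
    then show "norm (?f s) \<le> \<bar>h s\<bar> + \<bar>h' s\<bar>" using abs_triangle_ineq[of "h s" "(s - (1 - b)) * h' s"] by simp
  qed
  finally show ?thesis .
qed

text \<open>The trace inequality for smooth functions, from \<open>endpoint_le_integral\<close> along each line.\<close>

lemma side_integral_le:
  assumes \<phi>: "smooth \<phi>" and b: "b = 0 \<or> b = 1"
  shows "(LINT t|leb I. \<bar>\<phi> (vector [t, b])\<bar>) \<le> (LINT x|leb Omega. \<bar>\<phi> x\<bar>) + (LINT x|leb Omega. \<bar>dpartial ey \<phi> x\<bar>)"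
    and "(LINT t|leb I. \<bar>\<phi> (vector [b, t])\<bar>) \<le> (LINT x|leb Omega. \<bar>\<phi> x\<bar>) + (LINT x|leb Omega. \<bar>dpartial ex \<phi> x\<bar>)"
proof -
  have sm: "smooth (dpartial ex \<phi>)" "smooth (dpartial ey \<phi>)" using \<phi> by (auto intro: smooth_dpartial)
  have si: "integrable (leb Omega) g" if "smooth g" for g using that bounded_Omega by (intro smooth_integrable) auto
  have H: "(\<lambda>x. \<bar>\<phi> x\<bar> + \<bar>g x\<bar>) \<in> borel_measurable borel" "integrable (leb Omega) (\<lambda>x. \<bar>\<phi> x\<bar> + \<bar>g x\<bar>)"
    "(LINT x|leb Omega. \<bar>\<phi> x\<bar> + \<bar>g x\<bar>) = (LINT x|leb Omega. \<bar>\<phi> x\<bar>) + (LINT x|leb Omega. \<bar>g x\<bar>)" if "smooth g" for g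
    using smooth_borel_measurable[OF \<phi>] smooth_borel_measurable[OF that] si[OF \<phi>] si[OF that] by auto
  have c: "continuous_on UNIV (\<lambda>s. dpartial ey \<phi> (vector [t, s]))" "continuous_on UNIV (\<lambda>s. dpartial ex \<phi> (vector [s, t]))" for t
  proof -
    show "continuous_on UNIV (\<lambda>s. dpartial ey \<phi> (vector [t, s]))"
      by (rule continuous_on_compose2[OF smooth_continuous_on[OF sm(2), of UNIV]
          continuous_vector[OF continuous_on_const continuous_on_id]]) simp
    show "continuous_on UNIV (\<lambda>s. dpartial ex \<phi> (vector [s, t]))"
      by (rule continuous_on_compose2[OF smooth_continuous_on[OF sm(1), of UNIV]
          continuous_vector[OF continuous_on_id continuous_on_const]]) simp
  qed
  have "(LINT t|leb I. \<bar>\<phi> (vector [t, b])\<bar>) \<le> (LINT t|leb I. LINT s|leb I. \<bar>\<phi> (vector [t, s])\<bar> + \<bar>dpartial ey \<phi> (vector [t, s])\<bar>)"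
    using smooth_top_integrable(1)[OF \<phi>] Fubini_Omega(4)[OF H(1,2)[OF sm(2)]] endpoint_le_integral[OF slice_DERIV(1)[OF \<phi>] c(1) b]
    by (intro integral_mono) auto
  then show "(LINT t|leb I. \<bar>\<phi> (vector [t, b])\<bar>) \<le> (LINT x|leb Omega. \<bar>\<phi> x\<bar>) + (LINT x|leb Omega. \<bar>dpartial ey \<phi> x\<bar>)"
    unfolding H(3)[OF sm(2), symmetric] Fubini_Omega(1)[OF H(1,2)[OF sm(2)]] .
  have "(LINT t|leb I. \<bar>\<phi> (vector [b, t])\<bar>) \<le> (LINT t|leb I. LINT s|leb I. \<bar>\<phi> (vector [s, t])\<bar> + \<bar>dpartial ex \<phi> (vector [s, t])\<bar>)"
    using smooth_top_integrable(2)[OF \<phi>] Fubini_Omega(5)[OF H(1,2)[OF sm(1)]] endpoint_le_integral[OF slice_DERIV(2)[OF \<phi>] c(2) b]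
    by (intro integral_mono) auto
  then show "(LINT t|leb I. \<bar>\<phi> (vector [b, t])\<bar>) \<le> (LINT x|leb Omega. \<bar>\<phi> x\<bar>) + (LINT x|leb Omega. \<bar>dpartial ex \<phi> x\<bar>)"
    unfolding H(3)[OF sm(1), symmetric] Fubini_Omega(2)[OF H(1,2)[OF sm(1)]] .
qed

text \<open>By the trace inequality, the boundary values of any smooth approximation converge to the
  trace, so one sequence serves all four sides.\<close>

lemma zero_trace_side_limit:
  assumes tr: "has_trace Omega (leb I) \<sigma> z (\<lambda>t. 0)"
    and \<sigma>: "\<exists>b. (b = 0 \<or> b = 1) \<and> (\<sigma> = (\<lambda>t. vector [t, b]) \<or> \<sigma> = (\<lambda>t. vector [b, t]))"
    and \<phi>: "\<And>n::nat. smooth (\<phi> n)" "L1_tendsto (leb Omega) \<phi> z"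
    "\<And>i. i \<in> Basis \<Longrightarrow> L1_tendsto (leb Omega) (\<lambda>n. dpartial i (\<phi> n)) (wderiv Omega [i] z)"
  shows "(\<lambda>n. LINT t|leb I. \<bar>\<phi> n (\<sigma> t)\<bar>) \<longlonglongrightarrow> 0"
proof -
  let ?N = "leb Omega" and ?M = "leb I"
  have zs: "z \<in> sobolev 1 1 Omega" using tr unfolding has_trace_def by blast
  note z = sobolev_11D[OF zs open_Omega]
  obtain \<psi> where \<psi>: "\<And>n::nat. smooth (\<psi> n)" "\<And>n. integrable ?M (\<lambda>t. \<psi> n (\<sigma> t))"
    "L1_tendsto ?N \<psi> z"
    "\<And>i. i \<in> Basis \<Longrightarrow> L1_tendsto ?N (\<lambda>n. dpartial i (\<psi> n)) (wderiv Omega [i] z)"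
    "(\<lambda>n. LINT t|?M. \<bar>\<psi> n (\<sigma> t) - 0\<bar>) \<longlonglongrightarrow> 0"
    by (rule has_trace_approx[OF tr open_Omega bounded_Omega]) (rule that)
  have si: "integrable ?N g" if "smooth g" for g using that bounded_Omega by (intro smooth_integrable) auto
  have ti: "integrable ?M (\<lambda>t. g (\<sigma> t))" if "smooth g" for g
    using \<sigma> smooth_top_integrable[OF that] by auto
  have tri: "L1_dist ?N u v \<le> L1_dist ?N u w + L1_dist ?N v w"
    if "integrable ?N u" "integrable ?N v" "integrable ?N w" for u v w :: "real ^ 2 \<Rightarrow> real"
  proof -
    have "L1_dist ?N u v \<le> (LINT x|?N. \<bar>u x - w x\<bar> + \<bar>v x - w x\<bar>)"
      by (rule integral_mono) (use that in auto)
    then show ?thesis using that by (subst (asm) Bochner_Integration.integral_add) auto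
  qed
  define e where "e u = L1_dist ?N u z + L1_dist ?N (dpartial ex u) (wderiv Omega [ex] z)
      + L1_dist ?N (dpartial ey u) (wderiv Omega [ey] z)" for u
  have e: "(\<lambda>n. e (\<phi> n)) \<longlonglongrightarrow> 0" "(\<lambda>n. e (\<psi> n)) \<longlonglongrightarrow> 0"
    unfolding e_def using tendsto_add[OF tendsto_add[OF \<phi>(2) \<phi>(3)[OF ex_Basis(1)]] \<phi>(3)[OF ex_Basis(2)]]
      tendsto_add[OF tendsto_add[OF \<psi>(3) \<psi>(4)[OF ex_Basis(1)]] \<psi>(4)[OF ex_Basis(2)]] by simp_all
  have le: "(LINT t|?M. \<bar>\<phi> n (\<sigma> t)\<bar>) \<le> (LINT t|?M. \<bar>\<psi> n (\<sigma> t) - 0\<bar>) + (e (\<phi> n) + e (\<psi> n))" for n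
  proof -
    let ?d = "\<lambda>x. \<phi> n x - \<psi> n x"
    have d: "smooth ?d" by (intro smooth_diff \<phi> \<psi>)
    have dd: "dpartial i ?d x = dpartial i (\<phi> n) x - dpartial i (\<psi> n) x" for i x by (simp add: dpartial_diff \<phi>(1) \<psi>(1))
    have "(LINT t|?M. \<bar>\<phi> n (\<sigma> t)\<bar>) \<le> (LINT t|?M. \<bar>\<psi> n (\<sigma> t) - 0\<bar> + \<bar>?d (\<sigma> t)\<bar>)"
      using ti[OF \<phi>(1)] \<psi>(2) by (intro integral_mono) auto
    also have "\<dots> = (LINT t|?M. \<bar>\<psi> n (\<sigma> t) - 0\<bar>) + (LINT t|?M. \<bar>?d (\<sigma> t)\<bar>)"
      using ti[OF \<phi>(1)] \<psi>(2) by (intro Bochner_Integration.integral_add) auto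
    also have "(LINT t|?M. \<bar>?d (\<sigma> t)\<bar>) \<le> (LINT x|?N. \<bar>?d x\<bar>) + (LINT x|?N. \<bar>dpartial ex ?d x\<bar>) + (LINT x|?N. \<bar>dpartial ey ?d x\<bar>)"
    proof -
      have nn: "0 \<le> (LINT x|?N. \<bar>dpartial ex ?d x\<bar>)" "0 \<le> (LINT x|?N. \<bar>dpartial ey ?d x\<bar>)"
        by (intro Bochner_Integration.integral_nonneg; simp)+
      obtain b where b: "b = 0 \<or> b = 1" "\<sigma> = (\<lambda>t. vector [t, b]) \<or> \<sigma> = (\<lambda>t. vector [b, t])" using \<sigma> by blast
      from b(2) show ?thesis
      proof
        assume "\<sigma> = (\<lambda>t. vector [t, b])"
        then have "(LINT t|?M. \<bar>?d (\<sigma> t)\<bar>) = (LINT t|?M. \<bar>?d (vector [t, b])\<bar>)" by simp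
        then show ?thesis using side_integral_le(1)[OF d b(1)] nn by linarith
      next
        assume "\<sigma> = (\<lambda>t. vector [b, t])"
        then have "(LINT t|?M. \<bar>?d (\<sigma> t)\<bar>) = (LINT t|?M. \<bar>?d (vector [b, t])\<bar>)" by simp
        then show ?thesis using side_integral_le(2)[OF d b(1)] nn by linarith
      qed
    qed
    also have "(LINT x|?N. \<bar>?d x\<bar>) \<le> L1_dist ?N (\<phi> n) z + L1_dist ?N (\<psi> n) z"
      by (rule tri[OF si[OF \<phi>(1)] si[OF \<psi>(1)] z(1)])
    also have "(LINT x|?N. \<bar>dpartial ex ?d x\<bar>) \<le> L1_dist ?N (dpartial ex (\<phi> n)) (wderiv Omega [ex] z) + L1_dist ?N (dpartial ex (\<psi> n)) (wderiv Omega [ex] z)"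
      unfolding dd by (intro tri si smooth_dpartial \<phi> \<psi> z) auto
    also have "(LINT x|?N. \<bar>dpartial ey ?d x\<bar>) \<le> L1_dist ?N (dpartial ey (\<phi> n)) (wderiv Omega [ey] z) + L1_dist ?N (dpartial ey (\<psi> n)) (wderiv Omega [ey] z)"
      unfolding dd by (intro tri si smooth_dpartial \<phi> \<psi> z) auto
    finally show ?thesis by (simp add: e_def)
  qed
  show ?thesis
  proof (rule tendsto_sandwich[OF _ _ tendsto_const])
    show "(\<lambda>n. (LINT t|?M. \<bar>\<psi> n (\<sigma> t) - 0\<bar>) + (e (\<phi> n) + e (\<psi> n))) \<longlonglongrightarrow> 0"
      using tendsto_add[OF \<psi>(5) tendsto_add[OF e]] by simp
  qed (use le in auto)
qed

text \<open>Smooth approximations of \<open>z\<close> have small boundary integrals, and the flux of \<open>F\<close> against them is bounded by those.\<close>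

lemma flux_against_zero_trace:
  fixes F1 F2 :: "real ^ 2 \<Rightarrow> real"
  assumes F: "F1 \<in> borel_measurable (leb Omega)" "F2 \<in> borel_measurable (leb Omega)"
    and K: "AE x in leb Omega. \<bar>F1 x\<bar> \<le> K" "AE x in leb Omega. \<bar>F2 x\<bar> \<le> K" "0 \<le> K"
    and div0: "\<And>\<psi>. test_function Omega \<psi> \<Longrightarrow> (LINT x|leb Omega. F1 x * dpartial ex \<psi> x + F2 x * dpartial ey \<psi> x) = 0"
    and z: "z \<in> sobolev0_Omega p"
  shows "(LINT x|leb Omega. F1 x * wderiv Omega [ex] z x + F2 x * wderiv Omega [ey] z x) = 0"
proof -
  let ?N = "leb Omega"
  have tr: "has_trace Omega (leb I) \<sigma> z (\<lambda>t. 0)" if "\<sigma> \<in> insert top_side Sigma_sides" for \<sigma>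
    using z that by (auto simp: sobolev0_Omega_def)
  have zs: "z \<in> sobolev 1 1 Omega" using tr[of top_side] unfolding has_trace_def by blast
  note zz = sobolev_11D[OF zs open_Omega]
  obtain C where C: "\<And>\<phi>. smooth \<phi> \<Longrightarrow> \<bar>LINT x|?N. F1 x * dpartial ex \<phi> x + F2 x * dpartial ey \<phi> x\<bar> \<le> C * side_integrals \<phi>"
    by (rule boundary_flux_bound[OF F K div0]) (assumption | rule that)+
  obtain \<phi> where \<phi>: "\<And>n::nat. smooth (\<phi> n)" "L1_tendsto ?N \<phi> z"
    "\<And>i. i \<in> Basis \<Longrightarrow> L1_tendsto ?N (\<lambda>n. dpartial i (\<phi> n)) (wderiv Omega [i] z)"
    by (rule smooth_dense_W11[OF open_Omega convex_Omega Omega_nonempty zz]) (assumption | rule that)+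
  have top: "top_side = (\<lambda>t. vector [t, 1])" by (simp add: top_side_def fun_eq_iff)
  have lims: "(\<lambda>n. LINT t|leb I. \<bar>\<phi> n (vector [0, t])\<bar>) \<longlonglongrightarrow> 0" "(\<lambda>n. LINT t|leb I. \<bar>\<phi> n (vector [1, t])\<bar>) \<longlonglongrightarrow> 0"
    "(\<lambda>n. LINT t|leb I. \<bar>\<phi> n (vector [t, 0])\<bar>) \<longlonglongrightarrow> 0" "(\<lambda>n. LINT t|leb I. \<bar>\<phi> n (vector [t, 1])\<bar>) \<longlonglongrightarrow> 0"
  proof -
    have side: "(\<lambda>n. LINT t|leb I. \<bar>\<phi> n (\<sigma> t)\<bar>) \<longlonglongrightarrow> 0"
      if "\<sigma> \<in> insert top_side Sigma_sides" for \<sigma>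
    proof (rule zero_trace_side_limit[OF tr[OF that] _ \<phi>])
      from that consider "\<sigma> = (\<lambda>t. vector [t, 1])" | "\<sigma> = (\<lambda>t. vector [t, 0])" | "\<sigma> = (\<lambda>t. vector [0, t])" | "\<sigma> = (\<lambda>t. vector [1, t])"
        unfolding Sigma_sides_def top by blast
      then show "\<exists>b. (b = 0 \<or> b = 1) \<and> (\<sigma> = (\<lambda>t. vector [t, b]) \<or> \<sigma> = (\<lambda>t. vector [b, t]))"
        by cases blast+
    qed assumption
    show "(\<lambda>n. LINT t|leb I. \<bar>\<phi> n (vector [0, t])\<bar>) \<longlonglongrightarrow> 0"
      by (rule side[of "\<lambda>t. vector [0, t]"]) (simp add: Sigma_sides_def)
    show "(\<lambda>n. LINT t|leb I. \<bar>\<phi> n (vector [1, t])\<bar>) \<longlonglongrightarrow> 0"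
      by (rule side[of "\<lambda>t. vector [1, t]"]) (simp add: Sigma_sides_def)
    show "(\<lambda>n. LINT t|leb I. \<bar>\<phi> n (vector [t, 0])\<bar>) \<longlonglongrightarrow> 0"
      by (rule side[of "\<lambda>t. vector [t, 0]"]) (simp add: Sigma_sides_def)
    show "(\<lambda>n. LINT t|leb I. \<bar>\<phi> n (vector [t, 1])\<bar>) \<longlonglongrightarrow> 0"
      by (rule side[of "\<lambda>t. vector [t, 1]"]) (simp add: top)
  qed
  have sides: "(\<lambda>n. C * side_integrals (\<phi> n)) \<longlonglongrightarrow> 0"
    using tendsto_mult_left[OF tendsto_add[OF tendsto_add[OF tendsto_add[OF lims(1) lims(2)] lims(3)] lims(4)], of C]
    unfolding side_integrals_def by simp
  have 0: "(\<lambda>n. LINT x|?N. F1 x * dpartial ex (\<phi> n) x + F2 x * dpartial ey (\<phi> n) x) \<longlonglongrightarrow> 0"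
  proof (rule Lim_null_comparison[OF always_eventually sides], rule allI)
    fix n
    show "norm (LINT x|?N. F1 x * dpartial ex (\<phi> n) x + F2 x * dpartial ey (\<phi> n) x) \<le> C * side_integrals (\<phi> n)"
      unfolding real_norm_def by (rule C[OF \<phi>(1)])
  qed
  have si: "integrable ?N g" if "smooth g" for g using that bounded_Omega by (intro smooth_integrable) auto
  have sd: "smooth (dpartial ex (\<phi> n))" "smooth (dpartial ey (\<phi> n))" for n using \<phi>(1) by (auto intro: smooth_dpartial)
  have 1: "(\<lambda>n. (LINT x|?N. dpartial ex (\<phi> n) x * F1 x) + (LINT x|?N. dpartial ey (\<phi> n) x * F2 x))
      \<longlonglongrightarrow> (LINT x|?N. wderiv Omega [ex] z x * F1 x) + (LINT x|?N. wderiv Omega [ey] z x * F2 x)"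
    using L1_tendsto_times_bounded[OF si[OF sd(1)] zz(3)[OF ex_Basis(1)] \<phi>(3)[OF ex_Basis(1)] F(1) K(1)]
      L1_tendsto_times_bounded[OF si[OF sd(2)] zz(3)[OF ex_Basis(2)] \<phi>(3)[OF ex_Basis(2)] F(2) K(2)]
    by (rule tendsto_add)
  have split: "(LINT x|?N. F1 x * u x + F2 x * w x) = (LINT x|?N. u x * F1 x) + (LINT x|?N. w x * F2 x)"
    if "integrable ?N u" "integrable ?N w" for u w
    using integrable_times_bounded[OF that(1) F(1) K(1)] integrable_times_bounded[OF that(2) F(2) K(2)]
    by (simp add: mult.commute)
  from 0 1 show ?thesis
    unfolding split[OF si[OF sd(1)] si[OF sd(2)]] split[OF zz(3)[OF ex_Basis(1)] zz(3)[OF ex_Basis(2)]]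
    by (rule LIMSEQ_unique[rotated])
qed

section \<open>The elliptic operator in nondivergence form\<close>

lemma smooth_id_sq: "smooth (\<lambda>t::real. t)" "smooth (\<lambda>t::real. t * t)"
proof -
  show *: "smooth (\<lambda>t::real. t)" using smooth_inner[of "1::real"] by simp
  show "smooth (\<lambda>t::real. t * t)" by (rule smooth_mult[OF * *])
qed

lemma separable_L1:
  fixes u :: "nat \<Rightarrow> real \<Rightarrow> real" and P :: "real \<Rightarrow> real"
  assumes P: "smooth P" "\<forall>t\<in>I. \<bar>P t\<bar> \<le> C" and C: "0 \<le> C"
    and U: "integrable (leb I) U"
  shows "integrable (leb Omega) (\<lambda>x. U (x $ 1) * P (x $ 2))"
    and "\<And>n. integrable (leb I) (u n) \<Longrightarrow> (LINT x|leb Omega. \<bar>u n (x $ 1) * P (x $ 2) - U (x $ 1) * P (x $ 2)\<bar>)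
      \<le> C * L1_dist (leb I) (u n) U"
proof -
  let ?N = "leb Omega"
  have PC: "continuous_on UNIV P" using P(1) by (rule smooth_continuous_on)
  have "continuous_on UNIV (\<lambda>x::real ^ 2. P (x $ 2))"
    by (rule continuous_on_compose2[OF PC]) (auto intro!: continuous_intros)
  then have m: "(\<lambda>x::real ^ 2. P (x $ 2)) \<in> borel_measurable ?N" by (rule continuous_lebesgue_measurable)
  have b: "\<bar>P (x $ 2)\<bar> \<le> C" if "x \<in> Omega" for x :: "real ^ 2" using P(2) that by (auto simp: Omega_def I_def)
  have bd: "AE x in ?N. \<bar>P (x $ 2)\<bar> \<le> C" by (rule AE_I2) (use b in \<open>simp add: space_restrict_space\<close>)
  have int: "integrable ?N (\<lambda>x. h (x $ 1) * P (x $ 2))" if "integrable (leb I) h" for h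
    by (rule integrable_times_bounded[OF first_coordinate_integrable(1)[OF that] m bd])
  show "integrable ?N (\<lambda>x. U (x $ 1) * P (x $ 2))" by (rule int[OF U])
  fix n assume u: "integrable (leb I) (u n)"
  have d: "integrable (leb I) (\<lambda>t. u n t - U t)" using u U by simp
  have d': "integrable (leb I) (\<lambda>t. C * \<bar>u n t - U t\<bar>)" using d by simp
  have "(LINT x|?N. \<bar>u n (x $ 1) * P (x $ 2) - U (x $ 1) * P (x $ 2)\<bar>) \<le> (LINT x|?N. C * \<bar>u n (x $ 1) - U (x $ 1)\<bar>)"
  proof (rule integral_mono)
    show "integrable ?N (\<lambda>x. \<bar>u n (x $ 1) * P (x $ 2) - U (x $ 1) * P (x $ 2)\<bar>)"
      using int[OF u] int[OF U] by simp
    show "integrable ?N (\<lambda>x. C * \<bar>u n (x $ 1) - U (x $ 1)\<bar>)" by (rule first_coordinate_integrable(1)[OF d'])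
    fix x assume "x \<in> space ?N"
    then have "\<bar>P (x $ 2)\<bar> \<le> C" using b by (simp add: space_restrict_space)
    then have "\<bar>u n (x $ 1) - U (x $ 1)\<bar> * \<bar>P (x $ 2)\<bar> \<le> \<bar>u n (x $ 1) - U (x $ 1)\<bar> * C" by (intro mult_left_mono) auto
    then show "\<bar>u n (x $ 1) * P (x $ 2) - U (x $ 1) * P (x $ 2)\<bar> \<le> C * \<bar>u n (x $ 1) - U (x $ 1)\<bar>"
      by (simp add: left_diff_distrib[symmetric] abs_mult mult.commute)
  qed
  also have "\<dots> = (LINT t|leb I. C * \<bar>u n t - U t\<bar>)" by (rule first_coordinate_integrable(2)[OF d'])
  finally show "(LINT x|?N. \<bar>u n (x $ 1) * P (x $ 2) - U (x $ 1) * P (x $ 2)\<bar>) \<le> C * L1_dist (leb I) (u n) U" by simp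
qed

lemma separable_smooth:
  fixes u P :: "real \<Rightarrow> real"
  assumes u: "smooth u" and P: "smooth P"
  shows "smooth (\<lambda>x::real ^ 2. u (x $ 1) * P (x $ 2))"
    and "dpartial ex (\<lambda>x::real ^ 2. u (x $ 1) * P (x $ 2)) = (\<lambda>x. dpartial 1 u (x $ 1) * P (x $ 2))"
    and "dpartial ey (\<lambda>x::real ^ 2. u (x $ 1) * P (x $ 2)) = (\<lambda>x. u (x $ 1) * dpartial 1 P (x $ 2))"
proof -
  have s: "smooth (\<lambda>x::real ^ 2. u (x $ 1))" "smooth (\<lambda>x::real ^ 2. P (x $ 2))"
    using smooth_ridge[OF u, of 0 "axis 1 1 :: real ^ 2"] smooth_ridge[OF P, of 0 "axis 2 1 :: real ^ 2"] by simp_all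
  show "smooth (\<lambda>x::real ^ 2. u (x $ 1) * P (x $ 2))" by (rule smooth_mult[OF s])
  have d: "dpartial i (\<lambda>x::real ^ 2. u (x $ 1)) x = i $ 1 * dpartial 1 u (x $ 1)"
    "dpartial i (\<lambda>x::real ^ 2. P (x $ 2)) x = i $ 2 * dpartial 1 P (x $ 2)" for i x
    using dpartial_ridge[OF u, of i 0 "axis 1 1 :: real ^ 2" x] dpartial_ridge[OF P, of i 0 "axis 2 1 :: real ^ 2" x] by simp_all
  note dm = dpartial_mult[OF smooth_differentiable[OF s(1)] smooth_differentiable[OF s(2)], unfolded d]
  show "dpartial ex (\<lambda>x::real ^ 2. u (x $ 1) * P (x $ 2)) = (\<lambda>x. dpartial 1 u (x $ 1) * P (x $ 2))"
    by (rule ext, subst dm) (simp add: axis_def)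
  show "dpartial ey (\<lambda>x::real ^ 2. u (x $ 1) * P (x $ 2)) = (\<lambda>x. u (x $ 1) * dpartial 1 P (x $ 2))"
    by (rule ext, subst dm) (simp add: axis_def)
qed

lemma tendsto_0_le:
  fixes f :: "nat \<Rightarrow> real"
  assumes "g \<longlonglongrightarrow> 0" "\<And>n. 0 \<le> f n" "\<And>n. f n \<le> C * g n"
  shows "f \<longlonglongrightarrow> 0"
  by (rule tendsto_sandwich[OF always_eventually always_eventually tendsto_const tendsto_mult_right_zero[OF assms(1), of C]])
    (use assms in auto)

text \<open>The entries of \<open>A[\<gamma>]\<close> are sums of such products, and smooth products have classical derivatives. For the second
  direction \<open>u\<close> is approximated in \<open>L\<^sup>1\<close> only.\<close>

lemma separable_weak_deriv:
  fixes u P :: "real \<Rightarrow> real"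
  assumes P: "smooth P" "\<forall>t\<in>I. \<bar>P t\<bar> \<le> C" "\<forall>t\<in>I. \<bar>dpartial 1 P t\<bar> \<le> C" and C: "0 \<le> C"
    and u: "integrable (leb I) u"
  shows "integrable (leb I) u' \<Longrightarrow> weak_deriv I [1] u u' \<Longrightarrow>
      weak_deriv Omega [ex] (\<lambda>x. u (x $ 1) * P (x $ 2)) (\<lambda>x. u' (x $ 1) * P (x $ 2))"
    and "weak_deriv Omega [ey] (\<lambda>x. u (x $ 1) * P (x $ 2)) (\<lambda>x. u (x $ 1) * dpartial 1 P (x $ 2))"
proof -
  have P': "smooth (dpartial 1 P)" using P(1) by (rule smooth_dpartial) simp
  have si: "integrable (leb I) g" if "smooth g" for g :: "real \<Rightarrow> real" using that bounded_I by (intro smooth_integrable) auto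
  have s1: "smooth (dpartial 1 g)" if "smooth g" for g :: "real \<Rightarrow> real" using that by (rule smooth_dpartial) simp
  have lim: "(\<lambda>n. LINT x|leb Omega. \<bar>f n (x $ 1) * Q (x $ 2) - F (x $ 1) * Q (x $ 2)\<bar>) \<longlonglongrightarrow> 0"
    if "smooth Q" "\<forall>t\<in>I. \<bar>Q t\<bar> \<le> C" "integrable (leb I) F" "\<And>n. smooth (f n)"
      "L1_tendsto (leb I) f F" for Q F and f :: "nat \<Rightarrow> real \<Rightarrow> real"
    by (rule tendsto_0_le[OF that(5), of _ C], simp, rule separable_L1(2)[OF that(1,2) C that(3), where u = f], rule si[OF that(4)])
  have w: "weak_deriv Omega [i] (\<lambda>x. g (x $ 1) * P (x $ 2)) (dpartial i (\<lambda>x. g (x $ 1) * P (x $ 2)))"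
    if "smooth g" "i \<in> Basis" for g i
    by (rule weak_deriv_smooth[OF separable_smooth(1)[OF that(1) P(1)] that(2) open_Omega])
  {
    assume u': "integrable (leb I) u'" and wd: "weak_deriv I [1] u u'"
    obtain f where f: "\<And>n::nat. smooth (f n)" "L1_tendsto (leb I) f u"
      "L1_tendsto (leb I) (\<lambda>n. dpartial 1 (f n)) u'"
      using W11_I_approx[OF u u' wd] by blast
    have w1: "weak_deriv Omega [ex] (\<lambda>x. f n (x $ 1) * P (x $ 2)) (\<lambda>x. dpartial 1 (f n) (x $ 1) * P (x $ 2))" for n
      using w[OF f(1) ex_Basis(1), of n] unfolding separable_smooth(2)[OF f(1) P(1)] .
    show "weak_deriv Omega [ex] (\<lambda>x. u (x $ 1) * P (x $ 2)) (\<lambda>x. u' (x $ 1) * P (x $ 2))"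
      by (rule weak_deriv_limit[OF open_Omega ex_Basis(1) w1
          separable_L1(1)[OF P(1,2) C si[OF f(1)]] separable_L1(1)[OF P(1,2) C u] lim[OF P(1,2) u f(1,2)]
          separable_L1(1)[OF P(1,2) C si[OF s1[OF f(1)]]] separable_L1(1)[OF P(1,2) C u'] lim[OF P(1,2) u' s1[OF f(1)] f(3)]])
  }
  \<comment> \<open>The derivatives of smooth approximations of a primitive of \<open>u\<close> are smooth approximations of \<open>u\<close>.\<close>
  obtain f where f: "\<And>n::nat. smooth (f n)" "L1_tendsto (leb I) (\<lambda>n. dpartial 1 (f n)) u"
    by (rule W11_I_approx[OF integrable_prim[OF u] u weak_deriv_prim[OF u]]) (rule that)
  have w2: "weak_deriv Omega [ey] (\<lambda>x. dpartial 1 (f n) (x $ 1) * P (x $ 2)) (\<lambda>x. dpartial 1 (f n) (x $ 1) * dpartial 1 P (x $ 2))" for n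
    using w[OF s1[OF f(1)] ex_Basis(2), of n] unfolding separable_smooth(3)[OF s1[OF f(1)] P(1)] .
  show "weak_deriv Omega [ey] (\<lambda>x. u (x $ 1) * P (x $ 2)) (\<lambda>x. u (x $ 1) * dpartial 1 P (x $ 2))"
    by (rule weak_deriv_limit[OF open_Omega ex_Basis(2) w2
        separable_L1(1)[OF P(1,2) C si[OF s1[OF f(1)]]] separable_L1(1)[OF P(1,2) C u] lim[OF P(1,2) u s1[OF f(1)] f(2)]
        separable_L1(1)[OF P' P(3) C si[OF s1[OF f(1)]]] separable_L1(1)[OF P' P(3) C u] lim[OF P' P(3) u s1[OF f(1)] f(2)]])
qed

lemma W12_derivs:
  assumes w: "w \<in> sobolev 2 p Omega" and p: "1 \<le> p" and ij: "i \<in> Basis" "j \<in> Basis"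
  shows "weak_deriv Omega [j] (wderiv Omega [i] w) (wderiv Omega [i, j] w)"
    and "integrable (leb Omega) (wderiv Omega [i] w)" "integrable (leb Omega) (wderiv Omega [i, j] w)"
    and "wderiv Omega [i] w \<in> sobolev 1 1 Omega"
proof -
  note s = sobolev_weak_deriv[OF w open_Omega]
  have a: "weak_deriv Omega [j] (wderiv Omega [i] w) (wderiv Omega [i, j] w)" if "j \<in> Basis" for j
    by (rule weak_deriv_step[OF s(1) s(1) that]) (use ij that in simp_all)
  have b: "integrable (leb Omega) (wderiv Omega [i] w)"
    using s(2)[of "[i]"] ij by (intro Lspace_integrable[OF _ finite_measure_Omega p]) auto
  have c: "integrable (leb Omega) (wderiv Omega [i, j] w)" if "j \<in> Basis" for j
    using s(2)[of "[i, j]"] ij that by (intro Lspace_integrable[OF _ finite_measure_Omega p]) auto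
  show "weak_deriv Omega [j] (wderiv Omega [i] w) (wderiv Omega [i, j] w)"
    "integrable (leb Omega) (wderiv Omega [i] w)" "integrable (leb Omega) (wderiv Omega [i, j] w)"
    by (rule a[OF ij(2)] b c[OF ij(2)])+
  show "wderiv Omega [i] w \<in> sobolev 1 1 Omega" by (rule sobolev_11I[OF open_Omega b a c])
qed

text \<open>The operator \<open>div (A[\<gamma>] \<nabla>w)\<close> after differentiating the products. The first column of \<open>A[\<gamma>]\<close> is divergence free, so
  only \<open>\<partial>\<^sub>2 w\<close> appears among the first-order terms.\<close>

definition ellip :: "(real \<Rightarrow> real) \<Rightarrow> (real ^ 2 \<Rightarrow> real) \<Rightarrow> real ^ 2 \<Rightarrow> real" where
  "ellip \<gamma> w x = (let s = \<gamma> (x $ 1); r = d1 \<gamma> (x $ 1); b = x $ 2 in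
     (1 + s) * wderiv Omega [ex, ex] w x - r * b * wderiv Omega [ey, ex] w x - r * b * wderiv Omega [ex, ey] w x
     + (1 + (r * b)\<^sup>2) / (1 + s) * wderiv Omega [ey, ey] w x
     + (2 * r\<^sup>2 * b / (1 + s) - d2 \<gamma> (x $ 1) * b) * wderiv Omega [ey] w x)"

lemma A_vec: "A \<gamma> x *v z = vector [(1 + \<gamma> (x $ 1)) * z $ 1 - d1 \<gamma> (x $ 1) * x $ 2 * z $ 2,
    - d1 \<gamma> (x $ 1) * x $ 2 * z $ 1 + (1 + (d1 \<gamma> (x $ 1) * x $ 2)\<^sup>2) / (1 + \<gamma> (x $ 1)) * z $ 2]" for z :: "real ^ 2"
  unfolding R2_eq_iff A_def A_mat_def matrix_vector_mult_def vec_lambda_beta sum_2 vector_2 by simp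

lemma grad_nth: "grad w x $ 1 = wderiv Omega [ex] w x" "grad w x $ 2 = wderiv Omega [ey] w x"
  by (simp_all add: grad_def)

abbreviation (input) small_coeffs :: "(real \<Rightarrow> real) \<Rightarrow> bool" where
  "small_coeffs \<gamma> \<equiv> AE t in leb I. \<bar>\<gamma> t\<bar> \<le> 1 / 4 \<and> \<bar>d1 \<gamma> t\<bar> \<le> 1 / 2 \<and> \<bar>d2 \<gamma> t\<bar> \<le> 1"

abbreviation (input) close_coeffs :: "real \<Rightarrow> (real \<Rightarrow> real) \<Rightarrow> (real \<Rightarrow> real) \<Rightarrow> bool" where
  "close_coeffs D \<gamma> \<eta> \<equiv> AE t in leb I. \<bar>\<gamma> t - \<eta> t\<bar> \<le> D / 4 \<and> \<bar>d1 \<gamma> t - d1 \<eta> t\<bar> \<le> D / 2 \<and> \<bar>d2 \<gamma> t - d2 \<eta> t\<bar> \<le> D"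

text \<open>By these bounds \<open>1 + \<gamma> \<ge> 3/4\<close>, which keeps the quotient in \<open>A[\<gamma>]\<close> under control.\<close>

lemma regular_gammas_bounds:
  assumes "\<gamma> \<in> sobolev 2 \<infinity> I" "\<gamma> \<in> sobolev0_I \<infinity>" "AE t in leb I. \<bar>d2 \<gamma> t\<bar> \<le> 1"
  shows "small_coeffs \<gamma>"
  using zero_trace_second_order_bounds[OF assms] assms(3) by auto

text \<open>The product rule applies to each entry of \<open>A[\<gamma>]\<close>, the last one split as \<open>n1(x\<^sub>1) + n2(x\<^sub>1) x\<^sub>2\<^sup>2\<close>.\<close>

lemma divergence_formula:
  assumes \<gamma>: "\<gamma> \<in> sobolev 2 \<infinity> I" "\<gamma> \<in> sobolev0_I \<infinity>" "AE t in leb I. \<bar>d2 \<gamma> t\<bar> \<le> 1"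
    and w: "w \<in> sobolev 2 p Omega" and p: "1 \<le> p"
  shows "has_weak_div Omega (\<lambda>x. A \<gamma> x *v grad w x) (ellip \<gamma> w)"
    and "integrable (leb Omega) (\<lambda>x. A \<gamma> x *v grad w x)"
proof -
  let ?N = "leb Omega"
  let ?w = "\<lambda>is. wderiv Omega is w"
  note bd = regular_gammas_bounds[OF \<gamma>]
  note D = I_derivs[OF \<gamma>(1)]
  have m[measurable]: "\<gamma> \<in> borel_measurable (leb I)" "d1 \<gamma> \<in> borel_measurable (leb I)" "d2 \<gamma> \<in> borel_measurable (leb I)"
    using sobolev_Lspace[OF \<gamma>(1) open_I] D(4,5) by (auto dest: Lspace_measurable)
  have int: "integrable (leb I) \<gamma>" "integrable (leb I) (d1 \<gamma>)" "integrable (leb I) (d2 \<gamma>)"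
    by (rule integrable_I_bounded[OF m(1), of "1/4"], use bd in auto) (rule integrable_I_bounded[OF m(2), of "1/2"], use bd in auto,
      rule integrable_I_bounded[OF m(3), of 1], use bd in auto)
  define n1 n2 where "n1 = (\<lambda>t. 1 / (1 + \<gamma> t))" and "n2 = (\<lambda>t. (d1 \<gamma> t)\<^sup>2 / (1 + \<gamma> t))"
  have nm[measurable]: "n1 \<in> borel_measurable (leb I)" "n2 \<in> borel_measurable (leb I)"
    unfolding n1_def n2_def by measurable
  have nb: "AE t in leb I. \<bar>n1 t\<bar> \<le> 2 \<and> \<bar>n2 t\<bar> \<le> 1"
    using bd
  proof eventually_elim
    case (elim t)
    have "3 / 4 \<le> 1 + \<gamma> t" using elim by linarith
    moreover have "(d1 \<gamma> t)\<^sup>2 \<le> (1 / 2)\<^sup>2" using elim by (intro power2_le_iff_abs_le[THEN iffD2]) auto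
    ultimately show ?case unfolding n1_def n2_def by (simp add: abs_if field_simps power2_eq_square)
  qed
  have nint: "integrable (leb I) n1" "integrable (leb I) n2"
    by (rule integrable_I_bounded[OF nm(1), of 2], use nb in auto) (rule integrable_I_bounded[OF nm(2), of 1], use nb in auto)
  note one = smooth_const[of "1::real"] and sq = smooth_id_sq
  have dsq: "dpartial 1 (\<lambda>t::real. t) = (\<lambda>t. 1)" "dpartial 1 (\<lambda>t::real. t * t) = (\<lambda>t. 2 * t)"
    by (rule ext, rule dpartial_realI, auto intro!: derivative_eq_intros)+
  have wd1: "weak_deriv I [1] (\<lambda>t. 1 + \<gamma> t) (d1 \<gamma>)"
    using weak_deriv_add[OF weak_deriv_smooth[OF one _ open_I, of 1] D(1) open_I] by simp
  have ax: "weak_deriv Omega [ex] (\<lambda>x. 1 + \<gamma> (x $ 1)) (\<lambda>x. d1 \<gamma> (x $ 1))"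
    using separable_weak_deriv(1)[OF one, of 1 "\<lambda>t. 1 + \<gamma> t" "d1 \<gamma>"] int wd1 by simp
  have bx: "weak_deriv Omega [ex] (\<lambda>x. d1 \<gamma> (x $ 1) * x $ 2) (\<lambda>x. d2 \<gamma> (x $ 1) * x $ 2)"
    by (rule separable_weak_deriv(1)[OF sq(1), of 1]) (use int D(3) in \<open>auto simp: I_def dsq\<close>)
  have "by": "weak_deriv Omega [ey] (\<lambda>x. d1 \<gamma> (x $ 1) * x $ 2) (\<lambda>x. d1 \<gamma> (x $ 1))"
    using separable_weak_deriv(2)[OF sq(1), of 1 "d1 \<gamma>"] int by (auto simp: I_def dsq)
  have c1: "weak_deriv Omega [ey] (\<lambda>x. n1 (x $ 1)) (\<lambda>x. 0)"
    using separable_weak_deriv(2)[OF one, of 1 n1] nint by simp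
  have tt: "t * t \<le> 2" if "0 < t" "t < 1" for t :: real using mult_le_one[of t t] that by simp
  have c2: "weak_deriv Omega [ey] (\<lambda>x. n2 (x $ 1) * (x $ 2 * x $ 2)) (\<lambda>x. n2 (x $ 1) * (2 * x $ 2))"
    by (rule separable_weak_deriv(2)[OF sq(2), of 2 n2, unfolded dsq]) (use nint tt in \<open>auto simp: I_def abs_mult\<close>)
  have cy: "weak_deriv Omega [ey] (\<lambda>x. n1 (x $ 1) + n2 (x $ 1) * (x $ 2 * x $ 2)) (\<lambda>x. n2 (x $ 1) * (2 * x $ 2))"
    using weak_deriv_add[OF c1 c2 open_Omega] by simp
  have box: "AE x in ?N. 0 < x $ 2 \<and> x $ 2 < 1" by (rule AE_I2) (simp add: space_restrict_space Omega_def)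
  have bnds: "AE x in ?N. \<bar>1 + \<gamma> (x $ 1)\<bar> \<le> 4 \<and> \<bar>d1 \<gamma> (x $ 1)\<bar> \<le> 4 \<and> \<bar>d1 \<gamma> (x $ 1) * x $ 2\<bar> \<le> 4 \<and> \<bar>d2 \<gamma> (x $ 1) * x $ 2\<bar> \<le> 4
      \<and> \<bar>n1 (x $ 1) + n2 (x $ 1) * (x $ 2 * x $ 2)\<bar> \<le> 4 \<and> \<bar>n2 (x $ 1) * (2 * x $ 2)\<bar> \<le> 4"
    using AE_first_coordinate[OF bd] AE_first_coordinate[OF nb] box
  proof eventually_elim
    case (elim x)
    have le: "\<bar>c * t\<bar> \<le> B" if "\<bar>c\<bar> \<le> B" "0 \<le> t" "t \<le> 1" for c t B :: real
      using that mult_left_le[of t "\<bar>c\<bar>"] by (simp add: abs_mult)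
    have "x $ 2 * x $ 2 \<le> 1" "0 \<le> x $ 2 * x $ 2" using elim by (auto intro: mult_le_one)
    then have n: "\<bar>n2 (x $ 1) * (x $ 2 * x $ 2)\<bar> \<le> 1" using elim by (intro le) auto
    have "\<bar>n2 (x $ 1) * x $ 2\<bar> \<le> 1" using elim by (intro le) auto
    then have "\<bar>n2 (x $ 1) * (2 * x $ 2)\<bar> \<le> 4" by (simp add: mult.left_commute abs_mult)
    moreover have "\<bar>n1 (x $ 1) + n2 (x $ 1) * (x $ 2 * x $ 2)\<bar> \<le> 4" using elim n by linarith
    moreover have "\<bar>d1 \<gamma> (x $ 1) * x $ 2\<bar> \<le> 4" by (rule le) (use elim in auto)
    moreover have "\<bar>d2 \<gamma> (x $ 1) * x $ 2\<bar> \<le> 4" by (rule le) (use elim in auto)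
    moreover have "\<bar>1 + \<gamma> (x $ 1)\<bar> \<le> 4" "\<bar>d1 \<gamma> (x $ 1)\<bar> \<le> 4" using elim by auto
    ultimately show ?case by blast
  qed
  note mult = weak_deriv_mult[OF open_Omega convex_Omega bounded_Omega Omega_nonempty]
  note W = W12_derivs[OF w p]
  have bnds': "AE x in ?N. \<bar>1 + \<gamma> (x $ 1)\<bar> \<le> 4" "AE x in ?N. \<bar>d1 \<gamma> (x $ 1)\<bar> \<le> 4" "AE x in ?N. \<bar>d1 \<gamma> (x $ 1) * x $ 2\<bar> \<le> 4"
    "AE x in ?N. \<bar>d2 \<gamma> (x $ 1) * x $ 2\<bar> \<le> 4" "AE x in ?N. \<bar>n1 (x $ 1) + n2 (x $ 1) * (x $ 2 * x $ 2)\<bar> \<le> 4" "AE x in ?N. \<bar>n2 (x $ 1) * (2 * x $ 2)\<bar> \<le> 4"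
    using bnds unfolding AE_conj_iff by blast+
  have M: "weak_deriv Omega [i] (\<lambda>x. ?w [k] x * a x) (\<lambda>x. ?w [k] x * a' x + ?w [k, i] x * a x)" "integrable ?N (\<lambda>x. ?w [k] x * a x)"
    if "i \<in> Basis" "k \<in> Basis" "weak_deriv Omega [i] a a'" "AE x in ?N. \<bar>a x\<bar> \<le> 4" "AE x in ?N. \<bar>a' x\<bar> \<le> 4" for i k a a'
    by (rule mult(1,2)[OF that(1,3,4,5) W(2)[OF that(2,2)] W(1)[OF that(2)] W(3)[OF that(2)]]; assumption)+
  have f11: "weak_deriv Omega [ex] (\<lambda>x. ?w [ex] x * (1 + \<gamma> (x $ 1))) (\<lambda>x. ?w [ex] x * d1 \<gamma> (x $ 1) + ?w [ex, ex] x * (1 + \<gamma> (x $ 1)))"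
    and i11: "integrable ?N (\<lambda>x. ?w [ex] x * (1 + \<gamma> (x $ 1)))"
    by (rule M(1)[OF ex_Basis(1) ex_Basis(1) ax bnds'(1) bnds'(2)], rule M(2)[OF ex_Basis(1) ex_Basis(1) ax bnds'(1) bnds'(2)])
  have f12: "weak_deriv Omega [ex] (\<lambda>x. ?w [ey] x * (d1 \<gamma> (x $ 1) * x $ 2)) (\<lambda>x. ?w [ey] x * (d2 \<gamma> (x $ 1) * x $ 2) + ?w [ey, ex] x * (d1 \<gamma> (x $ 1) * x $ 2))"
    and i12: "integrable ?N (\<lambda>x. ?w [ey] x * (d1 \<gamma> (x $ 1) * x $ 2))"
    by (rule M(1)[OF ex_Basis(1) ex_Basis(2) bx bnds'(3) bnds'(4)], rule M(2)[OF ex_Basis(1) ex_Basis(2) bx bnds'(3) bnds'(4)])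
  have f21: "weak_deriv Omega [ey] (\<lambda>x. ?w [ex] x * (d1 \<gamma> (x $ 1) * x $ 2)) (\<lambda>x. ?w [ex] x * d1 \<gamma> (x $ 1) + ?w [ex, ey] x * (d1 \<gamma> (x $ 1) * x $ 2))"
    and i21: "integrable ?N (\<lambda>x. ?w [ex] x * (d1 \<gamma> (x $ 1) * x $ 2))"
    by (rule M(1)[OF ex_Basis(2) ex_Basis(1) "by" bnds'(3) bnds'(2)], rule M(2)[OF ex_Basis(2) ex_Basis(1) "by" bnds'(3) bnds'(2)])
  have f22: "weak_deriv Omega [ey] (\<lambda>x. ?w [ey] x * (n1 (x $ 1) + n2 (x $ 1) * (x $ 2 * x $ 2)))
      (\<lambda>x. ?w [ey] x * (n2 (x $ 1) * (2 * x $ 2)) + ?w [ey, ey] x * (n1 (x $ 1) + n2 (x $ 1) * (x $ 2 * x $ 2)))"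
    and i22: "integrable ?N (\<lambda>x. ?w [ey] x * (n1 (x $ 1) + n2 (x $ 1) * (x $ 2 * x $ 2)))"
    by (rule M(1)[OF ex_Basis(2) ex_Basis(2) cy bnds'(5) bnds'(6)], rule M(2)[OF ex_Basis(2) ex_Basis(2) cy bnds'(5) bnds'(6)])
  define F1 F2 where "F1 = (\<lambda>x. ?w [ex] x * (1 + \<gamma> (x $ 1)) - ?w [ey] x * (d1 \<gamma> (x $ 1) * x $ 2))"
    and "F2 = (\<lambda>x. ?w [ey] x * (n1 (x $ 1) + n2 (x $ 1) * (x $ 2 * x $ 2)) - ?w [ex] x * (d1 \<gamma> (x $ 1) * x $ 2))"
  have li: "[ex] \<in> lists Basis" "[ey] \<in> lists Basis" by simp_all
  note G1 = weak_deriv_diff[OF f11 f12 open_Omega li(1), folded F1_def] and G2 = weak_deriv_diff[OF f22 f21 open_Omega li(2), folded F2_def]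
  have F: "(\<lambda>x. A \<gamma> x *v grad w x) = (\<lambda>x. F1 x *\<^sub>R ex + F2 x *\<^sub>R ey)"
    by (rule ext) (simp add: A_vec R2_eq_iff grad_nth F1_def F2_def n1_def n2_def axis_def add_divide_distrib power2_eq_square field_simps)
  have Fi: "integrable ?N F1" "integrable ?N F2" unfolding F1_def F2_def using i11 i12 i21 i22 by auto
  show i: "integrable ?N (\<lambda>x. A \<gamma> x *v grad w x)"
    unfolding F by (intro Bochner_Integration.integrable_add integrable_scaleR_left Fi)
  note L = weak_derivD(2)[OF G1] weak_derivD(2)[OF G2]
  have e: "ellip \<gamma> w = (\<lambda>x. 1 * (?w [ex] x * d1 \<gamma> (x $ 1) + ?w [ex, ex] x * (1 + \<gamma> (x $ 1)) - (?w [ey] x * (d2 \<gamma> (x $ 1) * x $ 2) + ?w [ey, ex] x * (d1 \<gamma> (x $ 1) * x $ 2)))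
     + 1 * (?w [ey] x * (n2 (x $ 1) * (2 * x $ 2)) + ?w [ey, ey] x * (n1 (x $ 1) + n2 (x $ 1) * (x $ 2 * x $ 2)) - (?w [ex] x * d1 \<gamma> (x $ 1) + ?w [ex, ey] x * (d1 \<gamma> (x $ 1) * x $ 2))))"
    by (rule ext) (simp add: ellip_def Let_def n1_def n2_def add_divide_distrib power2_eq_square algebra_simps)
  have le: "loc_integrable Omega (ellip \<gamma> w)" unfolding e by (rule loc_integrable_lincomb) (use L in simp_all)
  show "has_weak_div Omega (\<lambda>x. A \<gamma> x *v grad w x) (ellip \<gamma> w)"
    unfolding has_weak_div_def
  proof (intro conjI allI impI)
    show "loc_integrable Omega (\<lambda>x. A \<gamma> x *v grad w x)" by (rule integrable_imp_loc_integrable[OF i]) simp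
    show "loc_integrable Omega (ellip \<gamma> w)" by (rule le)
    fix \<phi> :: "real ^ 2 \<Rightarrow> real" assume \<phi>: "test_function Omega \<phi>"
    have "(LINT x|?N. (\<Sum>i\<in>Basis. ((A \<gamma> x *v grad w x) \<bullet> i) * dpartial i \<phi> x)) = (LINT x|?N. F1 x * dpartial ex \<phi> x + F2 x * dpartial ey \<phi> x)"
      unfolding R2_Basis by (simp add: fun_cong[OF F])
    also have "\<dots> = (LINT x|?N. F1 x * dpartial ex \<phi> x) + (LINT x|?N. F2 x * dpartial ey \<phi> x)"
      by (intro Bochner_Integration.integral_add integrable_times_test[OF integrable_imp_loc_integrable[OF Fi(1)]]
          integrable_times_test[OF integrable_imp_loc_integrable[OF Fi(2)]] test_function_dpartial \<phi>) auto
    also have "\<dots> = - (LINT x|?N. ellip \<gamma> w x * \<phi> x)"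
      unfolding e using weak_derivD(3)[OF G1 \<phi>] weak_derivD(3)[OF G2 \<phi>]
      by (subst integral_lincomb_times) (use L in \<open>auto intro!: integrable_times_test \<phi>\<close>)
    finally show "(LINT x|?N. (\<Sum>i\<in>Basis. ((A \<gamma> x *v grad w x) \<bullet> i) * dpartial i \<phi> x)) = - (LINT x|?N. ellip \<gamma> w x * \<phi> x)" .
  qed
qed

lemma has_weak_div_unique:
  assumes "has_weak_div S F g" "has_weak_div S F h" "open S"
  shows "AE x in leb S. g x = h x"
  using assms unfolding has_weak_div_def by (intro AE_eq_if_equal_against_tests) auto

section \<open>Norms of order \<open>p\<close>\<close>

lemma powr_convex_combination:
  fixes a b s :: real
  assumes "0 \<le> a" "0 \<le> b" "0 \<le> s" "s \<le> 1" "1 \<le> p"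
  shows "((1 - s) * a + s * b) powr p \<le> (1 - s) * a powr p + s * b powr p"
proof -
  have le: "(t * c) powr p \<le> t * c powr p" if "0 \<le> t" "t \<le> 1" "0 \<le> c" for t c :: real
    using that assms(5) powr_le_one_le[of t p] by (cases "t = 0") (auto simp: powr_mult intro!: mult_right_mono)
  consider "a = 0" | "b = 0" | "0 < a" "0 < b" using assms by linarith
  then show ?thesis
  proof cases
    case 3
    then show ?thesis using powr_convex[OF assms(5)] assms by (auto simp: convex_on_def dest!: bspec[of _ _ a] bspec[of _ _ b] spec[of _ "1 - s"])
  qed (use le[of s b] le[of "1 - s" a] assms in auto)
qed

text \<open>Convexity of the power, with weights proportional to \<open>F\<close> and \<open>G\<close>. Summed and integrated with \<open>F\<close> and \<open>G\<close> the
  norms of the summands, this is Minkowski's inequality.\<close>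

lemma powr_sum_le:
  fixes a b F G p :: real
  assumes "0 \<le> a" "0 \<le> b" "0 < F" "0 < G" "1 \<le> p"
  shows "(a + b) powr p \<le> (F + G) powr p * (F / (F + G) * (a / F) powr p + G / (F + G) * (b / G) powr p)"
proof -
  let ?s = "G / (F + G)"
  have s: "1 - ?s = F / (F + G)" using assms by (simp add: field_simps)
  have "a + b = (F + G) * ((1 - ?s) * (a / F) + ?s * (b / G))" unfolding s using assms by (simp add: add_divide_distrib[symmetric])
  then have "(a + b) powr p = (F + G) powr p * ((1 - ?s) * (a / F) + ?s * (b / G)) powr p"
    using assms by (simp add: powr_mult)
  also have "\<dots> \<le> (F + G) powr p * ((1 - ?s) * (a / F) powr p + ?s * (b / G) powr p)"
    using assms by (intro mult_left_mono powr_convex_combination) auto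
  finally show ?thesis unfolding s .
qed

text \<open>The integrand of the \<open>p\<close>-th power of the Sobolev norm.\<close>

definition Dpow :: "real \<Rightarrow> nat \<Rightarrow> 'a::euclidean_space set \<Rightarrow> ('a \<Rightarrow> real) \<Rightarrow> 'a \<Rightarrow> real" where
  "Dpow p k S f x = (\<Sum>j\<le>k. Dlen j S f x powr p)"

lemma Lspace_dominated:
  assumes g: "g \<in> Lspace p M" and f: "f \<in> borel_measurable M" and le: "AE x in M. norm (f x) \<le> norm (g x)" and p: "0 \<le> p"
  shows "f \<in> Lspace p M"
proof (cases "p = \<infinity>")
  case True
  with g obtain C where "AE x in M. norm (g x) \<le> C" by (auto simp: Lspace_def)
  with le have "AE x in M. norm (f x) \<le> C" by eventually_elim (rule order_trans)
  with True f show ?thesis by (auto simp: Lspace_def)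
next
  case False
  with g have "integrable M (\<lambda>x. norm (g x) powr real_of_ereal p)" by (simp add: Lspace_def)
  then have "integrable M (\<lambda>x. norm (f x) powr real_of_ereal p)"
  proof (rule Bochner_Integration.integrable_bound)
    show "AE x in M. norm (norm (f x) powr real_of_ereal p) \<le> norm (norm (g x) powr real_of_ereal p)"
      using le by eventually_elim (use p in \<open>auto intro!: powr_mono2 simp: real_of_ereal_pos\<close>)
  qed (use f in measurable)
  with False f show ?thesis by (auto simp: Lspace_def)
qed

lemma Dlen_Lspace:
  assumes f: "f \<in> sobolev k p S" and S: "open S" and p: "1 \<le> p" and j: "j \<le> k"
  shows "Dlen j S f \<in> Lspace p (leb S)"
proof (rule Lspace_dominated)
  let ?J = "{is \<in> lists Basis. length is = j}"
  have p0: "0 \<le> p" by (rule order_trans[OF _ p]) simp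
  have sum: "(\<lambda>x. \<Sum>is\<in>J. \<bar>wderiv S is f x\<bar>) \<in> Lspace p (leb S)" if "J \<subseteq> ?J" "finite J" for J
    using that(2,1)
  proof (induction J)
    case empty
    then show ?case by (auto simp: Lspace_def)
  next
    case (insert i J)
    have w: "wderiv S i f \<in> Lspace p (leb S)" using sobolev_weak_deriv(2)[OF f S] insert(4) j by auto
    have "(\<lambda>x. \<bar>wderiv S i f x\<bar>) \<in> Lspace p (leb S)"
      by (rule Lspace_dominated[OF w _ _ p0]) (use Lspace_measurable[OF w] in auto)
    from Lspace_diff(2)[OF this insert(3) p] insert show ?case by auto
  qed
  show "(\<lambda>x. \<Sum>is\<in>?J. \<bar>wderiv S is f x\<bar>) \<in> Lspace p (leb S)" by (rule sum[OF order_refl finite_multi_indices])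
  show "Dlen j S f \<in> borel_measurable (leb S)" by (rule Dlen_measurable[OF f S j])
  have "Dlen j S f x \<le> (\<Sum>is\<in>?J. \<bar>wderiv S is f x\<bar>)" for x unfolding Dlen_def by (rule L2_set_le_sum_abs)
  then have "norm (Dlen j S f x) \<le> norm (\<Sum>is\<in>?J. \<bar>wderiv S is f x\<bar>)" for x
    unfolding real_norm_def abs_of_nonneg[OF Dlen_nonneg] by (rule order_trans[OF _ abs_ge_self])
  then show "AE x in leb S. norm (Dlen j S f x) \<le> norm (\<Sum>is\<in>?J. \<bar>wderiv S is f x\<bar>)" by (rule AE_I2)
  show "0 \<le> p" by (rule p0)
qed

lemma sob_norm_Dpow:
  assumes f: "f \<in> sobolev k (ereal p) S" and S: "open S" and p: "1 \<le> p"
  shows "integrable (leb S) (Dpow p k S f)"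
    and "sob_norm k (ereal p) S f powr p = (LINT x|leb S. Dpow p k S f x)"
    and "0 \<le> sob_norm k (ereal p) S f"
proof -
  have i: "integrable (leb S) (\<lambda>x. Dlen j S f x powr p)" if "j \<le> k" for j
    using Dlen_Lspace[OF f S _ that] p by (simp add: Lspace_ereal_iff Dlen_nonneg)
  show "integrable (leb S) (Dpow p k S f)" unfolding Dpow_def by (rule Bochner_Integration.integrable_sum) (use i in auto)
  have "sob_norm k (ereal p) S f powr p = (\<Sum>j\<le>k. sob_seminorm j (ereal p) S f powr p)"
    unfolding sob_norm_def using p by (simp add: powr_powr sum_nonneg)
  also have "\<dots> = (\<Sum>j\<le>k. LINT x|leb S. Dlen j S f x powr p)"
    unfolding sob_seminorm_Dlen using p by (intro sum.cong refl, subst Lnorm_powr) (auto simp: Dlen_nonneg)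
  also have "\<dots> = (LINT x|leb S. Dpow p k S f x)" unfolding Dpow_def by (rule Bochner_Integration.integral_sum[symmetric]) (use i in auto)
  finally show "sob_norm k (ereal p) S f powr p = (LINT x|leb S. Dpow p k S f x)" .
  show "0 \<le> sob_norm k (ereal p) S f" unfolding sob_norm_def by simp
qed

lemma le_if_powr_le:
  fixes x y p :: real
  assumes "x powr p \<le> y powr p" "0 \<le> x" "0 \<le> y" "0 < p"
  shows "x \<le> y"
  using assms by (metis linorder_not_le powr_less_mono2)

lemma sob_norm_triangle:
  assumes f: "f \<in> sobolev k (ereal p) S" and g: "g \<in> sobolev k (ereal p) S" and S: "open S" and p: "1 \<le> p"
  shows "sob_norm k (ereal p) S (\<lambda>x. f x + g x) \<le> sob_norm k (ereal p) S f + sob_norm k (ereal p) S g"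
proof (rule field_le_epsilon)
  fix e :: real assume e: "0 < e"
  let ?N = "\<lambda>f. sob_norm k (ereal p) S f"
  let ?h = "\<lambda>x. f x + g x"
  define F G where "F = ?N f + e / 2" and "G = ?N g + e / 2"
  note nf = sob_norm_Dpow[OF f S p] and ng = sob_norm_Dpow[OF g S p]
  have h: "?h \<in> sobolev k (ereal p) S" using sobolev_diff(2)[OF f g S] p by simp
  note nh = sob_norm_Dpow[OF h S p]
  have FG: "0 < F" "0 < G" unfolding F_def G_def using nf(3) ng(3) e by linarith+
  let ?R = "\<lambda>x. (F + G) powr p * (F / (F + G) * (Dpow p k S f x / F powr p) + G / (F + G) * (Dpow p k S g x / G powr p))"
  have "AE x in leb S. \<forall>j\<in>{..k}. Dlen j S ?h x \<le> Dlen j S f x + Dlen j S g x"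
    using Dlen_triangle(1)[OF f g S] by (intro AE_finite_allI) auto
  then have ae: "AE x in leb S. Dpow p k S ?h x \<le> ?R x"
  proof eventually_elim
    case (elim x)
    have "Dpow p k S ?h x \<le> (\<Sum>j\<le>k. (F + G) powr p * (F / (F + G) * (Dlen j S f x / F) powr p + G / (F + G) * (Dlen j S g x / G) powr p))"
      unfolding Dpow_def
    proof (rule sum_mono)
      fix j assume j: "j \<in> {..k}"
      have "Dlen j S ?h x powr p \<le> (Dlen j S f x + Dlen j S g x) powr p" using elim j p by (intro powr_mono2) (auto simp: Dlen_nonneg)
      also have "\<dots> \<le> (F + G) powr p * (F / (F + G) * (Dlen j S f x / F) powr p + G / (F + G) * (Dlen j S g x / G) powr p)"
        using FG p by (intro powr_sum_le) (auto simp: Dlen_nonneg)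
      finally show "Dlen j S ?h x powr p \<le> (F + G) powr p * (F / (F + G) * (Dlen j S f x / F) powr p + G / (F + G) * (Dlen j S g x / G) powr p)" .
    qed
    also have "\<dots> = ?R x"
      using FG by (simp add: Dpow_def powr_divide Dlen_nonneg sum_distrib_left[symmetric] sum.distrib sum_divide_distrib[symmetric])
    finally show ?case .
  qed
  have le1: "?N f powr p / F powr p \<le> 1" "?N g powr p / G powr p \<le> 1"
    using nf(3) ng(3) FG e p by (auto simp: F_def G_def intro!: powr_mono2)
  have "?N ?h powr p \<le> (LINT x|leb S. ?R x)"
    unfolding nh(2) by (rule integral_mono_AE[OF nh(1) _ ae]) (use nf(1) ng(1) in simp)
  also have "\<dots> = (F + G) powr p * (F / (F + G) * (?N f powr p / F powr p) + G / (F + G) * (?N g powr p / G powr p))"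
    unfolding nf(2) ng(2) using nf(1) ng(1) by simp
  also have "\<dots> \<le> (F + G) powr p * (F / (F + G) * 1 + G / (F + G) * 1)"
    using FG le1 by (intro mult_left_mono add_mono) auto
  also have "\<dots> = (F + G) powr p" using FG by (simp add: add_divide_distrib[symmetric])
  finally have "?N ?h \<le> F + G" by (rule le_if_powr_le) (use nh(3) FG p in auto)
  then show "?N ?h \<le> ?N f + ?N g + e" by (simp add: F_def G_def)
qed

text \<open>Both terms are at most the maximum of the two lengths, whose \<open>p\<close>-th power is at most \<open>Dpow\<close>; this avoids the loss
  of a constant that adding the seminorms would cause.\<close>

lemma Lnorm_le_sob_norm:
  assumes u: "u \<in> sobolev 2 (ereal p) S" and S: "open S" and p: "1 \<le> p"
    and f: "f \<in> borel_measurable (leb S)" "AE x in leb S. \<bar>f x\<bar> \<le> c * Dlen 2 S u x + d * Dlen 1 S u x"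
    and cd: "0 \<le> c" "0 \<le> d"
  shows "f \<in> Lspace (ereal p) (leb S)"
    and "Lnorm (ereal p) (leb S) f \<le> (c + d) * sob_norm 2 (ereal p) S u"
proof -
  note n = sob_norm_Dpow[OF u S p]
  have ae: "AE x in leb S. norm (f x) powr p \<le> (c + d) powr p * Dpow p 2 S u x"
    using f(2)
  proof eventually_elim
    case (elim x)
    define m where "m = max (Dlen 2 S u x) (Dlen 1 S u x)"
    have "c * Dlen 2 S u x \<le> c * m" "d * Dlen 1 S u x \<le> d * m" using cd by (auto simp: m_def intro!: mult_left_mono)
    then have "norm (f x) \<le> (c + d) * m" using elim by (simp add: distrib_right)
    then have "norm (f x) powr p \<le> ((c + d) * m) powr p" using p by (intro powr_mono2) auto
    also have "\<dots> = (c + d) powr p * m powr p" using cd by (simp add: powr_mult m_def le_max_iff_disj Dlen_nonneg)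
    also have "m powr p \<le> Dpow p 2 S u x"
      unfolding Dpow_def m_def by (auto simp: max_def numeral_2_eq_2)
    finally show ?case by (simp add: mult_left_mono)
  qed
  have i: "integrable (leb S) (\<lambda>x. (c + d) powr p * Dpow p 2 S u x)" using n(1) by simp
  have fi: "integrable (leb S) (\<lambda>x. norm (f x) powr p)"
    by (rule Bochner_Integration.integrable_bound[OF i]) (use f(1) ae in auto)
  then show "f \<in> Lspace (ereal p) (leb S)" using f(1) by (simp add: Lspace_ereal_iff)
  have "Lnorm (ereal p) (leb S) f powr p = (LINT x|leb S. norm (f x) powr p)" using p by (simp add: Lnorm_powr)
  also have "\<dots> \<le> (LINT x|leb S. (c + d) powr p * Dpow p 2 S u x)" by (rule integral_mono_AE[OF fi i ae])
  also have "\<dots> = ((c + d) * sob_norm 2 (ereal p) S u) powr p" using cd n(3) by (simp add: n(2) powr_mult)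
  finally show "Lnorm (ereal p) (leb S) f \<le> (c + d) * sob_norm 2 (ereal p) S u"
    by (rule le_if_powr_le) (use cd n(3) p in \<open>auto intro: Lnorm_nonneg\<close>)
qed

text \<open>Young's inequality, applied to \<open>f\<close> and \<open>g\<close> divided by numbers slightly larger than their norms, as these may vanish.\<close>

lemma Holder_bound:
  fixes f g h :: "'a \<Rightarrow> real" and p q :: real
  assumes pq: "1 < p" "1 < q" "1 / p + 1 / q = 1"
    and f: "f \<in> Lspace (ereal p) M" and g: "g \<in> Lspace (ereal q) M" and h: "h \<in> borel_measurable M"
    and le: "AE x in M. \<bar>h x\<bar> \<le> C * (\<bar>f x\<bar> * \<bar>g x\<bar>)" and C: "0 \<le> C"
  shows "\<bar>LINT x|M. h x\<bar> \<le> C * (Lnorm (ereal p) M f * Lnorm (ereal q) M g)"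
proof -
  let ?F = "Lnorm (ereal p) M f" and ?G = "Lnorm (ereal q) M g"
  have n: "0 \<le> ?F" "0 \<le> ?G" by (auto intro: Lnorm_nonneg)
  have fg: "integrable M (\<lambda>x. \<bar>f x\<bar> powr p)" "integrable M (\<lambda>x. \<bar>g x\<bar> powr q)" using f g by (auto simp: Lspace_ereal_iff)
  have F: "?F powr p = (LINT x|M. \<bar>f x\<bar> powr p)" "?G powr q = (LINT x|M. \<bar>g x\<bar> powr q)" using pq by (auto simp: Lnorm_powr)
  have eps: "\<bar>LINT x|M. h x\<bar> \<le> C * ((?F + e) * (?G + e))" if e: "0 < e" for e
  proof -
    let ?R = "\<lambda>x. C * ((?F + e) * (?G + e)) * (\<bar>f x\<bar> powr p / (?F + e) powr p / p + \<bar>g x\<bar> powr q / (?G + e) powr q / q)"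
    have p: "0 < ?F + e" "0 < ?G + e" using n e by linarith+
    have ae: "AE x in M. norm (h x) \<le> ?R x"
      using le
    proof eventually_elim
      case (elim x)
      have "\<bar>f x\<bar> / (?F + e) * (\<bar>g x\<bar> / (?G + e)) \<le> (\<bar>f x\<bar> / (?F + e)) powr p / p + (\<bar>g x\<bar> / (?G + e)) powr q / q"
        using p by (intro Youngs_inequality pq) auto
      then have "C * ((?F + e) * (?G + e)) * (\<bar>f x\<bar> / (?F + e) * (\<bar>g x\<bar> / (?G + e))) \<le> ?R x"
        using p C by (intro mult_left_mono) (auto simp: powr_divide)
      moreover have "C * ((?F + e) * (?G + e)) * (\<bar>f x\<bar> / (?F + e) * (\<bar>g x\<bar> / (?G + e))) = C * (\<bar>f x\<bar> * \<bar>g x\<bar>)"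
        using p by simp
      ultimately show ?case using elim by simp
    qed
    have iR: "integrable M ?R" using fg by simp
    have ih: "integrable M h" by (rule Bochner_Integration.integrable_bound[OF iR h]) (use ae in auto)
    have le1: "?F powr p / (?F + e) powr p \<le> 1" "?G powr q / (?G + e) powr q \<le> 1"
      using n e pq p by (auto intro!: powr_mono2)
    have "\<bar>LINT x|M. h x\<bar> \<le> (LINT x|M. norm (h x))" using integral_norm_bound[of M h] by simp
    also have "\<dots> \<le> (LINT x|M. ?R x)" by (rule integral_mono_AE[OF _ iR ae]) (use ih in simp)
    also have "\<dots> = C * ((?F + e) * (?G + e)) * (?F powr p / (?F + e) powr p / p + ?G powr q / (?G + e) powr q / q)"
      unfolding F using fg by simp
    also have "\<dots> \<le> C * ((?F + e) * (?G + e)) * (1 / p + 1 / q)"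
      using p C le1 pq by (intro mult_left_mono add_mono divide_right_mono) auto
    finally show ?thesis using pq by simp
  qed
  have "((\<lambda>e. C * ((?F + e) * (?G + e))) \<longlongrightarrow> C * ((?F + 0) * (?G + 0))) (at_right 0)" by (intro tendsto_intros)
  moreover have "eventually (\<lambda>e. \<bar>LINT x|M. h x\<bar> \<le> C * ((?F + e) * (?G + e))) (at_right (0::real))"
    using eventually_at_right_less[of "0::real"] by eventually_elim (rule eps)
  ultimately have "\<bar>LINT x|M. h x\<bar> \<le> C * ((?F + 0) * (?G + 0))" by (rule tendsto_lowerbound) simp
  then show ?thesis by simp
qed

section \<open>Pointwise estimates of the coefficients\<close>

lemma abs_sum_le: "z = x + y \<Longrightarrow> \<bar>x\<bar> \<le> X \<Longrightarrow> \<bar>y\<bar> \<le> Y \<Longrightarrow> X + Y \<le> Z \<Longrightarrow> \<bar>z\<bar> \<le> Z" for x y z :: real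
  by linarith

lemma norm_mat2: "(norm (vector [vector [a, b], vector [c, d]] :: real ^ 2 ^ 2))\<^sup>2 = a\<^sup>2 + b\<^sup>2 + c\<^sup>2 + d\<^sup>2"
  unfolding power2_norm_eq_inner by (simp add: inner_vec_def sum_2 vector_2 power2_eq_square)

lemma norm_mat2_le:
  assumes "a\<^sup>2 + b\<^sup>2 + c\<^sup>2 + d\<^sup>2 \<le> B\<^sup>2" "0 \<le> B"
  shows "norm (vector [vector [a, b], vector [c, d]] :: real ^ 2 ^ 2) \<le> B"
  using assms norm_mat2[of a b c d] by (metis norm_ge_zero power2_le_imp_le)

lemma norm_matrix_vector_le: "norm (M *v z) \<le> norm M * norm z" for M :: "real ^ 2 ^ 2"
proof -
  have "norm (M *v z) = L2_set (\<lambda>i. norm (M $ i \<bullet> z)) UNIV"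
    unfolding norm_vec_def by (rule L2_set_cong) (simp_all add: matrix_vector_mult_def inner_vec_def)
  also have "\<dots> \<le> L2_set (\<lambda>i. norm (M $ i) * norm z) UNIV" by (rule L2_set_mono) (auto intro: Cauchy_Schwarz_ineq2)
  also have "\<dots> = norm M * norm z" by (simp add: norm_vec_def[of M] L2_set_left_distrib)
  finally show ?thesis .
qed

context
  fixes s r b :: real
  assumes s: "\<bar>s\<bar> \<le> 1 / 4" and r: "\<bar>r\<bar> \<le> 1 / 2" and b: "0 \<le> b" "b \<le> 1"
begin

lemma coefficient_products: "3 / 4 \<le> 1 + s" "\<bar>r * b\<bar> \<le> 1 / 2" "(r * b)\<^sup>2 \<le> 1 / 4" "r\<^sup>2 * b \<le> 1 / 4" "0 \<le> r\<^sup>2 * b"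
proof -
  show "3 / 4 \<le> 1 + s" using s by linarith
  show rb: "\<bar>r * b\<bar> \<le> 1 / 2" using mult_mono[OF r b(2)] b by (simp add: abs_mult)
  show "(r * b)\<^sup>2 \<le> 1 / 4" using power_mono[OF rb, of 2] by (simp add: power2_eq_square)
  have "r\<^sup>2 \<le> 1 / 4" using power_mono[OF r, of 2] by (simp add: power2_eq_square)
  then show "r\<^sup>2 * b \<le> 1 / 4" using mult_mono[of "r\<^sup>2" "1 / 4" b 1] b by simp
  show "0 \<le> r\<^sup>2 * b" using b by simp
qed

lemma A_mat_bound: "norm (A_mat s r b) \<le> 9 / 4"
  unfolding A_mat_def
proof (rule norm_mat2_le)
  note c = coefficient_products
  have "(1 + s)\<^sup>2 \<le> (5 / 4)\<^sup>2" using s by (intro power_mono) auto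
  moreover have "(1 + (r * b)\<^sup>2) / (1 + s) \<le> (5 / 4) / (3 / 4)" using c by (intro frac_le) auto
  then have "((1 + (r * b)\<^sup>2) / (1 + s))\<^sup>2 \<le> (5 / 3)\<^sup>2" using c by (intro power_mono) auto
  moreover have "(- r * b)\<^sup>2 \<le> 1 / 4" using c(3) by simp
  ultimately have "(1 + s)\<^sup>2 + (- r * b)\<^sup>2 + (- r * b)\<^sup>2 + ((1 + (r * b)\<^sup>2) / (1 + s))\<^sup>2 \<le> (5 / 4)\<^sup>2 + 1 / 4 + 1 / 4 + (5 / 3)\<^sup>2"
    by (intro add_mono)
  also have "\<dots> \<le> (9 / 4)\<^sup>2" by (simp add: power2_eq_square)
  finally show "(1 + s)\<^sup>2 + (- r * b)\<^sup>2 + (- r * b)\<^sup>2 + ((1 + (r * b)\<^sup>2) / (1 + s))\<^sup>2 \<le> (9 / 4)\<^sup>2" .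
qed simp

lemma div_coefficient_bound:
  assumes "\<bar>m\<bar> \<le> 1"
  shows "\<bar>2 * r\<^sup>2 * b / (1 + s) - m * b\<bar> \<le> 9 / 4"
proof -
  note c = coefficient_products
  have "\<bar>2 * r\<^sup>2 * b / (1 + s)\<bar> \<le> (1 / 2) / (3 / 4)" unfolding abs_divide using c by (intro frac_le) auto
  moreover have "\<bar>- (m * b)\<bar> \<le> 1" using mult_mono[OF assms b(2)] b by (simp add: abs_mult)
  ultimately show ?thesis by (rule abs_sum_le[rotated]) auto
qed

end

lemma quotient_difference:
  fixes x y s t D :: real
  assumes "3 / 4 \<le> s" "3 / 4 \<le> t" "\<bar>s - t\<bar> \<le> D / 4" "\<bar>y\<bar> \<le> Y" "\<bar>x - y\<bar> \<le> X"
  shows "\<bar>x / s - y / t\<bar> \<le> 4 / 3 * X + 4 / 9 * Y * D"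
proof (rule abs_sum_le)
  have n: "0 < s" "0 < t" "0 \<le> X" "0 \<le> Y" "0 \<le> D / 4" using assms by linarith+
  show "x / s - y / t = (x - y) / s + y * (t - s) / (s * t)" using n by (simp add: field_simps)
  show "\<bar>(x - y) / s\<bar> \<le> X / (3 / 4)" unfolding abs_divide by (intro frac_le) (use assms n in linarith)+
  show "\<bar>y * (t - s) / (s * t)\<bar> \<le> Y * (D / 4) / (3 / 4 * (3 / 4))"
    unfolding abs_divide abs_mult by (intro frac_le mult_mono mult_nonneg_nonneg) (use assms n in \<open>simp_all add: abs_minus_commute\<close>)
qed (simp add: field_simps)

context
  fixes s s' r r' b D :: real
  assumes s: "\<bar>s\<bar> \<le> 1 / 4" "\<bar>s'\<bar> \<le> 1 / 4" and r: "\<bar>r\<bar> \<le> 1 / 2" "\<bar>r'\<bar> \<le> 1 / 2" and b: "0 \<le> b" "b \<le> 1"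
    and D: "\<bar>s - s'\<bar> \<le> D / 4" "\<bar>r - r'\<bar> \<le> D / 2"
begin

lemma square_difference: "\<bar>r\<^sup>2 - r'\<^sup>2\<bar> \<le> D / 2" "0 \<le> D"
proof -
  show D0: "0 \<le> D" using D by linarith
  have "\<bar>r + r'\<bar> \<le> 1" using r by linarith
  then have "\<bar>r - r'\<bar> * \<bar>r + r'\<bar> \<le> (D / 2) * 1" using D D0 by (intro mult_mono) auto
  moreover have "r\<^sup>2 - r'\<^sup>2 = (r - r') * (r + r')" by (simp add: power2_eq_square algebra_simps)
  ultimately show "\<bar>r\<^sup>2 - r'\<^sup>2\<bar> \<le> D / 2" by (simp add: abs_mult)
qed

lemma times_b: "\<bar>x * b\<bar> \<le> B" if "\<bar>x\<bar> \<le> B" for x B :: real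
  using mult_mono[OF that b(2)] b that by (simp add: abs_mult)

lemma A_mat_diff_bound: "norm (A_mat s r b - A_mat s' r' b) \<le> 3 / 2 * D"
proof -
  note c = coefficient_products[OF s(1) r(1) b] and c' = coefficient_products[OF s(2) r(2) b]
  have eq: "A_mat s r b - A_mat s' r' b = vector [vector [s - s', - r * b + r' * b], vector [- r * b + r' * b,
      (1 + (r * b)\<^sup>2) / (1 + s) - (1 + (r' * b)\<^sup>2) / (1 + s')]]"
    unfolding A_mat_def by (simp add: vec_eq_iff forall_2 vector_2)
  have "\<bar>(r' - r) * b\<bar> \<le> D / 2" by (rule times_b) (use D(2) in \<open>simp add: abs_minus_commute\<close>)
  then have rb: "\<bar>- r * b + r' * b\<bar> \<le> D / 2" by (simp add: left_diff_distrib)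
  have "\<bar>(r\<^sup>2 - r'\<^sup>2) * b\<^sup>2\<bar> \<le> D / 2 * 1"
    unfolding abs_mult using square_difference b by (intro mult_mono) (auto simp: power_le_one)
  then have "\<bar>(1 + (r * b)\<^sup>2) - (1 + (r' * b)\<^sup>2)\<bar> \<le> D / 2" by (simp add: power_mult_distrib left_diff_distrib)
  moreover have "\<bar>1 + (r' * b)\<^sup>2\<bar> \<le> 5 / 4" using c'(3) by simp
  ultimately have "\<bar>(1 + (r * b)\<^sup>2) / (1 + s) - (1 + (r' * b)\<^sup>2) / (1 + s')\<bar> \<le> 4 / 3 * (D / 2) + 4 / 9 * (5 / 4) * D"
    by (intro quotient_difference c c') (use D(1) in auto)
  also have "\<dots> = 11 / 9 * D" by simp
  finally have q: "\<bar>(1 + (r * b)\<^sup>2) / (1 + s) - (1 + (r' * b)\<^sup>2) / (1 + s')\<bar> \<le> 11 / 9 * D" .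
  show ?thesis
    unfolding eq
  proof (rule norm_mat2_le)
    have "(s - s')\<^sup>2 \<le> (D / 4)\<^sup>2" "(- r * b + r' * b)\<^sup>2 \<le> (D / 2)\<^sup>2"
      "((1 + (r * b)\<^sup>2) / (1 + s) - (1 + (r' * b)\<^sup>2) / (1 + s'))\<^sup>2 \<le> (11 / 9 * D)\<^sup>2"
      using D(1) rb q by (auto intro!: power2_le_iff_abs_le[THEN iffD2] simp: square_difference(2))
    moreover have "(D / 4)\<^sup>2 + (D / 2)\<^sup>2 + (D / 2)\<^sup>2 + (11 / 9 * D)\<^sup>2 \<le> (3 / 2 * D)\<^sup>2"
      by (simp add: power2_eq_square field_simps)
    ultimately show "(s - s')\<^sup>2 + (- r * b + r' * b)\<^sup>2 + (- r * b + r' * b)\<^sup>2 +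
      ((1 + (r * b)\<^sup>2) / (1 + s) - (1 + (r' * b)\<^sup>2) / (1 + s'))\<^sup>2 \<le> (3 / 2 * D)\<^sup>2" by linarith
  qed (simp add: square_difference(2))
qed

lemma div_coefficient_diff_bound:
  assumes m: "\<bar>m - m'\<bar> \<le> D"
  shows "\<bar>(2 * r\<^sup>2 * b / (1 + s) - m * b) - (2 * r'\<^sup>2 * b / (1 + s') - m' * b)\<bar> \<le> 3 * D"
proof -
  note c = coefficient_products[OF s(1) r(1) b] and c' = coefficient_products[OF s(2) r(2) b]
  have "2 * r\<^sup>2 * b - 2 * r'\<^sup>2 * b = 2 * ((r\<^sup>2 - r'\<^sup>2) * b)" by (simp add: algebra_simps)
  then have "\<bar>2 * r\<^sup>2 * b - 2 * r'\<^sup>2 * b\<bar> \<le> D" using times_b[OF square_difference(1)] by (simp add: abs_mult)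
  moreover have "\<bar>2 * r'\<^sup>2 * b\<bar> \<le> 1 / 2" using c'(4,5) by simp
  ultimately have "\<bar>2 * r\<^sup>2 * b / (1 + s) - 2 * r'\<^sup>2 * b / (1 + s')\<bar> \<le> 4 / 3 * D + 4 / 9 * (1 / 2) * D"
    by (intro quotient_difference c c') (use D(1) in auto)
  moreover have "\<bar>(m' - m) * b\<bar> \<le> D" by (rule times_b) (use m in simp)
  ultimately show ?thesis by (rule abs_sum_le[rotated]) (simp_all add: left_diff_distrib square_difference(2))
qed

end

text \<open>Transposed, so that the second-order part of \<open>ellip\<close> is the inner product with \<open>A[\<gamma>]\<close>.\<close>

definition hess :: "(real ^ 2 \<Rightarrow> real) \<Rightarrow> real ^ 2 \<Rightarrow> real ^ 2 ^ 2" where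
  "hess w x = vector [vector [wderiv Omega [ex, ex] w x, wderiv Omega [ey, ex] w x],
     vector [wderiv Omega [ex, ey] w x, wderiv Omega [ey, ey] w x]]"

lemma ellip_inner: "ellip \<gamma> w x = A \<gamma> x \<bullet> hess w x
    + (2 * (d1 \<gamma> (x $ 1))\<^sup>2 * x $ 2 / (1 + \<gamma> (x $ 1)) - d2 \<gamma> (x $ 1) * x $ 2) * grad w x $ 2"
  by (simp add: ellip_def Let_def A_def A_mat_def hess_def inner_vec_def sum_2 vector_2 grad_nth)

lemma R2_multi_indices:
  "{is \<in> lists (Basis :: (real ^ 2) set). length is = 1} = {[ex], [ey]}"
  "{is \<in> lists (Basis :: (real ^ 2) set). length is = 2} = {[ex, ex], [ex, ey], [ey, ex], [ey, ey]}"
  using multi_indices_1[of "Basis :: (real ^ 2) set"] multi_indices_2[of "Basis :: (real ^ 2) set"]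
  by (auto simp: R2_Basis)

lemma norm_grad: "norm (grad w x) = Dlen 1 Omega w x"
  unfolding Dlen_def R2_multi_indices norm_vec_def by (simp add: L2_set_def sum_2 grad_nth)

lemma norm_hess: "norm (hess w x) = Dlen 2 Omega w x"
proof -
  have "(norm (hess w x))\<^sup>2 = (Dlen 2 Omega w x)\<^sup>2"
    unfolding Dlen_def R2_multi_indices hess_def norm_mat2 by (simp add: L2_set_def sum_nonneg)
  then show ?thesis by (simp add: Dlen_nonneg)
qed

lemma ellip_estimate:
  assumes "small_coeffs \<gamma>"
  shows "AE x in leb Omega. \<bar>ellip \<gamma> w x\<bar> \<le> 9 / 4 * Dlen 2 Omega w x + 9 / 4 * Dlen 1 Omega w x"
    and "AE x in leb Omega. norm (A \<gamma> x) \<le> 9 / 4"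
proof -
  have box: "AE x in leb Omega. 0 \<le> x $ 2 \<and> x $ 2 \<le> 1" by (rule AE_I2) (auto simp: space_restrict_space Omega_def less_imp_le)
  have ae: "AE x in leb Omega. norm (A \<gamma> x) \<le> 9 / 4 \<and>
      \<bar>2 * (d1 \<gamma> (x $ 1))\<^sup>2 * x $ 2 / (1 + \<gamma> (x $ 1)) - d2 \<gamma> (x $ 1) * x $ 2\<bar> \<le> 9 / 4"
    using AE_first_coordinate[OF assms] box
    by eventually_elim (unfold A_def, intro conjI A_mat_bound div_coefficient_bound; blast)
  then show "AE x in leb Omega. norm (A \<gamma> x) \<le> 9 / 4" by auto
  show "AE x in leb Omega. \<bar>ellip \<gamma> w x\<bar> \<le> 9 / 4 * Dlen 2 Omega w x + 9 / 4 * Dlen 1 Omega w x"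
    using ae
  proof eventually_elim
    case (elim x)
    have "\<bar>A \<gamma> x \<bullet> hess w x\<bar> \<le> 9 / 4 * Dlen 2 Omega w x"
      unfolding norm_hess[symmetric] by (rule order_trans[OF Cauchy_Schwarz_ineq2 mult_right_mono]) (use elim in auto)
    moreover have "\<bar>(2 * (d1 \<gamma> (x $ 1))\<^sup>2 * x $ 2 / (1 + \<gamma> (x $ 1)) - d2 \<gamma> (x $ 1) * x $ 2) * grad w x $ 2\<bar> \<le> 9 / 4 * Dlen 1 Omega w x"
      unfolding abs_mult norm_grad[symmetric] using elim component_le_norm_cart[of "grad w x" 2] by (intro mult_mono) auto
    ultimately show ?case by (rule abs_sum_le[OF ellip_inner]) simp
  qed
qed

lemma ellip_diff_estimate:
  assumes "small_coeffs \<gamma>"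
    and "small_coeffs \<eta>"
    and "close_coeffs D \<gamma> \<eta>"
  shows "AE x in leb Omega. \<bar>ellip \<gamma> w x - ellip \<eta> w x\<bar> \<le> 3 / 2 * D * Dlen 2 Omega w x + 3 * D * Dlen 1 Omega w x"
proof -
  have box: "AE x in leb Omega. 0 \<le> x $ 2 \<and> x $ 2 \<le> 1" by (rule AE_I2) (auto simp: space_restrict_space Omega_def less_imp_le)
  show ?thesis
    using AE_first_coordinate[OF assms(1)] AE_first_coordinate[OF assms(2)] AE_first_coordinate[OF assms(3)] box
  proof eventually_elim
    case (elim x)
    let ?c = "\<lambda>\<gamma>. 2 * (d1 \<gamma> (x $ 1))\<^sup>2 * x $ 2 / (1 + \<gamma> (x $ 1)) - d2 \<gamma> (x $ 1) * x $ 2"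
    have e: "\<bar>\<gamma> (x $ 1)\<bar> \<le> 1 / 4" "\<bar>\<eta> (x $ 1)\<bar> \<le> 1 / 4" "\<bar>d1 \<gamma> (x $ 1)\<bar> \<le> 1 / 2" "\<bar>d1 \<eta> (x $ 1)\<bar> \<le> 1 / 2" "0 \<le> x $ 2" "x $ 2 \<le> 1"
      "\<bar>\<gamma> (x $ 1) - \<eta> (x $ 1)\<bar> \<le> D / 4" "\<bar>d1 \<gamma> (x $ 1) - d1 \<eta> (x $ 1)\<bar> \<le> D / 2" "\<bar>d2 \<gamma> (x $ 1) - d2 \<eta> (x $ 1)\<bar> \<le> D"
      using elim by blast+
    have "norm (A \<gamma> x - A \<eta> x) \<le> 3 / 2 * D" unfolding A_def by (rule A_mat_diff_bound[OF e(1-8)])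
    then have "\<bar>(A \<gamma> x - A \<eta> x) \<bullet> hess w x\<bar> \<le> 3 / 2 * D * Dlen 2 Omega w x"
      unfolding norm_hess[symmetric] by (intro order_trans[OF Cauchy_Schwarz_ineq2 mult_right_mono]) auto
    moreover have "\<bar>(?c \<gamma> - ?c \<eta>) * grad w x $ 2\<bar> \<le> 3 * D * Dlen 1 Omega w x"
      unfolding abs_mult norm_grad[symmetric]
      using div_coefficient_diff_bound[OF e] component_le_norm_cart[of "grad w x" 2] by (intro mult_mono) auto
    ultimately show ?case by (rule abs_sum_le[rotated]) (simp_all add: ellip_inner inner_diff_left left_diff_distrib)
  qed
qed

section \<open>Functions of one variable with zero boundary values\<close>

lemma R1_multi_indices:
  "{is \<in> lists (Basis :: real set). length is = 1} = {[1]}" "{is \<in> lists (Basis :: real set). length is = 2} = {[1, 1]}"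
  using multi_indices_1[of "Basis :: real set"] multi_indices_2[of "Basis :: real set"] by auto

lemma Dlen_I: "Dlen 1 I \<gamma> t = \<bar>d1 \<gamma> t\<bar>" "Dlen 2 I \<gamma> t = \<bar>d2 \<gamma> t\<bar>"
  unfolding Dlen_def R1_multi_indices by (simp_all add: L2_set_def d1_def d2_def)

lemma sob_norm_infinity: "sob_seminorm j \<infinity> S f \<le> sob_norm k \<infinity> S f" if "j \<le> k"
  unfolding sob_norm_def using that by simp

lemma d2_le_seminorm:
  assumes "\<gamma> \<in> sobolev 2 \<infinity> I"
  shows "AE t in leb I. \<bar>d2 \<gamma> t\<bar> \<le> sob_seminorm 2 \<infinity> I \<gamma>"
  using Lspace_infinity_bound[OF Dlen_Lspace[OF assms open_I, of 2]] by (simp add: sob_seminorm_Dlen Dlen_I)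

lemma zero_trace_norm_bounds:
  assumes \<gamma>: "\<gamma> \<in> sobolev 2 \<infinity> I" "\<gamma> \<in> sobolev0_I \<infinity>" and D: "AE t in leb I. \<bar>d2 \<gamma> t\<bar> \<le> D" "0 \<le> D"
  shows "sob_seminorm 1 \<infinity> I \<gamma> \<le> D" "sob_seminorm 2 \<infinity> I \<gamma> \<le> D" "sob_norm 2 \<infinity> I \<gamma> \<le> D"
proof -
  note b = zero_trace_second_order_bounds[OF \<gamma> D]
  have m: "Dlen j I \<gamma> \<in> borel_measurable (leb I)" if "j \<le> 2" for j by (rule Dlen_measurable[OF \<gamma>(1) open_I that])
  have "AE t in leb I. \<gamma> t = wderiv I [] \<gamma> t"
    using sobolev_weak_deriv(1)[OF \<gamma>(1) open_I, of "[]"] weak_deriv_Nil_AE[of I \<gamma> "wderiv I [] \<gamma>"] by auto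
  with b(2) have "AE t in leb I. norm (Dlen 0 I \<gamma> t) \<le> D"
    by eventually_elim (use D(2) in \<open>auto simp: Dlen_0\<close>)
  from Lnorm_infinity_le[OF m this D(2)] have 0: "sob_seminorm 0 \<infinity> I \<gamma> \<le> D" by (simp add: sob_seminorm_Dlen)
  have "AE t in leb I. norm (Dlen 1 I \<gamma> t) \<le> D" using b(1) unfolding Dlen_I by eventually_elim (use D(2) in auto)
  from Lnorm_infinity_le[OF m this D(2)] show 1: "sob_seminorm 1 \<infinity> I \<gamma> \<le> D" by (simp add: sob_seminorm_Dlen)
  have "AE t in leb I. norm (Dlen 2 I \<gamma> t) \<le> D" using D(1) by eventually_elim (simp add: Dlen_I)
  from Lnorm_infinity_le[OF m this D(2)] show 2: "sob_seminorm 2 \<infinity> I \<gamma> \<le> D" by (simp add: sob_seminorm_Dlen)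
  have "{..2::nat} = {0, 1, 2}" by auto
  then show "sob_norm 2 \<infinity> I \<gamma> \<le> D" unfolding sob_norm_def using 0 1 2 by simp
qed

lemma wderiv_diff_AE:
  assumes f: "f \<in> sobolev k p S" and g: "g \<in> sobolev k p S" and S: "open S" and "is": "is \<in> lists Basis" "length is \<le> k"
  shows "AE x in leb S. wderiv S is (\<lambda>x. f x - g x) x = wderiv S is f x - wderiv S is g x"
    and "AE x in leb S. wderiv S is (\<lambda>x. f x + g x) x = wderiv S is f x + wderiv S is g x"
  by (rule wderiv_AE_eq[OF weak_deriv_diff[OF sobolev_weak_deriv(1)[OF f S "is"] sobolev_weak_deriv(1)[OF g S "is"] S "is"(1)] S])
    (rule wderiv_AE_eq[OF weak_deriv_add[OF sobolev_weak_deriv(1)[OF f S "is"] sobolev_weak_deriv(1)[OF g S "is"] S "is"(1)] S])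

lemma d_diff_bounds:
  assumes \<gamma>: "\<gamma> \<in> sobolev 2 \<infinity> I" "\<gamma> \<in> sobolev0_I \<infinity>" and \<eta>: "\<eta> \<in> sobolev 2 \<infinity> I" "\<eta> \<in> sobolev0_I \<infinity>"
    and D: "AE t in leb I. \<bar>d2 \<gamma> t - d2 \<eta> t\<bar> \<le> D" "0 \<le> D"
  shows "close_coeffs D \<gamma> \<eta>"
    and "sob_norm 2 \<infinity> I (\<lambda>t. \<gamma> t - \<eta> t) \<le> D"
proof -
  let ?h = "\<lambda>t. \<gamma> t - \<eta> t"
  have h: "?h \<in> sobolev 2 \<infinity> I" "?h \<in> sobolev0_I \<infinity>" using sobolev_diff(1)[OF \<gamma>(1) \<eta>(1)] sobolev0_I_diff[OF \<gamma>(2) \<eta>(2)] by auto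
  have e: "AE t in leb I. d1 ?h t = d1 \<gamma> t - d1 \<eta> t" "AE t in leb I. d2 ?h t = d2 \<gamma> t - d2 \<eta> t"
    unfolding d1_def d2_def by (rule wderiv_diff_AE(1)[OF \<gamma>(1) \<eta>(1)]; simp)+
  have b: "AE t in leb I. \<bar>d2 ?h t\<bar> \<le> D" using e(2) D(1) by eventually_elim simp
  show "close_coeffs D \<gamma> \<eta>"
    using e(1) zero_trace_second_order_bounds[OF h b D(2)] D(1) by eventually_elim simp
  show "sob_norm 2 \<infinity> I ?h \<le> D" by (rule zero_trace_norm_bounds(3)[OF h b D(2)])
qed

lemma d2_diff_le:
  assumes \<gamma>: "\<gamma> \<in> sobolev 2 \<infinity> I" and \<eta>: "\<eta> \<in> sobolev 2 \<infinity> I"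
  shows "AE t in leb I. \<bar>d2 \<gamma> t - d2 \<eta> t\<bar> \<le> sob_seminorm 2 \<infinity> I (\<lambda>t. \<gamma> t - \<eta> t)"
proof -
  have "AE t in leb I. d2 (\<lambda>t. \<gamma> t - \<eta> t) t = d2 \<gamma> t - d2 \<eta> t"
    unfolding d2_def by (rule wderiv_diff_AE(1)[OF \<gamma> \<eta>]; simp)
  with d2_le_seminorm[OF sobolev_diff(1)[OF \<gamma> \<eta> open_I]] show ?thesis by (auto elim: AE_mp)
qed

lemma regular_gammasD:
  assumes "\<gamma> \<in> regular_gammas"
  shows "\<gamma> \<in> sobolev 2 \<infinity> I" "\<gamma> \<in> sobolev0_I \<infinity>" "AE t in leb I. \<bar>d2 \<gamma> t\<bar> \<le> 1"
proof -
  show "\<gamma> \<in> sobolev 2 \<infinity> I" "\<gamma> \<in> sobolev0_I \<infinity>" using assms by (auto simp: regular_gammas_def)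
  then show "AE t in leb I. \<bar>d2 \<gamma> t\<bar> \<le> 1"
    using d2_le_seminorm[of \<gamma>] assms by (auto simp: regular_gammas_def elim: AE_mp)
qed

lemma regular_gammasI:
  "\<gamma> \<in> sobolev 2 \<infinity> I \<Longrightarrow> \<gamma> \<in> sobolev0_I \<infinity> \<Longrightarrow> AE t in leb I. \<bar>d2 \<gamma> t\<bar> \<le> 1 \<Longrightarrow> \<gamma> \<in> regular_gammas"
  using zero_trace_norm_bounds[of \<gamma> 1] by (auto simp: regular_gammas_def)

lemma AE_Omega_witness:
  assumes "AE x in leb Omega. P x" "open B" "B \<noteq> {}" "B \<subseteq> Omega"
  obtains x where "x \<in> B" "P x"
proof -
  have "AE x in lebesgue. x \<in> Omega \<longrightarrow> P x" using assms(1) by (simp add: AE_restrict_space_iff)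
  then obtain N where N: "negligible N" "{x. \<not> (x \<in> Omega \<longrightarrow> P x)} \<subseteq> N" unfolding eventually_ae_filter_negligible by blast
  have "\<not> B \<subseteq> N" using open_not_negligible[OF assms(2,3)] negligible_subset[OF N(1)] by blast
  with N(2) assms(4) show thesis using that by blast
qed

text \<open>The estimates above are in terms of \<open>9/4\<close>, the theorem in terms of \<open>C\<^sub>A\<close>.\<close>

lemma A_bound_lower:
  assumes "A_bound C" shows "9 / 4 \<le> C"
proof -
  let ?g = "\<lambda>t::real. t * t - t" and ?g' = "\<lambda>t::real. 2 * t - 1"
  have sg: "smooth ?g" by (rule smooth_diff[OF smooth_id_sq(2,1)])
  have der: "(?g has_real_derivative ?g' t) (at t)" for t by (auto intro!: derivative_eq_intros)
  have dg: "dpartial 1 ?g = ?g'" by (rule ext, rule dpartial_realI, rule der)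
  have w: "weak_deriv I [1] ?g ?g'" using weak_deriv_smooth[OF sg _ open_I, of 1] unfolding dg by simp
  have cont: "continuous_on UNIV ?g" "continuous_on UNIV ?g'" by (intro continuous_intros)+
  note m = continuous_lebesgue_measurable(2)[OF cont(1), of I] continuous_lebesgue_measurable(2)[OF cont(2), of I]
  have bd: "\<bar>?g t\<bar> \<le> 1" "\<bar>?g' t\<bar> \<le> 1" if "t \<in> I" for t
  proof -
    from that have t: "0 < t" "t < 1" by (auto simp: I_def)
    then have "0 \<le> t * t" "t * t \<le> 1" by (auto intro: mult_le_one)
    with t show "\<bar>?g t\<bar> \<le> 1" "\<bar>?g' t\<bar> \<le> 1" by linarith+
  qed
  have ae: "AE t in leb I. \<bar>?g t\<bar> \<le> 1" "AE t in leb I. \<bar>?g' t\<bar> \<le> 1"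
    by (rule AE_I2, simp add: space_restrict_space bd)+
  have L: "?g \<in> Lspace \<infinity> (leb I)" "?g' \<in> Lspace \<infinity> (leb I)" using m ae by (auto simp: Lspace_def)
  note i = integrable_I_bounded[OF m(1) ae(1)] integrable_I_bounded[OF m(2) ae(2)]
  have s1: "?g \<in> sobolev 1 \<infinity> I"
    by (rule sobolev_1I[OF open_I L(1), where h = "\<lambda>_. ?g'"]) (use w L(2) smooth_loc_integrable[OF sg] in auto)
  have pr: "prim ?g' t = ?g t" if "0 \<le> t" "t \<le> 1" for t using LINT_I_FTC[OF der cont(2) that] by simp
  have "has_trace I (count_space {0, 1}) (\<lambda>t. t) ?g (\<lambda>t. 0)"
    unfolding zero_trace_I_iff[OF i w] using pr[of 1]
    by (auto simp: prim_one space_restrict_space I_def pr intro!: AE_I2)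
  with s1 have s0: "?g \<in> sobolev0_I \<infinity>" by (simp add: sobolev0_I_def)
  have d: "AE t in leb I. d1 ?g t = ?g' t" unfolding d1_def by (rule wderiv_AE_eq[OF w open_I])
  have "sob_seminorm 1 \<infinity> I ?g \<le> 1"
    unfolding sob_seminorm_Dlen
  proof (rule Lnorm_infinity_le)
    show "Dlen 1 I ?g \<in> borel_measurable (leb I)" by (rule Dlen_measurable[OF s1 open_I order_refl])
    show "AE t in leb I. norm (Dlen 1 I ?g t) \<le> 1" unfolding Dlen_I using d ae(2) by eventually_elim simp
  qed simp
  with assms s0 have "AE x in leb Omega. norm (A ?g x) \<le> C" unfolding A_bound_def by blast
  with AE_first_coordinate[OF d] have ae: "AE x in leb Omega. norm (A ?g x) \<le> C \<and> d1 ?g (x $ 1) = ?g' (x $ 1)" by auto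
  \<comment> \<open>At the corner \<open>(0, 1)\<close> the matrix tends to one with entries \<open>1, 1, 1, 2\<close>, of norm \<open>sqrt 7 > 9/4\<close>.\<close>
  let ?B = "box (vector [0, 19 / 20]) (vector [1 / 20, 1]) :: (real ^ 2) set"
  have "vector [1 / 40, 39 / 40] \<in> ?B" by (simp add: mem_box_cart forall_2)
  then have ne: "?B \<noteq> {}" by blast
  have sub: "?B \<subseteq> Omega" by (auto simp: mem_box_cart forall_2 Omega_def)
  obtain x where x: "x \<in> ?B" "norm (A ?g x) \<le> C" "d1 ?g (x $ 1) = ?g' (x $ 1)"
    by (rule AE_Omega_witness[OF ae open_box ne sub]) (use that in blast)
  define s b where "s = x $ 1" and "b = x $ 2"
  have sb: "0 < s" "s < 1 / 20" "19 / 20 < b" "b < 1" using x(1) by (auto simp: mem_box_cart forall_2 s_def b_def)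
  define k where "k = (1 - 2 * s) * b"
  have s2: "s * s \<le> 1 / 20 * (1 / 20)" "0 \<le> s * s" using mult_mono[of s "1 / 20" s "1 / 20"] sb by auto
  have "9 / 10 * (19 / 20) \<le> k" unfolding k_def using sb by (intro mult_mono) auto
  then have k2: "(17 / 20)\<^sup>2 \<le> k\<^sup>2" by (intro power_mono) auto
  have s3: "19 / 20 \<le> 1 + (s * s - s)" using sb s2(2) by linarith
  then have a: "(19 / 20)\<^sup>2 \<le> (1 + (s * s - s))\<^sup>2" by (intro power_mono) auto
  have "1 + (17 / 20)\<^sup>2 \<le> (1 + k\<^sup>2) / (1 + (s * s - s))"
  proof -
    have "0 < 1 + (s * s - s)" "1 + (s * s - s) \<le> 1" using s3 sb mult_left_le[of s s] by auto
    then have "1 + k\<^sup>2 \<le> (1 + k\<^sup>2) / (1 + (s * s - s))" by (simp add: pos_le_divide_eq mult_left_le)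
    with k2 show ?thesis by linarith
  qed
  then have c: "(1 + (17 / 20)\<^sup>2)\<^sup>2 \<le> ((1 + k\<^sup>2) / (1 + (s * s - s)))\<^sup>2" by (intro power_mono) auto
  have "A ?g x = vector [vector [1 + (s * s - s), k], vector [k, (1 + k\<^sup>2) / (1 + (s * s - s))]]"
    unfolding A_def A_mat_def x(3) by (simp add: s_def b_def k_def power_mult_distrib power2_commute left_diff_distrib right_diff_distrib mult.commute)
  then have "(norm (A ?g x))\<^sup>2 = (1 + (s * s - s))\<^sup>2 + k\<^sup>2 + k\<^sup>2 + ((1 + k\<^sup>2) / (1 + (s * s - s)))\<^sup>2" by (simp add: norm_mat2)
  moreover have "(9 / 4)\<^sup>2 \<le> (19 / 20 :: real)\<^sup>2 + (17 / 20)\<^sup>2 + (17 / 20)\<^sup>2 + (1 + (17 / 20)\<^sup>2)\<^sup>2" by (simp add: power2_eq_square)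
  ultimately have "(9 / 4)\<^sup>2 \<le> (norm (A ?g x))\<^sup>2" using a c k2 by linarith
  then have "9 / 4 \<le> norm (A ?g x)" by (rule power2_le_imp_le) simp
  with x(2) show ?thesis by linarith
qed

section \<open>The fixed point map\<close>

lemma ellip_linear:
  assumes w: "w \<in> sobolev 2 p Omega" and z: "z \<in> sobolev 2 p Omega"
  shows "AE x in leb Omega. ellip \<gamma> (\<lambda>x. w x - z x) x = ellip \<gamma> w x - ellip \<gamma> z x"
    and "AE x in leb Omega. ellip \<gamma> (\<lambda>x. w x + z x) x = ellip \<gamma> w x + ellip \<gamma> z x"
proof -
  let ?L = "[[ex, ex], [ey, ex], [ex, ey], [ey, ey], [ey]]"
  have L: "is \<in> lists Basis \<and> length is \<le> 2" if "is \<in> set ?L" for "is" using that by auto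
  have "AE x in leb Omega. \<forall>is\<in>set ?L. wderiv Omega is (\<lambda>x. w x - z x) x = wderiv Omega is w x - wderiv Omega is z x"
    using L by (intro AE_finite_allI wderiv_diff_AE(1)[OF w z open_Omega]) auto
  then show "AE x in leb Omega. ellip \<gamma> (\<lambda>x. w x - z x) x = ellip \<gamma> w x - ellip \<gamma> z x"
  proof eventually_elim
    case (elim x)
    show ?case by (simp add: elim[rule_format] ellip_def Let_def algebra_simps)
  qed
  have "AE x in leb Omega. \<forall>is\<in>set ?L. wderiv Omega is (\<lambda>x. w x + z x) x = wderiv Omega is w x + wderiv Omega is z x"
    using L by (intro AE_finite_allI wderiv_diff_AE(2)[OF w z open_Omega]) auto
  then show "AE x in leb Omega. ellip \<gamma> (\<lambda>x. w x + z x) x = ellip \<gamma> w x + ellip \<gamma> z x"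
  proof eventually_elim
    case (elim x)
    show ?case by (simp add: elim[rule_format] ellip_def Let_def algebra_simps)
  qed
qed

lemma grad_diff_AE:
  assumes w: "w \<in> sobolev 2 p Omega" and z: "z \<in> sobolev 2 p Omega"
  shows "AE x in leb Omega. grad (\<lambda>x. w x - z x) x = grad w x - grad z x"
proof -
  have "AE x in leb Omega. \<forall>is\<in>{[ex], [ey]}. wderiv Omega is (\<lambda>x. w x - z x) x = wderiv Omega is w x - wderiv Omega is z x"
    by (intro AE_finite_allI wderiv_diff_AE(1)[OF w z open_Omega]) auto
  then show ?thesis by eventually_elim (simp add: R2_eq_iff grad_nth)
qed

lemma A_top: "A \<gamma> (top_side t) = A_mat (\<gamma> t) (d1 \<gamma> t) 1"
  by (simp add: A_def top_side_def)

context
  fixes p q \<kappa> \<beta> C\<^sub>A C\<^sub>H C\<^sub>S :: real and v :: "real ^ 2 \<Rightarrow> real"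
  assumes p: "2 < p" and q: "q = p / (p - 1)" and \<kappa>: "0 < \<kappa>"
    and v: "v \<in> sobolev 2 (ereal p) Omega"
    and inf_sup: "inf_sup_Omega p q \<beta>" and bound: "A_bound C\<^sub>A"
    and estimate: "elliptic_estimate p C\<^sub>H" and solvable: "elliptic_solvable p"
    and embedding: "sobolev_embedding_constant p C\<^sub>S"
begin

abbreviation (input) W2 :: "(real ^ 2 \<Rightarrow> real) set" where "W2 \<equiv> sobolev 2 (ereal p) Omega"

abbreviation (input) N2 :: "(real ^ 2 \<Rightarrow> real) \<Rightarrow> real" where "N2 w \<equiv> sob_norm 2 (ereal p) Omega w"

lemma constants: "9 / 4 \<le> C\<^sub>A" "0 < C\<^sub>H" "0 < C\<^sub>S" "0 < \<beta>" "1 \<le> ereal p" "1 < p" "1 \<le> p"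
  using A_bound_lower[OF bound] estimate embedding inf_sup p
  by (auto simp: elliptic_estimate_def sobolev_embedding_constant_def inf_sup_Omega_def one_ereal_def)

lemma N2_nonneg: "w \<in> W2 \<Longrightarrow> 0 \<le> N2 w"
  by (rule sob_norm_Dpow(3)[OF _ open_Omega constants(7)])

lemma grad_bound:
  assumes "w \<in> W2"
  shows "AE x in leb Omega. norm (grad w x) \<le> C\<^sub>S * N2 w"
proof -
  from embedding assms have w: "w \<in> sobolev 1 \<infinity> Omega" "sob_norm 1 \<infinity> Omega w \<le> C\<^sub>S * N2 w"
    by (auto simp: sobolev_embedding_constant_def)
  have "AE x in leb Omega. norm (Dlen 1 Omega w x) \<le> sob_seminorm 1 \<infinity> Omega w"
    unfolding sob_seminorm_Dlen by (rule Lspace_infinity_bound[OF Dlen_Lspace[OF w(1) open_Omega _ order_refl]]) simp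
  then show ?thesis
  proof eventually_elim
    case (elim x)
    have "sob_seminorm 1 \<infinity> Omega w \<le> sob_norm 1 \<infinity> Omega w" by (rule sob_norm_infinity) simp
    with elim w(2) show ?case by (simp only: norm_grad real_norm_def abs_of_nonneg[OF Dlen_nonneg])
  qed
qed

lemma trace_difference_bound:
  assumes w: "w \<in> W2" and z: "z \<in> W2"
    and G: "\<And>i. top_trace (\<lambda>x. grad w x $ i) (\<lambda>t. G t $ i)"
    and H: "\<And>i. top_trace (\<lambda>x. grad z x $ i) (\<lambda>t. H t $ i)"
  shows "AE t in leb I. norm (G t - H t) \<le> C\<^sub>S * N2 (\<lambda>x. w x - z x)"
    and "AE t in leb I. norm (G t) \<le> C\<^sub>S * N2 w"
proof -
  have d: "(\<lambda>x. w x - z x) \<in> W2" by (rule sobolev_diff(1)[OF w z open_Omega constants(5)])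
  have "AE x in leb Omega. norm (grad w x - grad z x) \<le> C\<^sub>S * N2 (\<lambda>x. w x - z x)"
    using grad_diff_AE[OF w z] grad_bound[OF d] by eventually_elim simp
  then show "AE t in leb I. norm (G t - H t) \<le> C\<^sub>S * N2 (\<lambda>x. w x - z x)"
    using has_trace_diff[OF G H open_Omega bounded_Omega] constants(3) N2_nonneg[OF d]
    by (intro trace_top_bound[where f = "\<lambda>x. grad w x - grad z x"]) auto
  show "AE t in leb I. norm (G t) \<le> C\<^sub>S * N2 w"
    by (rule trace_top_bound[OF G grad_bound[OF w]]) (use constants(3) N2_nonneg[OF w] in simp)
qed

lemma exists_gradient_trace:
  assumes "w \<in> W2"
  obtains G :: "real \<Rightarrow> real ^ 2" where "\<And>i. top_trace (\<lambda>x. grad w x $ i) (\<lambda>t. G t $ i)"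
proof -
  note s = W12_derivs(4)[OF assms constants(5)]
  obtain \<tau>1 \<tau>2 where \<tau>: "top_trace (wderiv Omega [ex] w) \<tau>1"
    "top_trace (wderiv Omega [ey] w) \<tau>2"
    using exists_trace_top[OF s[OF ex_Basis(1) ex_Basis(1)]] exists_trace_top[OF s[OF ex_Basis(2) ex_Basis(2)]] by metis
  have "top_trace (\<lambda>x. grad w x $ i) (\<lambda>t. (vector [\<tau>1 t, \<tau>2 t] :: real ^ 2) $ i)" for i :: 2
    using exhaust_2[of i] \<tau> by (auto simp: grad_nth)
  then show thesis by (rule that)
qed

text \<open>Every \<open>w\<close> solves the elliptic problem with right-hand side \<open>- ellip \<gamma> w\<close>.\<close>

lemma elliptic_bound:
  assumes \<gamma>: "\<gamma> \<in> regular_gammas" and w: "w \<in> W2" "w \<in> sobolev0_Omega (ereal p)"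
    and z: "z \<in> W2"
    and le: "AE x in leb Omega. \<bar>ellip \<gamma> w x\<bar> \<le> c * Dlen 2 Omega z x + d * Dlen 1 Omega z x" and cd: "0 \<le> c" "0 \<le> d"
  shows "N2 w \<le> C\<^sub>H * ((c + d) * N2 z)"
proof -
  let ?f = "\<lambda>x. - ellip \<gamma> w x"
  note g = regular_gammasD[OF \<gamma>]
  note div = divergence_formula(1)[OF g w(1) constants(5)]
  have m: "?f \<in> borel_measurable (leb Omega)" using div by (simp add: has_weak_div_def loc_integrable_def)
  have le': "AE x in leb Omega. \<bar>?f x\<bar> \<le> c * Dlen 2 Omega z x + d * Dlen 1 Omega z x" using le by simp
  note f = Lnorm_le_sob_norm[OF z open_Omega constants(7) m le' cd]
  have "elliptic_solution p \<gamma> ?f w" using w div by (simp add: elliptic_solution_def)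
  then have "N2 w \<le> C\<^sub>H * Lnorm (ereal p) (leb Omega) ?f" using estimate \<gamma> f(1) by (auto simp: elliptic_estimate_def)
  also have "\<dots> \<le> C\<^sub>H * ((c + d) * N2 z)" using f(2) constants(2) by simp
  finally show ?thesis .
qed

lemma flux_integrable:
  assumes \<gamma>: "\<gamma> \<in> regular_gammas" and w: "w \<in> W2"
  defines "F \<equiv> \<lambda>x. A \<gamma> x *v grad w x"
  shows "(\<lambda>x. F x $ i) \<in> borel_measurable (leb Omega)"
    and "AE x in leb Omega. \<bar>F x $ i\<bar> \<le> 9 / 4 * (C\<^sub>S * N2 w)"
    and "integrable (leb Omega) g \<Longrightarrow> integrable (leb Omega) (\<lambda>x. F x $ i * g x)"
proof -
  note g = regular_gammasD[OF \<gamma>]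
  have "F \<in> borel_measurable (leb Omega)"
    unfolding F_def using divergence_formula(2)[OF g w constants(5)] by simp
  then show m: "(\<lambda>x. F x $ i) \<in> borel_measurable (leb Omega)" by (rule measurable_compose[OF _ component_measurable])
  show b: "AE x in leb Omega. \<bar>F x $ i\<bar> \<le> 9 / 4 * (C\<^sub>S * N2 w)"
    using ellip_estimate(2)[OF regular_gammas_bounds[OF g]] grad_bound[OF w]
  proof eventually_elim
    case (elim x)
    have "\<bar>F x $ i\<bar> \<le> norm (A \<gamma> x) * norm (grad w x)"
      unfolding F_def by (rule order_trans[OF component_le_norm_cart norm_matrix_vector_le])
    also have "\<dots> \<le> 9 / 4 * (C\<^sub>S * N2 w)" using elim by (intro mult_mono) auto
    finally show ?case .
  qed
  show "integrable (leb Omega) (\<lambda>x. F x $ i * g x)" if "integrable (leb Omega) g"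
    using integrable_times_bounded[OF that m b] by (simp add: mult.commute)
qed

text \<open>The total flux \<open>A[\<gamma>] \<nabla>(y + v)\<close> is bounded and divergence free, so that the bilinear form of \<open>y\<close> at \<open>z\<close> is minus
  that of \<open>v\<close>, to which Hoelder's inequality applies.\<close>

lemma energy_bound:
  assumes \<gamma>: "\<gamma> \<in> regular_gammas" and y: "y \<in> W2" "y \<in> sobolev0_Omega (ereal p)"
    and eq: "AE x in leb Omega. ellip \<gamma> y x = - ellip \<gamma> v x"
  shows "sob_seminorm 1 (ereal p) Omega y \<le> \<beta> * C\<^sub>A * sob_seminorm 1 (ereal p) Omega v"
proof -
  let ?N = "leb Omega" and ?v = "sob_seminorm 1 (ereal p) Omega v"
  note g = regular_gammasD[OF \<gamma>]
  note div = divergence_formula(1)[OF g _ constants(5)]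
  define F where "F w x = A \<gamma> x *v grad w x" for w x
  note Fm = flux_integrable[OF \<gamma>, folded F_def]
  have q1: "1 < q" "1 / p + 1 / q = 1" unfolding q using p by (auto simp: field_simps)
  have v0: "0 \<le> ?v" unfolding sob_seminorm_def by (rule Lnorm_nonneg) simp
  have R2: "integrable ?N a \<Longrightarrow> integrable ?N b \<Longrightarrow> w \<in> W2 \<Longrightarrow>
      integrable ?N (\<lambda>x. F w x $ 1 * a x + F w x $ 2 * b x)" for w and a b :: "real ^ 2 \<Rightarrow> real"
    by (intro Bochner_Integration.integrable_add Fm(3))
  have flux0: "(LINT x|?N. (F y x $ 1 + F v x $ 1) * dpartial ex \<psi> x + (F y x $ 2 + F v x $ 2) * dpartial ey \<psi> x) = 0"
    if \<psi>: "test_function Omega \<psi>" for \<psi>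
  proof -
    have si: "integrable ?N (dpartial i \<psi>)" if "i \<in> Basis" for i
      using test_function_dpartial[OF \<psi> that] bounded_Omega by (intro smooth_integrable test_function_smooth) auto
    have d: "(LINT x|?N. F w x $ 1 * dpartial ex \<psi> x + F w x $ 2 * dpartial ey \<psi> x) = - (LINT x|?N. ellip \<gamma> w x * \<psi> x)"
      if "w \<in> W2" for w
      using div[OF that] \<psi> by (simp add: has_weak_div_def R2_Basis F_def)
    have "(LINT x|?N. (F y x $ 1 + F v x $ 1) * dpartial ex \<psi> x + (F y x $ 2 + F v x $ 2) * dpartial ey \<psi> x)
        = (LINT x|?N. (F y x $ 1 * dpartial ex \<psi> x + F y x $ 2 * dpartial ey \<psi> x) + (F v x $ 1 * dpartial ex \<psi> x + F v x $ 2 * dpartial ey \<psi> x))"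
      by (simp add: algebra_simps)
    also have "\<dots> = - (LINT x|?N. ellip \<gamma> y x * \<psi> x) - (LINT x|?N. ellip \<gamma> v x * \<psi> x)"
      using R2[OF si si y(1), of ex ey] R2[OF si si v, of ex ey] d[OF y(1)] d[OF v] by simp
    also have "(LINT x|?N. ellip \<gamma> y x * \<psi> x) = (LINT x|?N. - ellip \<gamma> v x * \<psi> x)"
      using div[OF y(1)] div[OF v] test_function_measurable[OF \<psi>] eq
      by (intro integral_cong_AE) (auto simp: has_weak_div_def loc_integrable_def elim: AE_mp)
    finally show ?thesis by simp
  qed
  have "B_Omega y z (A \<gamma>) / sob_seminorm 1 (ereal q) Omega z \<le> C\<^sub>A * ?v" if z: "z \<in> sobolev0_Omega (ereal q)" for z
  proof -
    have z1: "z \<in> sobolev 1 (ereal q) Omega" using z by (simp add: sobolev0_Omega_def)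
    have zi: "integrable ?N (wderiv Omega [i] z)" if "i \<in> Basis" for i
      using sobolev_weak_deriv(2)[OF z1 open_Omega, of "[i]"] that q1 by (intro Lspace_integrable[OF _ finite_measure_Omega]) (auto simp: one_ereal_def)
    have inner: "F w x \<bullet> grad z x = F w x $ 1 * wderiv Omega [ex] z x + F w x $ 2 * wderiv Omega [ey] z x" for w x
      by (simp add: inner_vec_def sum_2 grad_nth)
    note zR = R2[OF zi[OF ex_Basis(1)] zi[OF ex_Basis(2)], folded inner]
    let ?K = "9 / 4 * (C\<^sub>S * N2 y) + 9 / 4 * (C\<^sub>S * N2 v)"
    have K: "AE x in ?N. \<bar>F y x $ i + F v x $ i\<bar> \<le> ?K" for i
      using Fm(2)[OF y(1), of i] Fm(2)[OF v, of i] by eventually_elim linarith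
    have "(LINT x|?N. (F y x $ 1 + F v x $ 1) * wderiv Omega [ex] z x + (F y x $ 2 + F v x $ 2) * wderiv Omega [ey] z x) = 0"
      by (rule flux_against_zero_trace[OF _ _ K K _ flux0 z])
        (use Fm(1)[OF y(1)] Fm(1)[OF v] constants(3) N2_nonneg[OF y(1)] N2_nonneg[OF v] in auto)
    also have "(LINT x|?N. (F y x $ 1 + F v x $ 1) * wderiv Omega [ex] z x + (F y x $ 2 + F v x $ 2) * wderiv Omega [ey] z x)
        = (LINT x|?N. F y x \<bullet> grad z x + F v x \<bullet> grad z x)" unfolding inner by (simp add: algebra_simps)
    also have "\<dots> = B_Omega y z (A \<gamma>) + (LINT x|?N. F v x \<bullet> grad z x)"
      using zR[OF y(1)] zR[OF v] by (simp add: B_Omega_def F_def)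
    finally have B: "B_Omega y z (A \<gamma>) = - (LINT x|?N. F v x \<bullet> grad z x)" by simp
    have "\<bar>LINT x|?N. F v x \<bullet> grad z x\<bar> \<le> C\<^sub>A * (Lnorm (ereal p) ?N (Dlen 1 Omega v) * Lnorm (ereal q) ?N (Dlen 1 Omega z))"
    proof (rule Holder_bound)
      show "Dlen 1 Omega v \<in> Lspace (ereal p) ?N" by (rule Dlen_Lspace[OF v open_Omega constants(5)]) simp
      show "Dlen 1 Omega z \<in> Lspace (ereal q) ?N" by (rule Dlen_Lspace[OF z1 open_Omega]) (use q1 in \<open>simp_all add: one_ereal_def\<close>)
      show "(\<lambda>x. F v x \<bullet> grad z x) \<in> borel_measurable ?N" using zR[OF v] by simp
      show "AE x in ?N. \<bar>F v x \<bullet> grad z x\<bar> \<le> C\<^sub>A * (\<bar>Dlen 1 Omega v x\<bar> * \<bar>Dlen 1 Omega z x\<bar>)"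
        using ellip_estimate(2)[OF regular_gammas_bounds[OF g]]
      proof eventually_elim
        case (elim x)
        have "\<bar>F v x \<bullet> grad z x\<bar> \<le> norm (F v x) * norm (grad z x)" by (rule Cauchy_Schwarz_ineq2)
        also have "\<dots> \<le> (norm (A \<gamma> x) * norm (grad v x)) * norm (grad z x)"
          unfolding F_def by (rule mult_right_mono[OF norm_matrix_vector_le]) simp
        also have "\<dots> \<le> (C\<^sub>A * norm (grad v x)) * norm (grad z x)" using elim constants(1) by (intro mult_right_mono) auto
        finally show ?case by (simp only: norm_grad[symmetric] abs_norm_cancel mult.assoc)
      qed
    qed (use q1 constants in auto)
    then have le: "B_Omega y z (A \<gamma>) \<le> C\<^sub>A * ?v * sob_seminorm 1 (ereal q) Omega z"
      unfolding B sob_seminorm_Dlen by (simp add: mult.assoc)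
    show ?thesis
    proof (cases "sob_seminorm 1 (ereal q) Omega z = 0")
      case True
      with v0 constants(1) show ?thesis by simp
    next
      case False
      moreover have "0 \<le> sob_seminorm 1 (ereal q) Omega z" unfolding sob_seminorm_def by (rule Lnorm_nonneg) simp
      ultimately show ?thesis using le by (simp add: pos_divide_le_eq)
    qed
  qed
  then have "(SUP z \<in> {z \<in> sobolev0_Omega (ereal q). \<not> (AE x in ?N. z x = 0)}.
      ereal (B_Omega y z (A \<gamma>) / sob_seminorm 1 (ereal q) Omega z)) \<le> ereal (C\<^sub>A * ?v)"
    by (intro SUP_least) auto
  then have "ereal \<beta> * (SUP z \<in> {z \<in> sobolev0_Omega (ereal q). \<not> (AE x in ?N. z x = 0)}.
      ereal (B_Omega y z (A \<gamma>) / sob_seminorm 1 (ereal q) Omega z)) \<le> ereal \<beta> * ereal (C\<^sub>A * ?v)"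
    by (rule ereal_mult_left_mono) (use constants(4) in simp)
  note upper = this
  have "sob_seminorm 1 \<infinity> I \<gamma> \<le> 1" "\<gamma> \<in> sobolev0_I \<infinity>" using \<gamma> by (auto simp: regular_gammas_def)
  then have "ereal (sob_seminorm 1 (ereal p) Omega y) \<le> ereal \<beta> * (SUP z \<in> {z \<in> sobolev0_Omega (ereal q). \<not> (AE x in ?N. z x = 0)}.
      ereal (B_Omega y z (A \<gamma>) / sob_seminorm 1 (ereal q) Omega z))"
    using inf_sup y(2) unfolding inf_sup_Omega_def by blast
  from order_trans[OF this upper] show ?thesis by (simp add: mult.assoc)
qed

lemma normal_flux_bound:
  assumes "small_coeffs \<gamma>"
    and G: "AE t in leb I. norm (G t) \<le> K"
  shows "AE t in leb I. \<bar>(A \<gamma> (top_side t) *v G t) \<bullet> ey\<bar> \<le> C\<^sub>A * K"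
  using assms
proof eventually_elim
  case (elim t)
  have "norm (A \<gamma> (top_side t)) \<le> 9 / 4" unfolding A_top by (rule A_mat_bound) (use elim in auto)
  with constants(1) elim have "norm (A \<gamma> (top_side t)) * norm (G t) \<le> C\<^sub>A * K" by (intro mult_mono) auto
  moreover have "\<bar>(A \<gamma> (top_side t) *v G t) \<bullet> ey\<bar> \<le> norm (A \<gamma> (top_side t) *v G t)"
    by (simp add: component_le_norm_cart)
  ultimately show ?case using norm_matrix_vector_le[of "A \<gamma> (top_side t)" "G t"] by linarith
qed

lemma B2D:
  assumes "(\<gamma>, y) \<in> B2 p \<beta> C\<^sub>A C\<^sub>H v"
  shows "\<gamma> \<in> regular_gammas" "y \<in> W2" "y \<in> sobolev0_Omega (ereal p)"
    and "(\<lambda>x. y x + v x) \<in> W2" "N2 (\<lambda>x. y x + v x) \<le> (1 + 2 * C\<^sub>A * C\<^sub>H) * N2 v"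
proof -
  show "\<gamma> \<in> regular_gammas" and y: "y \<in> W2" and "y \<in> sobolev0_Omega (ereal p)"
    using assms by (auto simp: B2_def B1_def W22_space_def regular_gammas_def)
  show "(\<lambda>x. y x + v x) \<in> W2" by (rule sobolev_diff(2)[OF y v open_Omega constants(5)])
  have "N2 y \<le> 2 * C\<^sub>A * C\<^sub>H * N2 v" using assms by (auto simp: B2_def)
  with sob_norm_triangle[OF y v open_Omega constants(7)]
  show "N2 (\<lambda>x. y x + v x) \<le> (1 + 2 * C\<^sub>A * C\<^sub>H) * N2 v" by (simp add: distrib_right)
qed

context
  fixes u :: "real \<Rightarrow> real"
  assumes u: "u \<in> Lspace \<infinity> (leb I)"
    and small: "C\<^sub>A * C\<^sub>S * (1 + 2 * C\<^sub>A * C\<^sub>H) * N2 v + Lnorm \<infinity> (leb I) u \<le> \<kappa>"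
begin

lemma boundary_data_bound:
  assumes a: "(\<gamma>, y) \<in> B2 p \<beta> C\<^sub>A C\<^sub>H v"
    and G: "\<And>i. top_trace (\<lambda>x. grad (\<lambda>x. y x + v x) x $ i) (\<lambda>t. G t $ i)"
  shows "AE t in leb I. \<bar>((A \<gamma> (top_side t) *v G t) \<bullet> ey + u t) / \<kappa>\<bar> \<le> 1"
proof -
  note b = B2D[OF a]
  note g = regular_gammasD[OF b(1)]
  have "C\<^sub>A * (C\<^sub>S * N2 (\<lambda>x. y x + v x)) \<le> C\<^sub>A * (C\<^sub>S * ((1 + 2 * C\<^sub>A * C\<^sub>H) * N2 v))"
    using b(5) constants by (intro mult_left_mono) auto
  moreover have "\<dots> = C\<^sub>A * C\<^sub>S * (1 + 2 * C\<^sub>A * C\<^sub>H) * N2 v" by simp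
  ultimately have K: "C\<^sub>A * (C\<^sub>S * N2 (\<lambda>x. y x + v x)) + Lnorm \<infinity> (leb I) u \<le> \<kappa>" using small by linarith
  have "AE t in leb I. \<bar>(A \<gamma> (top_side t) *v G t) \<bullet> ey\<bar> \<le> C\<^sub>A * (C\<^sub>S * N2 (\<lambda>x. y x + v x))"
    by (rule normal_flux_bound[OF regular_gammas_bounds[OF g] trace_difference_bound(2)[OF b(4) b(4) G G]])
  with Lspace_infinity_bound[OF u] show ?thesis
  proof eventually_elim
    case (elim t)
    then have "\<bar>(A \<gamma> (top_side t) *v G t) \<bullet> ey + u t\<bar> \<le> \<kappa>" using K unfolding real_norm_def by linarith
    then show ?case using \<kappa> by (simp add: abs_divide)
  qed
qed

lemma T_exists:
  assumes a: "(\<gamma>, y) \<in> B2 p \<beta> C\<^sub>A C\<^sub>H v"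
  shows "\<exists>b. T_equations p \<kappa> v u (\<gamma>, y) b"
proof -
  note b = B2D[OF a]
  note g = regular_gammasD[OF b(1)]
  obtain G :: "real \<Rightarrow> real ^ 2" where G: "\<And>i. top_trace (\<lambda>x. grad (\<lambda>x. y x + v x) x $ i) (\<lambda>t. G t $ i)"
    by (rule exists_gradient_trace[OF b(4)]) (rule that)
  have [measurable]: "(\<lambda>t. G t $ i) \<in> borel_measurable (leb I)" for i
    using G[of i] by (auto simp: has_trace_def dest: Lspace_measurable)
  have [measurable]: "\<gamma> \<in> borel_measurable (leb I)" "d1 \<gamma> \<in> borel_measurable (leb I)" "u \<in> borel_measurable (leb I)"
    using sobolev_Lspace[OF g(1) open_I] I_derivs(4)[OF g(1)] u by (auto dest: Lspace_measurable)
  define k where "k = (\<lambda>t. ((A \<gamma> (top_side t) *v G t) \<bullet> ey + u t) / \<kappa>)"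
  have "k \<in> borel_measurable (leb I)" unfolding k_def A_vec top_side_def by simp measurable
  then have km: "(\<lambda>t. - k t) \<in> borel_measurable (leb I)" by simp
  have kb: "AE t in leb I. \<bar>- k t\<bar> \<le> 1" using boundary_data_bound[OF a G] by (simp add: k_def)
  obtain \<gamma>' where \<gamma>': "\<gamma>' \<in> sobolev 2 \<infinity> I" "\<gamma>' \<in> sobolev0_I \<infinity>" "AE t in leb I. d2 \<gamma>' t = - k t"
    by (rule exists_zero_trace_second_primitive[OF km kb])
  have d2: "AE t in leb I. \<bar>d2 \<gamma>' t\<bar> \<le> 1" using \<gamma>'(3) kb by eventually_elim simp
  have r: "\<gamma>' \<in> regular_gammas" by (rule regular_gammasI[OF \<gamma>'(1,2) d2])
  note div = divergence_formula(1)[OF \<gamma>'(1,2) d2 v constants(5)]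
  have "ellip \<gamma>' v \<in> Lspace (ereal p) (leb Omega)"
    by (rule Lnorm_le_sob_norm(1)[OF v open_Omega constants(7) _ ellip_estimate(1)[OF regular_gammas_bounds[OF \<gamma>'(1,2) d2]]])
      (use div in \<open>auto simp: has_weak_div_def loc_integrable_def\<close>)
  with solvable r obtain y' where y': "elliptic_solution p \<gamma>' (ellip \<gamma>' v) y'" unfolding elliptic_solvable_def by blast
  have "AE t in leb I. - \<kappa> * d2 \<gamma>' t = (A \<gamma> (top_side t) *v G t) \<bullet> ey + u t"
    using \<gamma>'(3) by eventually_elim (use \<kappa> in \<open>simp add: k_def\<close>)
  with \<gamma>' G div y' have "T_equations p \<kappa> v u (\<gamma>, y) (\<gamma>', y')" unfolding T_equations_def by auto
  then show ?thesis by blast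
qed

lemma T_equationsD:
  assumes a: "(\<gamma>, y) \<in> B2 p \<beta> C\<^sub>A C\<^sub>H v" and T: "T_equations p \<kappa> v u (\<gamma>, y) (\<gamma>', y')"
  shows "\<gamma>' \<in> regular_gammas" "y' \<in> W2" "y' \<in> sobolev0_Omega (ereal p)"
    and "AE x in leb Omega. ellip \<gamma>' y' x = - ellip \<gamma>' v x"
proof -
  obtain G g where g: "\<gamma>' \<in> sobolev 2 \<infinity> I" "\<gamma>' \<in> sobolev0_I \<infinity>"
    and G: "\<And>i. top_trace (\<lambda>x. grad (\<lambda>x. y x + v x) x $ i) (\<lambda>t. (G t :: real ^ 2) $ i)"
    and eq: "AE t in leb I. - \<kappa> * d2 \<gamma>' t = (A \<gamma> (top_side t) *v G t) \<bullet> ey + u t"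
    and w: "has_weak_div Omega (\<lambda>x. A \<gamma>' x *v grad v x) g" and sol: "elliptic_solution p \<gamma>' g y'"
    using T unfolding T_equations_def by auto
  have d2: "AE t in leb I. \<bar>d2 \<gamma>' t\<bar> \<le> 1"
    using boundary_data_bound[OF a G] eq
  proof eventually_elim
    case (elim t)
    then have "((A \<gamma> (top_side t) *v G t) \<bullet> ey + u t) / \<kappa> = - d2 \<gamma>' t" using \<kappa> by (simp add: field_simps)
    then show ?case using elim(1) by simp
  qed
  show "\<gamma>' \<in> regular_gammas" by (rule regular_gammasI[OF g d2])
  show y: "y' \<in> W2" "y' \<in> sobolev0_Omega (ereal p)" using sol by (auto simp: elliptic_solution_def)
  have "has_weak_div Omega (\<lambda>x. A \<gamma>' x *v grad y' x) (\<lambda>x. - g x)" using sol by (simp add: elliptic_solution_def)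
  from has_weak_div_unique[OF divergence_formula(1)[OF g d2 y(1) constants(5)] this open_Omega]
    has_weak_div_unique[OF divergence_formula(1)[OF g d2 v constants(5)] w open_Omega]
  show "AE x in leb Omega. ellip \<gamma>' y' x = - ellip \<gamma>' v x" by eventually_elim simp
qed

lemma T_equations_B2:
  assumes a: "(\<gamma>, y) \<in> B2 p \<beta> C\<^sub>A C\<^sub>H v" and T: "T_equations p \<kappa> v u (\<gamma>, y) (\<gamma>', y')"
  shows "(\<gamma>', y') \<in> B2 p \<beta> C\<^sub>A C\<^sub>H v"
proof -
  note t = T_equationsD[OF a T]
  note g = regular_gammasD[OF t(1)]
  have "AE x in leb Omega. \<bar>ellip \<gamma>' y' x\<bar> \<le> 9 / 4 * Dlen 2 Omega v x + 9 / 4 * Dlen 1 Omega v x"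
    using t(4) ellip_estimate(1)[OF regular_gammas_bounds[OF g], of v] by eventually_elim simp
  from elliptic_bound[OF t(1-3) v this] have "N2 y' \<le> C\<^sub>H * (9 / 2 * N2 v)" by simp
  also have "\<dots> \<le> C\<^sub>H * (2 * C\<^sub>A * N2 v)"
    using constants(1,2) N2_nonneg[OF v] by (intro mult_left_mono mult_right_mono) auto
  finally have "N2 y' \<le> 2 * C\<^sub>A * C\<^sub>H * N2 v" by (simp add: ac_simps)
  moreover have "sob_seminorm 1 (ereal p) Omega y' \<le> \<beta> * C\<^sub>A * sob_seminorm 1 (ereal p) Omega v" by (rule energy_bound[OF t])
  ultimately show ?thesis using t(1-3) g(1,2) by (auto simp: B2_def B1_def W22_space_def regular_gammas_def)
qed

lemma normal_flux_diff_bound: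
  assumes "small_coeffs \<gamma>"
    and "small_coeffs \<eta>"
    and "close_coeffs D \<gamma> \<eta>"
    and "AE t in leb I. norm (G t) \<le> K" "AE t in leb I. norm (G t - H t) \<le> L"
  shows "AE t in leb I. \<bar>(A \<gamma> (top_side t) *v G t) \<bullet> ey - (A \<eta> (top_side t) *v H t) \<bullet> ey\<bar> \<le> C\<^sub>A * (D * K + L)"
  using assms
proof eventually_elim
  case (elim t)
  let ?A = "A \<gamma> (top_side t)" and ?B = "A \<eta> (top_side t)"
  have "norm (?A - ?B) \<le> 3 / 2 * D" unfolding A_top by (rule A_mat_diff_bound) (use elim in auto)
  moreover have D: "0 \<le> D" using elim(3) by linarith
  then have "3 / 2 * D \<le> C\<^sub>A * D" using constants(1) by (intro mult_right_mono) auto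
  ultimately have "norm (?A - ?B) * norm (G t) \<le> (C\<^sub>A * D) * K" using elim(4) D constants(1) by (intro mult_mono) auto
  moreover have "norm ?B \<le> 9 / 4" unfolding A_top by (rule A_mat_bound) (use elim in auto)
  with constants(1) elim(5) have "norm ?B * norm (G t - H t) \<le> C\<^sub>A * L" by (intro mult_mono) auto
  moreover have "\<bar>((?A - ?B) *v G t) \<bullet> ey\<bar> \<le> norm (?A - ?B) * norm (G t)" "\<bar>(?B *v (G t - H t)) \<bullet> ey\<bar> \<le> norm ?B * norm (G t - H t)"
    unfolding inner_axis_R2 by (rule order_trans[OF component_le_norm_cart norm_matrix_vector_le])+
  moreover have "(?A *v G t) \<bullet> ey - (?B *v H t) \<bullet> ey = ((?A - ?B) *v G t) \<bullet> ey + (?B *v (G t - H t)) \<bullet> ey"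
    by (simp add: matrix_vector_mult_diff_rdistrib matrix_vector_mult_diff_distrib)
  ultimately show ?case by (simp add: distrib_left)
qed

text \<open>First the second derivatives of \<open>\<gamma>'\<close> and \<open>\<eta>'\<close> are compared through the boundary condition, at the cost of the
  factor \<open>C\<^sub>A C\<^sub>S / \<kappa>\<close>; then \<open>y' - z'\<close> through the difference of the two elliptic operators at \<open>z' + v\<close>.\<close>

lemma T_equations_contract:
  assumes a: "(\<gamma>, y) \<in> B2 p \<beta> C\<^sub>A C\<^sub>H v" "(\<eta>, z) \<in> B2 p \<beta> C\<^sub>A C\<^sub>H v"
    and T: "T_equations p \<kappa> v u (\<gamma>, y) (\<gamma>', y')" "T_equations p \<kappa> v u (\<eta>, z) (\<eta>', z')"
  shows "W22_norm p C\<^sub>A C\<^sub>H v (state_diff (\<gamma>', y') (\<eta>', z'))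
    \<le> inverse \<kappa> * C\<^sub>A * C\<^sub>S * (1 + 2 * C\<^sub>A * C\<^sub>H)\<^sup>2 * N2 v * W22_norm p C\<^sub>A C\<^sub>H v (state_diff (\<gamma>, y) (\<eta>, z))"
    and "0 \<le> W22_norm p C\<^sub>A C\<^sub>H v (state_diff (\<gamma>, y) (\<eta>, z))"
proof -
  let ?N = "leb Omega"
  define M where "M = (1 + 2 * C\<^sub>A * C\<^sub>H) * N2 v"
  define d where "d = W22_norm p C\<^sub>A C\<^sub>H v (state_diff (\<gamma>, y) (\<eta>, z))"
  note b = B2D[OF a(1)] and c = B2D[OF a(2)]
  note g = regular_gammasD[OF b(1)] and h = regular_gammasD[OF c(1)]
  note t = T_equationsD[OF a(1) T(1)] and s = T_equationsD[OF a(2) T(2)]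
  note g' = regular_gammasD[OF t(1)] and h' = regular_gammasD[OF s(1)]
  note st = B2D[OF T_equations_B2[OF a(2) T(2)]]
  have M0: "0 \<le> M" unfolding M_def using constants(1,2) N2_nonneg[OF v] by (intro mult_nonneg_nonneg) auto
  define D where "D = sob_seminorm 2 \<infinity> I (\<lambda>t. \<gamma> t - \<eta> t)"
  have Dae: "AE t in leb I. \<bar>d2 \<gamma> t - d2 \<eta> t\<bar> \<le> D" unfolding D_def by (rule d2_diff_le[OF g(1) h(1)])
  have "\<exists>t. \<bar>d2 \<gamma> t - d2 \<eta> t\<bar> \<le> D"
  proof (rule ccontr)
    assume "\<not> ?thesis"
    with Dae have "AE t in leb I. False" by simp
    then show False using measure_I by (simp add: trivial_limit_def[symmetric] ae_filter_eq_bot_iff measure_def)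
  qed
  then have D0: "0 \<le> D" by (meson abs_ge_zero order_trans)
  have dyz: "(\<lambda>x. y x + v x - (z x + v x)) = (\<lambda>x. y x - z x)" by auto
  have yz: "(\<lambda>x. y x - z x) \<in> W2" by (rule sobolev_diff(1)[OF b(2) c(2) open_Omega constants(5)])
  have d: "M * D + N2 (\<lambda>x. y x - z x) \<le> d"
  proof -
    have "M * D \<le> M * sob_norm 2 \<infinity> I (\<lambda>t. \<gamma> t - \<eta> t)"
      unfolding D_def by (intro mult_left_mono sob_norm_infinity M0) simp
    then show ?thesis by (simp add: d_def W22_norm_def state_diff_def M_def)
  qed
  then have d0: "0 \<le> d" using M0 D0 N2_nonneg[OF yz] by (meson add_nonneg_nonneg mult_nonneg_nonneg order_trans)
  define D' where "D' = C\<^sub>A * C\<^sub>S * d / \<kappa>"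
  have D'0: "0 \<le> D'" unfolding D'_def using constants(1,3) d0 \<kappa> by simp
  obtain G where G: "\<And>i. top_trace (\<lambda>x. grad (\<lambda>x. y x + v x) x $ i) (\<lambda>t. (G t :: real ^ 2) $ i)"
    and Geq: "AE t in leb I. - \<kappa> * d2 \<gamma>' t = (A \<gamma> (top_side t) *v G t) \<bullet> ey + u t"
    using T(1) unfolding T_equations_def by auto
  obtain H where H: "\<And>i. top_trace (\<lambda>x. grad (\<lambda>x. z x + v x) x $ i) (\<lambda>t. (H t :: real ^ 2) $ i)"
    and Heq: "AE t in leb I. - \<kappa> * d2 \<eta>' t = (A \<eta> (top_side t) *v H t) \<bullet> ey + u t"
    using T(2) unfolding T_equations_def by auto
  note GH = trace_difference_bound[OF b(4) c(4) G H, unfolded dyz]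
  have "AE t in leb I. \<bar>d2 \<gamma>' t - d2 \<eta>' t\<bar> \<le> D'"
    using normal_flux_diff_bound[OF regular_gammas_bounds[OF g] regular_gammas_bounds[OF h]
        d_diff_bounds(1)[OF g(1,2) h(1,2) Dae D0] GH(2) GH(1)] Geq Heq
  proof eventually_elim
    case (elim t)
    have "D * (C\<^sub>S * N2 (\<lambda>x. y x + v x)) + C\<^sub>S * N2 (\<lambda>x. y x - z x) \<le> D * (C\<^sub>S * M) + C\<^sub>S * N2 (\<lambda>x. y x - z x)"
      using b(5) D0 constants(3) by (intro add_right_mono mult_left_mono) (auto simp: M_def)
    also have "\<dots> = C\<^sub>S * (M * D + N2 (\<lambda>x. y x - z x))" by (simp add: algebra_simps)
    also have "\<dots> \<le> C\<^sub>S * d" using d constants(3) by (intro mult_left_mono) auto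
    finally have "C\<^sub>A * (D * (C\<^sub>S * N2 (\<lambda>x. y x + v x)) + C\<^sub>S * N2 (\<lambda>x. y x - z x)) \<le> C\<^sub>A * (C\<^sub>S * d)"
      using constants(1) by (intro mult_left_mono) auto
    moreover have "\<kappa> * (d2 \<gamma>' t - d2 \<eta>' t) = (A \<eta> (top_side t) *v H t) \<bullet> ey - (A \<gamma> (top_side t) *v G t) \<bullet> ey"
      using elim(2,3) by (simp only: right_diff_distrib)
    then have "\<kappa> * \<bar>d2 \<gamma>' t - d2 \<eta>' t\<bar> = \<bar>(A \<gamma> (top_side t) *v G t) \<bullet> ey - (A \<eta> (top_side t) *v H t) \<bullet> ey\<bar>"
      using \<kappa> by (metis abs_minus_commute abs_mult abs_of_pos)
    ultimately have "\<kappa> * \<bar>d2 \<gamma>' t - d2 \<eta>' t\<bar> \<le> C\<^sub>A * (C\<^sub>S * d)" using elim(1) by linarith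
    then show ?case unfolding D'_def using \<kappa> by (simp add: pos_le_divide_eq mult.commute mult.left_commute)
  qed
  note db = d_diff_bounds[OF g'(1,2) h'(1,2) this D'0]
  have yz': "(\<lambda>x. y' x - z' x) \<in> W2" by (rule sobolev_diff(1)[OF t(2) s(2) open_Omega constants(5)])
  have yz0: "(\<lambda>x. y' x - z' x) \<in> sobolev0_Omega (ereal p)"
    unfolding sobolev0_Omega_def
  proof (intro CollectI conjI ballI)
    show "(\<lambda>x. y' x - z' x) \<in> sobolev 1 (ereal p) Omega" by (rule sobolev_mono[OF yz']) simp
    fix \<sigma> assume "\<sigma> \<in> insert top_side Sigma_sides"
    with t(3) s(3) have "has_trace Omega (leb I) \<sigma> y' (\<lambda>t. 0)" "has_trace Omega (leb I) \<sigma> z' (\<lambda>t. 0)"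
      by (auto simp: sobolev0_Omega_def)
    from has_trace_diff[OF this open_Omega bounded_Omega] show "has_trace Omega (leb I) \<sigma> (\<lambda>x. y' x - z' x) (\<lambda>t. 0)" by simp
  qed
  have le: "AE x in ?N. \<bar>ellip \<gamma>' (\<lambda>x. y' x - z' x) x\<bar>
      \<le> 3 / 2 * D' * Dlen 2 Omega (\<lambda>x. z' x + v x) x + 3 * D' * Dlen 1 Omega (\<lambda>x. z' x + v x) x"
    using ellip_diff_estimate[OF regular_gammas_bounds[OF g'] regular_gammas_bounds[OF h'] db(1), of "\<lambda>x. z' x + v x"]
      ellip_linear(1)[OF t(2) s(2), of \<gamma>'] ellip_linear(2)[OF s(2) v, of \<gamma>'] ellip_linear(2)[OF s(2) v, of \<eta>'] t(4) s(4)
    by eventually_elim (simp add: abs_minus_commute)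
  have "N2 (\<lambda>x. y' x - z' x) \<le> C\<^sub>H * ((3 / 2 * D' + 3 * D') * N2 (\<lambda>x. z' x + v x))"
    by (rule elliptic_bound[OF t(1) yz' yz0 st(4) le]) (use D'0 in auto)
  also have "\<dots> \<le> C\<^sub>H * ((2 * C\<^sub>A * D') * M)"
  proof (intro mult_left_mono mult_mono)
    have "9 / 2 * D' \<le> 2 * C\<^sub>A * D'" using constants(1) D'0 by (intro mult_right_mono) auto
    then show "3 / 2 * D' + 3 * D' \<le> 2 * C\<^sub>A * D'" by simp
    show "N2 (\<lambda>x. z' x + v x) \<le> M" unfolding M_def by (rule st(5))
  qed (use constants(1,2) D'0 N2_nonneg[OF st(4)] in auto)
  finally have "N2 (\<lambda>x. y' x - z' x) \<le> C\<^sub>H * ((2 * C\<^sub>A * D') * M)" .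
  moreover have "M * sob_norm 2 \<infinity> I (\<lambda>t. \<gamma>' t - \<eta>' t) \<le> M * D'" by (rule mult_left_mono[OF db(2) M0])
  ultimately have "W22_norm p C\<^sub>A C\<^sub>H v (state_diff (\<gamma>', y') (\<eta>', z')) \<le> M * D' + C\<^sub>H * ((2 * C\<^sub>A * D') * M)"
    by (simp add: W22_norm_def state_diff_def M_def)
  also have "\<dots> = (1 + 2 * C\<^sub>A * C\<^sub>H) * M * D'" by (simp add: algebra_simps)
  also have "\<dots> = inverse \<kappa> * C\<^sub>A * C\<^sub>S * (1 + 2 * C\<^sub>A * C\<^sub>H)\<^sup>2 * N2 v * d"
    unfolding M_def D'_def by (simp add: power2_eq_square divide_inverse)
  finally show "W22_norm p C\<^sub>A C\<^sub>H v (state_diff (\<gamma>', y') (\<eta>', z'))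
    \<le> inverse \<kappa> * C\<^sub>A * C\<^sub>S * (1 + 2 * C\<^sub>A * C\<^sub>H)\<^sup>2 * N2 v * W22_norm p C\<^sub>A C\<^sub>H v (state_diff (\<gamma>, y) (\<eta>, z))"
    unfolding d_def .
  show "0 \<le> W22_norm p C\<^sub>A C\<^sub>H v (state_diff (\<gamma>, y) (\<eta>, z))" using d0 unfolding d_def .
qed

end

end

theorem theorem3p4:
  fixes p q \<kappa> \<alpha> \<beta> C\<^sub>E C\<^sub>A C\<^sub>H C\<^sub>S \<theta>\<^sub>1 \<theta>\<^sub>2 \<Lambda> :: real
    and E :: "(real \<Rightarrow> real) \<Rightarrow> real ^ 2 \<Rightarrow> real"
    and v :: "real ^ 2 \<Rightarrow> real"
  assumes "2 < p" and "q = p / (p - 1)" and "0 < \<kappa>"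
    and "v \<in> sobolev 2 (ereal p) Omega"
    and "inf_sup_Gamma \<kappa> \<alpha>"
    and "inf_sup_Omega p q \<beta>"
    and "extension_operator q E C\<^sub>E"
    and "A_bound C\<^sub>A"
    and "elliptic_estimate p C\<^sub>H" and "elliptic_solvable p"
    and "sobolev_embedding_constant p C\<^sub>S"
    and "\<Lambda> = inverse \<kappa> * C\<^sub>A * C\<^sub>S * (1 + 2 * C\<^sub>A * C\<^sub>H)\<^sup>2"
    and "\<beta> * C\<^sub>A / (1 + \<beta> * C\<^sub>A) < \<theta>\<^sub>1" and "\<theta>\<^sub>1 < 1"
    and "sob_seminorm 1 (ereal p) Omega v \<le> (1 - \<theta>\<^sub>1) / (\<alpha> * C\<^sub>E * C\<^sub>A * (1 + \<beta> * C\<^sub>A))"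
    and "0 < \<theta>\<^sub>2" and "\<theta>\<^sub>2 < 1"
    and "sob_norm 2 (ereal p) Omega v \<le> (1 - \<theta>\<^sub>2) * inverse \<Lambda>"
  shows "\<forall>u \<in> U_ad \<alpha> \<theta>\<^sub>1.
      Lnorm 2 (lebesgue_on I) u \<le> \<theta>\<^sub>1 / \<alpha> \<and>
      u \<in> Lspace \<infinity> (lebesgue_on I) \<and>
      C\<^sub>A * C\<^sub>S * (1 + 2 * C\<^sub>A * C\<^sub>H) * sob_norm 2 (ereal p) Omega v
        + Lnorm \<infinity> (lebesgue_on I) u \<le> \<kappa> \<longrightarrow>
      contraction_on (\<lambda>a b. W22_norm p C\<^sub>A C\<^sub>H v (state_diff a b))
        (B2 p \<beta> C\<^sub>A C\<^sub>H v) (T p \<kappa> v u) (1 - \<theta>\<^sub>2)"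
proof (intro ballI impI, elim conjE)
  let ?v = "sob_norm 2 (ereal p) Omega v" and ?d = "\<lambda>a b. W22_norm p C\<^sub>A C\<^sub>H v (state_diff a b)"
  note h = assms(1-4,6,8-11)
  fix u :: "real \<Rightarrow> real" assume u: "u \<in> Lspace \<infinity> (lebesgue_on I)"
    and small: "C\<^sub>A * C\<^sub>S * (1 + 2 * C\<^sub>A * C\<^sub>H) * ?v + Lnorm \<infinity> (lebesgue_on I) u \<le> \<kappa>"
  have T: "T_equations p \<kappa> v u a (T p \<kappa> v u a)" if "a \<in> B2 p \<beta> C\<^sub>A C\<^sub>H v" for a
    unfolding T_def by (rule someI_ex[OF T_exists[OF h u small, of "fst a" "snd a", unfolded prod.collapse, OF that]])
  note const = constants[OF h]
  have CA: "0 < C\<^sub>A" using const(1) by linarith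
  have "0 < 1 + 2 * C\<^sub>A * C\<^sub>H" by (rule add_pos_pos[OF zero_less_one mult_pos_pos[OF _ const(2)]]) (use CA in simp)
  from mult_pos_pos[OF mult_pos_pos[OF mult_pos_pos[OF positive_imp_inverse_positive[OF assms(3)] CA] const(3)] zero_less_power[OF this]]
  have "0 < \<Lambda>" unfolding assms(12) .
  with assms(18) have contract: "\<Lambda> * ?v \<le> 1 - \<theta>\<^sub>2" by (simp add: field_simps)
  show "contraction_on ?d (B2 p \<beta> C\<^sub>A C\<^sub>H v) (T p \<kappa> v u) (1 - \<theta>\<^sub>2)"
    unfolding contraction_on_def
  proof (intro conjI ballI)
    show "T p \<kappa> v u ` B2 p \<beta> C\<^sub>A C\<^sub>H v \<subseteq> B2 p \<beta> C\<^sub>A C\<^sub>H v"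
    proof (rule image_subsetI)
      fix a assume "a \<in> B2 p \<beta> C\<^sub>A C\<^sub>H v"
      with T_equations_B2[OF h u small, of "fst a" "snd a" "fst (T p \<kappa> v u a)" "snd (T p \<kappa> v u a)"] T[of a]
      show "T p \<kappa> v u a \<in> B2 p \<beta> C\<^sub>A C\<^sub>H v" by simp
    qed
    fix a b assume ab: "a \<in> B2 p \<beta> C\<^sub>A C\<^sub>H v" "b \<in> B2 p \<beta> C\<^sub>A C\<^sub>H v"
    note c = T_equations_contract[OF h u small, of "fst a" "snd a" "fst b" "snd b" "fst (T p \<kappa> v u a)" "snd (T p \<kappa> v u a)"
        "fst (T p \<kappa> v u b)" "snd (T p \<kappa> v u b)", unfolded prod.collapse, OF ab T[OF ab(1)] T[OF ab(2)], folded assms(12)]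
    have "?d (T p \<kappa> v u a) (T p \<kappa> v u b) \<le> \<Lambda> * ?v * ?d a b" by (rule c(1))
    also have "\<dots> \<le> (1 - \<theta>\<^sub>2) * ?d a b" by (rule mult_right_mono[OF contract c(2)])
    finally show "?d (T p \<kappa> v u a) (T p \<kappa> v u b) \<le> (1 - \<theta>\<^sub>2) * ?d a b" .
  qed (use assms(16,17) in auto)
qed

end
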